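(* Assume $\eta=r_a$ and let $\{\varepsilon_n\}$ be a sequence of positive numbers converging to $0$. Then there exist $T>0$, a subsequence $\{\varepsilon_{n'}\}$ of $\{\varepsilon_n\}$, and an $N$-solution $\mu$ of the LS equation on $[0,T]$ with mass $m$ (with initial data $u^{\rm in},\mu^{\rm in}$), such that $f^{\varepsilon_{n'}}\to\mu$ as $n'\to+\infty$ in $\mathcal C([0,T];w\text{-}*\text{-}\mathcal M_f([0,+\infty)))$, where the nucleation rate is $$N(u)=\alpha u^2\,\frac{u}{u+\beta/(\overline a\,2^{\eta})}\quad (u\ge 0)\qquad\text{if }\eta=r_a<r_b,$$ $$N(u)=\alpha u^2\,\frac{\overline a u-\overline b}{\overline a u-\overline b+\beta/2^{\eta}}\quad (u>\rho)\qquad\text{if }\eta=r_a=r_b.$$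
   Context: **Rescaled Becker–Döring (BD) system.** Fix $\eta\ge 0$. For each $\varepsilon>0$ let $\alpha^\varepsilon,\beta^\varepsilon,(a_i^\varepsilon)_{i\ge2},(b_i^\varepsilon)_{i\ge3}$ be positive numbers for which there is a constant $K(\varepsilon)>0$ with $a_{i+1}^\varepsilon-a_i^\varepsilon\le K(\varepsilon)$ ($i\ge2$) and $b_i^\varepsilon-b_{i+1}^\varepsilon\le K(\varepsilon)$ ($i\ge3$). Let $u^\varepsilon$ and $(c_i^\varepsilon)_{i\ge2}$ be non-negative functions in $\mathcal C([0,+\infty))$ forming a global solution of $$\frac{d}{dt}u^\varepsilon=-\varepsilon J_1^\varepsilon-\varepsilon\sum_{i\ge1}J_i^\varepsilon,\qquad \frac{d}{dt}c_i^\varepsilon=\frac1\varepsilon\big[J_{i-1}^\varepsilon-J_i^\varepsilon\big]\quad(i\ge2),$$ $$J_1^\varepsilon=\alpha^\varepsilon(u^\varepsilon)^2-\varepsilon^\eta\beta^\varepsilon c_2^\varepsilon,\qquad J_i^\varepsilon=a_i^\varepsilon u^\varepsilon c_i^\varepsilon-b_{i+1}^\varepsilon c_{i+1}^\varepsilon\quad(i\ge2),$$ with non-negative initial data $u^{{\rm in},\varepsilon},(c_i^{{\rm in},\varepsilon})_{i\ge2}$, and satisfying the mass balance $u^\varepsilon(t)+\sum_{i\ge2}\varepsilon^2 i\,c_i^\varepsilon(t)=m^\varepsilon$ for all $t\ge0$, with $m^\varepsilon<\infty$ constant. Put $\Lambda_i^\varepsilon=[(i-\frac12)\varepsilon,(i+\frac12)\varepsilon)$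 and $$f^\varepsilon(t,x)=\sum_{i\ge2}c_i^\varepsilon(t)\mathbf 1_{\Lambda_i^\varepsilon}(x),\quad f^{{\rm in},\varepsilon}=f^\varepsilon(0,\cdot),\quad a^\varepsilon(x)=\sum_{i\ge2}a_i^\varepsilon\mathbf 1_{\Lambda_i^\varepsilon}(x),\quad b^\varepsilon(x)=\sum_{i\ge3}b_i^\varepsilon\mathbf 1_{\Lambda_i^\varepsilon}(x).$$ **Assumptions on the rates.** $\alpha,\beta>0$; $a,b$ are non-negative continuous functions on $[0,+\infty)$, positive on $(0,+\infty)$. As $\varepsilon\to0$: $\alpha^\varepsilon\to\alpha$, $\beta^\varepsilon\to\beta$, and $a^\varepsilon\to a$, $b^\varepsilon\to b$ uniformly on compact subsets of $[0,+\infty)$. There are $K_a,K_b>0$ with $a^\varepsilon(x)\le K_a(1+x)$ and $b^\varepsilon(x)\le K_b(1+x)$ for all $x\ge0$, $\varepsilon>0$. There are $r_a\in[0,1)$, $r_b\ge r_a$, $\overline a>0$, $\overline b>0$ with $a(x)\sim_{0^+}\overline a x^{r_a}$, $b(x)\sim_{0^+}\overline b x^{r_b}$, and $a^\varepsilon(\varepsilon i)=a(\varepsilon i)+o((\varepsilon i)^{r_a})$, $b^\varepsilon(\varepsilon i)=b(\varepsilon i)+o((\varepsilon i)^{r_b})$, where the Landau symbol refers to $\varepsilon i\to0$ ($i\ge2$ for $a$, $i\ge3$ for $b$). Set $\rho:=\lim_{x\to0^+}b(x)/a(x)=\lim_{x\to 0^+}\frac{\overline b}{\overline a}x^{r_b-r_a}\in[0,+\infty)$.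 **Assumptions on the initial data.** $\mathcal M_f(U)$ is the set of non-negative finite regular Borel measures on $U$, with the weak-$*$ topology: $\nu^n\to\nu$ iff $\int\varphi\,d\nu^n\to\int\varphi\,d\nu$ for all $\varphi\in\mathcal C_c(U)$; a density $f$ is identified with $f(x)dx$. There are $u^{\rm in}>\rho$ and $\mu^{\rm in}\in\mathcal M_f([0,+\infty))$ such that, as $\varepsilon\to0$, $u^{{\rm in},\varepsilon}\to u^{\rm in}$ and $f^{{\rm in},\varepsilon}\to\mu^{\rm in}$ weak-$*$ in $\mathcal M_f([0,+\infty))$. Let $\mathcal U$ be the set of non-negative convex functions $\Phi\in\mathcal C^1([0,+\infty))$, piecewise $\mathcal C^2$, with $\Phi(0)=0$, $\Phi'$ concave, $\Phi'(0)\ge0$, $\Phi(x)/x\to+\infty$ as $x\to+\infty$. There is $\Phi\in\mathcal U$ with $\sup_{\varepsilon>0}\int_0^\infty\Phi(x)f^{{\rm in},\varepsilon}(x)dx<\infty$. For all $z\in(0,1)$, $\sup_{\varepsilon>0}\sum_{i\ge2}\varepsilon^{r_a}c_i^{{\rm in},\varepsilon}e^{-iz}<\infty$. Set $m:=u^{\rm in}+\int_0^\infty x\,\mu^{\rm in}(dx)$. **$N$-solution.** Given $T>0$ and a function $N\in L^\infty_{loc}(\mathbb R_+)$ (nucleation rate; only its values at $u>\rho$ matter below, so it may be extended by any locally bounded function to $[0,\rho]$), $\mu\in L^\infty([0,T];\mathcal M_f([0,+\infty)))$ is an $N$-solution of the LS equation (in measure) on $[0,T]$ with mass $m$ if: (i)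 there is a non-negative $u\in\mathcal C([0,T])$ with $u(0)=u^{\rm in}$, $\inf_{[0,T]}u>\rho$, and $u(t)+\int_0^\infty x\,\mu_t(dx)=m$ for all $t\in[0,T]$ (for a suitable representative of $\mu$); (ii) for all $\varphi\in\mathcal C^1_c([0,T)\times[0,+\infty))$, $$\int_0^T\!\!\int_0^\infty\big[\partial_t\varphi(t,x)+(a(x)u(t)-b(x))\partial_x\varphi(t,x)\big]\mu_t(dx)\,dt+\int_0^\infty\varphi(0,x)\mu^{\rm in}(dx)+\int_0^T\varphi(s,0)N(u(s))\,ds=0.$$ $\mathcal C([0,T];w\text{-}*\text{-}\mathcal M_f([0,+\infty)))$ is the space of measure-valued functions on $[0,T]$ continuous in time for the weak-$*$ topology (with uniform-in-time convergence). *)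

theory Defs
  imports "HOL-Analysis.Analysis" "HOL-Library.Landau_Symbols"
begin

section \<open>Step functions on the grid of cells\<close>

definition cell :: "real \<Rightarrow> nat \<Rightarrow> real set" where
  "cell eps i = {(real i - 1/2) * eps ..< (real i + 1/2) * eps}"

text \<open>
  The cells are pairwise disjoint: at most one term of the series is nonzero at each point.
\<close>
definition step_fun :: "nat \<Rightarrow> real \<Rightarrow> (nat \<Rightarrow> real) \<Rightarrow> real \<Rightarrow> real" where
  "step_fun k eps s x = (\<Sum>i. s (i + k) * indicat_real (cell eps (i + k)) x)"

text \<open>The regime \<open>eps * i \<rightarrow> 0\<close> over all pairs \<open>(eps, i)\<close> with \<open>eps > 0\<close> and \<open>i \<ge> k\<close>.\<close>
definition small_size :: "nat \<Rightarrow> (real \<times> nat) filter" where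
  "small_size k =
     inf (filtercomap (\<lambda>(eps, i). eps * real i) (nhds 0)) (principal {(eps, i). 0 < eps \<and> k \<le> i})"


section \<open>The rescaled Becker--Doering system\<close>

definition BD_flux ::
  "real \<Rightarrow> real \<Rightarrow> real \<Rightarrow> real \<Rightarrow> (nat \<Rightarrow> real) \<Rightarrow> (nat \<Rightarrow> real) \<Rightarrow>
   (real \<Rightarrow> real) \<Rightarrow> (nat \<Rightarrow> real \<Rightarrow> real) \<Rightarrow> nat \<Rightarrow> real \<Rightarrow> real" where
  "BD_flux eta eps \<alpha> \<beta> a b u c i t =
     (if i = 1 then \<alpha> * (u t)\<^sup>2 - eps powr eta * \<beta> * c 2 t
      else a i * u t * c i t - b (i + 1) * c (i + 1) t)"

text \<open>
  Derivatives are classical, one-sided at \<open>t = 0\<close>. If \<open>a i\<close> and \<open>b i\<close> grow at most linearly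
  in \<open>i\<close>, this agrees with the integrated form of the system: by Dini's theorem, the mass balance
  makes \<open>\<Sum> i * c i t\<close> converge locally uniformly in \<open>t\<close>, so the total flux is continuous.
\<close>
definition BD_solution ::
  "real \<Rightarrow> real \<Rightarrow> real \<Rightarrow> real \<Rightarrow> (nat \<Rightarrow> real) \<Rightarrow> (nat \<Rightarrow> real) \<Rightarrow> real \<Rightarrow>
   (real \<Rightarrow> real) \<Rightarrow> (nat \<Rightarrow> real \<Rightarrow> real) \<Rightarrow> bool" where
  "BD_solution eta eps \<alpha> \<beta> a b m u c \<longleftrightarrow>
     (let J = BD_flux eta eps \<alpha> \<beta> a b u c in
       continuous_on {0..} u \<and> (\<forall>t\<ge>0. 0 \<le> u t) \<and>
       (\<forall>i\<ge>2. continuous_on {0..} (c i) \<and> (\<forall>t\<ge>0. 0 \<le> c i t)) \<and>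
       (\<forall>t\<ge>0. summable (\<lambda>i. J (i + 1) t) \<and>
          (u has_real_derivative (- eps * J 1 t - eps * (\<Sum>i. J (i + 1) t))) (at t within {0..})) \<and>
       (\<forall>i\<ge>2. \<forall>t\<ge>0.
          (c i has_real_derivative (1 / eps * (J (i - 1) t - J i t))) (at t within {0..})) \<and>
       (\<forall>t\<ge>0. (\<lambda>i. eps\<^sup>2 * real (i + 2) * c (i + 2) t) sums (m - u t)))"


section \<open>Finite measures and the weak-star topology\<close>

text \<open>Finite Borel measures on subsets of the line used here are automatically regular.\<close>
definition finite_borel :: "real set \<Rightarrow> real measure set" where
  "finite_borel U = {M. sets M = sets (restrict_space borel U) \<and> finite_measure M}"

definition density_on :: "real set \<Rightarrow> (real \<Rightarrow> real) \<Rightarrow> real measure" where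
  "density_on U f = density (restrict_space lborel U) (\<lambda>x. ennreal (f x))"

definition Cc :: "real set \<Rightarrow> (real \<Rightarrow> real) set" where
  "Cc U = {\<phi>. continuous_on U \<phi> \<and> (\<exists>K. compact K \<and> K \<subseteq> U \<and> (\<forall>x\<in>U - K. \<phi> x = 0))}"

definition weak_star_tendsto ::
  "real set \<Rightarrow> ('i \<Rightarrow> real measure) \<Rightarrow> real measure \<Rightarrow> 'i filter \<Rightarrow> bool" where
  "weak_star_tendsto U \<nu> \<nu>0 F \<longleftrightarrow>
     (\<forall>\<phi>\<in>Cc U. ((\<lambda>i. \<integral>x. \<phi> x \<partial>\<nu> i) \<longlongrightarrow> (\<integral>x. \<phi> x \<partial>\<nu>0)) F)"

definition weak_star_continuous :: "real \<Rightarrow> real set \<Rightarrow> (real \<Rightarrow> real measure) set" where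
  "weak_star_continuous T U =
     {\<mu>. (\<forall>t\<in>{0..T}. \<mu> t \<in> finite_borel U) \<and>
         (\<forall>\<phi>\<in>Cc U. continuous_on {0..T} (\<lambda>t. \<integral>x. \<phi> x \<partial>\<mu> t))}"

text \<open>
  Uniform convergence in time with respect to the uniform structure of the weak-star topology,
  i.e. the one generated by the seminorms \<open>\<nu> \<mapsto> \<bar>\<integral>\<phi> d\<nu>\<bar>\<close>.
\<close>
definition tendsto_weak_star_continuous ::
  "real \<Rightarrow> real set \<Rightarrow> (nat \<Rightarrow> real \<Rightarrow> real measure) \<Rightarrow> (real \<Rightarrow> real measure) \<Rightarrow> bool" where
  "tendsto_weak_star_continuous T U \<nu> \<mu> \<longleftrightarrow>
     (\<forall>n. \<nu> n \<in> weak_star_continuous T U) \<and> \<mu> \<in> weak_star_continuous T U \<and>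
     (\<forall>\<phi>\<in>Cc U. uniform_limit {0..T} (\<lambda>n t. \<integral>x. \<phi> x \<partial>\<nu> n t) (\<lambda>t. \<integral>x. \<phi> x \<partial>\<mu> t) sequentially)"

text \<open>
  Representatives of elements of \<open>L\<^sup>\<infinity>([0,T]; M\<^sub>f(U))\<close>, with weak-star measurability in time.
\<close>
definition Linf_measures :: "real \<Rightarrow> real set \<Rightarrow> (real \<Rightarrow> real measure) set" where
  "Linf_measures T U =
     {\<mu>. (\<forall>t\<in>{0..T}. \<mu> t \<in> finite_borel U) \<and>
         (\<forall>\<phi>\<in>Cc U. (\<lambda>t. \<integral>x. \<phi> x \<partial>\<mu> t) \<in> borel_measurable (lebesgue_on {0..T})) \<and>
         (\<exists>C. AE t in lebesgue_on {0..T}. measure (\<mu> t) U \<le> C)}"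

definition Linf_loc :: "(real \<Rightarrow> real) \<Rightarrow> bool" where
  "Linf_loc N \<longleftrightarrow>
     N \<in> borel_measurable (lebesgue_on {0..}) \<and>
     (\<forall>R. \<exists>C. AE x in lebesgue_on {0..R}. \<bar>N x\<bar> \<le> C)"


section \<open>Weight functions\<close>

text \<open>
  Piecewise \<open>C\<^sup>2\<close> is understood with a locally finite set of break points: \<open>\<Phi>\<close> may
  have infinitely many of them, accumulating at infinity only.
\<close>
definition superlinear_weights :: "(real \<Rightarrow> real) set" where
  "superlinear_weights =
     {\<Phi>. (\<forall>x\<ge>0. 0 \<le> \<Phi> x) \<and> convex_on {0..} \<Phi> \<and> \<Phi> 0 = 0 \<and>
         (\<exists>\<Phi>'. (\<forall>x\<ge>0. (\<Phi> has_real_derivative \<Phi>' x) (at x within {0..})) \<and>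
               continuous_on {0..} \<Phi>' \<and>
               (\<forall>R>0. \<Phi>' piecewise_C1_differentiable_on {0..R}) \<and>
               concave_on {0..} \<Phi>' \<and> 0 \<le> \<Phi>' 0) \<and>
         filterlim (\<lambda>x. \<Phi> x / x) at_top at_top}"


section \<open>Measure solutions of the Lifshitz--Slyozov equation with nucleation\<close>

text \<open>
  \<open>\<phi>\<close> is a compactly supported \<open>C\<^sup>1\<close> function on \<open>[0,T) \<times> [0,\<infinity>)\<close> with partial
  derivatives \<open>\<phi>t\<close> and \<open>\<phi>x\<close>. The support may meet \<open>t = 0\<close> and \<open>x = 0\<close>.
\<close>
definition C1c_test ::
  "real \<Rightarrow> (real \<times> real \<Rightarrow> real) \<Rightarrow> (real \<times> real \<Rightarrow> real) \<Rightarrow> (real \<times> real \<Rightarrow> real) \<Rightarrow> bool" where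
  "C1c_test T \<phi> \<phi>t \<phi>x \<longleftrightarrow>
     (let S = {0..<T} \<times> {0..} in
       (\<forall>p\<in>S. (\<phi> has_derivative (\<lambda>(h, k). \<phi>t p * h + \<phi>x p * k)) (at p within S)) \<and>
       continuous_on S \<phi>t \<and> continuous_on S \<phi>x \<and>
       (\<exists>K. compact K \<and> K \<subseteq> S \<and> (\<forall>p\<in>S - K. \<phi> p = 0)))"

text \<open>
  \<open>\<mu>\<close> stands for its class modulo equality at almost every time, hence the representative
  \<open>\<nu>\<close> in the mass balance.
\<close>
definition N_solution ::
  "real \<Rightarrow> (real \<Rightarrow> real) \<Rightarrow> (real \<Rightarrow> real) \<Rightarrow> real \<Rightarrow> real \<Rightarrow> real measure \<Rightarrow> real \<Rightarrow>
   (real \<Rightarrow> real) \<Rightarrow> (real \<Rightarrow> real measure) \<Rightarrow> bool" where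
  "N_solution T a b \<rho> u_in \<mu>_in m N \<mu> \<longleftrightarrow>
     \<mu> \<in> Linf_measures T {0..} \<and>
     (\<exists>u. continuous_on {0..T} u \<and> (\<forall>t\<in>{0..T}. 0 \<le> u t) \<and> u 0 = u_in \<and>
        \<rho> < (INF t\<in>{0..T}. u t) \<and>
        (\<exists>\<nu>\<in>Linf_measures T {0..}.
           (AE t in lebesgue_on {0..T}. \<nu> t = \<mu> t) \<and>
           (\<forall>t\<in>{0..T}. integrable (\<nu> t) (\<lambda>x. x) \<and> u t + (\<integral>x. x \<partial>\<nu> t) = m)) \<and>
        (\<forall>\<phi> \<phi>t \<phi>x. C1c_test T \<phi> \<phi>t \<phi>x \<longrightarrow>
           (\<integral>t. (\<integral>x. \<phi>t (t, x) + (a x * u t - b x) * \<phi>x (t, x) \<partial>\<mu> t) \<partial>lebesgue_on {0..<T})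
           + (\<integral>x. \<phi> (0, x) \<partial>\<mu>_in)
           + (\<integral>s. \<phi> (s, 0) * N (u s) \<partial>lebesgue_on {0..<T}) = 0))"

end

theory Submission
  imports Defs "HOL-Probability.Probability"
begin

text \<open>
  The clusters of macroscopic size form, in the limit, a measure transported by the velocity
  \<open>a(x) u(t) - b(x)\<close>; the point is to identify what enters at \<open>x = 0\<close>.  Tested against a function
  of the size, the system becomes a discrete transport equation with the boundary term \<open>J 1\<close>
  (\<open>weighted_sum_deriv\<close>), so that everything follows from compactness and from the limit of \<open>J 1\<close>.

  Compactness.  Nucleation is at most quadratic in the bounded monomer concentration, hence the
  number of clusters stays bounded, and growth rates that are at most linear propagate the uniform
  integrability of the first moment (\<open>moment_bound\<close>, \<open>tail_bound\<close>).  The monomer concentrations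
  are then uniformly Lipschitz in time, which gives a time \<open>T\<close> up to which all of them stay above a
  level \<open>ul > \<rho>\<close>.  Moments against Lipschitz functions are Lipschitz in time up to
  a small error, and Helly's selection theorem at the times \<open>T * j / N\<close>, a diagonal extraction and
  equicontinuity produce the limit path of measures (\<open>measure_path_compactness\<close>).  Since no first
  moment is lost, the mass balance passes to the limit and \<open>u\<close> converges as well
  (\<open>first_moment_limit\<close>).

  The boundary value.  Write \<open>d i = eps powr r * c i\<close> for the rescaled concentrations of the small
  sizes, with \<open>r = r\<^sub>a = \<eta>\<close>.  They evolve on the fast time scale \<open>eps powr (1 - r)\<close>, and as long
  as \<open>u\<close> exceeds \<open>\<rho>\<close> growth dominates fragmentation at small sizes, so that an exponential moment
  of \<open>d\<close> relaxes to a bounded value (\<open>exponential_moment\<close>, \<open>small_concentrations\<close>): \<open>d i\<close> is at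
  most of order \<open>exp (i * z)\<close> with \<open>\<rho> * exp z < ul\<close>.  Averaged in time, the fluxes through
  consecutive small sizes coincide (\<open>flux_balance\<close>).  With \<open>q = \<rho> / u\<close> and
  \<open>J i = abar * (u * i powr r * d i - \<rho> * (i + 1) powr r * d (i + 1))\<close> to leading order, the sum of
  \<open>q ^ (i - 2) * J i\<close> over \<open>2 \<le> i \<le> I\<close> telescopes to
  \<open>abar * u * (2 powr r * d 2 - q ^ (I - 1) * (I + 1) powr r * d (I + 1))\<close>, and the last
  term vanishes as \<open>I\<close> grows because of the exponential bound.  Hence, on average, the common value
  \<open>J 1\<close> of the fluxes is \<open>abar * 2 powr r * (u - \<rho>) * d 2\<close>.  Together with
  \<open>J 1 = \<alpha> * u\<^sup>2 - \<beta> * d 2\<close> this determines \<open>d 2\<close>, and with it \<open>J 1 = N u\<close>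
  (\<open>qss_identity\<close>, \<open>quasi_steady_state\<close>).  The two formulas for \<open>N\<close> are the cases
  \<open>\<rho> = bbar / abar\<close> and \<open>\<rho> = 0\<close> of this one.
\<close>


section \<open>Differential inequalities\<close>

lemma deriv_nonpos_decreasing:
  fixes g :: "real \<Rightarrow> real"
  assumes "0 \<le> t"
    and d: "\<And>s. 0 \<le> s \<Longrightarrow> s \<le> t \<Longrightarrow> (g has_real_derivative g' s) (at s within {0..})"
    and n: "\<And>s. 0 \<le> s \<Longrightarrow> s \<le> t \<Longrightarrow> g' s \<le> 0"
  shows "g t \<le> g 0"
proof (rule DERIV_nonpos_imp_decreasing_open[of 0 t g])
  show "continuous_on {0..t} g"
    by (rule DERIV_continuous_on, rule has_field_derivative_subset[OF d]) auto
  show "\<exists>y. (g has_real_derivative y) (at x) \<and> y \<le> 0" if "0 < x" "x < t" for x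
    using d[of x] n[of x] that by (auto simp: at_within_interior[of x "{0..}"])
qed (use assms in auto)

lemma gronwall_linear:
  fixes g :: "real \<Rightarrow> real"
  assumes "0 \<le> t" "0 \<le> A" "0 \<le> D"
    and d: "\<And>s. 0 \<le> s \<Longrightarrow> s \<le> t \<Longrightarrow> (g has_real_derivative g' s) (at s within {0..})"
    and n: "\<And>s. 0 \<le> s \<Longrightarrow> s \<le> t \<Longrightarrow> g' s \<le> A * g s + D"
  shows "g t \<le> exp (A * t) * (g 0 + t * D)"
proof -
  let ?h = "\<lambda>s. exp (- (A * s)) * g s - D * s"
  have "?h t \<le> ?h 0"
  proof (rule deriv_nonpos_decreasing[OF assms(1)])
    fix s assume s: "0 \<le> s" "s \<le> t"
    show "(?h has_real_derivative (exp (- (A * s)) * (g' s - A * g s) - D)) (at s within {0..})"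
      by (auto intro!: derivative_eq_intros d s simp: algebra_simps)
    have "exp (- (A * s)) * (g' s - A * g s) \<le> exp (- (A * s)) * D"
      using n[OF s] by (intro mult_left_mono) auto
    also have "\<dots> \<le> D" using s assms by (simp add: mult_left_le_one_le)
    finally show "exp (- (A * s)) * (g' s - A * g s) - D \<le> 0" by simp
  qed
  then have "exp (A * t) * (exp (- (A * t)) * g t) \<le> exp (A * t) * (g 0 + t * D)"
    by (intro mult_left_mono) (auto simp: mult.commute)
  then show ?thesis by (simp add: mult.assoc[symmetric] exp_minus)
qed

text \<open>For a quantity that is damped at rate \<open>k\<close>: the bound does not grow with time.\<close>
lemma gronwall_relaxation:
  fixes g :: "real \<Rightarrow> real"
  assumes "0 \<le> t" "0 < k"
    and d: "\<And>s. 0 \<le> s \<Longrightarrow> s \<le> t \<Longrightarrow> (g has_real_derivative g' s) (at s within {0..})"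
    and n: "\<And>s. 0 \<le> s \<Longrightarrow> s \<le> t \<Longrightarrow> g' s \<le> D - k * g s"
  shows "g t \<le> max (g 0) (D / k)"
proof -
  let ?h = "\<lambda>s. exp (k * s) * (g s - D / k)"
  have "?h t \<le> ?h 0"
  proof (rule deriv_nonpos_decreasing[OF assms(1)])
    fix s assume s: "0 \<le> s" "s \<le> t"
    show "(?h has_real_derivative (exp (k * s) * (g' s + k * g s - D))) (at s within {0..})"
      using \<open>0 < k\<close> by (auto intro!: derivative_eq_intros d s simp: field_simps)
    show "exp (k * s) * (g' s + k * g s - D) \<le> 0"
      using n[OF s] by (intro mult_nonneg_nonpos) auto
  qed
  then have *: "exp (k * t) * (g t - D / k) \<le> g 0 - D / k" by simp
  show ?thesis
  proof (cases "g t \<le> D / k")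
    case False
    then have "1 * (g t - D / k) \<le> exp (k * t) * (g t - D / k)"
      using assms by (intro mult_right_mono) auto
    with * show ?thesis by simp
  qed simp
qed


section \<open>Estimates for one Becker--Doering system\<close>

lemma summation_by_parts:
  fixes w J :: "nat \<Rightarrow> real"
  assumes "1 \<le> n"
  shows "(\<Sum>i=2..n. w i * (J (i - 1) - J i)) =
    w 2 * J 1 + (\<Sum>i=2..n. (w (i + 1) - w i) * J i) - w (n + 1) * J n"
  using assms
proof (induction n rule: nat_induct_at_least)
  case base
  then show ?case by (simp add: numeral_2_eq_2)
next
  case (Suc n)
  then show ?case by (simp add: algebra_simps)
qed

lemma sum_shift2: "(\<Sum>i=2..n. f i) = (\<Sum>i<n - 1. f (i + 2))" for f :: "nat \<Rightarrow> real"
proof (cases "n \<ge> 2")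
  case True
  have "(\<Sum>i=2..n. f i) = (\<Sum>i=0+2..(n-2)+2. f i)"
    by (simp only: le_add_diff_inverse2[OF True] add_0)
  also have "\<dots> = (\<Sum>i=0..n-2. f (i + 2))" by (rule sum.shift_bounds_cl_nat_ivl)
  also have "{0..n-2} = {..<n-1}" using True by auto
  finally show ?thesis .
qed auto

lemma sums_le_partial:
  fixes f :: "nat \<Rightarrow> real"
  assumes "f sums s" "\<And>i. 0 \<le> f i" shows "(\<Sum>i<n. f i) \<le> s"
  using sum_le_suminf[of f "{..<n}"] assms by (auto simp: sums_iff)

locale BD_system =
  fixes r e \<alpha> \<beta> K m :: real and a b :: "nat \<Rightarrow> real"
    and u :: "real \<Rightarrow> real" and c :: "nat \<Rightarrow> real \<Rightarrow> real"
  assumes e_pos: "0 < e" and e_le: "e \<le> 1" and r_nonneg: "0 \<le> r"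
    and \<alpha>_nonneg: "0 \<le> \<alpha>" and \<beta>_nonneg: "0 \<le> \<beta>" and K_nonneg: "0 \<le> K"
    and a_nonneg: "\<And>i. 2 \<le> i \<Longrightarrow> 0 \<le> a i" and b_nonneg: "\<And>i. 3 \<le> i \<Longrightarrow> 0 \<le> b i"
    and a_le: "\<And>i. 2 \<le> i \<Longrightarrow> a i \<le> K * (1 + e * i)"
    and b_le: "\<And>i. 3 \<le> i \<Longrightarrow> b i \<le> K * (1 + e * i)"
    and sol: "BD_solution r e \<alpha> \<beta> a b m u c"
begin

abbreviation J :: "nat \<Rightarrow> real \<Rightarrow> real" where
  "J \<equiv> BD_flux r e \<alpha> \<beta> a b u c"

lemma J_1: "J 1 t = \<alpha> * (u t)\<^sup>2 - e powr r * \<beta> * c 2 t"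
  by (simp add: BD_flux_def)

lemma J_ge2: "2 \<le> i \<Longrightarrow> J i t = a i * u t * c i t - b (i + 1) * c (i + 1) t"
  by (simp add: BD_flux_def)

lemma u_cont: "continuous_on {0..} u" and u_nonneg: "0 \<le> t \<Longrightarrow> 0 \<le> u t"
  and c_cont: "2 \<le> i \<Longrightarrow> continuous_on {0..} (c i)"
  and c_nonneg: "2 \<le> i \<Longrightarrow> 0 \<le> t \<Longrightarrow> 0 \<le> c i t"
  and J_summable: "0 \<le> t \<Longrightarrow> summable (\<lambda>i. J (i + 1) t)"
  and u_deriv: "0 \<le> t \<Longrightarrow>
    (u has_real_derivative (- e * J 1 t - e * (\<Sum>i. J (i + 1) t))) (at t within {0..})"
  and c_deriv: "2 \<le> i \<Longrightarrow> 0 \<le> t \<Longrightarrow>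
    (c i has_real_derivative (1 / e * (J (i - 1) t - J i t))) (at t within {0..})"
  and mass_sums: "0 \<le> t \<Longrightarrow> (\<lambda>i. e\<^sup>2 * real (i + 2) * c (i + 2) t) sums (m - u t)"
  using sol unfolding BD_solution_def Let_def by (elim conjE; simp)+

lemma J_cont: "1 \<le> i \<Longrightarrow> continuous_on {0..} (J i)"
  unfolding BD_flux_def using u_cont c_cont[of 2] c_cont[of i] c_cont[of "i+1"]
  by (cases "i = 1") (auto intro!: continuous_intros)

lemma mass_partial:
  assumes "0 \<le> t" shows "(\<Sum>i=2..n. e\<^sup>2 * real i * c i t) \<le> m - u t"
proof -
  have "(\<Sum>i<n-1. e\<^sup>2 * real (i + 2) * c (i + 2) t) \<le> m - u t"
    using mass_sums[OF assms] c_nonneg[OF _ assms]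
    by (intro sums_le_partial) auto
  then show ?thesis by (simp add: sum_shift2)
qed

lemma u_le: "0 \<le> t \<Longrightarrow> u t \<le> m"
  using mass_partial[of t 0] by simp

lemma m_nonneg: "0 \<le> m" using u_le[of 0] u_nonneg[of 0] by simp

lemma size_le:
  assumes "2 \<le> i" "0 \<le> t" shows "e\<^sup>2 * real i * c i t \<le> m"
proof -
  have "e\<^sup>2 * real i * c i t \<le> (\<Sum>i=2..i. e\<^sup>2 * real i * c i t)"
    using assms c_nonneg by (intro member_le_sum) auto
  also have "\<dots> \<le> m" using mass_partial[OF assms(2), of i] u_nonneg[OF assms(2)] by linarith
  finally show ?thesis .
qed

lemma J_upper: "2 \<le> i \<Longrightarrow> 0 \<le> t \<Longrightarrow> J i t \<le> a i * u t * c i t"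
  using b_nonneg[of "i+1"] c_nonneg[of "i+1" t] by (simp add: J_ge2)

lemma J_lower: "2 \<le> i \<Longrightarrow> 0 \<le> t \<Longrightarrow> - (b (i + 1) * c (i + 1) t) \<le> J i t"
  using a_nonneg[of "i"] c_nonneg[of "i" t] u_nonneg[of t] by (simp add: J_ge2)

lemma J1_upper: "0 \<le> t \<Longrightarrow> J 1 t \<le> \<alpha> * m\<^sup>2"
proof -
  assume t: "0 \<le> t"
  have "\<alpha> * (u t)\<^sup>2 \<le> \<alpha> * m\<^sup>2"
    using u_le[OF t] u_nonneg[OF t] \<alpha>_nonneg by (intro mult_left_mono power_mono) auto
  moreover have "0 \<le> e powr r * \<beta> * c 2 t" using c_nonneg[of 2 t] t \<beta>_nonneg by simp
  ultimately show ?thesis unfolding J_1 by linarith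
qed

text \<open>
  Summation by parts turns the differences of fluxes into increments of the weights.  Weights that
  vanish beyond \<open>n\<close> leave no boundary term there, so the nucleation flux \<open>J 1\<close> is the only one.
\<close>
lemma weighted_sum_deriv:
  assumes "0 \<le> t" "1 \<le> n" "w (n + 1) t = 0"
    and w: "\<And>i. 2 \<le> i \<Longrightarrow> i \<le> n \<Longrightarrow> (w i has_real_derivative w' i) (at t within {0..})"
  shows "((\<lambda>s. \<Sum>i=2..n. e * w i s * c i s) has_real_derivative
    ((\<Sum>i=2..n. e * w' i * c i t) + w 2 t * J 1 t + (\<Sum>i=2..n. (w (i + 1) t - w i t) * J i t)))
    (at t within {0..})"
proof -
  have "((\<lambda>s. \<Sum>i=2..n. e * w i s * c i s) has_real_derivative
    (\<Sum>i=2..n. e * w' i * c i t + w i t * (J (i - 1) t - J i t))) (at t within {0..})"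
  proof (rule DERIV_sum)
    fix i assume "i \<in> {2..n}"
    then have i: "2 \<le> i" "i \<le> n" by auto
    show "((\<lambda>s. e * w i s * c i s) has_real_derivative
      e * w' i * c i t + w i t * (J (i - 1) t - J i t)) (at t within {0..})"
      using e_pos
      by (auto intro!: derivative_eq_intros w[OF i] c_deriv[OF i(1) assms(1)])
  qed
  then show ?thesis
    using summation_by_parts[OF assms(2), of "\<lambda>i. w i t" "\<lambda>i. J i t"] assms(3)
    by (simp add: sum.distrib add.assoc)
qed

lemma weighted_sum_deriv_const:
  assumes "0 \<le> t" "1 \<le> n" "w (n + 1) = 0"
  shows "((\<lambda>s. \<Sum>i=2..n. e * w i * c i s) has_real_derivative
    (w 2 * J 1 t + (\<Sum>i=2..n. (w (i + 1) - w i) * J i t))) (at t within {0..})"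
  using weighted_sum_deriv[of t n "\<lambda>i _. w i" "\<lambda>_. 0"] assms by simp

text \<open>
  Fragmentation decreases a moment against a non-decreasing weight \<open>w\<close>, so that only nucleation and
  growth have to be estimated.  Multiplying \<open>w\<close> by the logarithmic cutoff
  \<open>max 0 (1 - ln i / ln I)\<close> makes the sums finite; since the increments of the cutoff are
  at most \<open>1 / (i * ln I)\<close>, the fragmentation they cause is controlled by the mass alone and
  vanishes as \<open>I\<close> grows.
\<close>
lemma moment_bound:
  fixes w :: "nat \<Rightarrow> real"
  assumes w0: "\<And>i. 2 \<le> i \<Longrightarrow> 0 \<le> w i" and w_mono: "\<And>i. 2 \<le> i \<Longrightarrow> w i \<le> w (i + 1)"
    and w_lin: "\<And>i. 2 \<le> i \<Longrightarrow> w i \<le> C * real i"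
    and A: "0 \<le> A" and B: "0 \<le> B"
    and step: "\<And>i. 2 \<le> i \<Longrightarrow> (w (i + 1) - w i) * (a i * m) \<le> e * (A * w i + B)"
    and init: "\<And>n. (\<Sum>i=2..n. e * w i * c i 0) \<le> S"
    and Q: "\<And>n s. 0 \<le> s \<Longrightarrow> s \<le> t \<Longrightarrow> B * (\<Sum>i=2..n. e * c i s) \<le> Q"
    and t: "0 \<le> t"
  shows "(\<Sum>i=2..N. e * w i * c i t) \<le> exp (A * t) * (S + t * (w 2 * (\<alpha> * m\<^sup>2) + Q))"
proof -
  define chi where "chi I i = max 0 (1 - ln (real i) / ln (real I))" for I i :: nat
  define D where "D I = w 2 * (\<alpha> * m\<^sup>2) + Q + 2 * C * K * m / e\<^sup>2 / ln (real I)" for I :: nat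
  have C: "0 \<le> C" using w0[of 2] w_lin[of 2] by simp
  have Q0: "0 \<le> Q" using Q[of 0 0] t by simp
  have D0: "0 \<le> D I" for I
    using C K_nonneg m_nonneg Q0 w0[of 2] \<alpha>_nonneg e_pos
    by (cases "I = 0") (auto simp: D_def intro!: add_nonneg_nonneg divide_nonneg_nonneg)
  have main: "(\<Sum>i=2..N. e * (w i * chi I i) * c i t) \<le> exp (A * t) * (S + t * D I)"
    if I: "3 \<le> I" "N < I" for I
  proof -
    have lnI: "0 < ln (real I)" using I by simp
    let ?W = "\<lambda>i. w i * chi I i"
    let ?G = "\<lambda>s. \<Sum>i=2..I-1. e * ?W i * c i s"
    have chi01: "0 \<le> chi I i" "1 \<le> i \<Longrightarrow> chi I i \<le> 1" for i
      using lnI by (auto simp: chi_def)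
    have chi_mono: "chi I (i+1) \<le> chi I i" if "1 \<le> i" for i
    proof -
      have "ln (real i) / ln (real I) \<le> ln (real (i+1)) / ln (real I)"
        using that lnI by (intro divide_right_mono) auto
      then show ?thesis by (auto simp: chi_def)
    qed
    have chi_diff: "chi I i - chi I (i+1) \<le> 1 / (real i * ln (real I))" if "1 \<le> i" for i
    proof -
      have "real (i+1) = real i * (1 + 1 / real i)" using that by (simp add: field_simps)
      then have "ln (real (i+1)) - ln (real i) = ln (1 + 1 / real i)"
        using that by (simp only: ln_mult_pos) (simp add: ln_mult_pos add_pos_pos)
      also have "\<dots> \<le> 1 / real i" using that by (intro ln_add_one_self_le_self) auto
      finally have "(ln (real (i+1)) - ln (real i)) / ln (real I) \<le> 1 / real i / ln (real I)"
        using lnI by (intro divide_right_mono) auto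
      moreover have "0 \<le> 1 / (real i * ln (real I))" using lnI by simp
      moreover have "ln (real i) / ln (real I) \<le> ln (real (i+1)) / ln (real I)"
        using that lnI by (intro divide_right_mono) auto
      ultimately show ?thesis by (auto simp: chi_def diff_divide_distrib max_def)
    qed
    have W_end: "?W (I - 1 + 1) = 0" using I lnI by (simp add: chi_def)
    have "?G t \<le> exp (A * t) * (?G 0 + t * D I)"
    proof (rule gronwall_linear[OF t A D0])
      fix s assume s: "0 \<le> s" "s \<le> t"
      show "(?G has_real_derivative
         (?W 2 * J 1 s + (\<Sum>i=2..I-1. (?W (i + 1) - ?W i) * J i s))) (at s within {0..})"
        by (rule weighted_sum_deriv_const) (use s I W_end in auto)
      have 1: "?W 2 * J 1 s \<le> w 2 * (\<alpha> * m\<^sup>2)"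
      proof -
        have "?W 2 * J 1 s \<le> ?W 2 * (\<alpha> * m\<^sup>2)"
          using J1_upper[OF s(1)] w0[of 2] chi01(1)[of 2] by (intro mult_left_mono) auto
        also have "\<dots> \<le> w 2 * (\<alpha> * m\<^sup>2)"
          using w0[of 2] chi01(2)[of 2] \<alpha>_nonneg by (intro mult_right_mono mult_right_le_one_le) (auto simp: chi01)
        finally show ?thesis .
      qed
      have 2: "(?W (i + 1) - ?W i) * J i s \<le>
         (A * (e * ?W i * c i s) + B * (e * c i s))
         + (C / ln (real I) * K * 2 / e\<^sup>2) * (e\<^sup>2 * real (i+1) * c (i+1) s)" if "i \<in> {2..I-1}" for i
      proof -
        have i: "2 \<le> i" using that by simp
        have ci: "0 \<le> c i s" "0 \<le> c (i+1) s" using i s by (auto intro: c_nonneg)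
        have "(?W (i + 1) - ?W i) * J i s =
            (w (i+1) - w i) * chi I (i+1) * J i s + w i * (chi I i - chi I (i+1)) * (- J i s)"
          by (simp add: algebra_simps)
        also have "(w (i+1) - w i) * chi I (i+1) * J i s
            \<le> (w (i+1) - w i) * chi I (i+1) * (a i * u s * c i s)"
          using w_mono[OF i] chi01 J_upper[OF i s(1)] by (intro mult_left_mono) auto
        also have "\<dots> \<le> (w (i+1) - w i) * chi I (i+1) * (a i * m * c i s)"
          using w_mono[OF i] chi01 a_nonneg[OF i] u_le[OF s(1)] ci
          by (intro mult_left_mono mult_right_mono) auto
        also have "\<dots> = ((w (i+1) - w i) * (a i * m)) * (chi I (i+1) * c i s)" by simp
        also have "\<dots> \<le> (e * (A * w i + B)) * (chi I (i+1) * c i s)"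
          using step[OF i] ci chi01 by (intro mult_right_mono) auto
        also have "\<dots> \<le> (e * (A * w i + B)) * (chi I i * c i s)"
          using chi_mono[of i] i ci A B w0[OF i] e_pos
          by (intro mult_right_mono mult_left_mono) auto
        also have "\<dots> \<le> A * (e * ?W i * c i s) + B * (e * c i s)"
        proof -
          have "B * (e * c i s) * chi I i \<le> B * (e * c i s)"
            using B e_pos ci i chi01 by (intro mult_right_le_one_le) auto
          then show ?thesis by (simp add: algebra_simps)
        qed
        also have "w i * (chi I i - chi I (i+1)) * (- J i s) \<le>
           (C / ln (real I)) * (b (i+1) * c (i+1) s)"
        proof -
          have "w i * (chi I i - chi I (i+1)) \<le> (C * real i) * (1 / (real i * ln (real I)))"
            using w_lin[OF i] chi_diff[of i] chi_mono[of i] w0[OF i] i C by (intro mult_mono) auto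
          also have "\<dots> = C / ln (real I)" using i by simp
          finally have *: "w i * (chi I i - chi I (i+1)) \<le> C / ln (real I)" .
          have "w i * (chi I i - chi I (i+1)) * (- J i s)
            \<le> w i * (chi I i - chi I (i+1)) * (b (i+1) * c (i+1) s)"
            using J_lower[OF i s(1)] w0[OF i] chi_mono[of i] i by (intro mult_left_mono) auto
          also have "\<dots> \<le> (C / ln (real I)) * (b (i+1) * c (i+1) s)"
            using * b_nonneg[of "i+1"] ci i by (intro mult_right_mono) auto
          finally show ?thesis .
        qed
        also have "(C / ln (real I)) * (b (i+1) * c (i+1) s) \<le>
            (C / ln (real I)) * ((K * (2 * real (i+1))) * c (i+1) s)"
        proof -
          have "e * real (i+1) \<le> real (i+1)" using e_le by (simp add: mult_left_le_one_le e_pos less_imp_le)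
          moreover have "1 \<le> real (i+1)" by simp
          moreover have "1 + x \<le> 2 * y" if "x \<le> y" "1 \<le> y" for x y :: real using that by simp
          ultimately have "1 + e * real (i+1) \<le> 2 * real (i+1)" by blast
          then have "K * (1 + e * real (i+1)) \<le> K * (2 * real (i+1))"
            using K_nonneg by (rule mult_left_mono)
          then have "b (i+1) \<le> K * (2 * real (i+1))" using b_le[of "i+1"] i by (simp del: of_nat_Suc of_nat_add)
          then show ?thesis using ci C lnI by (intro mult_left_mono mult_right_mono) auto
        qed
        also have "\<dots> = (C / ln (real I) * K * 2 / e\<^sup>2) * (e\<^sup>2 * real (i+1) * c (i+1) s)"
          using e_pos lnI by (simp add: field_simps)
        finally show ?thesis by simp
      qed
      have 3: "(\<Sum>i=2..I-1. e\<^sup>2 * real (i+1) * c (i+1) s) \<le> m"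
      proof -
        have "(\<Sum>i=2..I-1. e\<^sup>2 * real (i+1) * c (i+1) s) = (\<Sum>i=2+1..I-1+1. e\<^sup>2 * real i * c i s)"
          by (subst sum.shift_bounds_cl_nat_ivl) simp
        also have "\<dots> \<le> (\<Sum>i=2..I. e\<^sup>2 * real i * c i s)"
          using I s c_nonneg by (intro sum_mono2) auto
        also have "\<dots> \<le> m" using mass_partial[OF s(1), of I] u_nonneg[OF s(1)] by simp
        finally show ?thesis .
      qed
      have "(\<Sum>i=2..I-1. (?W (i + 1) - ?W i) * J i s) \<le>
          (\<Sum>i=2..I-1. (A * (e * ?W i * c i s) + B * (e * c i s))
         + (C / ln (real I) * K * 2 / e\<^sup>2) * (e\<^sup>2 * real (i+1) * c (i+1) s))"
        by (rule sum_mono) (rule 2)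
      also have "\<dots> = A * ?G s + B * (\<Sum>i=2..I-1. e * c i s)
         + (C / ln (real I) * K * 2 / e\<^sup>2) * (\<Sum>i=2..I-1. e\<^sup>2 * real (i+1) * c (i+1) s)"
        by (simp only: sum.distrib sum_distrib_left)
      also have "\<dots> \<le> A * ?G s + Q + (C / ln (real I) * K * 2 / e\<^sup>2) * m"
        using 3 Q[OF s, of "I-1"] C lnI K_nonneg e_pos A
        by (intro add_mono mult_left_mono) auto
      finally show "?W 2 * J 1 s + (\<Sum>i=2..I-1. (?W (i + 1) - ?W i) * J i s) \<le> A * ?G s + D I"
        using 1 by (simp add: D_def mult_ac)
    qed
    also have "?G 0 \<le> S"
    proof -
      have "?G 0 \<le> (\<Sum>i=2..I-1. e * w i * c i 0)"
        using e_pos w0 c_nonneg[of _ 0] chi01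
        by (intro sum_mono mult_right_mono mult_left_mono mult_right_le_one_le) auto
      then show ?thesis using init[of "I-1"] by simp
    qed
    finally have "?G t \<le> exp (A * t) * (S + t * D I)" by simp
    moreover have "(\<Sum>i=2..N. e * ?W i * c i t) \<le> ?G t"
      using I e_pos w0 c_nonneg t chi01 by (intro sum_mono2) auto
    ultimately show ?thesis by simp
  qed
  have ln_inf: "filterlim (\<lambda>I. ln (real I)) at_top sequentially"
    using filterlim_compose[OF ln_at_top filterlim_real_sequentially] .
  \<comment> \<open>for fixed \<open>i\<close> the cutoff tends to \<open>1\<close>, and the error that it causes tends to \<open>0\<close>\<close>
  have inf_lim: "(\<lambda>I. C' / ln (real I)) \<longlonglongrightarrow> 0" for C'
    by (rule tendsto_divide_0[OF tendsto_const filterlim_at_top_imp_at_infinity[OF ln_inf]])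
  have chi_lim: "(\<lambda>I. chi I i) \<longlonglongrightarrow> 1" for i
  proof -
    have "(\<lambda>I. max 0 (1 - ln (real i) / ln (real I))) \<longlonglongrightarrow> max 0 (1 - 0)"
      by (intro tendsto_max tendsto_diff tendsto_const inf_lim)
    then show ?thesis by (simp add: chi_def)
  qed
  have "(\<lambda>I. \<Sum>i=2..N. e * (w i * chi I i) * c i t) \<longlonglongrightarrow> (\<Sum>i=2..N. e * (w i * 1) * c i t)"
    by (intro tendsto_intros chi_lim)
  moreover have "(\<lambda>I. exp (A * t) * (S + t * D I)) \<longlonglongrightarrow>
      exp (A * t) * (S + t * (w 2 * (\<alpha> * m\<^sup>2) + Q + 0))"
    unfolding D_def
    by (intro tendsto_add tendsto_mult tendsto_const inf_lim)
  ultimately have "(\<Sum>i=2..N. e * (w i * 1) * c i t) \<le>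
      exp (A * t) * (S + t * (w 2 * (\<alpha> * m\<^sup>2) + Q + 0))"
    by (rule LIMSEQ_le) (intro exI[of _ "max 3 (Suc N)"], use main in auto)
  then show ?thesis by simp
qed


lemma zeroth_moment:
  assumes "\<And>n. (\<Sum>i=2..n. e * c i 0) \<le> Z" "0 \<le> t"
  shows "(\<Sum>i=2..n. e * c i t) \<le> Z + t * (\<alpha> * m\<^sup>2)"
  using moment_bound[of "\<lambda>_. 1" 1 0 0 Z t 0 n] assms by simp

text \<open>
  The weight \<open>x\<^sup>2 / (x + R)\<close> is comparable to \<open>x\<close> beyond \<open>R\<close>, is small below, and its logarithmic
  derivative is at most \<open>2 / x\<close>, which balances a growth rate that is at most linear.  Hence tails
  of the first moment that are uniformly small at time \<open>0\<close> stay so.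
\<close>
lemma tail_bound:
  assumes R: "0 < R"
    and init: "\<And>n. (\<Sum>i=2..n. e * ((e * real i)\<^sup>2 / (e * real i + R)) * c i 0) \<le> S"
    and Z: "\<And>n s. 0 \<le> s \<Longrightarrow> s \<le> t \<Longrightarrow> (\<Sum>i=2..n. e * c i s) \<le> Z"
    and t: "0 \<le> t"
  shows "(\<Sum>i\<in>{i\<in>{2..N}. R \<le> e * real i}. e\<^sup>2 * real i * c i t) \<le>
    2 * (exp (6 * K * m * t) * (S + t / R * (4 * \<alpha> * m\<^sup>2 + 3 * K * m * Z)))"
proof -
  define h where "h x = x\<^sup>2 / (x + R)" for x :: real
  let ?w = "\<lambda>i::nat. h (e * real i)"
  have h_diff: "h y - h x = (y - x) * ((x * y + R * (x + y)) / ((x + R) * (y + R)))"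
    if "0 \<le> x" "0 \<le> y" for x y
  proof -
    have "x + R \<noteq> 0" "y + R \<noteq> 0" using that R by auto
    then show ?thesis unfolding h_def by (simp add: field_simps power2_eq_square)
  qed
  have h_le: "h x \<le> x" if "0 \<le> x" for x
    using that R by (simp add: h_def field_simps power2_eq_square)
  have Km: "0 \<le> K * m" using K_nonneg m_nonneg by simp
  have "(\<Sum>i=2..N. e * ?w i * c i t) \<le> exp (6 * K * m * t) *
     (S + t * (?w 2 * (\<alpha> * m\<^sup>2) + 3 * K * m / R * Z))"
  proof (rule moment_bound)
    fix i :: nat assume i: "2 \<le> i"
    let ?x = "e * real i" and ?y = "e * real (i + 1)"
    have x: "0 < ?x" "?x \<le> ?y" "?y \<le> 2 * ?x" using i e_pos by (auto simp: field_simps)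
    show "0 \<le> ?w i" using x R by (simp add: h_def)
    have quot: "0 \<le> (?x * ?y + R * (?x + ?y)) / ((?x + R) * (?y + R))"
      using x R e_pos
      by (intro divide_nonneg_nonneg add_nonneg_nonneg mult_nonneg_nonneg) (auto intro: add_nonneg_nonneg)
    show "?w i \<le> ?w (i + 1)"
    proof -
      have "0 \<le> ?x" "0 \<le> ?y" "0 \<le> ?y - ?x" using x by linarith+
      then have "h ?y - h ?x \<ge> 0" using h_diff[of ?x ?y] mult_nonneg_nonneg[OF _ quot] by metis
      then show ?thesis by linarith
    qed
    show "?w i \<le> 1 * real i"
      using h_le[of ?x] x(1) mult_right_mono[OF e_le, of "real i"] by linarith
    have "(?x * ?y + R * (?x + ?y)) / ((?x + R) * (?y + R)) \<le> (3 * ?x * (?x + R)) / ((?x + R) * (?x + R))"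
    proof (rule frac_le)
      have "?x * ?y \<le> ?x * (2 * ?x)" using x by (intro mult_left_mono) auto
      moreover have "R * (?x + ?y) \<le> R * (3 * ?x)" using x R by (intro mult_left_mono) auto
      moreover have "0 \<le> ?x * ?x" by simp
      ultimately show "?x * ?y + R * (?x + ?y) \<le> 3 * ?x * (?x + R)"
        unfolding distrib_left by (simp add: mult_ac)
      show "(?x + R) * (?x + R) \<le> (?x + R) * (?y + R)" using x R by (intro mult_left_mono) linarith+
      show "0 < (?x + R) * (?x + R)" by (intro mult_pos_pos add_pos_pos x R)
      have "0 \<le> ?x + R" "0 \<le> 3 * ?x" using x R by linarith+
      then show "0 \<le> 3 * ?x * (?x + R)" using mult_nonneg_nonneg by blast
    qed
    also have "\<dots> = 3 * ?x / (?x + R)" using x R by simp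
    finally have quot2: "(?x * ?y + R * (?x + ?y)) / ((?x + R) * (?y + R)) \<le> 3 * ?x / (?x + R)" .
    have aim: "a i * m \<le> K * (1 + ?x) * m"
      using a_le[OF i] m_nonneg by (intro mult_right_mono) auto
    have "?w (i + 1) - ?w i = e * ((?x * ?y + R * (?x + ?y)) / ((?x + R) * (?y + R)))"
      using h_diff[of ?x ?y] x by (simp add: algebra_simps)
    also have "\<dots> \<le> e * (3 * ?x / (?x + R))" using quot2 e_pos by (intro mult_left_mono) auto
    finally have incr: "?w (i + 1) - ?w i \<le> e * (3 * ?x / (?x + R))" .
    have "0 \<le> e * (3 * ?x / (?x + R))" using x R e_pos by simp
    moreover have "0 \<le> a i * m" using a_nonneg[OF i] m_nonneg by simp
    ultimately have "(?w (i + 1) - ?w i) * (a i * m) \<le> (e * (3 * ?x / (?x + R))) * (K * (1 + ?x) * m)"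
      by (rule mult_mono[OF incr aim])
    also have "\<dots> = e * (3 * K * m) * (?x * (1 + ?x) / (?x + R))" by simp
    also have "\<dots> \<le> e * (3 * K * m) * (2 * h ?x + 1 / R)"
    proof (rule mult_left_mono)
      have "?x * (1 + ?x) \<le> 2 * ?x\<^sup>2 + 1"
        using sum_squares_ge_zero[of "?x - 1" 0] zero_le_power2[of "?x - 1"] zero_le_power2[of ?x]
        by (auto simp: power2_eq_square algebra_simps)
      then have "?x * (1 + ?x) / (?x + R) \<le> (2 * ?x\<^sup>2 + 1) / (?x + R)"
        using x R by (intro divide_right_mono) auto
      also have "\<dots> = 2 * h ?x + 1 / (?x + R)" by (simp add: h_def add_divide_distrib)
      also have "\<dots> \<le> 2 * h ?x + 1 / R" using x R by (simp add: frac_le)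
      finally show "?x * (1 + ?x) / (?x + R) \<le> 2 * h ?x + 1 / R" .
    qed (use Km e_pos in \<open>simp add: mult.assoc\<close>)
    also have "\<dots> = e * (6 * K * m * ?w i + 3 * K * m / R)" by (simp add: algebra_simps)
    finally show "(?w (i + 1) - ?w i) * (a i * m) \<le> e * (6 * K * m * ?w i + 3 * K * m / R)" .
  next
    show "(\<Sum>i = 2..n. e * ?w i * c i 0) \<le> S" for n
      using init[of n] by (simp add: h_def)
    show "3 * K * m / R * (\<Sum>i = 2..n. e * c i s) \<le> 3 * K * m / R * Z" if "0 \<le> s" "s \<le> t" for n s
      using Z[OF that] Km R by (intro mult_left_mono) auto
  qed (use t Km R in \<open>auto simp: mult.assoc\<close>)
  also have "\<dots> \<le> exp (6 * K * m * t) * (S + t / R * (4 * \<alpha> * m\<^sup>2 + 3 * K * m * Z))"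
  proof -
    have "?w 2 \<le> 4 / R"
    proof -
      have "(e * 2)\<^sup>2 / (e * 2 + R) \<le> 4 / R"
      proof (rule frac_le)
        have "e * 2 \<le> 2" using e_le by simp
        then have "(e * 2)\<^sup>2 \<le> 2\<^sup>2" using e_pos by (intro power_mono) auto
        then show "(e * 2)\<^sup>2 \<le> 4" by simp
      qed (use R e_pos in auto)
      then show ?thesis by (simp add: h_def)
    qed
    then have "?w 2 * (\<alpha> * m\<^sup>2) \<le> 4 / R * (\<alpha> * m\<^sup>2)" using \<alpha>_nonneg by (intro mult_right_mono) auto
    then have "t * (?w 2 * (\<alpha> * m\<^sup>2) + 3 * K * m / R * Z) \<le> t * (4 / R * (\<alpha> * m\<^sup>2) + 3 * K * m / R * Z)"
      using t by (intro mult_left_mono) auto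
    also have "\<dots> = t / R * (4 * \<alpha> * m\<^sup>2 + 3 * K * m * Z)" using R by (simp add: field_simps)
    finally show ?thesis by simp
  qed
  finally have *: "(\<Sum>i=2..N. e * ?w i * c i t) \<le> exp (6 * K * m * t) * (S + t / R * (4 * \<alpha> * m\<^sup>2 + 3 * K * m * Z))" .
  have "(\<Sum>i\<in>{i\<in>{2..N}. R \<le> e * real i}. e\<^sup>2 * real i * c i t)
     \<le> (\<Sum>i\<in>{i\<in>{2..N}. R \<le> e * real i}. 2 * (e * ?w i * c i t))"
  proof (rule sum_mono)
    fix i assume "i \<in> {i\<in>{2..N}. R \<le> e * real i}"
    then have i: "2 \<le> i" "R \<le> e * real i" by auto
    let ?x = "e * real i"
    have "?x * (?x + R) \<le> 2 * ?x\<^sup>2"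
    proof -
      have "?x * R \<le> ?x * ?x" using i(2) R by (intro mult_left_mono) linarith+
      then show ?thesis by (simp add: power2_eq_square distrib_left mult.assoc mult.left_commute)
    qed
    then have "?x \<le> 2 * h ?x" using i R by (simp add: h_def field_simps)
    then have "e * ?x * c i t \<le> e * (2 * h ?x) * c i t"
      using e_pos c_nonneg[OF i(1) t] by (intro mult_right_mono mult_left_mono) auto
    then show "e\<^sup>2 * real i * c i t \<le> 2 * (e * ?w i * c i t)" by (simp add: power2_eq_square mult_ac)
  qed
  also have "\<dots> \<le> (\<Sum>i=2..N. 2 * (e * ?w i * c i t))"
    using e_pos R t by (intro sum_mono2) (auto simp: h_def c_nonneg)
  also have "\<dots> = 2 * (\<Sum>i=2..N. e * ?w i * c i t)" by (simp add: sum_distrib_left)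
  finally show ?thesis using * by simp
qed

text \<open>
  A flux costs at most a rate that is linear in the size, so number and mass of the clusters control
  the sum; this is behind all estimates of time derivatives below.
\<close>
lemma flux_sum_bound:
  assumes t: "0 \<le> t" and Z: "\<And>n. (\<Sum>i=2..n. e * c i t) \<le> Z"
  shows "(\<Sum>i=2..n. e * \<bar>J i t\<bar>) \<le> K * (1 + m) * (Z + m)"
proof -
  have mass: "(\<Sum>i=2..n. e\<^sup>2 * real i * c i t) \<le> m" for n
    using mass_partial[OF t, of n] u_nonneg[OF t] by linarith
  have lin: "(\<Sum>i=2..n. K * (e * c i t + e\<^sup>2 * real i * c i t)) \<le> K * (Z + m)" for n
  proof -
    have "(\<Sum>i=2..n. K * (e * c i t + e\<^sup>2 * real i * c i t)) =
        K * ((\<Sum>i=2..n. e * c i t) + (\<Sum>i=2..n. e\<^sup>2 * real i * c i t))"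
      by (simp only: sum_distrib_left sum.distrib distrib_left)
    also have "\<dots> \<le> K * (Z + m)" by (intro mult_left_mono add_mono Z mass K_nonneg)
    finally show ?thesis .
  qed
  have growth: "e * (k * c i t) \<le> K * (e * c i t + e\<^sup>2 * real i * c i t)"
    if "2 \<le> i" "k \<le> K * (1 + e * real i)" for i k
  proof -
    have "e * (k * c i t) \<le> e * ((K * (1 + e * real i)) * c i t)"
      using that e_pos c_nonneg[of i t] t by (intro mult_left_mono mult_right_mono) auto
    then show ?thesis by (simp add: algebra_simps power2_eq_square)
  qed
  have "(\<Sum>i=2..n. e * \<bar>J i t\<bar>) \<le>
     (\<Sum>i=2..n. m * (K * (e * c i t + e\<^sup>2 * real i * c i t)) +
        K * (e * c (i+1) t + e\<^sup>2 * real (i+1) * c (i+1) t))"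
  proof (rule sum_mono)
    fix i assume "i \<in> {2..n}"
    then have i: "2 \<le> i" by simp
    have "\<bar>J i t\<bar> \<le> a i * u t * c i t + b (i+1) * c (i+1) t"
    proof -
      have "0 \<le> a i * u t * c i t" using a_nonneg[OF i] c_nonneg[OF i t] u_nonneg[OF t] by simp
      moreover have "0 \<le> b (i+1) * c (i+1) t" using b_nonneg[of "i+1"] c_nonneg[of "i+1" t] i t by simp
      ultimately show ?thesis using J_upper[OF i t] J_lower[OF i t] by linarith
    qed
    also have "\<dots> \<le> a i * m * c i t + b (i+1) * c (i+1) t"
      using u_le[OF t] a_nonneg[OF i] c_nonneg[OF i t] by (simp add: mult_left_mono mult_right_mono)
    finally have "e * \<bar>J i t\<bar> \<le> e * (a i * m * c i t + b (i+1) * c (i+1) t)"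
      using e_pos by (intro mult_left_mono) auto
    also have "\<dots> = m * (e * (a i * c i t)) + e * (b (i+1) * c (i+1) t)" by (simp add: algebra_simps)
    also have "\<dots> \<le> m * (K * (e * c i t + e\<^sup>2 * real i * c i t)) +
        K * (e * c (i+1) t + e\<^sup>2 * real (i+1) * c (i+1) t)"
      using growth[of i "a i"] growth[of "i+1" "b (i+1)"] a_le[OF i] b_le[of "i+1"] i m_nonneg
      by (intro add_mono mult_left_mono) auto
    finally show "e * \<bar>J i t\<bar> \<le> m * (K * (e * c i t + e\<^sup>2 * real i * c i t)) +
        K * (e * c (i+1) t + e\<^sup>2 * real (i+1) * c (i+1) t)" .
  qed
  also have "\<dots> = m * (\<Sum>i=2..n. K * (e * c i t + e\<^sup>2 * real i * c i t)) +
      (\<Sum>i=2..n. K * (e * c (i+1) t + e\<^sup>2 * real (i+1) * c (i+1) t))"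
    by (simp only: sum.distrib sum_distrib_left)
  also have "(\<Sum>i=2..n. K * (e * c (i+1) t + e\<^sup>2 * real (i+1) * c (i+1) t)) =
     (\<Sum>i=2+1..n+1. K * (e * c i t + e\<^sup>2 * real i * c i t))"
    by (subst sum.shift_bounds_cl_nat_ivl) simp
  also have "\<dots> \<le> (\<Sum>i=2..n+1. K * (e * c i t + e\<^sup>2 * real i * c i t))"
    using K_nonneg e_pos c_nonneg t by (intro sum_mono2) auto
  also have "\<dots> \<le> K * (Z + m)" by (rule lin)
  also have "m * (\<Sum>i=2..n. K * (e * c i t + e\<^sup>2 * real i * c i t)) \<le> m * (K * (Z + m))"
    using lin[of n] m_nonneg by (intro mult_left_mono) auto
  finally show ?thesis by (simp add: algebra_simps)
qed

lemma u_deriv_bound: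
  assumes t0: "0 \<le> t" and Zt: "\<And>n. (\<Sum>i=2..n. e * c i t) \<le> Z"
  shows "\<bar>- e * J 1 t - e * (\<Sum>i. J (i + 1) t)\<bar> \<le>
    2 * (\<alpha> * m\<^sup>2 + \<beta> * Z) + K * (1 + m) * (Z + m)"
proof -
  let ?B = "\<alpha> * m\<^sup>2 + \<beta> * Z" and ?D = "K * (1 + m) * (Z + m)"
  have J1: "\<bar>e * J 1 t\<bar> \<le> ?B"
  proof -
    have er: "e powr r \<le> 1" using e_pos e_le r_nonneg by (simp add: powr_le1)
    have ec: "0 \<le> e * c 2 t" "e * c 2 t \<le> Z" using Zt[of 2] e_pos c_nonneg[of 2 t] t0 by auto
    have "e powr r * \<beta> * (e * c 2 t) \<le> 1 * \<beta> * Z"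
      using er ec \<beta>_nonneg by (intro mult_mono) auto
    moreover have "0 \<le> e powr r * \<beta> * (e * c 2 t)" using ec \<beta>_nonneg by auto
    moreover have "\<alpha> * (u t)\<^sup>2 \<le> \<alpha> * m\<^sup>2"
      using u_le[OF t0] u_nonneg[OF t0] \<alpha>_nonneg by (intro mult_left_mono power_mono) auto
    then have "e * (\<alpha> * (u t)\<^sup>2) \<le> 1 * (\<alpha> * m\<^sup>2)"
      using mult_mono[OF e_le, of "\<alpha> * (u t)\<^sup>2" "\<alpha> * m\<^sup>2"] \<alpha>_nonneg
      by (meson mult_nonneg_nonneg zero_le_one zero_le_power2)
    moreover have "0 \<le> e * (\<alpha> * (u t)\<^sup>2)" using e_pos \<alpha>_nonneg by simp
    moreover have "e * J 1 t = e * (\<alpha> * (u t)\<^sup>2) - e powr r * \<beta> * (e * c 2 t)"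
      by (simp add: J_1[simplified] algebra_simps)
    ultimately show ?thesis by linarith
  qed
  have part: "\<bar>e * (\<Sum>i<n. J (i + 1) t)\<bar> \<le> ?B + ?D" for n
  proof (cases n)
    case 0
    then show ?thesis using J1 flux_sum_bound[OF t0 Zt, of 0] by simp
  next
    case (Suc k)
    have "(\<Sum>i<n. J (i + 1) t) = J 1 t + (\<Sum>i=2..n. J i t)"
      using sum_shift2[of "\<lambda>i. J i t" n] unfolding Suc sum.lessThan_Suc_shift by simp
    then have "\<bar>e * (\<Sum>i<n. J (i + 1) t)\<bar> \<le> \<bar>e * J 1 t\<bar> + \<bar>\<Sum>i=2..n. e * J i t\<bar>"
      by (simp add: distrib_left sum_distrib_left)
    also have "\<bar>\<Sum>i=2..n. e * J i t\<bar> \<le> (\<Sum>i=2..n. e * \<bar>J i t\<bar>)"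
      using e_pos by (intro order.trans[OF sum_abs]) (simp add: abs_mult)
    finally show ?thesis using J1 flux_sum_bound[OF t0 Zt, of n] by linarith
  qed
  have "(\<lambda>n. \<bar>e * (\<Sum>i<n. J (i + 1) t)\<bar>) \<longlonglongrightarrow> \<bar>e * (\<Sum>i. J (i + 1) t)\<bar>"
    using summable_LIMSEQ[OF J_summable[OF t0]] by (intro tendsto_intros)
  then have "\<bar>e * (\<Sum>i. J (i + 1) t)\<bar> \<le> ?B + ?D"
    using part by (intro LIMSEQ_le_const2) auto
  then show ?thesis using J1 by (simp add: abs_if split: if_splits)
qed

text \<open>
  The increments of a Lipschitz weight are of order \<open>e\<close>, which is what \<open>flux_sum_bound\<close> requires.  At
  the boundary, however, the weight need not vanish, and a bound on \<open>J 1\<close> has to come from elsewhere.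
\<close>
lemma weighted_sum_lipschitz:
  assumes Z: "\<And>n t. 0 \<le> t \<Longrightarrow> t \<le> T \<Longrightarrow> (\<Sum>i=2..n. e * c i t) \<le> Z"
    and J1: "\<And>t. 0 \<le> t \<Longrightarrow> t \<le> T \<Longrightarrow> \<bar>J 1 t\<bar> \<le> D"
    and w: "1 \<le> n" "w (n + 1) = 0" "\<bar>w 2\<bar> \<le> B" "0 \<le> L"
      "\<And>i. 2 \<le> i \<Longrightarrow> \<bar>w (i + 1) - w i\<bar> \<le> L * e"
    and st: "s \<in> {0..T}" "t \<in> {0..T}"
  shows "\<bar>(\<Sum>i=2..n. e * w i * c i t) - (\<Sum>i=2..n. e * w i * c i s)\<bar>
    \<le> (B * D + L * (K * (1 + m) * (Z + m))) * \<bar>t - s\<bar>"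
proof -
  let ?G = "\<lambda>s. \<Sum>i=2..n. e * w i * c i s"
  have "norm (w 2 * J 1 t + (\<Sum>i=2..n. (w (i + 1) - w i) * J i t)) \<le>
     B * D + L * (K * (1 + m) * (Z + m))" if "t \<in> {0..T}" for t
  proof -
    have t: "0 \<le> t" "t \<le> T" using that by auto
    have "\<bar>w 2 * J 1 t\<bar> \<le> B * D"
      using w(3) J1[OF t] unfolding abs_mult by (intro mult_mono) auto
    moreover have "\<bar>\<Sum>i=2..n. (w (i + 1) - w i) * J i t\<bar> \<le> (\<Sum>i=2..n. L * e * \<bar>J i t\<bar>)"
      using w(5) by (intro order.trans[OF sum_abs] sum_mono) (auto simp: abs_mult intro!: mult_right_mono)
    moreover have "(\<Sum>i=2..n. L * e * \<bar>J i t\<bar>) = L * (\<Sum>i=2..n. e * \<bar>J i t\<bar>)"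
      by (simp add: sum_distrib_left mult.assoc)
    moreover have "\<dots> \<le> L * (K * (1 + m) * (Z + m))"
      using flux_sum_bound[OF t(1) Z[OF t]] w(4) by (intro mult_left_mono) auto
    ultimately show ?thesis by simp
  qed
  then have "norm (?G t - ?G s) \<le> (B * D + L * (K * (1 + m) * (Z + m))) * norm (t - s)"
  proof (intro field_differentiable_bound[where S="{0..T}"])
    show "(?G has_real_derivative (w 2 * J 1 x + (\<Sum>i=2..n. (w (i + 1) - w i) * J i x)))
        (at x within {0..T})" if "x \<in> {0..T}" for x
      using that w(1,2)
      by (intro has_field_derivative_subset[OF weighted_sum_deriv_const[of x n w]]) auto
  qed (use st in auto)
  then show ?thesis by simp
qed

text \<open>
  As long as growth dominates fragmentation for the sizes below \<open>I\<close>, a decreasing weight damps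
  the small concentrations on the fast time scale \<open>e powr (1 - r)\<close>, while nucleation feeds them at a
  bounded rate.  The weight \<open>exp (- i * z) - exp (- I * z)\<close> vanishes at \<open>I\<close> but has the same increments
  as \<open>exp (- i * z)\<close>; the fragmentation of clusters of size \<open>I\<close> remains as the source \<open>Q\<close>.
\<close>
lemma exponential_moment:
  assumes z: "0 < z" and k: "0 < k"
    and ul: "\<And>t. 0 \<le> t \<Longrightarrow> t \<le> T \<Longrightarrow> ul \<le> u t"
    and dom: "\<And>i. 2 \<le> i \<Longrightarrow> i < I \<Longrightarrow> k * e powr r \<le> a i * ul - exp z * (if i = 2 then 0 else b i)"
    and init: "\<And>n. (\<Sum>i=2..n. e powr r * c i 0 * exp (- real i * z)) \<le> S"
    and last: "\<And>t. 0 \<le> t \<Longrightarrow> t \<le> T \<Longrightarrow> exp (- (real I - 1) * z) * (b I * c I t) \<le> Q"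
    and t: "0 \<le> t" "t \<le> T" and i: "2 \<le> i" "i < I"
  shows "e powr r * c i t * (exp (- real i * z) - exp (- real I * z)) \<le>
    max S ((\<alpha> * m\<^sup>2 + Q) / (k * (1 - exp (- z))))"
proof -
  define p where "p = 1 - exp (- z)"
  have p: "0 < p" "p < 1" using z by (auto simp: p_def)
  let ?w = "\<lambda>i::nat. exp (- real i * z) - exp (- real I * z)"
  let ?G = "\<lambda>s. \<Sum>i=2..I-1. e * ?w i * c i s"
  have w0: "0 \<le> ?w i" if "i \<le> I" for i using that z by simp
  have I: "3 \<le> I" using i by simp
  have w2: "?w 2 \<le> 1"
  proof -
    have "exp (- real 2 * z) \<le> 1" using z by simp
    then show ?thesis using exp_gt_zero[of "- real I * z"] by linarith
  qed
  have wdiff: "?w (i + 1) - ?w i = - (p * exp (- real i * z))" for i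
    by (simp add: p_def algebra_simps exp_diff exp_minus exp_add field_simps)
  have Q0: "0 \<le> Q"
  proof -
    have "0 \<le> exp (- (real I - 1) * z) * (b I * c I t)"
      using b_nonneg[of I] c_nonneg[of I t] I t by simp
    then show ?thesis using last[OF t] by linarith
  qed
  have "?G t \<le> max (?G 0) ((\<alpha> * m\<^sup>2 + Q) / (p * k * e powr (r - 1)))"
  proof (rule gronwall_relaxation[OF t(1)])
    show "0 < p * k * e powr (r - 1)" using p k e_pos by simp
    fix s assume "0 \<le> s" "s \<le> t"
    then have s: "0 \<le> s" "s \<le> T" using t by auto
    show "(?G has_real_derivative
         (?w 2 * J 1 s + (\<Sum>i=2..I-1. (?w (i + 1) - ?w i) * J i s))) (at s within {0..})"
      by (rule weighted_sum_deriv_const) (use s I in auto)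
    have 1: "?w 2 * J 1 s \<le> \<alpha> * m\<^sup>2"
    proof -
      have "?w 2 * J 1 s \<le> ?w 2 * (\<alpha> * m\<^sup>2)"
        using J1_upper[OF s(1)] w0[of 2] I by (intro mult_left_mono) auto
      also have "\<dots> \<le> \<alpha> * m\<^sup>2" using w2 w0[of 2] I \<alpha>_nonneg by (intro mult_left_le_one_le) auto
      finally show ?thesis .
    qed
    let ?B = "\<lambda>i. if i = 2 then 0 else b i"
    have shift: "(\<Sum>i=2..I-1. exp (- real i * z) * (b (i+1) * c (i+1) s)) =
       (\<Sum>i=2..I-1. exp (- real i * z) * (exp z * ?B i * c i s)) + exp (- (real I - 1) * z) * (b I * c I s)"
    proof -
      have "(\<Sum>i=2..I-1. exp (- real i * z) * (b (i+1) * c (i+1) s)) =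
        (\<Sum>i=2..I-1. exp (- real (i+1) * z) * (exp z * ?B (i+1) * c (i+1) s))"
        by (intro sum.cong) (auto simp: exp_add[symmetric] algebra_simps)
      also have "\<dots> = (\<Sum>i=2+1..I-1+1. exp (- real i * z) * (exp z * ?B i * c i s))"
        by (subst sum.shift_bounds_cl_nat_ivl) simp
      also have "\<dots> = (\<Sum>i=2..I. exp (- real i * z) * (exp z * ?B i * c i s))"
      proof (rule sum.mono_neutral_left)
        have "{2..I} - {2 + 1..I - 1 + 1} = {2}" using I by auto
        then show "\<forall>i\<in>{2..I} - {2 + 1..I - 1 + 1}. exp (- real i * z) * (exp z * ?B i * c i s) = 0"
          by simp
      qed (use I in auto)
      also have "\<dots> = (\<Sum>i=2..Suc (I-1). exp (- real i * z) * (exp z * ?B i * c i s))"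
        using I by simp
      also have "\<dots> = (\<Sum>i=2..I-1. exp (- real i * z) * (exp z * ?B i * c i s))
         + exp (- real I * z) * (exp z * ?B I * c I s)"
        using I by (subst sum.cl_ivl_Suc) auto
      also have "exp (- real I * z) * (exp z * ?B I * c I s) = exp (- (real I - 1) * z) * (b I * c I s)"
        using I by (simp add: algebra_simps exp_add[symmetric] exp_diff exp_minus field_simps)
      finally show ?thesis .
    qed
    have "(\<Sum>i=2..I-1. (?w (i + 1) - ?w i) * J i s) =
        - (p * (\<Sum>i=2..I-1. exp (- real i * z) * (a i * u s * c i s)))
        + p * (\<Sum>i=2..I-1. exp (- real i * z) * (b (i+1) * c (i+1) s))"
      unfolding sum_distrib_left sum_negf[symmetric] sum.distrib[symmetric]
      by (intro sum.cong refl) (simp only: wdiff, simp add: J_ge2 algebra_simps)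
    also have "\<dots> = p * (exp (- (real I - 1) * z) * (b I * c I s))
       - p * (\<Sum>i=2..I-1. exp (- real i * z) * ((a i * u s - exp z * ?B i) * c i s))"
      unfolding shift by (simp add: distrib_left sum_subtractf algebra_simps)
    also have "\<dots> \<le> Q - p * (\<Sum>i=2..I-1. k * e powr (r - 1) * (e * ?w i * c i s))"
    proof (intro diff_mono mult_left_mono sum_mono)
      have "p * (exp (- (real I - 1) * z) * (b I * c I s)) \<le> 1 * Q"
        using last[OF s] p Q0 b_nonneg[of I] c_nonneg[of I s] s I
        by (intro mult_mono) auto
      then show "p * (exp (- (real I - 1) * z) * (b I * c I s)) \<le> Q" by simp
      fix i assume "i \<in> {2..I-1}"
      then have i: "2 \<le> i" "i < I" using I by auto
      have ci: "0 \<le> c i s" by (rule c_nonneg[OF i(1) s(1)])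
      have "a i * ul \<le> a i * u s" using ul[OF s] a_nonneg[OF i(1)] by (intro mult_left_mono) auto
      then have dm: "k * e powr r \<le> a i * u s - exp z * ?B i" using dom[OF i] by linarith
      have "k * e powr (r - 1) * (e * ?w i * c i s) = k * e powr r * (?w i * c i s)"
        using e_pos by (simp add: powr_diff)
      also have "\<dots> \<le> k * e powr r * (exp (- real i * z) * c i s)"
        using k ci by (intro mult_left_mono mult_right_mono) auto
      also have "\<dots> = exp (- real i * z) * ((k * e powr r) * c i s)" by simp
      also have "\<dots> \<le> exp (- real i * z) * ((a i * u s - exp z * ?B i) * c i s)"
        using dm ci by (intro mult_left_mono mult_right_mono) auto
      finally show "k * e powr (r - 1) * (e * ?w i * c i s)
        \<le> exp (- real i * z) * ((a i * u s - exp z * ?B i) * c i s)" .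
    qed (use p in auto)
    also have "\<dots> = Q - p * k * e powr (r - 1) * ?G s" by (simp add: sum_distrib_left mult.assoc)
    finally show "?w 2 * J 1 s + (\<Sum>i=2..I-1. (?w (i + 1) - ?w i) * J i s)
      \<le> \<alpha> * m\<^sup>2 + Q - p * k * e powr (r - 1) * ?G s" using 1 by linarith
  qed
  then have *: "e powr (r - 1) * ?G t \<le> e powr (r - 1) * max (?G 0) ((\<alpha> * m\<^sup>2 + Q) / (p * k * e powr (r - 1)))"
    by (intro mult_left_mono) auto
  have G_scaled: "e powr (r - 1) * ?G s = (\<Sum>i=2..I-1. e powr r * c i s * ?w i)" for s
    unfolding sum_distrib_left using e_pos by (intro sum.cong) (auto simp: powr_diff field_simps)
  have "e powr (r - 1) * max (?G 0) ((\<alpha> * m\<^sup>2 + Q) / (p * k * e powr (r - 1))) =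
    max (e powr (r - 1) * ?G 0) ((\<alpha> * m\<^sup>2 + Q) / (k * p))"
    using e_pos by (simp add: max_mult_distrib_left mult_ac)
  also have "\<dots> \<le> max S ((\<alpha> * m\<^sup>2 + Q) / (k * p))"
  proof -
    have "e powr (r - 1) * ?G 0 \<le> (\<Sum>i=2..I-1. e powr r * c i 0 * exp (- real i * z))"
      unfolding G_scaled using e_pos c_nonneg[of _ 0] by (intro sum_mono mult_left_mono) auto
    also have "\<dots> \<le> S" by (rule init)
    finally show ?thesis by auto
  qed
  finally have "e powr (r - 1) * ?G t \<le> max S ((\<alpha> * m\<^sup>2 + Q) / (k * p))" using * by linarith
  moreover have "e powr r * c i t * ?w i \<le> (\<Sum>i=2..I-1. e powr r * c i t * ?w i)"
    using i t w0 c_nonneg by (intro member_le_sum[of i]) auto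
  ultimately show ?thesis unfolding G_scaled p_def by linarith
qed

text \<open>
  Since \<open>J (i - 1) - J i\<close> is the time derivative of \<open>e * c i\<close>, an integration by parts in time leaves
  only \<open>e * c i\<close>, which is small although \<open>c i\<close> is large: this is the quasi-steady state of the
  small sizes.
\<close>
lemma flux_balance:
  assumes T: "0 \<le> T" and i: "2 \<le> i"
    and psi: "\<And>t. 0 \<le> t \<Longrightarrow> t \<le> T \<Longrightarrow> (\<psi> has_real_derivative \<psi>' t) (at t within {0..T})"
    and bd: "\<And>t. 0 \<le> t \<Longrightarrow> t \<le> T \<Longrightarrow> \<bar>\<psi> t\<bar> \<le> C" "\<And>t. 0 \<le> t \<Longrightarrow> t \<le> T \<Longrightarrow> \<bar>\<psi>' t\<bar> \<le> C"
    and D: "\<And>t. 0 \<le> t \<Longrightarrow> t \<le> T \<Longrightarrow> e * c i t \<le> D"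
  shows "\<bar>integral {0..T} (\<lambda>t. \<psi> t * (J (i - 1) t - J i t))\<bar> \<le> C * D * (2 + T)"
proof -
  let ?f = "\<lambda>t. \<psi> t * (e * c i t)" and ?h = "\<lambda>t. \<psi> t * (J (i - 1) t - J i t)"
  have psi_cont: "continuous_on {0..T} \<psi>" using psi by (intro DERIV_continuous_on) auto
  have "continuous_on {0..T} ?h"
    using i by (intro continuous_intros psi_cont continuous_on_subset[OF J_cont]) auto
  then have h: "(?h has_integral integral {0..T} ?h) {0..T}"
    by (intro integrable_integral integrable_continuous_real)
  have "((\<lambda>t. \<psi>' t * (e * c i t) + ?h t) has_integral (?f T - ?f 0)) {0..T}"
  proof (rule fundamental_theorem_of_calculus[OF T])
    fix t assume "t \<in> {0..T}"
    then have t: "0 \<le> t" "t \<le> T" by auto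
    have "(c i has_real_derivative (1 / e * (J (i - 1) t - J i t))) (at t within {0..T})"
      by (rule has_field_derivative_subset[OF c_deriv[OF i t(1)]]) auto
    then have "(?f has_real_derivative (\<psi>' t * (e * c i t) + ?h t)) (at t within {0..T})"
      using e_pos by (auto intro!: derivative_eq_intros psi[OF t] simp: algebra_simps)
    then show "(?f has_vector_derivative (\<psi>' t * (e * c i t) + ?h t)) (at t within {0..T})"
      by (rule has_real_derivative_iff_has_vector_derivative[THEN iffD1])
  qed
  from has_integral_diff[OF this h]
  have "((\<lambda>t. \<psi>' t * (e * c i t)) has_integral (?f T - ?f 0 - integral {0..T} ?h)) {0..T}" by simp
  moreover have D0: "0 \<le> D" using D[of 0] T e_pos c_nonneg[OF i, of 0]
    by (smt (verit) mult_nonneg_nonneg)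
  moreover have C0: "0 \<le> C" using bd(1)[of 0] T by simp
  moreover have "norm (\<psi>' t * (e * c i t)) \<le> C * D" if "t \<in> {0..T}" for t
    using that bd(2)[of t] D[of t] c_nonneg[OF i, of t] e_pos C0 unfolding norm_mult
    by (intro mult_mono) auto
  ultimately have "norm (?f T - ?f 0 - integral {0..T} ?h) \<le> C * D * measure lborel {0..T}"
    by (intro has_integral_bound_real[where S="{}"]) auto
  moreover have "\<bar>?f t\<bar> \<le> C * D" if "0 \<le> t" "t \<le> T" for t
    using that bd(1)[of t] D[of t] c_nonneg[OF i, of t] e_pos C0 unfolding abs_mult
    by (intro mult_mono) auto
  from this[of T] this[of 0] have "\<bar>?f T\<bar> \<le> C * D" "\<bar>?f 0\<bar> \<le> C * D" using T by auto
  ultimately show ?thesis using T by (simp add: algebra_simps)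
qed

end


section \<open>Compactness for paths of measures on the half-line\<close>

lemma finite_borel_measurable:
  assumes "\<mu> \<in> finite_borel U"
  shows "borel_measurable \<mu> = borel_measurable (restrict_space borel U)" and "space \<mu> = U"
proof -
  have s: "sets \<mu> = sets (restrict_space borel U)" using assms by (simp add: finite_borel_def)
  show "borel_measurable \<mu> = borel_measurable (restrict_space borel U)"
    by (rule measurable_cong_sets[OF s refl])
  show "space \<mu> = U" using sets_eq_imp_space_eq[OF s] by (simp add: space_restrict_space)
qed

lemma integrable_finite_borel:
  fixes \<phi> :: "real \<Rightarrow> real"
  assumes "\<mu> \<in> finite_borel U" "continuous_on U \<phi>" "\<And>x. x \<in> U \<Longrightarrow> \<bar>\<phi> x\<bar> \<le> B"
  shows "integrable \<mu> \<phi>"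
proof -
  interpret finite_measure \<mu> using assms(1) by (simp add: finite_borel_def)
  show ?thesis
    using assms finite_borel_measurable[OF assms(1)]
    by (intro integrable_const_bound[of _ B]) (auto intro!: borel_measurable_continuous_on_restrict)
qed

lemma Cc_half_line_iff:
  "\<phi> \<in> Cc {0..} \<longleftrightarrow> continuous_on {0..} \<phi> \<and> (\<exists>R>0. \<forall>x\<ge>R. \<phi> x = (0::real))"
proof
  assume "\<phi> \<in> Cc {0..}"
  then obtain K where c: "continuous_on {0..} \<phi>" and K: "compact K" "\<forall>x\<in>{0..} - K. \<phi> x = 0"
    by (auto simp: Cc_def)
  obtain R where R: "\<And>x. x \<in> K \<Longrightarrow> norm x < R" "0 < R"
    using compact_imp_bounded[OF K(1)] bounded_pos_less by metis
  have "\<phi> x = 0" if "R \<le> x" for x using that R K(2) by force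
  then show "continuous_on {0..} \<phi> \<and> (\<exists>R>0. \<forall>x\<ge>R. \<phi> x = 0)" using c R by auto
next
  assume "continuous_on {0..} \<phi> \<and> (\<exists>R>0. \<forall>x\<ge>R. \<phi> x = 0)"
  then obtain R where "continuous_on {0..} \<phi>" "\<forall>x\<ge>R. \<phi> x = 0" by auto
  then show "\<phi> \<in> Cc {0..}" unfolding Cc_def by (auto intro!: exI[of _ "{0..R}"])
qed

lemma Cc_half_line_bounded:
  assumes "\<phi> \<in> Cc {0..}"
  obtains B :: real where "0 \<le> B" "\<And>x. 0 \<le> x \<Longrightarrow> \<bar>\<phi> x\<bar> \<le> B"
proof -
  obtain R where c: "continuous_on {0..} \<phi>" and R: "\<And>x. x \<ge> R \<Longrightarrow> \<phi> x = 0"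
    using assms Cc_half_line_iff by auto
  have "bounded (\<phi> ` {0..R})"
    by (intro compact_imp_bounded compact_continuous_image continuous_on_subset[OF c]) auto
  then obtain B where "\<forall>y\<in>\<phi> ` {0..R}. norm y \<le> B" by (auto simp: bounded_iff)
  then have B: "\<And>x. 0 \<le> x \<Longrightarrow> x \<le> R \<Longrightarrow> \<bar>\<phi> x\<bar> \<le> B" by auto
  have "\<bar>\<phi> x\<bar> \<le> max 0 B" if "0 \<le> x" for x
    using B[of x] R[of x] that by (cases "x \<le> R") auto
  then show ?thesis using that[of "max 0 B"] by auto
qed

lemma integrable_Cc:
  assumes "\<mu> \<in> finite_borel {0..}" "\<phi> \<in> Cc {0..}" shows "integrable \<mu> \<phi>"
proof -
  obtain B where "\<And>x. 0 \<le> x \<Longrightarrow> \<bar>\<phi> x\<bar> \<le> B" by (rule Cc_half_line_bounded[OF assms(2)]) blast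
  then show ?thesis
    using assms(2) by (intro integrable_finite_borel[OF assms(1), of _ B]) (auto simp: Cc_def)
qed

lemma density_on_integral:
  fixes g \<phi> :: "real \<Rightarrow> real"
  assumes "g \<in> borel_measurable borel" "\<And>x. 0 \<le> g x" "continuous_on {0..} \<phi>"
  shows "(\<integral>x. \<phi> x \<partial>density_on {0..} g) = (\<integral>x. indicator {0..} x * g x * \<phi> x \<partial>lborel)"
proof -
  have m: "borel_measurable (restrict_space lborel {0..}) = borel_measurable (restrict_space borel {0..})"
    by (rule measurable_cong_sets) (auto simp: sets_restrict_space)
  have "(\<integral>x. \<phi> x \<partial>density_on {0..} g) = (\<integral>x. g x *\<^sub>R \<phi> x \<partial>restrict_space lborel {0..})"
    unfolding density_on_def
    using assms by (intro integral_density)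
      (auto simp: m intro: borel_measurable_continuous_on_restrict measurable_restrict_space1)
  also have "\<dots> = (\<integral>x. indicator {0..} x * g x * \<phi> x \<partial>lborel)"
    by (subst integral_restrict_space) (auto simp: mult.assoc)
  finally show ?thesis .
qed

text \<open>
  The densities are completed to probability densities by mass on \<open>[-2, -1]\<close>, where no test function
  of the half-line sees it; the bound on the first moments gives tightness, and Helly's selection
  theorem applies.  The limit does not charge the gap \<open>(-1, 0)\<close>, so that a test function, which is
  only continuous on the closed half-line, may be continued through the gap to \<open>0\<close>.
\<close>
lemma density_compactness:
  fixes g :: "nat \<Rightarrow> real \<Rightarrow> real"
  assumes meas: "\<And>n. g n \<in> borel_measurable borel" and nonneg: "\<And>n x. 0 \<le> g n x"
    and mass: "\<And>n. (\<integral>\<^sup>+x. ennreal (indicator {0..} x * g n x) \<partial>lborel) \<le> ennreal C"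
    and moment: "\<And>n. (\<integral>\<^sup>+x. ennreal (indicator {0..} x * (x * g n x)) \<partial>lborel) \<le> ennreal C"
    and C: "0 < C"
  obtains r \<mu> where "strict_mono r" "\<mu> \<in> finite_borel {0..}" "measure \<mu> {0..} \<le> C"
    "weak_star_tendsto {0..} (\<lambda>n. density_on {0..} (g (r n))) \<mu> sequentially"
proof -
  define z where "z n = enn2real (\<integral>\<^sup>+x. ennreal (indicator {0..} x * g n x) \<partial>lborel)" for n
  have z: "(\<integral>\<^sup>+x. ennreal (indicator {0..} x * g n x) \<partial>lborel) = ennreal (z n)" "0 \<le> z n" "z n \<le> C" for n
  proof -
    have "(\<integral>\<^sup>+x. ennreal (indicator {0..} x * g n x) \<partial>lborel) < top"
      using mass[of n] by (simp add: order.strict_trans1)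
    then show "(\<integral>\<^sup>+x. ennreal (indicator {0..} x * g n x) \<partial>lborel) = ennreal (z n)" by (simp add: z_def)
    then show "z n \<le> C" using mass[of n] C by simp
  qed (simp add: z_def)
  define G where "G n x = indicator {0..} x * g n x / C + (C - z n) / C * indicator {-2..-1} x" for n x
  define M where "M n = density lborel (\<lambda>x. ennreal (G n x))" for n
  have G_meas[measurable]: "G n \<in> borel_measurable borel" for n
    unfolding G_def using meas[of n] by measurable
  have G_nonneg: "0 \<le> G n x" for n x using nonneg z C by (auto simp: G_def)
  have prob: "emeasure (M n) UNIV = 1" for n
  proof -
    have "emeasure (M n) UNIV = (\<integral>\<^sup>+x. ennreal (G n x) \<partial>lborel)"
      unfolding M_def by (subst emeasure_density) auto
    also have "\<dots> = (\<integral>\<^sup>+x. ennreal (1 / C) * ennreal (indicator {0..} x * g n x)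
        + ennreal ((C - z n) / C) * indicator {-2..-1} x \<partial>lborel)"
      using C z nonneg
      by (intro nn_integral_cong)
        (auto simp: G_def ennreal_mult'[symmetric] split: split_indicator)
    also have "\<dots> = ennreal (1 / C) * ennreal (z n) + ennreal ((C - z n) / C) * 1"
      using meas[of n] by (subst nn_integral_add) (auto simp: nn_integral_cmult z)
    also have "\<dots> = ennreal (1 / C * z n + (C - z n) / C)"
    proof -
      have "0 \<le> 1 / C * z n" "0 \<le> (C - z n) / C" using C z(2,3)[of n] by auto
      then show ?thesis using C z(2)[of n]
        by (subst ennreal_plus) (auto simp: ennreal_mult'[symmetric])
    qed
    also have "\<dots> = 1" using C by (simp add: field_simps)
    finally show ?thesis .
  qed
  have rd: "real_distribution (M n)" for n
  proof (intro real_distribution.intro real_distribution_axioms.intro prob_spaceI)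
    have "space (M n) = UNIV" "sets (M n) = sets borel" by (simp_all add: M_def)
    then show "emeasure (M n) (space (M n)) = 1" "sets (M n) = sets borel" using prob by simp_all
  qed
  have tight: "tight M"
    unfolding tight_def
  proof (intro conjI allI impI rd)
    fix e :: real assume e: "0 < e"
    define b where "b = 1 / e + 1"
    have b: "0 < b" "1 / b < e" using e by (auto simp: b_def field_simps add_pos_pos)
    have "measure (M n) {-3<..b} > 1 - e" for n
    proof -
      interpret real_distribution "M n" by (rule rd)
      have "emeasure (M n) (UNIV - {-3<..b}) = (\<integral>\<^sup>+x. ennreal (G n x) * indicator (UNIV - {-3<..b}) x \<partial>lborel)"
        unfolding M_def by (subst emeasure_density) auto
      also have "\<dots> \<le> (\<integral>\<^sup>+x. ennreal (1 / (b * C)) * ennreal (indicator {0..} x * (x * g n x)) \<partial>lborel)"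
      proof (rule nn_integral_mono)
        fix x :: real
        show "ennreal (G n x) * indicator (UNIV - {-3<..b}) x
           \<le> ennreal (1 / (b * C)) * ennreal (indicator {0..} x * (x * g n x))"
        proof (cases "b < x")
          case True
          have "g n x / C \<le> 1 / (b * C) * (x * g n x)"
            using True b C nonneg[of n x] mult_right_mono[of b x "g n x"] by (simp add: field_simps)
          then show ?thesis using True b C
            by (simp add: G_def ennreal_mult'[symmetric] ennreal_leI)
        next
          case False
          then show ?thesis by (auto simp: G_def split: split_indicator)
        qed
      qed
      also have "\<dots> = ennreal (1 / (b * C)) * (\<integral>\<^sup>+x. ennreal (indicator {0..} x * (x * g n x)) \<partial>lborel)"
        using meas[of n] by (intro nn_integral_cmult) measurable
      also have "\<dots> \<le> ennreal (1 / (b * C)) * ennreal C" by (intro mult_left_mono moment) auto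
      also have "\<dots> = ennreal (1 / b)" using b C by (simp add: ennreal_mult'[symmetric])
      finally have "measure (M n) (UNIV - {-3<..b}) \<le> 1 / b"
        using b by (simp add: emeasure_eq_measure)
      moreover have "measure (M n) (UNIV - {-3<..b}) = 1 - measure (M n) {-3<..b}"
        using prob_compl[of "{-3<..b}"] by (simp add: space_eq_univ)
      ultimately show ?thesis using b by simp
    qed
    then show "\<exists>a b. a < b \<and> (\<forall>n. 1 - e < measure (M n) {a<..b})"
      using b by (intro exI[of _ "-3"] exI[of _ b]) auto
  qed
  obtain r P where r: "strict_mono (r :: nat \<Rightarrow> nat)" and P: "real_distribution P"
    and conv: "weak_conv_m (M \<circ> id \<circ> r) P"
    using tight_imp_convergent_subsubsequence[OF tight, of id] by (auto simp: strict_mono_def)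
  interpret P: real_distribution P by (rule P)
  have lim: "(\<lambda>n. integral\<^sup>L (M (r n)) f) \<longlonglongrightarrow> integral\<^sup>L P f"
    if "\<And>x. isCont f x" "\<And>x. norm (f x) \<le> B" for f :: "real \<Rightarrow> real" and B
    using weak_conv_imp_integral_bdd_continuous_conv[of "M \<circ> id \<circ> r" P f B] that rd P conv by simp
  have int_M: "integral\<^sup>L (M n) f = (\<integral>x. indicator {0..} x * g n x * f x \<partial>lborel) / C"
    if [measurable]: "f \<in> borel_measurable borel" and "\<And>x. x \<le> -1 \<Longrightarrow> f x = 0" for f n
  proof -
    have "integral\<^sup>L (M n) f = (\<integral>x. G n x *\<^sub>R f x \<partial>lborel)"
      unfolding M_def using G_nonneg by (intro integral_density) auto
    also have "\<dots> = (\<integral>x. (indicator {0..} x * g n x * f x) / C \<partial>lborel)"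
      using that(2) by (intro Bochner_Integration.integral_cong) (auto simp: G_def split: split_indicator)
    also have "\<dots> = (\<integral>x. indicator {0..} x * g n x * f x \<partial>lborel) / C" by simp
    finally show ?thesis .
  qed
  \<comment> \<open>the hat function on the gap integrates to \<open>0\<close> against all members of the sequence\<close>
  have gap: "AE x in P. x \<le> -1 \<or> 0 \<le> x"
  proof -
    let ?h = "\<lambda>x::real. max 0 (min (x + 1) (- x))"
    have hb: "norm (?h x) \<le> 1" for x by (auto simp: max_def min_def)
    have hc: "isCont ?h x" for x by (intro continuous_intros)
    have hm: "?h \<in> borel_measurable borel" by measurable
    have "integral\<^sup>L (M n) ?h = 0" for n
    proof -
      have "integral\<^sup>L (M n) ?h = (\<integral>x. indicator {0..} x * g n x * ?h x \<partial>lborel) / C"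
        by (rule int_M) auto
      also have "(\<lambda>x. indicator {0..} x * g n x * ?h x) = (\<lambda>x. 0)"
        by (auto split: split_indicator)
      finally show ?thesis by simp
    qed
    then have "integral\<^sup>L P ?h = 0" using lim[OF hc hb] by (simp add: LIMSEQ_const_iff)
    moreover have "integrable P ?h" using hb by (intro P.integrable_const_bound[of _ 1]) auto
    ultimately have "AE x in P. ?h x = 0" by (subst (asm) integral_nonneg_eq_0_iff_AE) auto
    then show ?thesis by eventually_elim (auto simp: max_def min_def split: if_splits)
  qed
  define \<mu> where "\<mu> = density (restrict_space P {0..}) (\<lambda>_. ennreal C)"
  have sets_\<mu>: "sets \<mu> = sets (restrict_space borel {0..})"
    by (simp add: \<mu>_def sets_restrict_space)
  have space_\<mu>: "space \<mu> = {0..}" by (simp add: \<mu>_def space_restrict_space)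
  have em: "emeasure \<mu> {0..} = ennreal (C * measure P {0..})"
  proof -
    have "emeasure \<mu> {0..} = ennreal C * emeasure (restrict_space P {0..}) {0..}"
      unfolding \<mu>_def
      by (subst emeasure_density_const) (auto simp: sets_restrict_space_iff)
    also have "emeasure (restrict_space P {0..}) {0..} = emeasure P {0..}"
      by (intro emeasure_restrict_space) auto
    finally show ?thesis using C by (simp add: P.emeasure_eq_measure ennreal_mult')
  qed
  have "\<mu> \<in> finite_borel {0..}"
    unfolding finite_borel_def using sets_\<mu> em space_\<mu> by (auto intro!: finite_measureI)
  moreover have "measure \<mu> {0..} \<le> C"
    using em C P.prob_le_1[of "{0..}"] by (simp add: measure_def mult_left_le)
  moreover have "weak_star_tendsto {0..} (\<lambda>n. density_on {0..} (g (r n))) \<mu> sequentially"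
    unfolding weak_star_tendsto_def
  proof
    fix \<phi> :: "real \<Rightarrow> real" assume \<phi>: "\<phi> \<in> Cc {0..}"
    then have c: "continuous_on {0..} \<phi>" using Cc_half_line_iff by auto
    obtain B where B: "0 \<le> B" "\<And>x. 0 \<le> x \<Longrightarrow> \<bar>\<phi> x\<bar> \<le> B" using Cc_half_line_bounded[OF \<phi>] by blast
    define f where "f x = \<phi> (max 0 x) * max 0 (1 + min x 0)" for x :: real
    have f_cont: "continuous_on UNIV f"
      unfolding f_def by (intro continuous_intros continuous_on_compose2[OF c]) auto
    then have fm: "f \<in> borel_measurable borel" by (rule borel_measurable_continuous_onI)
    have fb: "norm (f x) \<le> B" for x
    proof -
      have "\<bar>\<phi> (max 0 x)\<bar> * \<bar>max 0 (1 + min x 0)\<bar> \<le> B * 1"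
        using B by (intro mult_mono) auto
      then show ?thesis by (simp add: f_def abs_mult)
    qed
    have "(\<integral>x. \<phi> x \<partial>density_on {0..} (g n)) = C * integral\<^sup>L (M n) f" for n
    proof -
      have "integral\<^sup>L (M n) f = (\<integral>x. indicator {0..} x * g n x * f x \<partial>lborel) / C"
        by (rule int_M[OF fm]) (simp add: f_def)
      also have "(\<lambda>x. indicator {0..} x * g n x * f x) = (\<lambda>x. indicator {0..} x * g n x * \<phi> x)"
        by (auto simp: f_def split: split_indicator)
      finally show ?thesis using density_on_integral[OF meas[of n] nonneg c] C by simp
    qed
    moreover have "(\<integral>x. \<phi> x \<partial>\<mu>) = C * integral\<^sup>L P f"
    proof -
      have pm: "\<phi> \<in> borel_measurable (restrict_space P {0..})"
      proof -
        have "borel_measurable (restrict_space P {0..}) = borel_measurable (restrict_space borel {0..})"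
          by (rule measurable_cong_sets) (auto simp: sets_restrict_space)
        then show ?thesis using borel_measurable_continuous_on_restrict[OF c] by simp
      qed
      have "(\<integral>x. \<phi> x \<partial>\<mu>) = (\<integral>x. C *\<^sub>R \<phi> x \<partial>restrict_space P {0..})"
        unfolding \<mu>_def using pm C by (intro integral_density) auto
      also have "\<dots> = C * (\<integral>x. \<phi> x \<partial>restrict_space P {0..})" by simp
      also have "(\<integral>x. \<phi> x \<partial>restrict_space P {0..}) = (\<integral>x. indicator {0..} x *\<^sub>R \<phi> x \<partial>P)"
        by (intro integral_restrict_space) auto
      also have "\<dots> = integral\<^sup>L P f"
      proof (rule integral_cong_AE)
        show "(\<lambda>x. indicator {0..} x *\<^sub>R \<phi> x) \<in> borel_measurable P"
          using pm by (subst (asm) borel_measurable_restrict_space_iff) auto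
        show "AE x in P. indicator {0..} x *\<^sub>R \<phi> x = f x"
          using gap by eventually_elim (auto simp: f_def split: split_indicator)
      qed (use fm in auto)
      finally show ?thesis .
    qed
    moreover have "(\<lambda>n. C * integral\<^sup>L (M (r n)) f) \<longlonglongrightarrow> C * integral\<^sup>L P f"
      using f_cont fb by (intro tendsto_intros lim[of f B]) (auto simp: continuous_on_eq_continuous_at)
    ultimately show "(\<lambda>n. \<integral>x. \<phi> x \<partial>density_on {0..} (g (r n))) \<longlonglongrightarrow> (\<integral>x. \<phi> x \<partial>\<mu>)" by simp
  qed
  ultimately show ?thesis using that r by blast
qed

text \<open>
  Equicontinuity is only asked for up to an error that vanishes along the sequence.  Every time is
  within \<open>T / N\<close> of one of the finitely many grid times, where the sequence is Cauchy.
\<close>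
lemma uniform_limit_from_grid:
  fixes F :: "nat \<Rightarrow> real \<Rightarrow> real"
  assumes T: "0 < T"
    and equi: "\<And>e. 0 < e \<Longrightarrow> \<exists>\<delta>>0. \<exists>n0. \<forall>n\<ge>n0. \<forall>s\<in>{0..T}. \<forall>t\<in>{0..T}.
       \<bar>s - t\<bar> \<le> \<delta> \<longrightarrow> \<bar>F n s - F n t\<bar> \<le> e"
    and conv: "\<And>j N. j \<le> N \<Longrightarrow> 0 < N \<Longrightarrow> convergent (\<lambda>n. F n (T * real j / real N))"
  shows "\<exists>L. uniform_limit {0..T} F L sequentially"
proof -
  have "uniformly_Cauchy_on {0..T} F"
    unfolding uniformly_Cauchy_on_def
  proof (intro allI impI)
    fix e :: real assume e: "0 < e"
    obtain \<delta> n0 where \<delta>: "0 < \<delta>" and n0: "\<And>n s t. n \<ge> n0 \<Longrightarrow> s \<in> {0..T} \<Longrightarrow> t \<in> {0..T} \<Longrightarrow>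
       \<bar>s - t\<bar> \<le> \<delta> \<Longrightarrow> \<bar>F n s - F n t\<bar> \<le> e / 4"
    proof -
      have "\<exists>\<delta>>0. \<exists>n0. \<forall>n\<ge>n0. \<forall>s\<in>{0..T}. \<forall>t\<in>{0..T}. \<bar>s - t\<bar> \<le> \<delta> \<longrightarrow> \<bar>F n s - F n t\<bar> \<le> e / 4"
        using e by (intro equi) simp
      then show ?thesis using that by blast
    qed
    obtain N :: nat where N: "T / \<delta> < real N" using reals_Archimedean2 by blast
    then have N0: "0 < N" using T \<delta> by (metis divide_pos_pos less_trans of_nat_0_less_iff)
    have grid: "\<exists>n1. \<forall>m\<ge>n1. \<forall>n\<ge>n1. dist (F m (T * real j / real N)) (F n (T * real j / real N)) < e / 4"
      if "j \<le> N" for j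
      using conv[OF that N0] e unfolding Cauchy_convergent_iff[symmetric] by (intro metric_CauchyD) auto
    then obtain n1 where n1: "\<And>j m n. j \<le> N \<Longrightarrow> m \<ge> n1 j \<Longrightarrow> n \<ge> n1 j \<Longrightarrow>
       dist (F m (T * real j / real N)) (F n (T * real j / real N)) < e / 4" by metis
    define n2 where "n2 = max n0 (Max (n1 ` {..N}))"
    have "dist (F m x) (F n x) < e" if x: "x \<in> {0..T}" and m: "m \<ge> n2" and n: "n \<ge> n2" for x m n
    proof -
      define j where "j = nat \<lfloor>x * real N / T\<rfloor>"
      have xN: "0 \<le> x * real N / T" "x * real N / T \<le> real N" using x T by (auto simp: field_simps intro: mult_right_mono)
      have jr: "real j = of_int \<lfloor>x * real N / T\<rfloor>" using xN by (simp add: j_def)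
      have j1: "real j \<le> x * real N / T" "x * real N / T < real j + 1" unfolding jr by linarith+
      have jN: "j \<le> N" using j1(1) xN(2) by linarith
      let ?y = "T * real j / real N"
      have "real j * T \<le> x * real N" "x * real N < (real j + 1) * T" using j1 T by (auto simp: field_simps)
      then have "?y \<le> x" "x \<le> (T + T * real j) / real N"
        using N0 by (auto simp: pos_divide_le_eq pos_le_divide_eq algebra_simps)
      then have y: "?y \<le> x" "x - ?y \<le> T / real N" by (auto simp: add_divide_distrib)
      have "T / real N < \<delta>" using N \<delta> N0 T by (simp add: field_simps)
      then have xy: "\<bar>x - ?y\<bar> \<le> \<delta>" using y by linarith
      have yT: "?y \<in> {0..T}" using y(1) x T by auto
      have "n1 j \<le> Max (n1 ` {..N})" using jN by (intro Max_ge) auto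
      then have "n1 j \<le> n2" "n0 \<le> n2" by (auto simp: n2_def)
      then have "dist (F m ?y) (F n ?y) < e / 4" "\<bar>F m x - F m ?y\<bar> \<le> e / 4" "\<bar>F n x - F n ?y\<bar> \<le> e / 4"
        using n1[OF jN, of m n] n0[of m x ?y] n0[of n x ?y] m n x yT xy by auto
      then show ?thesis using e unfolding dist_real_def by linarith
    qed
    then show "\<exists>M. \<forall>x\<in>{0..T}. \<forall>m\<ge>M. \<forall>n\<ge>M. dist (F m x) (F n x) < e" by blast
  qed
  then show ?thesis
    using uniformly_convergent_eq_Cauchy uniformly_convergent_on_def by metis
qed

text \<open>
  The forward averages \<open>(F (x + h) - F x) / h\<close> of the primitive \<open>F\<close> are Lipschitz because \<open>F\<close> is, and
  by the mean value theorem they are values of \<open>\<phi>\<close> at distance less than \<open>h\<close>.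
\<close>
lemma Cc_Lipschitz_approx:
  fixes \<phi> :: "real \<Rightarrow> real"
  assumes \<phi>: "\<phi> \<in> Cc {0..}" and e: "0 < e"
  obtains \<psi> L R where "0 \<le> L" "0 < R" "\<And>x. x \<ge> R \<Longrightarrow> \<psi> x = 0"
    "\<And>x y. 0 \<le> x \<Longrightarrow> 0 \<le> y \<Longrightarrow> \<bar>\<psi> x - \<psi> y\<bar> \<le> L * \<bar>x - y\<bar>"
    "\<And>x. 0 \<le> x \<Longrightarrow> \<bar>\<phi> x - \<psi> x\<bar> \<le> e"
proof -
  obtain R where c: "continuous_on {0..} \<phi>" and R: "0 < R" "\<And>x. x \<ge> R \<Longrightarrow> \<phi> x = 0"
    using \<phi> Cc_half_line_iff by auto
  obtain B where B: "0 \<le> B" "\<And>x. 0 \<le> x \<Longrightarrow> \<bar>\<phi> x\<bar> \<le> B" using Cc_half_line_bounded[OF \<phi>] by blast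
  have "uniformly_continuous_on {0..R+1} \<phi>"
    by (intro compact_uniformly_continuous continuous_on_subset[OF c]) auto
  then obtain d where d: "0 < d" "\<And>x y. x \<in> {0..R+1} \<Longrightarrow> y \<in> {0..R+1} \<Longrightarrow> dist y x < d \<Longrightarrow> dist (\<phi> y) (\<phi> x) < e"
    unfolding uniformly_continuous_on_def using e by metis
  define h where "h = min 1 (d / 2)"
  have h: "0 < h" "h \<le> 1" "h < d" using d(1) by (auto simp: h_def)
  define F where "F x = integral {0..x} \<phi>" for x
  have F': "(F has_real_derivative \<phi> x) (at x within {0..b})" if "0 \<le> x" "x \<le> b" for x b
    unfolding F_def has_real_derivative_iff_has_vector_derivative
    using that by (intro integral_has_vector_derivative continuous_on_subset[OF c]) auto
  have F_cont: "continuous_on {x..y} F" if "0 \<le> x" for x y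
    by (rule DERIV_continuous_on, rule has_field_derivative_subset[OF F'[of _ y]]) (use that in auto)
  have mvt: "\<exists>\<xi>. x < \<xi> \<and> \<xi> < y \<and> F y - F x = (y - x) * \<phi> \<xi>" if "0 \<le> x" "x < y" for x y
  proof -
    have "\<exists>l \<xi>. x < \<xi> \<and> \<xi> < y \<and> (F has_real_derivative l) (at \<xi>) \<and> F y - F x = (y - x) * l"
    proof (rule MVT[OF that(2) F_cont[OF that(1)]])
      show "F differentiable (at \<xi>)" if "x < \<xi>" "\<xi> < y" for \<xi>
        using F'[of \<xi> y] that \<open>0 \<le> x\<close>
        by (auto simp: real_differentiable_def at_within_interior[of \<xi> "{0..y}"])
    qed
    then obtain l \<xi> where *: "x < \<xi>" "\<xi> < y" "(F has_real_derivative l) (at \<xi>)" "F y - F x = (y - x) * l"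
      by blast
    have "(F has_real_derivative \<phi> \<xi>) (at \<xi>)"
      using F'[of \<xi> y] * \<open>0 \<le> x\<close> by (auto simp: at_within_interior[of \<xi> "{0..y}"])
    then show ?thesis using * DERIV_unique by blast
  qed
  have F_lip: "\<bar>F x - F y\<bar> \<le> B * \<bar>x - y\<bar>" if "0 \<le> x" "0 \<le> y" for x y
  proof -
    have "\<bar>F x - F y\<bar> \<le> B * \<bar>x - y\<bar>" if xy: "0 \<le> x" "x < y" for x y
    proof -
      obtain \<xi> where "x < \<xi>" "F y - F x = (y - x) * \<phi> \<xi>" using mvt[OF xy] by blast
      then show ?thesis
        using B(2)[of \<xi>] xy mult_left_mono[of "\<bar>\<phi> \<xi>\<bar>" B "y - x"]
        by (simp add: abs_minus_commute[of "F x"] abs_mult mult.commute)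
    qed
    from this[of x y] this[of y x] that show ?thesis
      by (cases x y rule: linorder_cases) (auto simp: abs_minus_commute)
  qed
  define \<psi> where "\<psi> x = (F (x + h) - F x) / h" for x
  have near: "\<exists>\<xi>. x < \<xi> \<and> \<xi> < x + h \<and> \<psi> x = \<phi> \<xi>" if "0 \<le> x" for x
    using mvt[of x "x + h"] that h by (auto simp: \<psi>_def field_simps)
  show ?thesis
  proof (rule that[of "2 * B / h" R \<psi>])
    show "0 \<le> 2 * B / h" using B h by simp
    show "\<psi> x = 0" if "R \<le> x" for x using near[of x] that R by fastforce
    show "\<bar>\<psi> x - \<psi> y\<bar> \<le> 2 * B / h * \<bar>x - y\<bar>" if "0 \<le> x" "0 \<le> y" for x y
    proof -
      have "\<psi> x - \<psi> y = ((F (x + h) - F (y + h)) - (F x - F y)) / h"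
        by (simp add: \<psi>_def diff_divide_distrib)
      then have "\<bar>\<psi> x - \<psi> y\<bar> = \<bar>(F (x + h) - F (y + h)) - (F x - F y)\<bar> / h" using h by simp
      also have "\<dots> \<le> (2 * B * \<bar>x - y\<bar>) / h"
        using F_lip[of "x + h" "y + h"] F_lip[of x y] that h by (intro divide_right_mono) auto
      finally show ?thesis by simp
    qed
    show "\<bar>\<phi> x - \<psi> x\<bar> \<le> e" if x: "0 \<le> x" for x
    proof -
      obtain \<xi> where \<xi>: "x < \<xi>" "\<xi> < x + h" "\<psi> x = \<phi> \<xi>" using near[OF x] by blast
      show ?thesis
      proof (cases "x \<le> R")
        case True
        then have "dist (\<phi> \<xi>) (\<phi> x) < e" using \<xi> x h by (intro d(2)) (auto simp: dist_real_def)
        then show ?thesis using \<xi> by (simp add: dist_real_def abs_minus_commute)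
      qed (use \<xi> R e in simp)
    qed
  qed (use R in auto)
qed

text \<open>
  Diagonal extraction over the times \<open>T * j / N\<close> gives convergence there; equicontinuity
  against Lipschitz test functions extends it to all times, uniformly.
\<close>
lemma measure_path_compactness:
  fixes g :: "nat \<Rightarrow> real \<Rightarrow> real \<Rightarrow> real"
  assumes T: "0 < T" and C: "0 < C"
    and meas: "\<And>n t. g n t \<in> borel_measurable borel" and nonneg: "\<And>n t x. t \<in> {0..T} \<Longrightarrow> 0 \<le> g n t x"
    and mass: "\<And>n t. t \<in> {0..T} \<Longrightarrow> (\<integral>\<^sup>+x. ennreal (indicator {0..} x * g n t x) \<partial>lborel) \<le> ennreal C"
    and moment: "\<And>n t. t \<in> {0..T} \<Longrightarrow>
      (\<integral>\<^sup>+x. ennreal (indicator {0..} x * (x * g n t x)) \<partial>lborel) \<le> ennreal C"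
    and equi: "\<And>\<psi> L R. 0 \<le> L \<Longrightarrow> 0 < R \<Longrightarrow> (\<And>x. x \<ge> R \<Longrightarrow> \<psi> x = 0) \<Longrightarrow>
      (\<And>x y. 0 \<le> x \<Longrightarrow> 0 \<le> y \<Longrightarrow> \<bar>\<psi> x - \<psi> y\<bar> \<le> L * \<bar>x - y\<bar>) \<Longrightarrow>
      \<exists>D d. d \<longlonglongrightarrow> 0 \<and> (\<forall>n. \<forall>s\<in>{0..T}. \<forall>t\<in>{0..T}.
        \<bar>(\<integral>x. \<psi> x \<partial>density_on {0..} (g n s)) - (\<integral>x. \<psi> x \<partial>density_on {0..} (g n t))\<bar> \<le> D * \<bar>s - t\<bar> + d n)"
  obtains r \<mu> where "strict_mono r"
    "\<And>t. t \<in> {0..T} \<Longrightarrow> \<mu> t \<in> finite_borel {0..}" "\<And>t. t \<in> {0..T} \<Longrightarrow> measure (\<mu> t) {0..} \<le> C"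
    "\<And>\<phi>. \<phi> \<in> Cc {0..} \<Longrightarrow> uniform_limit {0..T} (\<lambda>n t. \<integral>x. \<phi> x \<partial>density_on {0..} (g (r n) t))
      (\<lambda>t. \<integral>x. \<phi> x \<partial>\<mu> t) sequentially"
proof -
  let ?I = "\<lambda>\<phi> n t. \<integral>x. \<phi> x \<partial>density_on {0..} (g n t)"
  have compact: "\<exists>r \<mu>. strict_mono (r::nat \<Rightarrow> nat) \<and> \<mu> \<in> finite_borel {0..} \<and> measure \<mu> {0..} \<le> C \<and>
     (\<forall>\<phi>\<in>Cc {0..}. (\<lambda>n. ?I \<phi> (s (r n)) t) \<longlonglongrightarrow> (\<integral>x. \<phi> x \<partial>\<mu>))"
    if t: "t \<in> {0..T}" for t and s :: "nat \<Rightarrow> nat"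
    using density_compactness[of "\<lambda>n. g (s n) t" C, OF meas nonneg[OF t] mass[OF t] moment[OF t] C]
    unfolding weak_star_tendsto_def by metis
  define q where "q k = (case prod_decode k of (j, N) \<Rightarrow> min T (T * real j / real N))" for k
  have q: "q k \<in> {0..T}" for k
    unfolding q_def using T by (auto split: prod.split)
  interpret subseqs "\<lambda>k s. \<forall>\<phi>\<in>Cc {0..}. convergent (\<lambda>n. ?I \<phi> (s n) (q k))"
  proof
    fix k and s :: "nat \<Rightarrow> nat" assume "strict_mono s"
    show "\<exists>r'. strict_mono r' \<and> (\<forall>\<phi>\<in>Cc {0..}. convergent (\<lambda>n. ?I \<phi> ((s \<circ> r') n) (q k)))"
      using compact[OF q[of k], of s] unfolding convergent_def o_def by blast
  qed
  let ?r = diagseq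
  have r: "strict_mono ?r" by (rule subseq_diagseq)
  have conv_q: "convergent (\<lambda>n. ?I \<phi> (?r n) (q k))" if \<phi>: "\<phi> \<in> Cc {0..}" for \<phi> k
  proof -
    have "\<forall>\<phi>\<in>Cc {0..}. convergent (\<lambda>n. ?I \<phi> ((diagseq \<circ> (+) (Suc k)) n) (q k))"
    proof (rule diagseq_holds)
      fix r s :: "nat \<Rightarrow> nat" and n
      assume r: "strict_mono r" and c: "\<forall>\<phi>\<in>Cc {0..}. convergent (\<lambda>k. ?I \<phi> (s k) (q n))"
      show "\<forall>\<phi>\<in>Cc {0..}. convergent (\<lambda>k. ?I \<phi> ((s \<circ> r) k) (q n))"
        using convergent_subseq_convergent[OF _ r] c by (fastforce simp: o_def)
    qed
    then have "convergent (\<lambda>n. ?I \<phi> (?r (n + Suc k)) (q k))" using \<phi> by (simp add: add.commute)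
    then show ?thesis
      using convergent_ignore_initial_segment[of "\<lambda>n. ?I \<phi> (?r n) (q k)" "Suc k"] by simp
  qed
  have approx: "\<bar>?I \<phi> n t - ?I \<psi> n t\<bar> \<le> C * e"
    if \<phi>: "\<phi> \<in> Cc {0..}" and \<psi>: "\<psi> \<in> Cc {0..}" and le: "\<And>x. 0 \<le> x \<Longrightarrow> \<bar>\<phi> x - \<psi> x\<bar> \<le> e" and t: "t \<in> {0..T}" for \<phi> \<psi> e n t
  proof -
    let ?\<nu> = "density_on {0..} (g n t)"
    have sets: "sets ?\<nu> = sets (restrict_space borel {0..})"
      by (simp add: density_on_def sets_restrict_space)
    have em: "emeasure ?\<nu> {0..} \<le> ennreal C"
    proof -
      have "emeasure ?\<nu> {0..} = (\<integral>\<^sup>+x. ennreal (g n t x) * indicator {0..} x \<partial>restrict_space lborel {0..})"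
        unfolding density_on_def using meas
        by (subst emeasure_density) (auto simp: sets_restrict_space_iff intro!: measurable_restrict_space1)
      also have "\<dots> = (\<integral>\<^sup>+x. ennreal (indicator {0..} x * g n t x) \<partial>lborel)"
        by (subst nn_integral_restrict_space)
           (auto intro!: nn_integral_cong split: split_indicator)
      finally show ?thesis using mass[OF t] by simp
    qed
    have sp: "space ?\<nu> = {0..}" by (simp add: density_on_def space_restrict_space)
    then have fb: "?\<nu> \<in> finite_borel {0..}"
      unfolding finite_borel_def using sets em
      by (auto intro!: finite_measureI simp: top.extremum_unique)
    interpret finite_measure ?\<nu> using fb by (simp add: finite_borel_def)
    have i: "integrable ?\<nu> \<phi>" "integrable ?\<nu> \<psi>"
      using \<phi> \<psi> by (auto intro: integrable_Cc[OF fb])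
    have e0: "0 \<le> e" using le[of 0] by simp
    have "\<bar>?I \<phi> n t - ?I \<psi> n t\<bar> = \<bar>\<integral>x. \<phi> x - \<psi> x \<partial>?\<nu>\<bar>" using i by simp
    also have "\<dots> \<le> (\<integral>x. \<bar>\<phi> x - \<psi> x\<bar> \<partial>?\<nu>)" by (rule integral_abs_bound)
    also have "\<dots> \<le> (\<integral>x. e \<partial>?\<nu>)" using i le sp by (intro integral_mono) auto
    also have "\<dots> = measure ?\<nu> {0..} * e" using sp by simp
    also have "\<dots> \<le> C * e" using em e0 C by (intro mult_right_mono) (auto simp: emeasure_eq_measure)
    finally show ?thesis .
  qed
  have unif: "\<exists>L. uniform_limit {0..T} (\<lambda>n. ?I \<phi> (?r n)) L sequentially" if \<phi>: "\<phi> \<in> Cc {0..}" for \<phi>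
  proof (rule uniform_limit_from_grid[OF T])
    fix j N :: nat assume "j \<le> N" "0 < N"
    then have "q (prod_encode (j, N)) = T * real j / real N"
      using T by (simp add: q_def min_def field_simps)
    then show "convergent (\<lambda>n. ?I \<phi> (?r n) (T * real j / real N))"
      using conv_q[OF \<phi>, of "prod_encode (j, N)"] by simp
  next
    fix e :: real assume e: "0 < e"
    obtain \<psi> L R where \<psi>: "0 \<le> L" "0 < R" "\<And>x. x \<ge> R \<Longrightarrow> \<psi> x = 0"
      "\<And>x y. 0 \<le> x \<Longrightarrow> 0 \<le> y \<Longrightarrow> \<bar>\<psi> x - \<psi> y\<bar> \<le> L * \<bar>x - y\<bar>"
      "\<And>x. 0 \<le> x \<Longrightarrow> \<bar>\<phi> x - \<psi> x\<bar> \<le> e / (4 * C)"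
      by (rule Cc_Lipschitz_approx[OF \<phi>, of "e / (4 * C)"]) (use e C in auto)
    obtain D d where d: "d \<longlonglongrightarrow> 0" and D: "\<And>n s t. s \<in> {0..T} \<Longrightarrow> t \<in> {0..T} \<Longrightarrow>
      \<bar>?I \<psi> n s - ?I \<psi> n t\<bar> \<le> D * \<bar>s - t\<bar> + d n"
      using equi[OF \<psi>(1-4)] by blast
    have "continuous_on {0..} \<psi>"
      using \<psi>(1,4) by (intro lipschitz_on_continuous_on[of L]) (auto simp: lipschitz_on_def dist_real_def)
    then have \<psi>c: "\<psi> \<in> Cc {0..}" using \<psi>(2,3) Cc_half_line_iff by blast
    have "eventually (\<lambda>n. d n < e / 4) sequentially" using d e by (intro order_tendstoD(2)) auto
    then obtain n0 where n0: "\<And>n. n \<ge> n0 \<Longrightarrow> d n < e / 4" by (auto simp: eventually_sequentially)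
    define c where "c = \<bar>D\<bar> + 1"
    have c: "0 < c" "D \<le> c" by (auto simp: c_def)
    define \<delta> where "\<delta> = e / (4 * c)"
    have "\<bar>?I \<phi> (?r n) s - ?I \<phi> (?r n) t\<bar> \<le> e"
      if n: "n \<ge> n0" and st: "s \<in> {0..T}" "t \<in> {0..T}" "\<bar>s - t\<bar> \<le> \<delta>" for n s t
    proof -
      have "D * \<bar>s - t\<bar> \<le> c * \<delta>" using st(3) c by (intro mult_mono) auto
      moreover have "c * \<delta> = e / 4" using c by (simp add: \<delta>_def)
      ultimately have 1: "D * \<bar>s - t\<bar> \<le> e / 4" by simp
      have 2: "d (?r n) < e / 4" using n0 seq_suble[OF r, of n] n by auto
      have Ce: "C * (e / (4 * C)) = e / 4" using C by simp
      have 3: "\<bar>?I \<phi> (?r n) s - ?I \<psi> (?r n) s\<bar> \<le> e / 4" "\<bar>?I \<phi> (?r n) t - ?I \<psi> (?r n) t\<bar> \<le> e / 4"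
        using approx[OF \<phi> \<psi>c \<psi>(5) st(1), of "?r n"] approx[OF \<phi> \<psi>c \<psi>(5) st(2), of "?r n"]
        unfolding Ce by blast+
      show ?thesis using 1 2 3 D[OF st(1,2), of "?r n"] by linarith
    qed
    moreover have "0 < \<delta>" using e c by (simp add: \<delta>_def)
    ultimately show "\<exists>\<delta>>0. \<exists>n0. \<forall>n\<ge>n0. \<forall>s\<in>{0..T}. \<forall>t\<in>{0..T}.
       \<bar>s - t\<bar> \<le> \<delta> \<longrightarrow> \<bar>?I \<phi> (?r n) s - ?I \<phi> (?r n) t\<bar> \<le> e" by blast
  qed
  let ?P = "\<lambda>t \<mu>. \<mu> \<in> finite_borel {0..} \<and> measure \<mu> {0..} \<le> C \<and>
     (\<forall>\<phi>\<in>Cc {0..}. (\<lambda>n. ?I \<phi> (?r n) t) \<longlonglongrightarrow> (\<integral>x. \<phi> x \<partial>\<mu>))"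
  have ex: "\<exists>\<mu>. ?P t \<mu>" if t: "t \<in> {0..T}" for t
  proof -
    obtain r' \<mu> where r': "strict_mono r'" and \<mu>: "\<mu> \<in> finite_borel {0..}" "measure \<mu> {0..} \<le> C"
      and l: "\<And>\<phi>. \<phi> \<in> Cc {0..} \<Longrightarrow> (\<lambda>n. ?I \<phi> (?r (r' n)) t) \<longlonglongrightarrow> (\<integral>x. \<phi> x \<partial>\<mu>)"
      using compact[OF t, of ?r] by auto
    have "(\<lambda>n. ?I \<phi> (?r n) t) \<longlonglongrightarrow> (\<integral>x. \<phi> x \<partial>\<mu>)" if \<phi>: "\<phi> \<in> Cc {0..}" for \<phi>
    proof -
      obtain L where "uniform_limit {0..T} (\<lambda>n. ?I \<phi> (?r n)) L sequentially" using unif[OF \<phi>] by blast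
      then have *: "(\<lambda>n. ?I \<phi> (?r n) t) \<longlonglongrightarrow> L t" using t by (rule tendsto_uniform_limitI)
      have "(\<lambda>n. ?I \<phi> (?r (r' n)) t) \<longlonglongrightarrow> L t"
        using LIMSEQ_subseq_LIMSEQ[OF * r'] by (simp add: o_def)
      from LIMSEQ_unique[OF this l[OF \<phi>]] * show ?thesis by simp
    qed
    then show ?thesis using \<mu> by blast
  qed
  define \<mu> where "\<mu> t = (SOME \<mu>. ?P t \<mu>)" for t
  have "?P t (\<mu> t)" if "t \<in> {0..T}" for t
    unfolding \<mu>_def by (rule someI_ex[OF ex[OF that]])
  then have \<mu>: "t \<in> {0..T} \<Longrightarrow> \<mu> t \<in> finite_borel {0..}"
    "t \<in> {0..T} \<Longrightarrow> measure (\<mu> t) {0..} \<le> C"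
    "t \<in> {0..T} \<Longrightarrow> \<phi> \<in> Cc {0..} \<Longrightarrow> (\<lambda>n. ?I \<phi> (?r n) t) \<longlonglongrightarrow> (\<integral>x. \<phi> x \<partial>\<mu> t)" for t \<phi>
    by simp_all
  have lim: "uniform_limit {0..T} (\<lambda>n t. ?I \<phi> (?r n) t) (\<lambda>t. \<integral>x. \<phi> x \<partial>\<mu> t) sequentially"
    if \<phi>: "\<phi> \<in> Cc {0..}" for \<phi>
  proof -
    obtain L where L: "uniform_limit {0..T} (\<lambda>n. ?I \<phi> (?r n)) L sequentially" using unif[OF \<phi>] ..
    have eq: "L t = (\<integral>x. \<phi> x \<partial>\<mu> t)" if t: "t \<in> {0..T}" for t
      using tendsto_uniform_limitI[OF L t] \<mu>(3)[OF t \<phi>] by (rule LIMSEQ_unique)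
    show ?thesis
      by (rule uniform_limit_cong'[THEN iffD1, OF refl eq L])
  qed
  show ?thesis by (rule that[OF r \<mu>(1,2) lim])
qed


definition truncated_size :: "real \<Rightarrow> real \<Rightarrow> real" where
  "truncated_size R x = x * max 0 (min 1 (2 - x / R))"

lemma truncated_size_Cc: "0 < R \<Longrightarrow> truncated_size R \<in> Cc {0..}"
  unfolding Cc_half_line_iff truncated_size_def
proof (intro conjI exI[of _ "2 * R"] allI impI)
  fix x assume "0 < R" "2 * R \<le> x"
  then have "2 \<le> x / R" by (simp add: field_simps)
  then show "x * max 0 (min 1 (2 - x / R)) = 0" by simp
qed (auto intro!: continuous_intros)

lemma truncated_size_bounds:
  assumes "0 < R" "0 \<le> x"
  shows "0 \<le> truncated_size R x" "truncated_size R x \<le> x" "x \<le> R \<Longrightarrow> truncated_size R x = x"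
  using assms by (auto simp: truncated_size_def mult_left_le max_def min_def field_simps)

text \<open>Monotonicity in the cutoff is what monotone convergence needs.\<close>
lemma truncated_size_mono:
  assumes "0 < R" "R \<le> S" "0 \<le> x"
  shows "truncated_size R x \<le> truncated_size S x"
proof -
  have "x / S \<le> x / R" using assms by (intro divide_left_mono) auto
  then show ?thesis unfolding truncated_size_def using assms by (intro mult_left_mono) auto
qed

text \<open>
  The size function itself is no test function, but its truncations are, and by the assumption
  they capture the quantity \<open>X\<close> up to \<open>e\<close>.  The integrals of the truncations against the limit are
  therefore bounded, and monotone convergence removes the truncation.
\<close>
lemma first_moment_limit:
  assumes \<mu>: "\<mu> \<in> finite_borel {0..}" and lim: "weak_star_tendsto {0..} \<nu> \<mu> sequentially"
    and tail: "\<And>e. 0 < e \<Longrightarrow> \<exists>R0>0. \<forall>R\<ge>R0.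
      eventually (\<lambda>n. \<bar>X n - (\<integral>x. truncated_size R x \<partial>\<nu> n)\<bar> \<le> e) sequentially"
  shows "integrable \<mu> (\<lambda>x. x)" and "X \<longlonglongrightarrow> (\<integral>x. x \<partial>\<mu>)"
proof -
  define A where "A R = (\<integral>x. truncated_size R x \<partial>\<mu>)" for R
  have A_lim: "(\<lambda>n. \<integral>x. truncated_size R x \<partial>\<nu> n) \<longlonglongrightarrow> A R" if "0 < R" for R
    using lim truncated_size_Cc[OF that] unfolding weak_star_tendsto_def A_def by blast
  have close: "\<exists>R0>0. \<forall>R\<ge>R0. eventually (\<lambda>n. \<bar>X n - A R\<bar> \<le> 2 * e) sequentially" if e: "0 < e" for e
  proof -
    obtain R0 where R0: "0 < R0" "\<And>R. R \<ge> R0 \<Longrightarrow>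
        eventually (\<lambda>n. \<bar>X n - (\<integral>x. truncated_size R x \<partial>\<nu> n)\<bar> \<le> e) sequentially"
      using tail[OF e] by blast
    have "eventually (\<lambda>n. \<bar>X n - A R\<bar> \<le> 2 * e) sequentially" if R: "R \<ge> R0" for R
    proof -
      have "eventually (\<lambda>n. dist (\<integral>x. truncated_size R x \<partial>\<nu> n) (A R) < e) sequentially"
        using A_lim[of R] R R0(1) e by (intro tendstoD) auto
      with R0(2)[OF R] show ?thesis
        by eventually_elim (auto simp: dist_real_def)
    qed
    then show ?thesis using R0(1) by blast
  qed
  have int: "integrable \<mu> (truncated_size R)" if "0 < R" for R
    by (intro integrable_Cc[OF \<mu>] truncated_size_Cc that)
  have space: "space \<mu> = {0..}" by (rule finite_borel_measurable(2)[OF \<mu>])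
  have A_mono: "A R \<le> A S" if "0 < R" "R \<le> S" for R S
    unfolding A_def using that space truncated_size_mono int by (intro integral_mono) auto
  have bdd: "\<exists>B. \<forall>k. A (real (Suc k)) \<le> B"
  proof -
    obtain R0 where R0: "0 < R0" "\<And>R. R \<ge> R0 \<Longrightarrow> eventually (\<lambda>n. \<bar>X n - A R\<bar> \<le> 2) sequentially"
      using close[of 1] by auto
    have "A (real (Suc k)) \<le> A R0 + 4" for k
    proof -
      let ?R = "max R0 (real (Suc k))"
      have "eventually (\<lambda>n. \<bar>X n - A ?R\<bar> \<le> 2 \<and> \<bar>X n - A R0\<bar> \<le> 2) sequentially"
        using R0(2)[of ?R] R0(2)[of R0] by (intro eventually_conj) auto
      then have "\<exists>n. \<bar>X n - A ?R\<bar> \<le> 2 \<and> \<bar>X n - A R0\<bar> \<le> 2"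
        by (rule eventually_happens'[OF sequentially_bot])
      then obtain n where "\<bar>X n - A ?R\<bar> \<le> 2" "\<bar>X n - A R0\<bar> \<le> 2" by blast
      moreover have "A (real (Suc k)) \<le> A ?R" by (rule A_mono) auto
      ultimately show ?thesis by linarith
    qed
    then show ?thesis by blast
  qed
  have "incseq (\<lambda>k. A (real (Suc k)))" by (intro incseq_SucI A_mono) auto
  then obtain L where L: "(\<lambda>k. A (real (Suc k))) \<longlonglongrightarrow> L"
    using bdd incseq_convergent by metis
  have meas: "(\<lambda>x. x) \<in> borel_measurable \<mu>"
    unfolding finite_borel_measurable(1)[OF \<mu>] by (intro borel_measurable_continuous_on_restrict continuous_intros)
  have pointwise: "(\<lambda>k. truncated_size (real (Suc k)) x) \<longlonglongrightarrow> x" if "0 \<le> x" for x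
  proof (rule tendsto_eventually)
    obtain N :: nat where "x \<le> real N" using real_arch_simple by blast
    then show "eventually (\<lambda>k. truncated_size (real (Suc k)) x = x) sequentially"
      unfolding eventually_sequentially using that by (intro exI[of _ N]) (auto intro!: truncated_size_bounds(3))
  qed
  have mono: "AE x in \<mu>. mono (\<lambda>k. truncated_size (real (Suc k)) x)"
    using space by (intro AE_I2 monoI truncated_size_mono) auto
  have hb: "has_bochner_integral \<mu> (\<lambda>x. x) L"
    using int L mono pointwise space meas unfolding A_def
    by (intro has_bochner_integral_monotone_convergence[where f="\<lambda>k. truncated_size (real (Suc k))"])
       (auto intro!: truncated_size_bounds)
  then show "integrable \<mu> (\<lambda>x. x)" by (simp add: has_bochner_integral_iff)
  have L_eq: "(\<integral>x. x \<partial>\<mu>) = L" using hb by (simp add: has_bochner_integral_iff)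
  show "X \<longlonglongrightarrow> (\<integral>x. x \<partial>\<mu>)"
    unfolding L_eq
  proof (rule tendstoI)
    fix e :: real assume e: "0 < e"
    obtain R0 where R0: "0 < R0" "\<And>R. R \<ge> R0 \<Longrightarrow> eventually (\<lambda>n. \<bar>X n - A R\<bar> \<le> 2 * (e / 5)) sequentially"
      using close[of "e / 5"] e by auto
    have "eventually (\<lambda>k. dist (A (real (Suc k))) L < e / 5) sequentially"
      using L e by (intro tendstoD) auto
    moreover obtain N :: nat where "R0 \<le> real N" using real_arch_simple by blast
    then have "eventually (\<lambda>k. R0 \<le> real (Suc k)) sequentially"
      unfolding eventually_sequentially by (intro exI[of _ N]) auto
    ultimately have "eventually (\<lambda>k. dist (A (real (Suc k))) L < e / 5 \<and> R0 \<le> real (Suc k)) sequentially"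
      by (rule eventually_conj)
    then have "\<exists>k. dist (A (real (Suc k))) L < e / 5 \<and> R0 \<le> real (Suc k)"
      by (rule eventually_happens'[OF sequentially_bot])
    then obtain k where k: "dist (A (real (Suc k))) L < e / 5" "R0 \<le> real (Suc k)" by blast
    show "eventually (\<lambda>n. dist (X n) L < e) sequentially"
      using R0(2)[OF k(2)]
    proof eventually_elim
      case (elim n)
      then show ?case using k(1) e unfolding dist_real_def by argo
    qed
  qed
qed


section \<open>Step functions as measures\<close>

lemma cell_unique:
  assumes "0 < e" "x \<in> cell e i" "x \<in> cell e j" shows "i = j"
proof -
  have "(real i - 1/2) * e < (real j + 1/2) * e" "(real j - 1/2) * e < (real i + 1/2) * e"
    using assms(2,3) by (auto simp: cell_def)
  then have "real i - 1/2 < real j + 1/2" "real j - 1/2 < real i + 1/2"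
    using assms(1) by (auto simp: mult_less_cancel_right)
  then show ?thesis by linarith
qed

lemma cell_borel[measurable]: "cell e i \<in> sets borel"
  by (simp add: cell_def)

lemma emeasure_cell: "0 < e \<Longrightarrow> emeasure lborel (cell e i) = ennreal e"
  by (simp add: cell_def algebra_simps)

lemma measure_cell: "0 < e \<Longrightarrow> measure lborel (cell e i) = e"
  by (simp add: measure_def emeasure_cell)

lemma cell_bounds:
  assumes "0 < e" "2 \<le> i" "x \<in> cell e i"
  shows "e * real i / 2 \<le> x" "x \<le> 2 * (e * real i)" "\<bar>x - e * real i\<bar> \<le> e / 2" "0 \<le> x"
proof -
  have x: "e * real i - e / 2 \<le> x" "x \<le> e * real i + e / 2"
    using assms(3) by (auto simp: cell_def algebra_simps)
  have "e * 2 \<le> e * real i" using assms by (intro mult_left_mono) auto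
  then show "e * real i / 2 \<le> x" "x \<le> 2 * (e * real i)" "\<bar>x - e * real i\<bar> \<le> e / 2" "0 \<le> x"
    using x assms(1) by linarith+
qed

lemma mid_in_cell: "0 < e \<Longrightarrow> e * real i \<in> cell e i"
  by (auto simp: cell_def algebra_simps)

lemma step_fun_cell:
  assumes "0 < e" "k \<le> i" "x \<in> cell e i"
  shows "step_fun k e s x = s i"
proof -
  have "step_fun k e s x = (\<Sum>j\<in>{i - k}. s (j + k) * indicat_real (cell e (j + k)) x)"
    unfolding step_fun_def
  proof (intro suminf_finite)
    fix j assume "j \<notin> {i - k}"
    then have "i \<noteq> j + k" by auto
    then have "x \<notin> cell e (j + k)" using cell_unique[OF assms(1,3)] by blast
    then show "s (j + k) * indicat_real (cell e (j + k)) x = 0" by simp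
  qed simp
  then show ?thesis using assms by simp
qed

lemma step_fun_eq_sum:
  assumes "0 < e" "k \<le> n" "x < (real n + 1/2) * e"
  shows "step_fun k e s x = (\<Sum>i=k..n. s i * indicat_real (cell e i) x)"
proof -
  have "step_fun k e s x = (\<Sum>j\<in>{..n - k}. s (j + k) * indicat_real (cell e (j + k)) x)"
    unfolding step_fun_def
  proof (intro suminf_finite)
    fix j assume "j \<notin> {..n - k}"
    then have "n + 1 \<le> j + k" using assms(2) by auto
    then have "(real n + 1/2) * e \<le> (real (j + k) - 1/2) * e"
      using assms(1) by (intro mult_right_mono) auto
    then show "s (j + k) * indicat_real (cell e (j + k)) x = 0"
      using assms(3) by (auto simp: cell_def)
  qed simp
  also have "\<dots> = (\<Sum>i=k..n. s i * indicat_real (cell e i) x)"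
    using assms(2) by (intro sum.reindex_bij_witness[of _ "\<lambda>i. i - k" "\<lambda>j. j + k"]) auto
  finally show ?thesis .
qed

lemma exists_cell_beyond:
  assumes "0 < e" obtains n where "k \<le> n" "x < (real n + 1/2) * e"
proof -
  obtain n :: nat where n: "x / e < real n" using reals_Archimedean2 by blast
  have "x / e < real (max n k) + 1/2" using n by linarith
  then have "x < (real (max n k) + 1/2) * e" using assms by (simp add: pos_divide_less_eq)
  then show ?thesis using that[of "max n k"] by auto
qed

lemma step_fun_nonneg:
  assumes "0 < e" "\<And>i. k \<le> i \<Longrightarrow> 0 \<le> s i" shows "0 \<le> step_fun k e s x"
proof -
  obtain n where "k \<le> n" "x < (real n + 1/2) * e" by (rule exists_cell_beyond[OF assms(1)])
  then show ?thesis
    unfolding step_fun_eq_sum[OF assms(1) \<open>k \<le> n\<close> \<open>x < _\<close>]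
    by (intro sum_nonneg mult_nonneg_nonneg assms(2)) auto
qed

lemma step_fun_measurable[measurable]: "step_fun k e s \<in> borel_measurable borel"
  unfolding step_fun_def[abs_def] by measurable

lemma nn_integral_step_fun_le:
  assumes e: "0 < e" and s: "\<And>i. 2 \<le> i \<Longrightarrow> 0 \<le> s i"
    and le: "\<And>n. (\<Sum>i=2..n. e * s i) \<le> C"
  shows "(\<integral>\<^sup>+x. ennreal (step_fun 2 e s x) \<partial>lborel) \<le> ennreal C"
proof -
  have summ: "summable (\<lambda>i. s (i + 2) * indicat_real (cell e (i + 2)) x)" for x
  proof -
    obtain n where n: "2 \<le> n" "x < (real n + 1/2) * e" by (rule exists_cell_beyond[OF e])
    show ?thesis
    proof (rule summable_finite[of "{..n}"])
      fix j assume "j \<notin> {..n}"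
      then have "(real n + 1/2) * e \<le> (real (j + 2) - 1/2) * e"
        using e by (intro mult_right_mono) auto
      then show "s (j + 2) * indicat_real (cell e (j + 2)) x = 0" using n by (auto simp: cell_def)
    qed simp
  qed
  have "(\<integral>\<^sup>+x. ennreal (step_fun 2 e s x) \<partial>lborel)
     = (\<integral>\<^sup>+x. (\<Sum>i. ennreal (s (i + 2) * indicat_real (cell e (i + 2)) x)) \<partial>lborel)"
    unfolding step_fun_def using s by (intro nn_integral_cong suminf_ennreal2[symmetric] summ) auto
  also have "\<dots> = (\<Sum>i. \<integral>\<^sup>+x. ennreal (s (i + 2) * indicat_real (cell e (i + 2)) x) \<partial>lborel)"
    by (intro nn_integral_suminf) measurable
  also have "\<dots> = (\<Sum>i. ennreal (e * s (i + 2)))"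
  proof (intro suminf_cong)
    fix i
    have "(\<integral>\<^sup>+x. ennreal (s (i + 2) * indicat_real (cell e (i + 2)) x) \<partial>lborel)
      = (\<integral>\<^sup>+x. ennreal (s (i + 2)) * indicator (cell e (i + 2)) x \<partial>lborel)"
      by (intro nn_integral_cong) (auto split: split_indicator)
    also have "\<dots> = ennreal (s (i + 2)) * ennreal e"
      using emeasure_cell[OF e, of "i+2"] by (subst nn_integral_cmult_indicator) auto
    also have "\<dots> = ennreal (e * s (i + 2))" using e s[of "i+2"] by (simp add: ennreal_mult' mult.commute)
    finally show "(\<integral>\<^sup>+x. ennreal (s (i + 2) * indicat_real (cell e (i + 2)) x) \<partial>lborel) = ennreal (e * s (i + 2))" .
  qed
  also have "\<dots> \<le> ennreal C"
  proof (rule suminf_le_const)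
    fix n
    have "(\<Sum>i<n. ennreal (e * s (i + 2))) = ennreal (\<Sum>i<n. e * s (i + 2))"
      using e s by (intro sum_ennreal) auto
    also have "(\<Sum>i<n. e * s (i + 2)) = (\<Sum>i=2..n+1. e * s i)"
      by (intro sum.reindex_bij_witness[of _ "\<lambda>i. i - 2" "\<lambda>i. i + 2"]) auto
    finally show "(\<Sum>i<n. ennreal (e * s (i + 2))) \<le> ennreal C" using le[of "n+1"] by (simp add: ennreal_leI)
  qed (rule summableI)
  finally show ?thesis .
qed

text \<open>On the cell around \<open>e * i\<close> the size is at most \<open>2 * e * i\<close>.\<close>
lemma nn_integral_step_fun_moment_le:
  assumes e: "0 < e" and s: "\<And>i. 2 \<le> i \<Longrightarrow> 0 \<le> s i"
    and le: "\<And>n. (\<Sum>i=2..n. e\<^sup>2 * real i * s i) \<le> C"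
  shows "(\<integral>\<^sup>+x. ennreal (indicator {0..} x * (x * step_fun 2 e s x)) \<partial>lborel) \<le> ennreal (2 * C)"
proof -
  let ?s' = "\<lambda>i. 2 * (e * real i) * s i"
  have bound: "x * step_fun 2 e s x \<le> step_fun 2 e ?s' x" if "0 \<le> x" for x
  proof -
    obtain n where n: "2 \<le> n" "x < (real n + 1/2) * e" by (rule exists_cell_beyond[OF e])
    show ?thesis unfolding step_fun_eq_sum[OF e n] sum_distrib_left
      using s cell_bounds(2)[OF e] by (intro sum_mono) (auto split: split_indicator intro!: mult_right_mono)
  qed
  have "(\<integral>\<^sup>+x. ennreal (indicator {0..} x * (x * step_fun 2 e s x)) \<partial>lborel)
      \<le> (\<integral>\<^sup>+x. ennreal (step_fun 2 e ?s' x) \<partial>lborel)"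
  proof (intro nn_integral_mono ennreal_leI)
    fix x :: real
    have "0 \<le> step_fun 2 e ?s' x" using s e by (intro step_fun_nonneg) auto
    then show "indicator {0..} x * (x * step_fun 2 e s x) \<le> step_fun 2 e ?s' x"
      using bound[of x] by (auto split: split_indicator)
  qed
  also have "\<dots> \<le> ennreal (2 * C)"
  proof (rule nn_integral_step_fun_le[OF e])
    show "0 \<le> ?s' i" if "2 \<le> i" for i using that s[of i] e by simp
    show "(\<Sum>i=2..n. e * ?s' i) \<le> 2 * C" for n
    proof -
      have "(\<Sum>i=2..n. e * ?s' i) = 2 * (\<Sum>i=2..n. e\<^sup>2 * real i * s i)"
        unfolding sum_distrib_left by (intro sum.cong) (auto simp: power2_eq_square)
      then show ?thesis using le[of n] by simp
    qed
  qed
  finally show ?thesis .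
qed

lemma density_on_step_fun_finite_borel:
  assumes e: "0 < e" and s: "\<And>i. 2 \<le> i \<Longrightarrow> 0 \<le> s i"
    and le: "\<And>n. (\<Sum>i=2..n. e * s i) \<le> C"
  shows "density_on {0..} (step_fun 2 e s) \<in> finite_borel {0..}"
proof -
  have "emeasure (density_on {0..} (step_fun 2 e s)) {0..} =
      (\<integral>\<^sup>+x. ennreal (step_fun 2 e s x) * indicator {0..} x \<partial>restrict_space lborel {0..})"
    unfolding density_on_def
    by (subst emeasure_density) (auto simp: sets_restrict_space_iff intro!: measurable_restrict_space1)
  also have "\<dots> \<le> (\<integral>\<^sup>+x. ennreal (step_fun 2 e s x) \<partial>lborel)"
    by (subst nn_integral_restrict_space)
       (auto intro!: nn_integral_mono split: split_indicator)
  also have "\<dots> \<le> ennreal C" by (rule nn_integral_step_fun_le[OF assms])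
  finally have "emeasure (density_on {0..} (step_fun 2 e s)) {0..} \<noteq> \<infinity>"
    by (auto simp: top.extremum_unique)
  then show ?thesis
    unfolding finite_borel_def
    by (auto intro!: finite_measureI simp: density_on_def space_restrict_space sets_restrict_space)
qed

lemma cell_integrable:
  fixes \<phi> :: "real \<Rightarrow> real"
  assumes e: "0 < e" and i: "2 \<le> i" and c: "continuous_on {0..} \<phi>"
  shows "integrable lborel (\<lambda>x. indicator (cell e i) x * \<phi> x)"
proof -
  let ?I = "{(real i - 1/2) * e .. (real i + 1/2) * e}"
  have "0 \<le> (real i - 1/2) * e" using e i by simp
  then have sub: "?I \<subseteq> {0..}" by auto
  have "set_integrable lborel ?I \<phi>"
    by (intro borel_integrable_atLeastAtMost' continuous_on_subset[OF c sub])
  then have "set_integrable lborel (cell e i) \<phi>"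
    by (rule set_integrable_subset) (auto simp: cell_def)
  then show ?thesis by (simp add: set_integrable_def)
qed

lemma step_fun_integral:
  fixes \<phi> :: "real \<Rightarrow> real"
  assumes e: "0 < e" and s: "\<And>i. 2 \<le> i \<Longrightarrow> 0 \<le> s i" and c: "continuous_on {0..} \<phi>"
    and R: "\<And>x. x \<ge> R \<Longrightarrow> \<phi> x = 0" and n: "2 \<le> n" "R \<le> e * real n"
  shows "(\<integral>x. \<phi> x \<partial>density_on {0..} (step_fun 2 e s)) =
    (\<Sum>i=2..n. s i * (\<integral>x. indicator (cell e i) x * \<phi> x \<partial>lborel))"
proof -
  have "(\<integral>x. \<phi> x \<partial>density_on {0..} (step_fun 2 e s)) =
      (\<integral>x. indicator {0..} x * step_fun 2 e s x * \<phi> x \<partial>lborel)"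
    by (intro density_on_integral step_fun_nonneg e s c) measurable
  also have "\<dots> = (\<integral>x. (\<Sum>i=2..n. s i * (indicator (cell e i) x * \<phi> x)) \<partial>lborel)"
  proof (intro Bochner_Integration.integral_cong refl)
    fix x :: real
    show "indicator {0..} x * step_fun 2 e s x * \<phi> x = (\<Sum>i=2..n. s i * (indicator (cell e i) x * \<phi> x))"
    proof (cases "x < (real n + 1/2) * e")
      case True
      have "indicator (cell e i) x = (0::real)" if "x < 0" "2 \<le> i" for i
        using cell_bounds(4)[OF e that(2), of x] that(1) by (auto simp: indicator_def)
      then have zero: "(\<Sum>i=2..n. s i * (indicator (cell e i) x * \<phi> x)) = 0" if "x < 0"
        using that by (intro sum.neutral) auto
      show ?thesis
      proof (cases "0 \<le> x")
        case True
        then show ?thesis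
          unfolding step_fun_eq_sum[OF e n(1) \<open>x < (real n + 1/2) * e\<close>]
          by (simp only: indicator_simps atLeast_iff mult_1 sum_distrib_right mult.assoc)
      qed (use zero in simp)
    next
      case False
      then have "R \<le> x" using n(2) e by (simp add: algebra_simps)
      then show ?thesis using R by simp
    qed
  qed
  also have "\<dots> = (\<Sum>i=2..n. s i * (\<integral>x. indicator (cell e i) x * \<phi> x \<partial>lborel))"
    by (subst Bochner_Integration.integral_sum) (auto intro!: integrable_mult_right cell_integrable[OF e _ c])
  finally show ?thesis .
qed

text \<open>
  Replacing cell averages of the test function by its values at the midpoints costs its oscillation
  over half a cell.
\<close>
lemma step_fun_pairing:
  fixes \<phi> :: "real \<Rightarrow> real"
  assumes e: "0 < e" and s: "\<And>i. 2 \<le> i \<Longrightarrow> 0 \<le> s i" and c: "continuous_on {0..} \<phi>"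
    and R: "\<And>x. x \<ge> R \<Longrightarrow> \<phi> x = 0" and n: "2 \<le> n" "R \<le> e * real n"
    and osc: "\<And>x i. 2 \<le> i \<Longrightarrow> x \<in> cell e i \<Longrightarrow> \<bar>\<phi> x - \<phi> (e * real i)\<bar> \<le> \<omega>"
  shows "\<bar>(\<integral>x. \<phi> x \<partial>density_on {0..} (step_fun 2 e s)) - (\<Sum>i=2..n. e * \<phi> (e * real i) * s i)\<bar>
    \<le> \<omega> * (\<Sum>i=2..n. e * s i)"
proof -
  have one: "\<bar>(\<integral>x. indicator (cell e i) x * \<phi> x \<partial>lborel) - e * \<phi> (e * real i)\<bar> \<le> \<omega> * e"
    if i: "2 \<le> i" for i
  proof -
    have ci: "integrable lborel (\<lambda>x. indicator (cell e i) x * k)" for k :: real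
      using cell_integrable[OF e i, of "\<lambda>_. k"] by simp
    have ck: "(\<integral>x. indicator (cell e i) x * k \<partial>lborel) = e * k" for k :: real
      using measure_cell[OF e, of i] by simp
    have diff: "(\<integral>x. indicator (cell e i) x * \<phi> x \<partial>lborel) - e * \<phi> (e * real i)
      = (\<integral>x. indicator (cell e i) x * \<phi> x - indicator (cell e i) x * \<phi> (e * real i) \<partial>lborel)"
      using cell_integrable[OF e i c] ci by (subst Bochner_Integration.integral_diff) (auto simp: measure_cell[OF e])
    have "\<bar>(\<integral>x. indicator (cell e i) x * \<phi> x \<partial>lborel) - e * \<phi> (e * real i)\<bar>
       \<le> (\<integral>x. \<bar>indicator (cell e i) x * \<phi> x - indicator (cell e i) x * \<phi> (e * real i)\<bar> \<partial>lborel)"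
      unfolding diff by (rule integral_abs_bound)
    also have "\<dots> \<le> (\<integral>x. indicator (cell e i) x * \<omega> \<partial>lborel)"
      using cell_integrable[OF e i c] ci osc[OF i]
      by (intro integral_mono) (auto split: split_indicator)
    also have "\<dots> = \<omega> * e" by (simp add: measure_cell[OF e])
    finally show ?thesis .
  qed
  have "(\<integral>x. \<phi> x \<partial>density_on {0..} (step_fun 2 e s)) =
    (\<Sum>i=2..n. s i * (\<integral>x. indicator (cell e i) x * \<phi> x \<partial>lborel))"
    by (rule step_fun_integral) (use e s c R n in auto)
  then have "(\<integral>x. \<phi> x \<partial>density_on {0..} (step_fun 2 e s)) - (\<Sum>i=2..n. e * \<phi> (e * real i) * s i)
      = (\<Sum>i=2..n. s i * ((\<integral>x. indicator (cell e i) x * \<phi> x \<partial>lborel) - e * \<phi> (e * real i)))"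
    by (simp add: sum_subtractf[symmetric] algebra_simps)
  also have "\<bar>\<dots>\<bar> \<le> (\<Sum>i=2..n. \<omega> * (e * s i))"
  proof (rule order.trans[OF sum_abs sum_mono])
    fix i assume "i \<in> {2..n}"
    then have i: "2 \<le> i" by simp
    show "\<bar>s i * ((\<integral>x. indicator (cell e i) x * \<phi> x \<partial>lborel) - e * \<phi> (e * real i))\<bar> \<le> \<omega> * (e * s i)"
      using mult_left_mono[OF one[OF i] s[OF i]] s[OF i] by (simp add: abs_mult mult_ac)
  qed
  finally show ?thesis by (simp add: sum_distrib_left)
qed

text \<open>
  Beyond \<open>r\<close> the weight exceeds \<open>k * x\<close>, where \<open>k\<close> is as large as desired for a superlinear weight.  A
  cell around \<open>e * i\<close> lies beyond \<open>e * i / 2\<close>, which explains the two factors \<open>2\<close>.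
\<close>
lemma superlinear_moment_tail:
  assumes e: "0 < e" and s: "\<And>i. 2 \<le> i \<Longrightarrow> 0 \<le> s i"
    and P: "(\<integral>\<^sup>+x\<in>{0..}. ennreal (\<Phi> x * step_fun 2 e s x) \<partial>lborel) \<le> ennreal P" "0 \<le> P"
    and k: "0 < k" and \<Phi>: "\<And>x. 0 \<le> x \<Longrightarrow> 0 \<le> \<Phi> x" "\<And>x. r \<le> x \<Longrightarrow> k * x \<le> \<Phi> x"
  shows "(\<Sum>i\<in>{i\<in>{2..n}. 2 * r \<le> e * real i}. e\<^sup>2 * real i * s i) \<le> 2 * P / k"
proof -
  let ?I = "{i\<in>{2..n}. 2 * r \<le> e * real i}"
  let ?h = "\<lambda>x. \<Sum>i\<in>?I. k * (e * real i / 2) * s i * indicat_real (cell e i) x"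
  have int: "integrable lborel (\<lambda>x. d * indicat_real (cell e i) x)" for d i
    using emeasure_cell[OF e, of i] by (intro integrable_mult_right integrable_real_indicator) auto
  have hi: "integrable lborel ?h" by (intro Bochner_Integration.integrable_sum int)
  have h0: "0 \<le> ?h x" for x using s k e by (intro sum_nonneg) auto
  have "ennreal (\<integral>x. ?h x \<partial>lborel) = (\<integral>\<^sup>+x. ennreal (?h x) \<partial>lborel)"
    using h0 by (intro nn_integral_eq_integral[symmetric] hi) auto
  also have "\<dots> \<le> (\<integral>\<^sup>+x\<in>{0..}. ennreal (\<Phi> x * step_fun 2 e s x) \<partial>lborel)"
  proof (intro nn_integral_mono)
    fix x :: real
    show "ennreal (?h x) \<le> ennreal (\<Phi> x * step_fun 2 e s x) * indicator {0..} x"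
    proof (cases "\<exists>i\<in>?I. x \<in> cell e i")
      case True
      then obtain i where i: "i \<in> ?I" "x \<in> cell e i" by blast
      then have i2: "2 \<le> i" by simp
      note cb = cell_bounds[OF e i2 i(2)]
      have "?h x = (\<Sum>j\<in>{i}. k * (e * real j / 2) * s j * indicat_real (cell e j) x)"
      proof (intro sum.mono_neutral_right ballI)
        fix j assume "j \<in> ?I - {i}"
        then have "x \<notin> cell e j" using cell_unique[OF e i(2)] by blast
        then show "k * (e * real j / 2) * s j * indicat_real (cell e j) x = 0" by simp
      qed (use i in auto)
      also have "\<dots> = k * (e * real i / 2) * s i" using i by simp
      also have "\<dots> \<le> \<Phi> x * s i"
      proof (intro mult_right_mono s i2)
        have "k * (e * real i / 2) \<le> k * x" using cb k by (intro mult_left_mono) auto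
        also have "\<dots> \<le> \<Phi> x" using cb i by (intro \<Phi>) auto
        finally show "k * (e * real i / 2) \<le> \<Phi> x" .
      qed
      also have "\<dots> = \<Phi> x * step_fun 2 e s x" using step_fun_cell[OF e i2 i(2)] by simp
      finally show ?thesis using cb by (simp add: ennreal_leI)
    next
      case False
      then have "?h x = 0" by (intro sum.neutral) (auto simp: indicator_def)
      then show ?thesis by simp
    qed
  qed
  also have "\<dots> \<le> ennreal P" by (rule P)
  finally have "(\<integral>x. ?h x \<partial>lborel) \<le> P" using P(2) by simp
  moreover have "(\<integral>x. ?h x \<partial>lborel) = (\<Sum>i\<in>?I. k * (e * real i / 2) * s i * e)"
    using measure_cell[OF e]
    by (subst Bochner_Integration.integral_sum) (auto intro!: int sum.cong)
  moreover have "\<dots> = (k / 2) * (\<Sum>i\<in>?I. e\<^sup>2 * real i * s i)"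
    unfolding sum_distrib_left by (intro sum.cong) (auto simp: power2_eq_square)
  ultimately have "(k / 2) * (\<Sum>i\<in>?I. e\<^sup>2 * real i * s i) \<le> P" by simp
  then show ?thesis using k by (simp add: field_simps)
qed


section \<open>Uniform estimates along a sequence of systems\<close>

lemma exp_minus_le_inverse_square:
  assumes "0 < (y::real)" shows "exp (- y) \<le> 2 / y\<^sup>2"
proof -
  have "y\<^sup>2 / 2 \<le> exp y" using exp_lower_Taylor_quadratic[of y] assms by simp
  then have "1 / exp y \<le> 1 / (y\<^sup>2 / 2)" using assms by (intro divide_left_mono) auto
  then show ?thesis by (simp add: exp_minus inverse_eq_divide)
qed

text \<open>
  The setting in which all limits are taken: every bound is uniform in the index \<open>n\<close>.  The cases
  of equal and of different exponents of the two rates are unified in terms of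
  \<open>\<rho>\<close>: near \<open>0\<close> the rates behave like \<open>abar * x powr r\<close> and \<open>abar * \<rho> * x powr r\<close>, where the latter
  just says \<open>o(x powr r)\<close> if \<open>\<rho> = 0\<close>.
\<close>
locale BD_sequence =
  fixes r abar \<rho> \<alpha> \<beta> K A M Z0 u_low u_in :: real
    and e \<alpha>s \<beta>s ms :: "nat \<Rightarrow> real" and as bs :: "nat \<Rightarrow> nat \<Rightarrow> real"
    and us :: "nat \<Rightarrow> real \<Rightarrow> real" and cs :: "nat \<Rightarrow> nat \<Rightarrow> real \<Rightarrow> real"
    and a b N :: "real \<Rightarrow> real" and \<mu>_in :: "real measure"
  assumes sys: "\<And>n. BD_system r (e n) (\<alpha>s n) (\<beta>s n) K (ms n) (as n) (bs n) (us n) (cs n)"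
    and r_less: "r < 1"
    and e_lim: "e \<longlonglongrightarrow> 0"
    and \<alpha>s_le: "\<And>n. \<alpha>s n \<le> A" and \<beta>s_le: "\<And>n. \<beta>s n \<le> A" and ms_le: "\<And>n. ms n \<le> M"
    and \<alpha>s_lim: "\<alpha>s \<longlonglongrightarrow> \<alpha>" and \<beta>s_lim: "\<beta>s \<longlonglongrightarrow> \<beta>"
    and u0_lim: "(\<lambda>n. us n 0) \<longlonglongrightarrow> u_in"
    and pos: "0 < abar" "0 < \<alpha>" "0 < \<beta>" "0 \<le> \<rho>"
    and zeroth_init: "\<And>n k. (\<Sum>i=2..k. e n * cs n i 0) \<le> Z0"
    and rates: "\<And>\<kappa>. 0 < \<kappa> \<Longrightarrow> \<exists>x0>0. \<forall>n i. e n * real i < x0 \<longrightarrow>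
       (2 \<le> i \<longrightarrow> \<bar>as n i - abar * (e n * real i) powr r\<bar> \<le> \<kappa> * (e n * real i) powr r) \<and>
       (3 \<le> i \<longrightarrow> \<bar>bs n i - abar * \<rho> * (e n * real i) powr r\<bar> \<le> \<kappa> * (e n * real i) powr r)"
    and u_low: "\<rho> < u_low" and u0_ge: "\<And>n. u_low \<le> us n 0"
    and exp_init: "\<And>z. 0 < z \<Longrightarrow> z < 1 \<Longrightarrow>
       \<exists>S. \<forall>n k. (\<Sum>i=2..k. e n powr r * cs n i 0 * exp (- real i * z)) \<le> S"
    and tail_init: "\<And>\<epsilon>. 0 < \<epsilon> \<Longrightarrow> \<exists>R>0. \<forall>n k.
       (\<Sum>i\<in>{i\<in>{2..k}. R \<le> e n * real i}. (e n)\<^sup>2 * real i * cs n i 0) \<le> \<epsilon>"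
    and a_cont: "continuous_on {0..} a" and b_cont: "continuous_on {0..} b"
    and a_conv: "\<And>R \<epsilon>. 0 < \<epsilon> \<Longrightarrow>
       \<forall>\<^sub>F n in sequentially. \<forall>i\<ge>2. e n * real i \<le> R \<longrightarrow> \<bar>as n i - a (e n * real i)\<bar> \<le> \<epsilon>"
    and b_conv: "\<And>R \<epsilon>. 0 < \<epsilon> \<Longrightarrow>
       \<forall>\<^sub>F n in sequentially. \<forall>i\<ge>3. e n * real i \<le> R \<longrightarrow> \<bar>bs n i - b (e n * real i)\<bar> \<le> \<epsilon>"
    and \<mu>_in: "\<mu>_in \<in> finite_borel {0..}"
    and f_in_lim: "weak_star_tendsto {0..}
       (\<lambda>n. density_on {0..} (step_fun 2 (e n) (\<lambda>i. cs n i 0))) \<mu>_in sequentially"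
    and N_eq: "\<And>u. \<rho> < u \<Longrightarrow>
       N u = \<alpha> * u\<^sup>2 * (abar * 2 powr r * (u - \<rho>) / (\<beta> + abar * 2 powr r * (u - \<rho>)))"
begin

abbreviation J :: "nat \<Rightarrow> nat \<Rightarrow> real \<Rightarrow> real" where
  "J n \<equiv> BD_flux r (e n) (\<alpha>s n) (\<beta>s n) (as n) (bs n) (us n) (cs n)"

abbreviation f :: "nat \<Rightarrow> real \<Rightarrow> real \<Rightarrow> real" where
  "f n t \<equiv> step_fun 2 (e n) (\<lambda>i. cs n i t)"

definition Z :: real where "Z = Z0 + A * M\<^sup>2"

definition flux_const :: real where "flux_const = K * (1 + M) * (Z + M)"

definition speed :: real where "speed = 2 * (A * M\<^sup>2 + A * Z) + flux_const"

text \<open>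
  Starting above \<open>u_low\<close> and changing at most at the rate \<open>speed\<close>, the monomer concentrations need more
  than the time \<open>T\<close> to reach the midpoint \<open>ul\<close> between \<open>u_low\<close> and \<open>\<rho>\<close>.  The bound \<open>T \<le> 1\<close> only keeps
  \<open>Z\<close>, the bound on the number of clusters, free of the time.
\<close>
definition T :: real where "T = min 1 ((u_low - \<rho>) / (2 * (speed + 1)))"

definition ul :: real where "ul = (u_low + \<rho>) / 2"

lemma const_nonneg: "0 \<le> A" "0 \<le> M" "0 \<le> K" "0 \<le> Z0" "0 \<le> Z" "0 \<le> flux_const" "0 \<le> speed"
proof -
  interpret S: BD_system r "e 0" "\<alpha>s 0" "\<beta>s 0" K "ms 0" "as 0" "bs 0" "us 0" "cs 0" by (rule sys)
  show "0 \<le> A" using \<alpha>s_le[of 0] S.\<alpha>_nonneg by simp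
  then show "0 \<le> M" "0 \<le> K" "0 \<le> Z0" "0 \<le> Z" "0 \<le> flux_const" "0 \<le> speed"
    using ms_le[of 0] S.m_nonneg S.K_nonneg zeroth_init[of 0 0]
    by (auto simp: Z_def flux_const_def speed_def)
qed

lemma ul: "\<rho> < ul" "ul < u_low" "0 < ul" using u_low pos by (auto simp: ul_def)

lemma T: "0 < T" "T \<le> 1" using u_low const_nonneg by (auto simp: T_def)

lemma e_pos: "0 < e n" and e_le: "e n \<le> 1" and r_nonneg: "0 \<le> r"
  and us_nonneg: "0 \<le> t \<Longrightarrow> 0 \<le> us n t" and us_le: "0 \<le> t \<Longrightarrow> us n t \<le> M"
  and cs_nonneg: "2 \<le> i \<Longrightarrow> 0 \<le> t \<Longrightarrow> 0 \<le> cs n i t"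
  and mass_partial: "0 \<le> t \<Longrightarrow> (\<Sum>i=2..k. (e n)\<^sup>2 * real i * cs n i t) \<le> M"
proof -
  interpret S: BD_system r "e n" "\<alpha>s n" "\<beta>s n" K "ms n" "as n" "bs n" "us n" "cs n" by (rule sys)
  show "0 < e n" "e n \<le> 1" "0 \<le> r" by (rule S.e_pos S.e_le S.r_nonneg)+
  show "0 \<le> t \<Longrightarrow> 0 \<le> us n t" "2 \<le> i \<Longrightarrow> 0 \<le> t \<Longrightarrow> 0 \<le> cs n i t"
    by (rule S.u_nonneg S.c_nonneg; assumption)+
  show "us n t \<le> M" if "0 \<le> t" using S.u_le[OF that] ms_le[of n] by linarith
  show "(\<Sum>i=2..k. (e n)\<^sup>2 * real i * cs n i t) \<le> M" if "0 \<le> t"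
    using S.mass_partial[OF that, of k] S.u_nonneg[OF that] ms_le[of n] by linarith
qed

lemma size_le:
  assumes "2 \<le> i" "0 \<le> t" shows "(e n)\<^sup>2 * real i * cs n i t \<le> M"
proof -
  interpret S: BD_system r "e n" "\<alpha>s n" "\<beta>s n" K "ms n" "as n" "bs n" "us n" "cs n" by (rule sys)
  show ?thesis using S.size_le[OF assms] ms_le[of n] by linarith
qed

lemma nucleation_le: "\<alpha>s n * (ms n)\<^sup>2 \<le> A * M\<^sup>2"
proof -
  interpret S: BD_system r "e n" "\<alpha>s n" "\<beta>s n" K "ms n" "as n" "bs n" "us n" "cs n" by (rule sys)
  show ?thesis using S.\<alpha>_nonneg S.m_nonneg \<alpha>s_le ms_le const_nonneg
    by (intro mult_mono power_mono) auto
qed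

lemma zeroth: 
  assumes "0 \<le> t" "t \<le> 1" shows "(\<Sum>i=2..k. e n * cs n i t) \<le> Z"
proof -
  interpret S: BD_system r "e n" "\<alpha>s n" "\<beta>s n" K "ms n" "as n" "bs n" "us n" "cs n" by (rule sys)
  have "(\<Sum>i=2..k. e n * cs n i t) \<le> Z0 + t * (\<alpha>s n * (ms n)\<^sup>2)"
    by (rule S.zeroth_moment[OF zeroth_init assms(1)])
  also have "t * (\<alpha>s n * (ms n)\<^sup>2) \<le> 1 * (A * M\<^sup>2)"
    by (rule mult_mono[OF assms(2) nucleation_le]) (use S.\<alpha>_nonneg in auto)
  finally show ?thesis by (simp add: Z_def)
qed

lemma us_deriv:
  assumes "t \<in> {0..1}"
  obtains D where "(us n has_real_derivative D) (at t within {0..})" "\<bar>D\<bar> \<le> speed"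
proof -
  interpret S: BD_system r "e n" "\<alpha>s n" "\<beta>s n" K "ms n" "as n" "bs n" "us n" "cs n" by (rule sys)
  have t: "0 \<le> t" "t \<le> 1" using assms by auto
  have "\<bar>- e n * J n 1 t - e n * (\<Sum>i. J n (i + 1) t)\<bar> \<le>
      2 * (\<alpha>s n * (ms n)\<^sup>2 + \<beta>s n * Z) + K * (1 + ms n) * (Z + ms n)"
    by (rule S.u_deriv_bound[OF t(1) zeroth[OF t]])
  also have "\<dots> \<le> speed"
  proof -
    have "\<beta>s n * Z \<le> A * Z" using \<beta>s_le[of n] const_nonneg by (intro mult_right_mono) auto
    moreover have "K * (1 + ms n) * (Z + ms n) \<le> flux_const"
      unfolding flux_const_def
      using ms_le[of n] const_nonneg S.m_nonneg by (intro mult_mono) auto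
    ultimately show ?thesis using nucleation_le[of n] unfolding speed_def by (intro add_mono mult_left_mono) auto
  qed
  finally show ?thesis using that[OF S.u_deriv[OF t(1)]] by simp
qed

lemma us_lipschitz:
  assumes "s \<in> {0..1}" "t \<in> {0..1}" shows "\<bar>us n t - us n s\<bar> \<le> speed * \<bar>t - s\<bar>"
proof -
  have "\<exists>D. (us n has_real_derivative D) (at x within {0..1}) \<and> \<bar>D\<bar> \<le> speed" if x: "x \<in> {0..1}" for x
  proof -
    obtain D where D: "(us n has_real_derivative D) (at x within {0..})" "\<bar>D\<bar> \<le> speed"
      by (rule us_deriv[OF x])
    have "(us n has_real_derivative D) (at x within {0..1})"
      by (rule has_field_derivative_subset[OF D(1)]) auto
    then show ?thesis using D(2) by blast
  qed
  then have "\<forall>x\<in>{0..1}. \<exists>D. (us n has_real_derivative D) (at x within {0..1}) \<and> \<bar>D\<bar> \<le> speed" by blast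
  from bchoice[OF this] obtain D where
    "\<forall>x\<in>{0..1}. (us n has_real_derivative D x) (at x within {0..1}) \<and> \<bar>D x\<bar> \<le> speed" ..
  then have D: "\<And>x. x \<in> {0..1} \<Longrightarrow> (us n has_real_derivative D x) (at x within {0..1})"
    "\<And>x. x \<in> {0..1} \<Longrightarrow> norm (D x) \<le> speed" by simp_all
  have "norm (us n t - us n s) \<le> speed * norm (t - s)"
    by (rule field_differentiable_bound[OF _ D assms(2,1)]) simp
  then show ?thesis by simp
qed

lemma us_ge:
  assumes "t \<in> {0..T}" shows "ul \<le> us n t"
proof -
  have t: "t \<in> {0..1}" "t \<le> (u_low - \<rho>) / (2 * (speed + 1))" using assms T by (auto simp: T_def)
  then have "(speed + 1) * t \<le> (u_low - \<rho>) / 2"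
    using const_nonneg by (simp add: field_simps)
  then have "speed * t \<le> (u_low - \<rho>) / 2" using t by (simp add: distrib_right)
  then show ?thesis
    using us_lipschitz[of 0 t n] t u0_ge[of n] by (simp add: ul_def abs_le_iff field_simps)
qed

lemma tail:
  assumes \<epsilon>: "0 < \<epsilon>"
  shows "\<exists>R>0. \<forall>n k. \<forall>t\<in>{0..T}.
    (\<Sum>i\<in>{i\<in>{2..k}. R \<le> e n * real i}. (e n)\<^sup>2 * real i * cs n i t) \<le> \<epsilon>"
proof -
  define E where "E = 2 * exp (6 * K * M)"
  have E: "0 < E" by (simp add: E_def)
  obtain R1 where R1: "0 < R1" "\<And>n k.
       (\<Sum>i\<in>{i\<in>{2..k}. R1 \<le> e n * real i}. (e n)\<^sup>2 * real i * cs n i 0) \<le> \<epsilon> / (2 * E)"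
    using tail_init[of "\<epsilon> / (2 * E)"] \<epsilon> E by auto
  define Q where "Q = R1 * M + (4 * A * M\<^sup>2 + 3 * K * M * Z)"
  have Q: "0 \<le> Q" using R1 const_nonneg by (auto simp: Q_def)
  \<comment> \<open>so large that all terms of order \<open>1 / R\<close> in \<open>tail_bound\<close> sum up to at most \<open>\<epsilon> / 2\<close>\<close>
  define R where "R = 2 * E * (Q + 1) / \<epsilon>"
  have R: "0 < R" using E Q \<epsilon> by (simp add: R_def)
  have init: "(\<Sum>i=2..k. e n * ((e n * real i)\<^sup>2 / (e n * real i + R)) * cs n i 0) \<le> R1 * M / R + \<epsilon> / (2 * E)" for n k
  proof -
    let ?x = "\<lambda>i. e n * real i"
    have "(\<Sum>i=2..k. e n * ((?x i)\<^sup>2 / (?x i + R)) * cs n i 0) \<le>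
       (\<Sum>i=2..k. R1 / R * ((e n)\<^sup>2 * real i * cs n i 0) +
          (if R1 \<le> ?x i then (e n)\<^sup>2 * real i * cs n i 0 else 0))"
    proof (rule sum_mono)
      fix i assume "i \<in> {2..k}"
      then have i: "2 \<le> i" by simp
      have c: "0 \<le> cs n i 0" by (rule cs_nonneg[OF i]) simp
      have x: "0 \<le> ?x i" using e_pos[of n] by simp
      have "(?x i)\<^sup>2 / (?x i + R) \<le> R1 / R * ?x i + (if R1 \<le> ?x i then ?x i else 0)"
      proof (cases "R1 \<le> ?x i")
        case True
        have "(?x i)\<^sup>2 / (?x i + R) \<le> ?x i"
          using x R by (simp add: pos_divide_le_eq power2_eq_square distrib_left)
        moreover have "0 \<le> R1 / R * ?x i" using x R R1 by simp
        ultimately show ?thesis using True by simp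
      next
        case False
        have "(?x i)\<^sup>2 / (?x i + R) \<le> (R1 * ?x i) / R"
          using x R R1 False by (intro frac_le) (auto simp: power2_eq_square intro: mult_right_mono)
        then show ?thesis using False by simp
      qed
      then have "e n * ((?x i)\<^sup>2 / (?x i + R)) * cs n i 0 \<le>
          e n * (R1 / R * ?x i + (if R1 \<le> ?x i then ?x i else 0)) * cs n i 0"
        using c e_pos[of n] by (intro mult_right_mono mult_left_mono) auto
      then show "e n * ((?x i)\<^sup>2 / (?x i + R)) * cs n i 0 \<le> R1 / R * ((e n)\<^sup>2 * real i * cs n i 0) +
          (if R1 \<le> ?x i then (e n)\<^sup>2 * real i * cs n i 0 else 0)"
        by (auto simp: power2_eq_square algebra_simps)
    qed
    also have "\<dots> = R1 / R * (\<Sum>i=2..k. (e n)\<^sup>2 * real i * cs n i 0) +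
        (\<Sum>i\<in>{i\<in>{2..k}. R1 \<le> ?x i}. (e n)\<^sup>2 * real i * cs n i 0)"
      unfolding sum.distrib sum_distrib_left by (subst sum.inter_filter) auto
    also have "\<dots> \<le> R1 / R * M + \<epsilon> / (2 * E)"
      using R1 R mass_partial[of 0 n k] by (intro add_mono mult_left_mono) auto
    finally show ?thesis by simp
  qed
  have "(\<Sum>i\<in>{i\<in>{2..k}. R \<le> e n * real i}. (e n)\<^sup>2 * real i * cs n i t) \<le> \<epsilon>"
    if t: "t \<in> {0..T}" for n k t
  proof -
    interpret S: BD_system r "e n" "\<alpha>s n" "\<beta>s n" K "ms n" "as n" "bs n" "us n" "cs n" by (rule sys)
    have t01: "0 \<le> t" "t \<le> 1" using t T by auto
    have "(\<Sum>i\<in>{i\<in>{2..k}. R \<le> e n * real i}. (e n)\<^sup>2 * real i * cs n i t) \<le>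
      2 * (exp (6 * K * ms n * t) * ((R1 * M / R + \<epsilon> / (2 * E)) +
        t / R * (4 * \<alpha>s n * (ms n)\<^sup>2 + 3 * K * ms n * Z)))"
      by (rule S.tail_bound[OF R init]) (use zeroth t01 in auto)
    also have "\<dots> \<le> 2 * (exp (6 * K * M) * ((R1 * M / R + \<epsilon> / (2 * E)) +
        1 / R * (4 * A * M\<^sup>2 + 3 * K * M * Z)))"
    proof -
      have "6 * K * ms n * t \<le> 6 * K * M * 1"
        using ms_le[of n] const_nonneg S.m_nonneg t01 by (intro mult_mono) auto
      then have ex: "exp (6 * K * ms n * t) \<le> exp (6 * K * M)" by simp
      have "3 * K * ms n * Z \<le> 3 * K * M * Z"
        using ms_le[of n] const_nonneg by (intro mult_right_mono mult_left_mono) auto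
      then have src: "4 * \<alpha>s n * (ms n)\<^sup>2 + 3 * K * ms n * Z \<le> 4 * A * M\<^sup>2 + 3 * K * M * Z"
        using nucleation_le[of n] by linarith
      have src0: "0 \<le> 4 * \<alpha>s n * (ms n)\<^sup>2 + 3 * K * ms n * Z"
        using const_nonneg S.m_nonneg S.\<alpha>_nonneg by simp
      have tR: "t / R \<le> 1 / R" "0 \<le> 1 / R" using t01 R by (auto intro: divide_right_mono)
      have "t / R * (4 * \<alpha>s n * (ms n)\<^sup>2 + 3 * K * ms n * Z) \<le> 1 / R * (4 * A * M\<^sup>2 + 3 * K * M * Z)"
        by (rule mult_mono[OF tR(1) src tR(2) src0])
      then have "exp (6 * K * ms n * t) * ((R1 * M / R + \<epsilon> / (2 * E)) +
          t / R * (4 * \<alpha>s n * (ms n)\<^sup>2 + 3 * K * ms n * Z))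
        \<le> exp (6 * K * M) * ((R1 * M / R + \<epsilon> / (2 * E)) + 1 / R * (4 * A * M\<^sup>2 + 3 * K * M * Z))"
      proof (intro mult_mono[OF ex] add_left_mono)
        have "0 \<le> R1 * M / R + \<epsilon> / (2 * E)" using R R1 E \<epsilon> const_nonneg by simp
        moreover have "0 \<le> t / R * (4 * \<alpha>s n * (ms n)\<^sup>2 + 3 * K * ms n * Z)"
          using mult_nonneg_nonneg[OF _ src0, of "t / R"] t01 R by simp
        ultimately show "0 \<le> R1 * M / R + \<epsilon> / (2 * E) + t / R * (4 * \<alpha>s n * (ms n)\<^sup>2 + 3 * K * ms n * Z)"
          by (rule add_nonneg_nonneg)
      qed auto
      then show ?thesis by simp
    qed
    also have "\<dots> = E * (Q / R) + \<epsilon> / 2"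
      using E R by (simp add: E_def Q_def field_simps)
    also have "E * (Q / R) \<le> \<epsilon> / 2"
    proof -
      define q where "q = Q + 1"
      have q: "0 < q" "Q \<le> q" using Q by (auto simp: q_def)
      have "E * (Q / R) = \<epsilon> / 2 * (Q / q)" using E by (simp add: R_def q_def[symmetric])
      also have "\<dots> \<le> \<epsilon> / 2 * 1" using q \<epsilon> by (intro mult_left_mono) auto
      finally show ?thesis by simp
    qed
    finally show ?thesis by simp
  qed
  then show ?thesis using R by blast
qed

text \<open>
  Because \<open>\<rho> < ul\<close>, some exponential weight grows slowly enough for growth to dominate fragmentation
  strictly below a macroscopic size \<open>x0\<close>, and \<open>exponential_moment\<close> applies with \<open>I = x0 / e\<close>: the source
  at the size \<open>I\<close> is controlled by the mass, of order \<open>1 / e\<^sup>2\<close>, times an exponentially small weight.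
  Beyond \<open>x0\<close> the mass alone bounds the concentrations.
\<close>
lemma small_concentrations:
  obtains z D where "0 < z" "\<rho> * exp z < ul" "0 \<le> D"
    "\<And>n i t. 2 \<le> i \<Longrightarrow> t \<in> {0..T} \<Longrightarrow> e n powr r * cs n i t \<le> D * exp (real i * z)"
proof -
  have "((\<lambda>z. \<rho> * exp z) \<longlongrightarrow> \<rho> * exp 0) (at_right 0)" by (intro tendsto_intros)
  then have "\<forall>\<^sub>F z in at_right 0. \<rho> * exp z < ul" using ul by (intro order_tendstoD) auto
  moreover have "\<forall>\<^sub>F z::real in at_right 0. 0 < z \<and> z < 1"
    unfolding eventually_at_right_field by (intro exI[of _ 1]) auto
  ultimately have "\<forall>\<^sub>F z in at_right 0. \<rho> * exp z < ul \<and> 0 < z \<and> z < 1" by (rule eventually_conj)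
  then have "\<exists>z. \<rho> * exp z < ul \<and> 0 < z \<and> z < 1"
    by (rule eventually_happens'[rotated]) simp
  then obtain z where z: "\<rho> * exp z < ul" "0 < z" "z < 1" by blast
  define w where "w = ul + exp z"
  have w: "0 < w" using ul by (simp add: w_def add_pos_pos)
  \<comment> \<open>half of the strict gap \<open>abar * (ul - \<rho> * exp z)\<close> absorbs the deviation of the rates from powers\<close>
  define \<kappa> where "\<kappa> = abar * (ul - \<rho> * exp z) / (2 * w)"
  define k where "k = abar * (ul - \<rho> * exp z) / 2"
  have \<kappa>: "0 < \<kappa>" using z w pos by (simp add: \<kappa>_def)
  have k: "0 < k" using z pos by (simp add: k_def)
  have balance: "(abar - \<kappa>) * ul - exp z * (abar * \<rho> + \<kappa>) = k"
  proof -
    have "\<kappa> * w = k" using w by (simp add: \<kappa>_def k_def)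
    then show ?thesis by (simp add: k_def w_def algebra_simps)
  qed
  obtain x0 where x0: "0 < x0" and
    rt: "\<And>n i. e n * real i < x0 \<Longrightarrow> 2 \<le> i \<Longrightarrow> \<bar>as n i - abar * (e n * real i) powr r\<bar> \<le> \<kappa> * (e n * real i) powr r"
     "\<And>n i. e n * real i < x0 \<Longrightarrow> 3 \<le> i \<Longrightarrow> \<bar>bs n i - abar * \<rho> * (e n * real i) powr r\<bar> \<le> \<kappa> * (e n * real i) powr r"
    using rates[OF \<kappa>] by blast
  obtain S where S: "\<And>n k. (\<Sum>i=2..k. e n powr r * cs n i 0 * exp (- real i * z)) \<le> S"
    using exp_init[OF z(2,3)] by blast
  define Q where "Q = 4 * K * M * exp z / (z * x0)\<^sup>2"
  define p where "p = 1 - exp (- z)"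
  have p: "0 < p" using z by (simp add: p_def)
  define D0 where "D0 = max S ((A * M\<^sup>2 + Q) / (k * p))"
  define D where "D = D0 / p + M / (x0\<^sup>2 * z)"
  have Q0: "0 \<le> Q" using const_nonneg by (simp add: Q_def)
  have S0: "0 \<le> S" using S[of 0 0] by simp
  have D0: "0 \<le> D0" using S0 by (simp add: D0_def)
  have small: "e n powr r * cs n i t \<le> D * exp (real i * z)" if i: "2 \<le> i" and t: "t \<in> {0..T}" for n i t
  proof (cases "e n * real i < x0")
    case True
    interpret Y: BD_system r "e n" "\<alpha>s n" "\<beta>s n" K "ms n" "as n" "bs n" "us n" "cs n" by (rule sys)
    define I where "I = nat \<lceil>x0 / e n\<rceil>"
    have ceil_pos: "0 < \<lceil>x0 / e n\<rceil>" using x0 e_pos[of n] by simp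
    have I_iff: "j < I \<longleftrightarrow> e n * real j < x0" for j
    proof -
      have "j < I \<longleftrightarrow> int j < \<lceil>x0 / e n\<rceil>" using ceil_pos unfolding I_def by linarith
      also have "\<dots> \<longleftrightarrow> real j < x0 / e n" by (simp add: less_ceiling_iff)
      finally show ?thesis using e_pos[of n] by (simp add: pos_less_divide_eq mult.commute)
    qed
    have iI: "i < I" using True I_iff by simp
    then have I3: "3 \<le> I" using i by simp
    have I_ge: "x0 \<le> e n * real I" using I_iff[of I] by simp
    have t01: "0 \<le> t" "t \<le> T" using t by auto
    have "e n powr r * cs n i t * (exp (- real i * z) - exp (- real I * z)) \<le>
      max S ((\<alpha>s n * (ms n)\<^sup>2 + Q) / (k * (1 - exp (- z))))"
    proof (rule Y.exponential_moment[where T = T and ul = ul, OF z(2) k _ _ S _ t01 i iI])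
      show "ul \<le> us n s" if "0 \<le> s" "s \<le> T" for s using us_ge that by auto
      show "k * e n powr r \<le> as n j * ul - exp z * (if j = 2 then 0 else bs n j)"
        if j: "2 \<le> j" "j < I" for j
      proof -
        let ?P = "(e n * real j) powr r"
        have jx: "e n * real j < x0" using j I_iff by simp
        have P: "e n powr r \<le> ?P"
          using e_pos[of n] j r_nonneg by (intro powr_mono2) auto
        have aj: "(abar - \<kappa>) * ?P \<le> as n j"
          using rt(1)[OF jx j(1)] by (simp add: abs_le_iff algebra_simps)
        have bj: "(if j = 2 then 0 else bs n j) \<le> (abar * \<rho> + \<kappa>) * ?P"
        proof (cases "j = 2")
          case True
          then show ?thesis using pos \<kappa> by simp
        next
          case False
          then show ?thesis using rt(2)[OF jx] j by (simp add: abs_le_iff algebra_simps)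
        qed
        have "k * e n powr r \<le> k * ?P" using P k by (intro mult_left_mono) auto
        also have "\<dots> = ((abar - \<kappa>) * ?P) * ul - exp z * ((abar * \<rho> + \<kappa>) * ?P)"
          unfolding balance[symmetric] by (simp add: algebra_simps)
        also have "\<dots> \<le> as n j * ul - exp z * (if j = 2 then 0 else bs n j)"
          using aj bj ul by (intro diff_mono mult_right_mono mult_left_mono) auto
        finally show ?thesis .
      qed
      show "exp (- (real I - 1) * z) * (bs n I * cs n I s) \<le> Q" if s: "0 \<le> s" "s \<le> T" for s
      proof -
        have c: "0 \<le> cs n I s" using I3 s by (intro cs_nonneg) auto
        have "bs n I \<le> K * (1 + e n * real I)" using I3 by (rule Y.b_le)
        also have "\<dots> \<le> K * (2 * real I)"
        proof (intro mult_left_mono const_nonneg)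
          have "e n * real I \<le> 1 * real I" by (intro mult_right_mono e_le) auto
          moreover have "1 \<le> real I" using I3 by simp
          ultimately show "1 + e n * real I \<le> 2 * real I" by linarith
        qed
        finally have "bs n I * cs n I s \<le> K * (2 * real I) * cs n I s" using c by (rule mult_right_mono)
        also have "\<dots> = 2 * K / (e n)\<^sup>2 * ((e n)\<^sup>2 * real I * cs n I s)"
          using e_pos[of n] by simp
        also have "\<dots> \<le> 2 * K / (e n)\<^sup>2 * M"
          using size_le[of I s n] I3 s const_nonneg by (intro mult_left_mono) auto
        finally have bc: "bs n I * cs n I s \<le> 2 * K * M / (e n)\<^sup>2" by simp
        have "z * x0 / e n \<le> z * real I" using I_ge z e_pos[of n] by (simp add: field_simps)
        then have "- (real I - 1) * z \<le> z + - (z * x0 / e n)" by (simp add: algebra_simps)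
        then have "exp (- (real I - 1) * z) \<le> exp z * exp (- (z * x0 / e n))"
          unfolding exp_add[symmetric] by simp
        also have "\<dots> \<le> exp z * (2 / (z * x0 / e n)\<^sup>2)"
          using z x0 e_pos[of n] by (intro mult_left_mono exp_minus_le_inverse_square) auto
        finally have "exp (- (real I - 1) * z) * (bs n I * cs n I s) \<le>
           exp z * (2 / (z * x0 / e n)\<^sup>2) * (2 * K * M / (e n)\<^sup>2)"
          using bc c Y.b_nonneg[OF I3] by (intro mult_mono) auto
        also have "\<dots> = Q" using e_pos[of n] by (simp add: Q_def power_divide)
        finally show ?thesis .
      qed
    qed
    also have "\<dots> \<le> D0"
      unfolding D0_def p_def[symmetric]
      using nucleation_le[of n] k p Q0 by (intro max.mono divide_right_mono add_mono) auto
    finally have 1: "e n powr r * cs n i t * (exp (- real i * z) - exp (- real I * z)) \<le> D0" .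
    have "real (i + 1) * z \<le> real I * z" using iI z by (intro mult_right_mono) auto
    then have "exp (- real I * z) \<le> exp (- real (i + 1) * z)"
      by (simp only: exp_le_cancel_iff mult_minus_left neg_le_iff_le)
    also have "\<dots> = exp (- real i * z) * exp (- z)" by (simp add: exp_add[symmetric] algebra_simps)
    finally have "exp (- real i * z) * p \<le> exp (- real i * z) - exp (- real I * z)"
      by (simp add: p_def algebra_simps)
    then have "e n powr r * cs n i t * (exp (- real i * z) * p) \<le>
       e n powr r * cs n i t * (exp (- real i * z) - exp (- real I * z))"
      using cs_nonneg[OF i t01(1)] by (intro mult_left_mono) auto
    with 1 have "e n powr r * cs n i t * (exp (- real i * z) * p) \<le> D0" by linarith
    then have "e n powr r * cs n i t \<le> D0 / p * exp (real i * z)"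
      using p by (simp add: exp_minus field_simps)
    also have "\<dots> \<le> D * exp (real i * z)"
      using const_nonneg z x0 by (intro mult_right_mono) (auto simp: D_def)
    finally show ?thesis .
  next
    case False
    have c: "0 \<le> cs n i t" using cs_nonneg i t by auto
    have e0: "0 < e n" by (rule e_pos)
    have "x0\<^sup>2 \<le> (e n * real i)\<^sup>2" using False x0 by (intro power_mono) auto
    then have "x0\<^sup>2 * cs n i t \<le> (e n * real i)\<^sup>2 * cs n i t" using c by (rule mult_right_mono)
    also have "\<dots> = real i * ((e n)\<^sup>2 * real i * cs n i t)" by (simp add: power2_eq_square)
    also have "\<dots> \<le> real i * M" using size_le[OF i] t by (intro mult_left_mono) auto
    finally have "cs n i t \<le> real i * M / x0\<^sup>2" using x0 by (simp add: field_simps)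
    moreover have "e n powr r * cs n i t \<le> cs n i t"
      using c e_pos e_le r_nonneg by (intro mult_left_le_one_le powr_le1) (auto simp: less_imp_le)
    moreover have "real i * M / x0\<^sup>2 \<le> M / (x0\<^sup>2 * z) * exp (real i * z)"
    proof -
      have "real i * z \<le> exp (real i * z)" using exp_ge_add_one_self[of "real i * z"] by linarith
      then have "M / (x0\<^sup>2 * z) * (real i * z) \<le> M / (x0\<^sup>2 * z) * exp (real i * z)"
        using const_nonneg z by (intro mult_left_mono) auto
      then show ?thesis using z by (simp add: mult.commute)
    qed
    moreover have "\<dots> \<le> D * exp (real i * z)"
      using D0 p by (intro mult_right_mono) (auto simp: D_def)
    ultimately show ?thesis by linarith
  qed
  have "0 \<le> D" using D0 p const_nonneg z by (simp add: D_def)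
  show ?thesis by (rule that[OF z(2,1) \<open>0 \<le> D\<close> small])
qed

lemma dimer_bounds:
  obtains D where "0 \<le> D" "\<And>n t. t \<in> {0..T} \<Longrightarrow> e n powr r * cs n 2 t \<le> D"
    "\<And>n t. t \<in> {0..T} \<Longrightarrow> \<bar>J n 1 t\<bar> \<le> D"
proof -
  obtain z D where D: "0 < z" "0 \<le> D"
    "\<And>n i t. 2 \<le> i \<Longrightarrow> t \<in> {0..T} \<Longrightarrow> e n powr r * cs n i t \<le> D * exp (real i * z)"
    by (rule small_concentrations) blast
  define D2 where "D2 = D * exp (2 * z)"
  have D2: "0 \<le> D2" using D by (simp add: D2_def)
  have 1: "e n powr r * cs n 2 t \<le> D2" if "t \<in> {0..T}" for n t
    using D(3)[of 2 t n] that by (simp add: D2_def)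
  have 2: "\<bar>J n 1 t\<bar> \<le> A * M\<^sup>2 + A * D2" if t: "t \<in> {0..T}" for n t
  proof -
    interpret S: BD_system r "e n" "\<alpha>s n" "\<beta>s n" K "ms n" "as n" "bs n" "us n" "cs n" by (rule sys)
    have t0: "0 \<le> t" using t by simp
    have "\<alpha>s n * (us n t)\<^sup>2 \<le> A * M\<^sup>2"
      using \<alpha>s_le us_le[OF t0] us_nonneg[OF t0] const_nonneg by (intro mult_mono power_mono) auto
    moreover have "0 \<le> \<alpha>s n * (us n t)\<^sup>2" using S.\<alpha>_nonneg by simp
    moreover have "\<beta>s n * (e n powr r * cs n 2 t) \<le> A * D2"
      using \<beta>s_le 1[OF t] cs_nonneg[of 2 t n] t0 const_nonneg by (intro mult_mono) auto
    moreover have "0 \<le> \<beta>s n * (e n powr r * cs n 2 t)" using S.\<beta>_nonneg cs_nonneg[of 2 t n] t0 by simp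
    ultimately show ?thesis unfolding S.J_1 by (simp add: abs_le_iff mult_ac)
  qed
  have "0 \<le> A * M\<^sup>2 + A * D2" using const_nonneg D2 by simp
  show ?thesis
  proof (rule that[of "max D2 (A * M\<^sup>2 + A * D2)"])
    show "e n powr r * cs n 2 t \<le> max D2 (A * M\<^sup>2 + A * D2)" if "t \<in> {0..T}" for n t
      using 1[OF that, of n] by linarith
    show "\<bar>J n 1 t\<bar> \<le> max D2 (A * M\<^sup>2 + A * D2)" if "t \<in> {0..T}" for n t
      using 2[OF that, of n] by linarith
  qed (use D2 in simp)
qed

lemma f_nonneg: "0 \<le> t \<Longrightarrow> 0 \<le> f n t x"
  using step_fun_nonneg[OF e_pos[of n]] cs_nonneg by simp

lemma f_finite_borel: "0 \<le> t \<Longrightarrow> t \<le> 1 \<Longrightarrow> density_on {0..} (f n t) \<in> finite_borel {0..}"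
  using density_on_step_fun_finite_borel[OF e_pos[of n] _ zeroth] cs_nonneg by simp

text \<open>At least \<open>2\<close>, so that sums over the sizes from \<open>2\<close> on are never empty.\<close>
definition cells :: "nat \<Rightarrow> real \<Rightarrow> nat" where "cells n R = max 2 (nat \<lceil>R / e n\<rceil>)"

lemma cells: "2 \<le> cells n R" "R \<le> e n * real (cells n R)"
proof -
  have "R / e n \<le> real (cells n R)" unfolding cells_def by linarith
  then show "R \<le> e n * real (cells n R)" using e_pos[of n] by (simp add: field_simps)
qed (simp add: cells_def)

lemma f_pairing:
  fixes \<phi> :: "real \<Rightarrow> real"
  assumes t: "0 \<le> t" "t \<le> 1" and c: "continuous_on {0..} \<phi>" and R: "\<And>x. x \<ge> R \<Longrightarrow> \<phi> x = 0"
    and osc: "\<And>x y. 0 \<le> x \<Longrightarrow> 0 \<le> y \<Longrightarrow> \<bar>x - y\<bar> \<le> e n / 2 \<Longrightarrow> \<bar>\<phi> x - \<phi> y\<bar> \<le> \<omega>" and \<omega>: "0 \<le> \<omega>"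
  shows "\<bar>(\<integral>x. \<phi> x \<partial>density_on {0..} (f n t)) - (\<Sum>i=2..cells n R. e n * \<phi> (e n * real i) * cs n i t)\<bar>
    \<le> \<omega> * Z"
proof -
  have "\<bar>(\<integral>x. \<phi> x \<partial>density_on {0..} (f n t)) - (\<Sum>i=2..cells n R. e n * \<phi> (e n * real i) * cs n i t)\<bar>
    \<le> \<omega> * (\<Sum>i=2..cells n R. e n * cs n i t)"
  proof (rule step_fun_pairing[OF e_pos _ c R cells])
    fix x i assume i: "2 \<le> i" "x \<in> cell (e n) i"
    show "\<bar>\<phi> x - \<phi> (e n * real i)\<bar> \<le> \<omega>"
      using cell_bounds(3,4)[OF e_pos i] e_pos[of n] by (intro osc) auto
  qed (use cs_nonneg t in auto)
  also have "\<dots> \<le> \<omega> * Z" using zeroth[OF t] \<omega> by (intro mult_left_mono) auto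
  finally show ?thesis .
qed

text \<open>
  The bound on the nucleation flux from \<open>dimer_bounds\<close> is what makes moments against functions that do
  not vanish at \<open>0\<close> Lipschitz in time; passing from cell averages to midpoints costs \<open>L * e n * Z\<close>.
\<close>
lemma path_compactness:
  obtains s \<mu> where "strict_mono s"
    "\<And>t. t \<in> {0..T} \<Longrightarrow> \<mu> t \<in> finite_borel {0..}" "\<And>t. t \<in> {0..T} \<Longrightarrow> measure (\<mu> t) {0..} \<le> Z + 2 * M + 1"
    "\<And>\<phi>. \<phi> \<in> Cc {0..} \<Longrightarrow> uniform_limit {0..T} (\<lambda>n t. \<integral>x. \<phi> x \<partial>density_on {0..} (f (s n) t))
      (\<lambda>t. \<integral>x. \<phi> x \<partial>\<mu> t) sequentially"
proof (rule measure_path_compactness[of T "Z + 2 * M + 1" f])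
  show "0 < T" "0 < Z + 2 * M + 1" using T const_nonneg by auto
  show "f n t \<in> borel_measurable borel" for n t by measurable
  show "0 \<le> f n t x" if "t \<in> {0..T}" for n t x using that by (intro f_nonneg) auto
  show "(\<integral>\<^sup>+x. ennreal (indicator {0..} x * f n t x) \<partial>lborel) \<le> ennreal (Z + 2 * M + 1)" if t: "t \<in> {0..T}" for n t
  proof -
    have t': "0 \<le> t" "t \<le> 1" using t T by auto
    have "(\<integral>\<^sup>+x. ennreal (indicator {0..} x * f n t x) \<partial>lborel) \<le> (\<integral>\<^sup>+x. ennreal (f n t x) \<partial>lborel)"
      using f_nonneg[OF t'(1)] by (intro nn_integral_mono ennreal_leI) (auto split: split_indicator)
    also have "\<dots> \<le> ennreal Z"
      using cs_nonneg t' zeroth[OF t'] by (intro nn_integral_step_fun_le e_pos) auto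
    also have "\<dots> \<le> ennreal (Z + 2 * M + 1)" using const_nonneg by (intro ennreal_leI) auto
    finally show ?thesis .
  qed
  show "(\<integral>\<^sup>+x. ennreal (indicator {0..} x * (x * f n t x)) \<partial>lborel) \<le> ennreal (Z + 2 * M + 1)" if t: "t \<in> {0..T}" for n t
  proof -
    have "(\<integral>\<^sup>+x. ennreal (indicator {0..} x * (x * f n t x)) \<partial>lborel) \<le> ennreal (2 * M)"
      using cs_nonneg t mass_partial[of t n] by (intro nn_integral_step_fun_moment_le e_pos) auto
    also have "\<dots> \<le> ennreal (Z + 2 * M + 1)" using const_nonneg by (intro ennreal_leI) auto
    finally show ?thesis .
  qed
next
  fix \<psi> :: "real \<Rightarrow> real" and L R :: real
  assume L: "0 \<le> L" and R: "0 < R" and \<psi>0: "\<And>x. R \<le> x \<Longrightarrow> \<psi> x = 0"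
    and lip: "\<And>x y. 0 \<le> x \<Longrightarrow> 0 \<le> y \<Longrightarrow> \<bar>\<psi> x - \<psi> y\<bar> \<le> L * \<bar>x - y\<bar>"
  obtain D where D: "0 \<le> D" "\<And>n t. t \<in> {0..T} \<Longrightarrow> \<bar>J n 1 t\<bar> \<le> D" by (rule dimer_bounds) blast
  have c: "continuous_on {0..} \<psi>"
    using L lip by (intro lipschitz_on_continuous_on[of L]) (auto simp: lipschitz_on_def dist_real_def)
  have bound: "\<bar>\<psi> x\<bar> \<le> L * R" if "0 \<le> x" for x
  proof (cases "x \<le> R")
    case True
    have "\<bar>\<psi> x\<bar> \<le> L * \<bar>x - R\<bar>" using lip[OF that, of R] R \<psi>0[of R] by simp
    also have "\<dots> \<le> L * R" using True that L by (intro mult_left_mono) auto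
    finally show ?thesis .
  qed (use \<psi>0 L R in auto)
  let ?I = "\<lambda>n t. \<integral>x. \<psi> x \<partial>density_on {0..} (f n t)"
  let ?S = "\<lambda>n t. \<Sum>i=2..cells n R. e n * \<psi> (e n * real i) * cs n i t"
  have "\<bar>?I n s - ?I n t\<bar> \<le> (L * R * D + L * flux_const) * \<bar>s - t\<bar> + L * e n * Z"
    if st: "s \<in> {0..T}" "t \<in> {0..T}" for n s t
  proof -
    interpret Y: BD_system r "e n" "\<alpha>s n" "\<beta>s n" K "ms n" "as n" "bs n" "us n" "cs n" by (rule sys)
    have pair: "\<bar>?I n t - ?S n t\<bar> \<le> L * (e n / 2) * Z" if "t \<in> {0..T}" for t
    proof (rule f_pairing[OF _ _ c \<psi>0])
      fix x y :: real assume "0 \<le> x" "0 \<le> y" "\<bar>x - y\<bar> \<le> e n / 2"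
      then show "\<bar>\<psi> x - \<psi> y\<bar> \<le> L * (e n / 2)" using lip[of x y] L mult_left_mono[of "\<bar>x - y\<bar>" "e n / 2" L] by linarith
    qed (use that T L e_pos[of n] in auto)
    have "\<bar>?S n s - ?S n t\<bar> \<le> (L * R * D + L * (K * (1 + ms n) * (Z + ms n))) * \<bar>s - t\<bar>"
    proof (rule Y.weighted_sum_lipschitz[where T = T])
      show "(\<Sum>i=2..k. e n * cs n i t) \<le> Z" if "0 \<le> t" "t \<le> T" for k t using zeroth that T by auto
      show "\<psi> (e n * real (cells n R + 1)) = 0"
        using cells(2)[of R n] e_pos[of n] by (intro \<psi>0) (simp add: distrib_left)
      show "\<bar>\<psi> (e n * real (i + 1)) - \<psi> (e n * real i)\<bar> \<le> L * e n" for i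
        using lip[of "e n * real (i+1)" "e n * real i"] e_pos[of n] by (simp add: distrib_left)
    qed (use D st L cells(1)[of n R] bound e_pos[of n] in auto)
    also have "\<dots> \<le> (L * R * D + L * flux_const) * \<bar>s - t\<bar>"
    proof -
      have "K * (1 + ms n) * (Z + ms n) \<le> flux_const"
        unfolding flux_const_def
        using ms_le[of n] const_nonneg Y.m_nonneg by (intro mult_mono) auto
      from mult_left_mono[OF this L] show ?thesis by (intro mult_right_mono add_left_mono) auto
    qed
    finally have "\<bar>?S n s - ?S n t\<bar> \<le> (L * R * D + L * flux_const) * \<bar>s - t\<bar>" .
    moreover have "L * (e n / 2) * Z + L * (e n / 2) * Z = L * e n * Z" by simp
    ultimately show ?thesis using pair[OF st(1)] pair[OF st(2)] by linarith
  qed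
  moreover have "(\<lambda>n. L * e n * Z) \<longlonglongrightarrow> L * 0 * Z" by (intro tendsto_intros e_lim)
  ultimately show "\<exists>D d. d \<longlonglongrightarrow> 0 \<and> (\<forall>n. \<forall>s\<in>{0..T}. \<forall>t\<in>{0..T}. \<bar>?I n s - ?I n t\<bar> \<le> D * \<bar>s - t\<bar> + d n)"
    by (intro exI[of _ "L * R * D + L * flux_const"] exI[of _ "\<lambda>n. L * e n * Z"]) simp
qed (rule that)

end


section \<open>The quasi-steady state at the boundary\<close>

text \<open>
  The weights of the quasi-steady state are composed with the monomer concentration and then integrated
  by parts in time, which needs bounds on their derivatives.  The following rules
  provide these bounds without computing the derivatives.
\<close>
definition C1_bounded :: "real set \<Rightarrow> (real \<Rightarrow> real) \<Rightarrow> bool" where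
  "C1_bounded S g \<longleftrightarrow> (\<exists>g' C. \<forall>y\<in>S. (g has_real_derivative g' y) (at y) \<and> \<bar>g y\<bar> \<le> C \<and> \<bar>g' y\<bar> \<le> C)"

lemma C1_boundedI:
  assumes "\<And>y. y \<in> S \<Longrightarrow> (g has_real_derivative g' y) (at y)"
    "\<And>y. y \<in> S \<Longrightarrow> \<bar>g y\<bar> \<le> C" "\<And>y. y \<in> S \<Longrightarrow> \<bar>g' y\<bar> \<le> D"
  shows "C1_bounded S g"
proof -
  have "(g has_real_derivative g' y) (at y) \<and> \<bar>g y\<bar> \<le> max C D \<and> \<bar>g' y\<bar> \<le> max C D" if "y \<in> S" for y
    using assms[OF that] by (simp add: le_max_iff_disj)
  then show ?thesis unfolding C1_bounded_def by blast
qed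

lemma C1_boundedE:
  assumes "C1_bounded S g"
  obtains g' C where "0 \<le> C" "\<And>y. y \<in> S \<Longrightarrow> (g has_real_derivative g' y) (at y)"
    "\<And>y. y \<in> S \<Longrightarrow> \<bar>g y\<bar> \<le> C" "\<And>y. y \<in> S \<Longrightarrow> \<bar>g' y\<bar> \<le> C"
proof -
  obtain g' C where *: "\<forall>y\<in>S. (g has_real_derivative g' y) (at y) \<and> \<bar>g y\<bar> \<le> C \<and> \<bar>g' y\<bar> \<le> C"
    using assms unfolding C1_bounded_def by blast
  show ?thesis
  proof (rule that[of "max 0 C" g'])
    show "(g has_real_derivative g' y) (at y)" "\<bar>g y\<bar> \<le> max 0 C" "\<bar>g' y\<bar> \<le> max 0 C" if "y \<in> S" for y
      using *[rule_format, OF that] by linarith+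
  qed simp
qed

lemma C1_bounded_const: "C1_bounded S (\<lambda>_. k)"
  by (rule C1_boundedI[where g'="\<lambda>_. 0" and C="\<bar>k\<bar>" and D=0]) auto

lemma C1_bounded_mult:
  assumes "C1_bounded S g" "C1_bounded S h" shows "C1_bounded S (\<lambda>y. g y * h y)"
proof -
  obtain g' C where g: "0 \<le> C" "\<And>y. y \<in> S \<Longrightarrow> (g has_real_derivative g' y) (at y)"
    "\<And>y. y \<in> S \<Longrightarrow> \<bar>g y\<bar> \<le> C" "\<And>y. y \<in> S \<Longrightarrow> \<bar>g' y\<bar> \<le> C" by (rule C1_boundedE[OF assms(1)]) blast
  obtain h' D where h: "0 \<le> D" "\<And>y. y \<in> S \<Longrightarrow> (h has_real_derivative h' y) (at y)"
    "\<And>y. y \<in> S \<Longrightarrow> \<bar>h y\<bar> \<le> D" "\<And>y. y \<in> S \<Longrightarrow> \<bar>h' y\<bar> \<le> D" by (rule C1_boundedE[OF assms(2)]) blast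
  show ?thesis
  proof (rule C1_boundedI)
    fix y assume y: "y \<in> S"
    show "((\<lambda>y. g y * h y) has_real_derivative (g' y * h y + g y * h' y)) (at y)"
      by (auto intro!: derivative_eq_intros g(2) h(2) y)
    show "\<bar>g y * h y\<bar> \<le> C * D" unfolding abs_mult using g h y by (intro mult_mono) auto
    have "\<bar>g' y * h y\<bar> \<le> C * D" "\<bar>g y * h' y\<bar> \<le> C * D"
      unfolding abs_mult using g h y by (auto intro!: mult_mono)
    then show "\<bar>g' y * h y + g y * h' y\<bar> \<le> 2 * (C * D)" by linarith
  qed
qed

lemma C1_bounded_diff:
  assumes "C1_bounded S g" "C1_bounded S h" shows "C1_bounded S (\<lambda>y. g y - h y)"
proof -
  obtain g' C where g: "0 \<le> C" "\<And>y. y \<in> S \<Longrightarrow> (g has_real_derivative g' y) (at y)"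
    "\<And>y. y \<in> S \<Longrightarrow> \<bar>g y\<bar> \<le> C" "\<And>y. y \<in> S \<Longrightarrow> \<bar>g' y\<bar> \<le> C" by (rule C1_boundedE[OF assms(1)]) blast
  obtain h' D where h: "0 \<le> D" "\<And>y. y \<in> S \<Longrightarrow> (h has_real_derivative h' y) (at y)"
    "\<And>y. y \<in> S \<Longrightarrow> \<bar>h y\<bar> \<le> D" "\<And>y. y \<in> S \<Longrightarrow> \<bar>h' y\<bar> \<le> D" by (rule C1_boundedE[OF assms(2)]) blast
  show ?thesis
  proof (rule C1_boundedI)
    fix y assume y: "y \<in> S"
    show "((\<lambda>y. g y - h y) has_real_derivative (g' y - h' y)) (at y)"
      by (auto intro!: derivative_eq_intros g(2) h(2) y)
    show "\<bar>g y - h y\<bar> \<le> C + D" using g(3)[OF y] h(3)[OF y] by linarith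
    show "\<bar>g' y - h' y\<bar> \<le> C + D" using g(4)[OF y] h(4)[OF y] by linarith
  qed
qed

lemma C1_bounded_power: "C1_bounded S g \<Longrightarrow> C1_bounded S (\<lambda>y. g y ^ k)"
  by (induction k) (auto intro: C1_bounded_const C1_bounded_mult)

lemma C1_bounded_divide_affine:
  assumes "0 < d" "\<And>y. y \<in> S \<Longrightarrow> d \<le> p + q * y"
  shows "C1_bounded S (\<lambda>y. k / (p + q * y))"
proof (rule C1_boundedI)
  fix y assume y: "y \<in> S"
  have pos: "0 < p + q * y" using assms(1) assms(2)[OF y] by linarith
  show "((\<lambda>y. k / (p + q * y)) has_real_derivative (- (k * q / (p + q * y)\<^sup>2))) (at y)"
    using pos by (auto intro!: derivative_eq_intros simp: power2_eq_square)
  show "\<bar>k / (p + q * y)\<bar> \<le> \<bar>k\<bar> / d"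
    using pos assms(1) assms(2)[OF y] by (auto intro!: frac_le)
  have "d\<^sup>2 \<le> (p + q * y)\<^sup>2" using assms(1) assms(2)[OF y] by (intro power_mono) auto
  then show "\<bar>- (k * q / (p + q * y)\<^sup>2)\<bar> \<le> \<bar>k * q\<bar> / d\<^sup>2"
    using pos assms(1) by (auto intro!: frac_le simp: abs_mult)
qed

lemma C1_bounded_continuous: "C1_bounded S g \<Longrightarrow> continuous_on S g"
proof (elim C1_boundedE, rule continuous_at_imp_continuous_on, rule ballI)
  fix g' C y assume "\<And>y. y \<in> S \<Longrightarrow> (g has_real_derivative g' y) (at y)" "y \<in> S"
  then show "isCont g y" using DERIV_isCont[of g "g' y" y] by simp
qed

text \<open>Since \<open>\<rho> * q ^ (i - 2) = u * q ^ (i - 1)\<close>, each term is a difference of consecutive values.\<close>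
lemma telescope_geometric:
  fixes G :: "nat \<Rightarrow> real"
  assumes "q * u = \<rho>" "2 \<le> I"
  shows "(\<Sum>i=2..I. q ^ (i - 2) * (u * G i - \<rho> * G (i + 1))) = u * (G 2 - q ^ (I - 1) * G (I + 1))"
  using assms(2)
proof (induction I rule: nat_induct_at_least)
  case base
  show ?case by (simp add: assms(1)[symmetric] algebra_simps)
next
  case (Suc I)
  have "(\<Sum>i=2..Suc I. q ^ (i - 2) * (u * G i - \<rho> * G (i + 1))) =
      u * (G 2 - q ^ (I - 1) * G (I + 1)) + q ^ (I - 1) * (u * G (I + 1) - (q * u) * G (I + 2))"
    using Suc by (simp add: assms(1))
  also have "\<dots> = u * (G 2 - q ^ (I - 1) * q * G (I + 2))" by (simp add: algebra_simps)
  also have "q ^ (I - 1) * q = q ^ I" using Suc.hyps by (cases I) auto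
  finally show ?case by simp
qed

context BD_sequence
begin

lemma S_J_1: "J n 1 t = \<alpha>s n * (us n t)\<^sup>2 - e n powr r * \<beta>s n * cs n 2 t"
  and S_J_ge2: "2 \<le> i \<Longrightarrow> J n i t = as n i * us n t * cs n i t - bs n (i + 1) * cs n (i + 1) t"
  and S_J_cont: "1 \<le> i \<Longrightarrow> continuous_on {0..} (J n i)"
  and us_cont: "continuous_on {0..} (us n)"
  and cs_cont: "2 \<le> i \<Longrightarrow> continuous_on {0..} (cs n i)"
proof -
  interpret S: BD_system r "e n" "\<alpha>s n" "\<beta>s n" K "ms n" "as n" "bs n" "us n" "cs n" by (rule sys)
  show "J n 1 t = \<alpha>s n * (us n t)\<^sup>2 - e n powr r * \<beta>s n * cs n 2 t" by (rule S.J_1)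
  show "2 \<le> i \<Longrightarrow> J n i t = as n i * us n t * cs n i t - bs n (i + 1) * cs n (i + 1) t" by (rule S.J_ge2)
  show "1 \<le> i \<Longrightarrow> continuous_on {0..} (J n i)" by (rule S.J_cont)
  show "continuous_on {0..} (us n)" by (rule S.u_cont)
  show "2 \<le> i \<Longrightarrow> continuous_on {0..} (cs n i)" by (rule S.c_cont)
qed

lemma us_range: "t \<in> {0..T} \<Longrightarrow> us n t \<in> {ul..M}"
  using us_ge[of t n] us_le[of t n] by auto

definition cc :: real where "cc = abar * 2 powr r"

text \<open>
  With \<open>\<theta> = cc * (y - \<rho>) / \<beta>\<close>, the ratio of net growth to dissolution of the smallest clusters,
  \<open>H y = 1 / (1 + \<theta>)\<close> is the fraction of them that dissolves; the nucleation rate is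
  \<open>\<alpha> * y\<^sup>2 * (1 - H y)\<close>.  Numerator and denominator are multiplied by \<open>\<beta>\<close>, and the denominator
  is written as an affine function of \<open>y\<close>.
\<close>
definition H :: "real \<Rightarrow> real" where "H y = \<beta> / ((\<beta> - cc * \<rho>) + cc * y)"

text \<open>
  The increments \<open>g I (i + 1) - g I i\<close> are proportional to \<open>(\<rho> / y) ^ (i - 2)\<close>, so that the leading parts
  of the fluxes telescope, and \<open>g I (I + 1) = 0\<close>, so that no flux remains at the end.  The
  form \<open>0 + 1 * y\<close> of the denominator matches the rule for affine denominators.
\<close>
definition g :: "nat \<Rightarrow> nat \<Rightarrow> real \<Rightarrow> real" where
  "g I i y = H y * ((\<rho> / (0 + 1 * y)) ^ (I - 1) - (\<rho> / (0 + 1 * y)) ^ (i - 2))"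

lemma cc_pos: "0 < cc" using pos by (simp add: cc_def)

lemma H_denom: "ul \<le> y \<Longrightarrow> \<beta> + cc * (ul - \<rho>) \<le> (\<beta> - cc * \<rho>) + cc * y"
  using cc_pos by (simp add: algebra_simps)

lemma H_denom_pos: "0 < \<beta> + cc * (ul - \<rho>)"
  using cc_pos pos ul by (intro add_pos_pos mult_pos_pos) auto

lemma H_bounds:
  assumes "ul \<le> y"
  shows "0 < H y" "H y \<le> 1" "0 \<le> H y * (y - \<rho>) * cc / \<beta>" "H y * (y - \<rho>) * cc / \<beta> \<le> 1"
    "H y + H y * (y - \<rho>) * cc / \<beta> = 1"
    "N y = \<alpha> * y\<^sup>2 * (H y * (y - \<rho>) * cc / \<beta>)"
proof -
  define d where "d = (\<beta> - cc * \<rho>) + cc * y"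
  have d: "0 < d" using H_denom[OF assms] H_denom_pos by (simp add: d_def)
  have dy: "d = \<beta> + cc * (y - \<rho>)" by (simp add: d_def algebra_simps)
  have y: "0 < y - \<rho>" using assms ul by simp
  have Hd: "H y = \<beta> / d" by (simp add: H_def d_def)
  show H0: "0 < H y" using pos d by (simp add: Hd)
  have c0: "0 \<le> cc * (y - \<rho>)" using cc_pos y by simp
  then show "H y \<le> 1" using pos d by (simp add: Hd dy)
  have B: "H y * (y - \<rho>) * cc / \<beta> = cc * (y - \<rho>) / d" using pos by (simp add: Hd)
  show "0 \<le> H y * (y - \<rho>) * cc / \<beta>" using c0 d by (simp add: B)
  show "H y * (y - \<rho>) * cc / \<beta> \<le> 1" using pos d by (simp add: B dy)
  show "H y + H y * (y - \<rho>) * cc / \<beta> = 1"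
    unfolding B using d by (simp add: Hd dy add_divide_distrib[symmetric])
  have "N y = \<alpha> * y\<^sup>2 * (cc * (y - \<rho>) / (\<beta> + cc * (y - \<rho>)))"
    using N_eq[of y] y by (simp add: cc_def)
  then show "N y = \<alpha> * y\<^sup>2 * (H y * (y - \<rho>) * cc / \<beta>)" unfolding B dy .
qed

lemma g_C1: "C1_bounded {ul..M} (g I i)"
proof -
  have "C1_bounded {ul..M} H"
    unfolding H_def by (rule C1_bounded_divide_affine[OF H_denom_pos]) (use H_denom in auto)
  moreover have "C1_bounded {ul..M} (\<lambda>y. \<rho> / (0 + 1 * y))"
    by (rule C1_bounded_divide_affine[OF ul(3)]) auto
  ultimately show ?thesis
    unfolding g_def by (intro C1_bounded_mult C1_bounded_diff C1_bounded_power)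
qed

lemma N_continuous: "continuous_on {ul..M} N"
proof -
  have "continuous_on {ul..M} H"
    unfolding H_def
    by (rule C1_bounded_continuous[OF C1_bounded_divide_affine[OF H_denom_pos]]) (use H_denom in auto)
  then have "continuous_on {ul..M} (\<lambda>y. \<alpha> * y\<^sup>2 * (H y * (y - \<rho>) * cc / \<beta>))"
    using pos by (intro continuous_intros) auto
  then show ?thesis by (rule continuous_on_eq) (simp add: H_bounds(6))
qed

text \<open>
  By \<open>small_concentrations\<close>, \<open>e * c i\<close> is of order \<open>e powr (1 - r)\<close> for a fixed size \<open>i\<close>; here \<open>r < 1\<close>
  enters.
\<close>
lemma weighted_balance_vanishes:
  assumes S: "0 \<le> S" "S \<le> T" and i: "2 \<le> i" and g: "C1_bounded {ul..M} h"
    and psi: "\<And>t. 0 \<le> t \<Longrightarrow> t \<le> S \<Longrightarrow> (\<psi> has_real_derivative \<psi>' t) (at t within {0..S})"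
    and bd: "\<And>t. 0 \<le> t \<Longrightarrow> t \<le> S \<Longrightarrow> \<bar>\<psi> t\<bar> \<le> C" "\<And>t. 0 \<le> t \<Longrightarrow> t \<le> S \<Longrightarrow> \<bar>\<psi>' t\<bar> \<le> C"
  shows "(\<lambda>n. integral {0..S} (\<lambda>t. \<psi> t * h (us n t) * (J n (i - 1) t - J n i t))) \<longlonglongrightarrow> 0"
proof -
  obtain h' B where h: "0 \<le> B" "\<And>y. y \<in> {ul..M} \<Longrightarrow> (h has_real_derivative h' y) (at y)"
    "\<And>y. y \<in> {ul..M} \<Longrightarrow> \<bar>h y\<bar> \<le> B" "\<And>y. y \<in> {ul..M} \<Longrightarrow> \<bar>h' y\<bar> \<le> B"
    by (rule C1_boundedE[OF g]) blast
  obtain z D where D: "0 \<le> D"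
    "\<And>n i t. 2 \<le> i \<Longrightarrow> t \<in> {0..T} \<Longrightarrow> e n powr r * cs n i t \<le> D * exp (real i * z)"
    by (rule small_concentrations) blast
  have C: "0 \<le> C" using bd(1)[of 0] S by simp
  define C2 where "C2 = C * B * (1 + speed)"
  define D2 where "D2 = D * exp (real i * z)"
  have bound: "\<bar>integral {0..S} (\<lambda>t. \<psi> t * h (us n t) * (J n (i - 1) t - J n i t))\<bar> \<le>
     C2 * (e n powr (1 - r) * D2) * (2 + S)" for n
  proof -
    interpret Y: BD_system r "e n" "\<alpha>s n" "\<beta>s n" K "ms n" "as n" "bs n" "us n" "cs n" by (rule sys)
    have "\<forall>t\<in>{0..1}. \<exists>D. (us n has_real_derivative D) (at t within {0..}) \<and> \<bar>D\<bar> \<le> speed"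
    proof
      fix t :: real assume t: "t \<in> {0..1}"
      obtain D where "(us n has_real_derivative D) (at t within {0..})" "\<bar>D\<bar> \<le> speed"
        by (rule us_deriv[OF t])
      then show "\<exists>D. (us n has_real_derivative D) (at t within {0..}) \<and> \<bar>D\<bar> \<le> speed" by blast
    qed
    from bchoice[OF this] obtain u' where u': "\<And>t. t \<in> {0..1} \<Longrightarrow> (us n has_real_derivative u' t) (at t within {0..})"
      "\<And>t. t \<in> {0..1} \<Longrightarrow> \<bar>u' t\<bar> \<le> speed" by blast
    show ?thesis
    proof (rule Y.flux_balance[OF S(1) i])
      fix t assume t: "0 \<le> t" "t \<le> S"
      then have t1: "t \<in> {0..1}" and tT: "t \<in> {0..T}" using S T by auto
      have y: "us n t \<in> {ul..M}" by (rule us_range[OF tT])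
      have u_der: "(us n has_real_derivative u' t) (at t within {0..S})"
        by (rule has_field_derivative_subset[OF u'(1)[OF t1]]) auto
      show "((\<lambda>t. \<psi> t * h (us n t)) has_real_derivative
         (\<psi>' t * h (us n t) + \<psi> t * (h' (us n t) * u' t))) (at t within {0..S})"
        using DERIV_mult'[OF psi[OF t] DERIV_chain2[OF h(2)[OF y] u_der]] by (simp add: algebra_simps)
      have 1: "\<bar>\<psi> t * h (us n t)\<bar> \<le> C * B" "\<bar>\<psi>' t * h (us n t)\<bar> \<le> C * B"
        unfolding abs_mult using bd t h(3)[OF y] C by (auto intro!: mult_mono)
      have "\<bar>\<psi> t * (h' (us n t) * u' t)\<bar> \<le> C * (B * speed)"
        unfolding abs_mult using bd t h y C u'(2)[OF t1] by (intro mult_mono) auto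
      moreover have C2_eq: "C2 = C * B + C * (B * speed)" by (simp add: C2_def distrib_left)
      ultimately show "\<bar>\<psi>' t * h (us n t) + \<psi> t * (h' (us n t) * u' t)\<bar> \<le> C2"
        using 1(2) by linarith
      have "0 \<le> C * (B * speed)" using C h(1) const_nonneg by simp
      then show "\<bar>\<psi> t * h (us n t)\<bar> \<le> C2" using 1(1) C2_eq by linarith
      have "e n * cs n i t = e n powr (1 - r) * (e n powr r * cs n i t)"
        using e_pos[of n] by (simp add: powr_diff)
      also have "\<dots> \<le> e n powr (1 - r) * D2"
        using D(2)[OF i tT, of n] by (intro mult_left_mono) (auto simp: D2_def)
      finally show "e n * cs n i t \<le> e n powr (1 - r) * D2" .
    qed
  qed
  have "(\<lambda>n. e n powr (1 - r)) \<longlonglongrightarrow> 0"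
    by (rule tendsto_zero_powrI[OF e_lim tendsto_const]) (use e_pos r_less in \<open>auto simp: less_imp_le\<close>)
  then have "(\<lambda>n. C2 * (e n powr (1 - r) * D2) * (2 + S)) \<longlonglongrightarrow> C2 * (0 * D2) * (2 + S)"
    by (intro tendsto_intros)
  then have lim: "(\<lambda>n. C2 * (e n powr (1 - r) * D2) * (2 + S)) \<longlonglongrightarrow> 0" by simp
  show ?thesis
    by (rule Lim_null_comparison[OF always_eventually lim]) (use bound in simp)
qed

text \<open>
  The algebra of the quasi-steady state.  Summed against the weights \<open>g I i\<close>, the flux differences
  are \<open>N - J 1\<close> up to the flux through the size \<open>I\<close>, which is damped geometrically, and the
  deviation of the rates from pure powers, which vanishes for a fixed number of sizes.
\<close>
lemma qss_identity:
  fixes n :: nat and t :: real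
  assumes I: "2 \<le> I" and u: "ul \<le> us n t"
  defines "u \<equiv> us n t" and "q \<equiv> \<rho> / us n t"
    and "G \<equiv> \<lambda>i. abar * (e n * real i) powr r * cs n i t"
  defines "err \<equiv> \<lambda>i. J n i t - (u * G i - \<rho> * G (i + 1))"
  shows "J n 1 t - N u + (\<Sum>i=2..I. g I i u * (J n (i - 1) t - J n i t)) =
    H u * q ^ (I - 1) * J n 1 t - H u * (u - \<rho>) * (q ^ (I - 1) * G (I + 1))
    + H u * (1 - q) * (\<Sum>i=2..I. q ^ (i - 2) * err i)
    + (H u * (u - \<rho>) * cc / \<beta>) * ((\<alpha>s n - \<alpha>) * u\<^sup>2 + (\<beta> - \<beta>s n) * (e n powr r * cs n 2 t))"
proof -
  have u0: "0 < u" using u ul by (simp add: u_def)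
  have qu: "q * u = \<rho>" using u0 by (simp add: q_def u_def)
  have g_eq: "g I i u = H u * (q ^ (I - 1) - q ^ (i - 2))" for i by (simp add: g_def q_def u_def)
  define d where "d = e n powr r * cs n 2 t"
  define P where "P = H u * (u - \<rho>) * cc / \<beta>"
  have HP: "H u = 1 - P" "N u = \<alpha> * u\<^sup>2 * P"
    using H_bounds(5,6)[of u] u by (auto simp: P_def u_def)
  have "(\<Sum>i=2..I. g I i u * (J n (i - 1) t - J n i t)) =
     g I 2 u * J n 1 t + (\<Sum>i=2..I. (g I (i + 1) u - g I i u) * J n i t) - g I (I + 1) u * J n I t"
    by (rule summation_by_parts) (use I in simp)
  also have "g I (I + 1) u = 0" by (simp add: g_eq)
  also have "g I 2 u = H u * (q ^ (I - 1) - 1)" by (simp add: g_eq)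
  also have "(\<Sum>i=2..I. (g I (i + 1) u - g I i u) * J n i t) =
     (\<Sum>i=2..I. H u * (1 - q) * (q ^ (i - 2) * (u * G i - \<rho> * G (i + 1))) + H u * (1 - q) * (q ^ (i - 2) * err i))"
  proof (rule sum.cong[OF refl])
    fix i assume "i \<in> {2..I}"
    then have "i + 1 - 2 = Suc (i - 2)" unfolding atLeastAtMost_iff by arith
    then have diff: "g I (i + 1) u - g I i u = H u * (1 - q) * q ^ (i - 2)"
      unfolding g_eq by (simp add: algebra_simps)
    have split: "J n i t = (u * G i - \<rho> * G (i + 1)) + err i" by (simp add: err_def)
    show "(g I (i + 1) u - g I i u) * J n i t =
      H u * (1 - q) * (q ^ (i - 2) * (u * G i - \<rho> * G (i + 1))) + H u * (1 - q) * (q ^ (i - 2) * err i)"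
      unfolding diff split by (simp only: distrib_left mult.assoc)
  qed
  also have "\<dots> = H u * (1 - q) * (\<Sum>i=2..I. q ^ (i - 2) * (u * G i - \<rho> * G (i + 1)))
     + H u * (1 - q) * (\<Sum>i=2..I. q ^ (i - 2) * err i)"
    by (simp only: sum.distrib sum_distrib_left)
  also have "(\<Sum>i=2..I. q ^ (i - 2) * (u * G i - \<rho> * G (i + 1))) = u * (G 2 - q ^ (I - 1) * G (I + 1))"
    by (rule telescope_geometric[OF qu I])
  also have "H u * (1 - q) * (u * (G 2 - q ^ (I - 1) * G (I + 1))) =
      H u * (u - \<rho>) * G 2 - H u * (u - \<rho>) * (q ^ (I - 1) * G (I + 1))"
    unfolding qu[symmetric] by (simp add: algebra_simps)
  also have "G 2 = cc * d"
    using e_pos[of n] by (simp add: G_def cc_def d_def powr_mult mult_ac)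
  also have "H u * (u - \<rho>) * (cc * d) = P * (\<beta> * d)" using pos by (simp add: P_def)
  finally have sum_eq: "(\<Sum>i=2..I. g I i u * (J n (i - 1) t - J n i t)) =
     H u * (q ^ (I - 1) - 1) * J n 1 t + (P * (\<beta> * d) - H u * (u - \<rho>) * (q ^ (I - 1) * G (I + 1))
       + H u * (1 - q) * (\<Sum>i=2..I. q ^ (i - 2) * err i)) - 0 * J n I t" .
  have J1: "\<beta> * d = \<alpha>s n * u\<^sup>2 - J n 1 t + (\<beta> - \<beta>s n) * d"
    unfolding S_J_1 u_def[symmetric] by (simp add: d_def algebra_simps)
  have "J n 1 t - N u + H u * (q ^ (I - 1) - 1) * J n 1 t + P * (\<beta> * d) =
     H u * q ^ (I - 1) * J n 1 t + P * ((\<alpha>s n - \<alpha>) * u\<^sup>2 + (\<beta> - \<beta>s n) * d)"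
    unfolding J1 HP by (simp add: algebra_simps)
  then show ?thesis unfolding sum_eq P_def[symmetric] d_def[symmetric] by simp
qed

text \<open>\<open>\<kappa>\<close> is the relative error of the rates in the power laws that hold near \<open>0\<close>.\<close>
lemma rate_error:
  assumes \<kappa>: "0 < \<kappa>"
  shows "\<exists>x0>0. \<forall>n i t. 2 \<le> i \<longrightarrow> t \<in> {0..T} \<longrightarrow> e n * real (i + 1) < x0 \<longrightarrow>
    \<bar>J n i t - (us n t * (abar * (e n * real i) powr r * cs n i t)
        - \<rho> * (abar * (e n * real (i + 1)) powr r * cs n (i + 1) t))\<bar>
    \<le> \<kappa> * (M * ((e n * real i) powr r * cs n i t) + (e n * real (i + 1)) powr r * cs n (i + 1) t)"
proof -
  obtain x0 where x0: "0 < x0" and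
    ra: "\<And>n i. e n * real i < x0 \<Longrightarrow> 2 \<le> i \<Longrightarrow> \<bar>as n i - abar * (e n * real i) powr r\<bar> \<le> \<kappa> * (e n * real i) powr r" and
    rb: "\<And>n i. e n * real i < x0 \<Longrightarrow> 3 \<le> i \<Longrightarrow> \<bar>bs n i - abar * \<rho> * (e n * real i) powr r\<bar> \<le> \<kappa> * (e n * real i) powr r"
    using rates[OF \<kappa>] by blast
  have "\<bar>J n i t - (us n t * (abar * (e n * real i) powr r * cs n i t)
        - \<rho> * (abar * (e n * real (i + 1)) powr r * cs n (i + 1) t))\<bar>
    \<le> \<kappa> * (M * ((e n * real i) powr r * cs n i t) + (e n * real (i + 1)) powr r * cs n (i + 1) t)"
    if i: "2 \<le> i" and t: "t \<in> {0..T}" and x: "e n * real (i + 1) < x0" for n i t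
  proof -
    let ?x = "(e n * real i) powr r" and ?y = "(e n * real (i + 1)) powr r"
    have c: "0 \<le> cs n i t" "0 \<le> cs n (i + 1) t" using cs_nonneg i t by auto
    have u: "0 \<le> us n t" "us n t \<le> M" using us_nonneg us_le t by auto
    have "e n * real i < x0" using x e_pos[of n] by (simp add: distrib_left)
    then have A: "\<bar>as n i - abar * ?x\<bar> \<le> \<kappa> * ?x" using i by (rule ra)
    have B: "\<bar>bs n (i + 1) - abar * \<rho> * ?y\<bar> \<le> \<kappa> * ?y" using rb[OF x] i by simp
    have "\<bar>(as n i - abar * ?x) * (us n t * cs n i t)\<bar> \<le> (\<kappa> * ?x) * (M * cs n i t)"
      using A u c \<kappa> unfolding abs_mult by (intro mult_mono) (auto intro: mult_right_mono)
    moreover have "\<bar>(bs n (i + 1) - abar * \<rho> * ?y) * cs n (i + 1) t\<bar> \<le> (\<kappa> * ?y) * cs n (i + 1) t"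
      using B c unfolding abs_mult by (intro mult_mono) auto
    moreover have "J n i t - (us n t * (abar * ?x * cs n i t) - \<rho> * (abar * ?y * cs n (i + 1) t)) =
      (as n i - abar * ?x) * (us n t * cs n i t) - (bs n (i + 1) - abar * \<rho> * ?y) * cs n (i + 1) t"
      unfolding S_J_ge2[OF i] by (simp add: algebra_simps)
    ultimately have "\<bar>J n i t - (us n t * (abar * ?x * cs n i t) - \<rho> * (abar * ?y * cs n (i + 1) t))\<bar>
       \<le> (\<kappa> * ?x) * (M * cs n i t) + (\<kappa> * ?y) * cs n (i + 1) t" by linarith
    then show ?thesis by (simp add: algebra_simps)
  qed
  then show ?thesis using x0 by blast
qed

text \<open>
  For a fixed number \<open>I\<close> of sizes, all error terms of \<open>qss_identity\<close> vanish with \<open>e n\<close> except those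
  with the factor \<open>q ^ (I - 1)\<close>.
\<close>
lemma qss_pointwise:
  assumes D: "0 \<le> D" "\<And>n i t. 2 \<le> i \<Longrightarrow> t \<in> {0..T} \<Longrightarrow> e n powr r * cs n i t \<le> D * exp (real i * z)"
    and D1: "0 \<le> D1" "\<And>n t. t \<in> {0..T} \<Longrightarrow> \<bar>J n 1 t\<bar> \<le> D1"
    and I: "2 \<le> I" and \<epsilon>: "0 < \<epsilon>"
  shows "\<forall>\<^sub>F n in sequentially. \<forall>t\<in>{0..T}.
    \<bar>J n 1 t - N (us n t) + (\<Sum>i=2..I. g I i (us n t) * (J n (i - 1) t - J n i t))\<bar>
    \<le> (\<rho> / ul) ^ (I - 1) * (D1 + M * (abar * (real (I + 1) * (D * exp (real (I + 1) * z))))) + \<epsilon>"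
proof -
  define W where "W i = real i * (D * exp (real i * z))" for i :: nat
  have W: "0 \<le> W i" for i using D(1) by (simp add: W_def)
  have size: "(e n * real i) powr r * cs n i t \<le> W i" "0 \<le> (e n * real i) powr r * cs n i t"
    if "2 \<le> i" "t \<in> {0..T}" for n i t
  proof -
    have "real i powr r \<le> real i powr 1" using that r_less by (intro powr_mono) auto
    then have "real i powr r * (e n powr r * cs n i t) \<le> real i * (D * exp (real i * z))"
      using cs_nonneg[of i t n] that by (intro mult_mono D(2)[OF that]) auto
    then show "(e n * real i) powr r * cs n i t \<le> W i"
      using e_pos[of n] by (simp add: W_def powr_mult mult_ac)
    show "0 \<le> (e n * real i) powr r * cs n i t" using cs_nonneg[of i t n] that by simp
  qed
  define V where "V = (\<Sum>i=2..I. M * W i + W (i + 1)) + 1"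
  have V: "0 < V" using W const_nonneg by (auto simp: V_def intro!: add_nonneg_pos sum_nonneg)
  define \<kappa> where "\<kappa> = \<epsilon> / (2 * V)"
  have \<kappa>: "0 < \<kappa>" using \<epsilon> V by (simp add: \<kappa>_def)
  define F where "F n i t = J n i t - (us n t * (abar * (e n * real i) powr r * cs n i t)
        - \<rho> * (abar * (e n * real (i + 1)) powr r * cs n (i + 1) t))" for n i t
  obtain x0 where x0: "0 < x0" and err: "\<And>n i t. 2 \<le> i \<Longrightarrow> t \<in> {0..T} \<Longrightarrow> e n * real (i + 1) < x0 \<Longrightarrow>
    \<bar>F n i t\<bar> \<le> \<kappa> * (M * ((e n * real i) powr r * cs n i t) + (e n * real (i + 1)) powr r * cs n (i + 1) t)"
    using rate_error[OF \<kappa>] unfolding F_def by blast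
  have ev1: "\<forall>\<^sub>F n in sequentially. e n * real (I + 1) < x0"
  proof -
    have "(\<lambda>n. e n * real (I + 1)) \<longlonglongrightarrow> 0 * real (I + 1)" by (intro tendsto_intros e_lim)
    then show ?thesis using x0 by (intro order_tendstoD(2)) auto
  qed
  have ev2: "\<forall>\<^sub>F n in sequentially. \<bar>\<alpha>s n - \<alpha>\<bar> * M\<^sup>2 + \<bar>\<beta> - \<beta>s n\<bar> * W 2 < \<epsilon> / 2"
  proof -
    have "(\<lambda>n. \<bar>\<alpha>s n - \<alpha>\<bar> * M\<^sup>2 + \<bar>\<beta> - \<beta>s n\<bar> * W 2) \<longlonglongrightarrow> \<bar>\<alpha> - \<alpha>\<bar> * M\<^sup>2 + \<bar>\<beta> - \<beta>\<bar> * W 2"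
      by (intro tendsto_intros \<alpha>s_lim \<beta>s_lim)
    then show ?thesis using \<epsilon> by (intro order_tendstoD(2)) auto
  qed
  show ?thesis
    using ev1 ev2
  proof eventually_elim
    case (elim n)
    show ?case
    proof
      fix t assume t: "t \<in> {0..T}"
      define u where "u = us n t"
      define q where "q = \<rho> / u"
      let ?G = "\<lambda>i. abar * (e n * real i) powr r * cs n i t"
      have u: "ul \<le> u" "u \<le> M" using us_range[OF t, of n] by (auto simp: u_def)
      have u0: "0 < u" using u ul by linarith
      have q: "0 \<le> q" "q \<le> \<rho> / ul" "q \<le> 1"
        using u ul pos u0 by (auto simp: q_def intro!: divide_left_mono)
      note Hb = H_bounds[OF u(1)]
      have eq: "J n 1 t - N u + (\<Sum>i=2..I. g I i u * (J n (i - 1) t - J n i t)) =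
        H u * q ^ (I - 1) * J n 1 t - H u * (u - \<rho>) * (q ^ (I - 1) * ?G (I + 1))
        + H u * (1 - q) * (\<Sum>i=2..I. q ^ (i - 2) * F n i t)
        + (H u * (u - \<rho>) * cc / \<beta>) * ((\<alpha>s n - \<alpha>) * u\<^sup>2 + (\<beta> - \<beta>s n) * (e n powr r * cs n 2 t))"
        unfolding u_def q_def F_def by (rule qss_identity[OF I]) (use u u_def in simp)
      have b1: "\<bar>H u * q ^ (I - 1) * J n 1 t\<bar> \<le> (\<rho> / ul) ^ (I - 1) * D1"
      proof -
        have "\<bar>H u\<bar> * q ^ (I - 1) \<le> 1 * (\<rho> / ul) ^ (I - 1)"
          using Hb q by (intro mult_mono power_mono) auto
        then show ?thesis
          unfolding abs_mult using q D1(2)[OF t, of n] pos ul by (intro mult_mono) auto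
      qed
      have b2: "\<bar>H u * (u - \<rho>) * (q ^ (I - 1) * ?G (I + 1))\<bar> \<le> (\<rho> / ul) ^ (I - 1) * (M * (abar * W (I + 1)))"
      proof -
        have 1: "\<bar>H u * (u - \<rho>)\<bar> \<le> 1 * M"
          unfolding abs_mult using Hb u ul pos by (intro mult_mono) auto
        have 2: "\<bar>?G (I + 1)\<bar> \<le> abar * W (I + 1)"
          using size[of "I+1" t n] I t pos by (simp add: abs_mult mult.assoc mult_left_mono)
        have 3: "\<bar>q ^ (I - 1) * ?G (I + 1)\<bar> \<le> (\<rho> / ul) ^ (I - 1) * (abar * W (I + 1))"
          unfolding abs_mult[of "q ^ (I - 1)"] using q 2 pos ul by (intro mult_mono) (auto intro!: power_mono)
        have "\<bar>H u * (u - \<rho>) * (q ^ (I - 1) * ?G (I + 1))\<bar> \<le> (1 * M) * ((\<rho> / ul) ^ (I - 1) * (abar * W (I + 1)))"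
          unfolding abs_mult[of "H u * (u - \<rho>)"] using 1 3 const_nonneg by (intro mult_mono) auto
        then show ?thesis by (simp add: mult_ac)
      qed
      have b3: "\<bar>H u * (1 - q) * (\<Sum>i=2..I. q ^ (i - 2) * F n i t)\<bar> \<le> \<epsilon> / 2"
      proof -
        have "\<bar>\<Sum>i=2..I. q ^ (i - 2) * F n i t\<bar> \<le> (\<Sum>i=2..I. \<kappa> * (M * W i + W (i + 1)))"
        proof (rule order.trans[OF sum_abs sum_mono])
          fix i assume i: "i \<in> {2..I}"
          have "e n * real (i + 1) \<le> e n * real (I + 1)" using i e_pos[of n] by (intro mult_left_mono) auto
          then have "\<bar>F n i t\<bar> \<le> \<kappa> * (M * ((e n * real i) powr r * cs n i t) + (e n * real (i + 1)) powr r * cs n (i + 1) t)"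
            using i t elim(1) by (intro err) auto
          also have "\<dots> \<le> \<kappa> * (M * W i + W (i + 1))"
            using size[of i t n] size[of "i+1" t n] i t \<kappa> const_nonneg
            by (intro mult_left_mono add_mono) auto
          finally have F: "\<bar>F n i t\<bar> \<le> \<kappa> * (M * W i + W (i + 1))" .
          have "\<bar>q ^ (i - 2)\<bar> * \<bar>F n i t\<bar> \<le> 1 * (\<kappa> * (M * W i + W (i + 1)))"
            using q F by (intro mult_mono) (auto simp: power_le_one)
          then show "\<bar>q ^ (i - 2) * F n i t\<bar> \<le> \<kappa> * (M * W i + W (i + 1))" by (simp add: abs_mult)
        qed
        also have "\<dots> \<le> \<kappa> * V" using \<kappa> by (simp add: V_def sum_distrib_left[symmetric])
        also have "\<dots> = \<epsilon> / 2" using V by (simp add: \<kappa>_def)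
        finally have *: "\<bar>\<Sum>i=2..I. q ^ (i - 2) * F n i t\<bar> \<le> \<epsilon> / 2" .
        have "\<bar>H u * (1 - q)\<bar> \<le> 1 * 1" unfolding abs_mult using Hb q by (intro mult_mono) auto
        then have "\<bar>H u * (1 - q)\<bar> * \<bar>\<Sum>i=2..I. q ^ (i - 2) * F n i t\<bar> \<le> 1 * (\<epsilon> / 2)"
          using * by (intro mult_mono) auto
        then show ?thesis by (simp add: abs_mult)
      qed
      have b4: "\<bar>(H u * (u - \<rho>) * cc / \<beta>) * ((\<alpha>s n - \<alpha>) * u\<^sup>2 + (\<beta> - \<beta>s n) * (e n powr r * cs n 2 t))\<bar> \<le> \<epsilon> / 2"
      proof -
        have "e n powr r * cs n 2 t \<le> W 2"
        proof -
          have "e n powr r * cs n 2 t \<le> D * exp (2 * z)" using D(2)[of 2 t n] t by simp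
          also have "\<dots> \<le> W 2" using D(1) by (simp add: W_def)
          finally show ?thesis .
        qed
        moreover have "0 \<le> e n powr r * cs n 2 t" using cs_nonneg[of 2 t n] t by simp
        ultimately have "\<bar>(\<beta> - \<beta>s n) * (e n powr r * cs n 2 t)\<bar> \<le> \<bar>\<beta> - \<beta>s n\<bar> * W 2"
          unfolding abs_mult by (intro mult_left_mono) auto
        moreover have "\<bar>(\<alpha>s n - \<alpha>) * u\<^sup>2\<bar> \<le> \<bar>\<alpha>s n - \<alpha>\<bar> * M\<^sup>2"
          unfolding abs_mult using u u0 by (intro mult_left_mono) (auto intro: power_mono)
        ultimately have "\<bar>(\<alpha>s n - \<alpha>) * u\<^sup>2 + (\<beta> - \<beta>s n) * (e n powr r * cs n 2 t)\<bar> \<le> \<epsilon> / 2"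
          using elim(2) by linarith
        moreover have "\<bar>H u * (u - \<rho>) * cc / \<beta>\<bar> \<le> 1" using Hb by simp
        ultimately have "\<bar>H u * (u - \<rho>) * cc / \<beta>\<bar> * \<bar>(\<alpha>s n - \<alpha>) * u\<^sup>2 + (\<beta> - \<beta>s n) * (e n powr r * cs n 2 t)\<bar> \<le> 1 * (\<epsilon> / 2)"
          by (intro mult_mono) auto
        then show ?thesis by (simp only: abs_mult[symmetric] mult_1)
      qed
      have "\<bar>x - y + v + w\<bar> \<le> A + B + \<epsilon>"
        if "\<bar>x\<bar> \<le> A" "\<bar>y\<bar> \<le> B" "\<bar>v\<bar> \<le> \<epsilon> / 2" "\<bar>w\<bar> \<le> \<epsilon> / 2" for x y v w A B :: real
        using that by linarith
      from this[OF b1 b2 b3 b4] have "\<bar>J n 1 t - N u + (\<Sum>i=2..I. g I i u * (J n (i - 1) t - J n i t))\<bar> \<le>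
        (\<rho> / ul) ^ (I - 1) * D1 + (\<rho> / ul) ^ (I - 1) * (M * (abar * W (I + 1))) + \<epsilon>"
        unfolding eq .
      then show "\<bar>J n 1 t - N (us n t) + (\<Sum>i=2..I. g I i (us n t) * (J n (i - 1) t - J n i t))\<bar>
        \<le> (\<rho> / ul) ^ (I - 1) * (D1 + M * (abar * (real (I + 1) * (D * exp (real (I + 1) * z))))) + \<epsilon>"
        by (simp only: u_def[symmetric] W_def[symmetric] distrib_left)
    qed
  qed
qed

text \<open>
  First \<open>I\<close> is chosen, using \<open>\<rho> * exp z < ul\<close> to beat the exponential growth of the concentrations in
  the size by the geometric factor, and then \<open>n\<close>.  The flux differences of the finitely many sizes
  below \<open>I\<close> vanish on average.
\<close>
lemma quasi_steady_state:
  assumes S: "0 \<le> S" "S \<le> T"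
    and psi: "\<And>t. 0 \<le> t \<Longrightarrow> t \<le> S \<Longrightarrow> (\<psi> has_real_derivative \<psi>' t) (at t within {0..S})"
    and bd: "\<And>t. 0 \<le> t \<Longrightarrow> t \<le> S \<Longrightarrow> \<bar>\<psi> t\<bar> \<le> C" "\<And>t. 0 \<le> t \<Longrightarrow> t \<le> S \<Longrightarrow> \<bar>\<psi>' t\<bar> \<le> C"
  shows "(\<lambda>n. integral {0..S} (\<lambda>t. \<psi> t * (J n 1 t - N (us n t)))) \<longlonglongrightarrow> 0"
proof (rule tendstoI)
  fix \<epsilon> :: real assume \<epsilon>: "0 < \<epsilon>"
  obtain z D where z: "0 < z" "\<rho> * exp z < ul" and D: "0 \<le> D"
    "\<And>n i t. 2 \<le> i \<Longrightarrow> t \<in> {0..T} \<Longrightarrow> e n powr r * cs n i t \<le> D * exp (real i * z)"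
    by (rule small_concentrations) blast
  obtain D1 where D1: "0 \<le> D1" "\<And>n t. t \<in> {0..T} \<Longrightarrow> \<bar>J n 1 t\<bar> \<le> D1" by (rule dimer_bounds) blast
  have C: "0 \<le> C" using bd(1)[of 0] S by simp
  define k where "k = C * S + 1"
  define \<eta> where "\<eta> = \<epsilon> / (4 * k)"
  have CS: "0 < k" "C * S < k" using C S by (auto simp: k_def add_nonneg_pos)
  have \<eta>: "0 < \<eta>" using \<epsilon> CS by (simp add: \<eta>_def)
  let ?B = "\<lambda>I::nat. (\<rho> / ul) ^ (I - 1) * (D1 + M * (abar * (real (I + 1) * (D * exp (real (I + 1) * z)))))"
  have "(\<lambda>k. ?B (Suc k)) \<longlonglongrightarrow> 0"
  proof -
    let ?x = "\<rho> / ul" and ?y = "\<rho> * exp z / ul"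
    have x: "norm ?x < 1" "norm ?y < 1" using ul pos z by auto
    have "(\<lambda>k. ?x ^ k * D1 + (M * abar * D * exp (2 * z)) * (real k * ?y ^ k + 2 * ?y ^ k)) \<longlonglongrightarrow>
       0 * D1 + (M * abar * D * exp (2 * z)) * (0 + 2 * 0)"
      by (intro tendsto_intros LIMSEQ_power_zero x powser_times_n_limit_0)
    moreover have "?B (Suc k) = ?x ^ k * D1 + (M * abar * D * exp (2 * z)) * (real k * ?y ^ k + 2 * ?y ^ k)" for k
    proof -
      have "real (Suc k + 1) * z = 2 * z + real k * z" by (simp add: algebra_simps)
      then have "exp (real (Suc k + 1) * z) = exp (2 * z) * exp z ^ k"
        by (simp add: exp_add exp_of_nat_mult)
      then show ?thesis by (simp add: power_mult_distrib power_divide algebra_simps)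
    qed
    ultimately show ?thesis by simp
  qed
  then have "\<forall>\<^sub>F k in sequentially. ?B (Suc k) < \<eta>" using \<eta> by (intro order_tendstoD(2)) auto
  then obtain k0 where k0: "\<And>k. k \<ge> k0 \<Longrightarrow> ?B (Suc k) < \<eta>" by (auto simp: eventually_sequentially)
  define I where "I = Suc (max 1 k0)"
  have I: "2 \<le> I" "?B I < \<eta>" using k0[of "max 1 k0"] by (auto simp: I_def)
  let ?bal = "\<lambda>n i t. \<psi> t * g I i (us n t) * (J n (i - 1) t - J n i t)"
  have "(\<lambda>n. \<Sum>i=2..I. integral {0..S} (?bal n i)) \<longlonglongrightarrow> (\<Sum>i=2..I. 0)"
    by (intro tendsto_sum weighted_balance_vanishes[OF S _ g_C1 psi bd]) auto
  then have ev1: "\<forall>\<^sub>F n in sequentially. dist (\<Sum>i=2..I. integral {0..S} (?bal n i)) 0 < \<epsilon> / 2"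
    using \<epsilon> by (intro tendstoD) auto
  have ev2: "\<forall>\<^sub>F n in sequentially. \<forall>t\<in>{0..T}.
    \<bar>J n 1 t - N (us n t) + (\<Sum>i=2..I. g I i (us n t) * (J n (i - 1) t - J n i t))\<bar> \<le> ?B I + \<eta>"
    by (rule qss_pointwise[OF D D1 I(1) \<eta>])
  show "\<forall>\<^sub>F n in sequentially. dist (integral {0..S} (\<lambda>t. \<psi> t * (J n 1 t - N (us n t)))) 0 < \<epsilon>"
    using ev1 ev2
  proof eventually_elim
    case (elim n)
    have sub: "{0..S} \<subseteq> {0..}" "{0..S} \<subseteq> {0..T}" using S by auto
    have psi_cont: "continuous_on {0..S} \<psi>" using psi by (intro DERIV_continuous_on) auto
    have u_cont: "continuous_on {0..S} (us n)" by (rule continuous_on_subset[OF us_cont sub(1)])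
    have u_rng: "us n ` {0..S} \<subseteq> {ul..M}" using us_range sub(2) by blast
    have g_cont: "continuous_on {0..S} (\<lambda>t. g I i (us n t))" for i
      by (rule continuous_on_compose2[OF C1_bounded_continuous[OF g_C1] u_cont u_rng])
    have N_cont: "continuous_on {0..S} (\<lambda>t. N (us n t))"
      by (rule continuous_on_compose2[OF N_continuous u_cont u_rng])
    have J_cont: "continuous_on {0..S} (J n i)" if "1 \<le> i" for i
      by (rule continuous_on_subset[OF S_J_cont[OF that] sub(1)])
    have bal_cont: "continuous_on {0..S} (?bal n i)" if "i \<in> {2..I}" for i
      using that by (intro continuous_intros psi_cont g_cont J_cont) auto
    have main_cont: "continuous_on {0..S} (\<lambda>t. \<psi> t * (J n 1 t - N (us n t)))"
      by (intro continuous_intros psi_cont N_cont J_cont) simp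
    let ?E = "\<lambda>t. \<psi> t * (J n 1 t - N (us n t) + (\<Sum>i=2..I. g I i (us n t) * (J n (i - 1) t - J n i t)))"
    have E_eq: "?E t = \<psi> t * (J n 1 t - N (us n t)) + (\<Sum>i=2..I. ?bal n i t)" for t
      by (simp add: distrib_left sum_distrib_left mult.assoc)
    have sum_cont: "continuous_on {0..S} (\<lambda>t. \<Sum>i=2..I. ?bal n i t)"
      by (intro continuous_on_sum bal_cont)
    have "integral {0..S} ?E = integral {0..S} (\<lambda>t. \<psi> t * (J n 1 t - N (us n t))) + (\<Sum>i=2..I. integral {0..S} (?bal n i))"
      unfolding E_eq
      by (subst Henstock_Kurzweil_Integration.integral_add[OF integrable_continuous_real[OF main_cont]
            integrable_continuous_real[OF sum_cont]],
          subst Henstock_Kurzweil_Integration.integral_sum[OF finite_atLeastAtMost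
            integrable_continuous_real[OF bal_cont]]) (assumption, rule refl)
    moreover have "norm (integral {0..S} ?E) \<le> (C * (2 * \<eta>)) * (S - 0)"
    proof (rule integral_bound[OF S(1)])
      show "continuous_on {0..S} ?E" unfolding E_eq by (intro continuous_on_add main_cont sum_cont)
      fix t assume t: "t \<in> {0..S}"
      have "\<bar>J n 1 t - N (us n t) + (\<Sum>i=2..I. g I i (us n t) * (J n (i - 1) t - J n i t))\<bar> \<le> 2 * \<eta>"
        using elim(2)[rule_format, of t] t sub(2) I(2) by auto
      then show "norm (?E t) \<le> C * (2 * \<eta>)"
        using bd(1)[of t] t C unfolding norm_mult by (intro mult_mono) auto
    qed
    moreover have "(C * (2 * \<eta>)) * (S - 0) < \<epsilon> / 2 + 0"
    proof -
      have "(\<epsilon> / 2) * (C * S / k) < (\<epsilon> / 2) * 1"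
        using \<epsilon> CS by (intro mult_strict_left_mono) auto
      then show ?thesis by (simp add: \<eta>_def mult_ac)
    qed
    ultimately show ?case using elim(1) by (simp add: dist_real_def)
  qed
qed

end


section \<open>Passage to the limit\<close>

lemma Cc_half_line_uniformly_continuous:
  fixes \<phi> :: "real \<Rightarrow> real"
  assumes "\<phi> \<in> Cc {0..}" "0 < \<epsilon>"
  obtains d where "0 < d" "\<And>x y. 0 \<le> x \<Longrightarrow> 0 \<le> y \<Longrightarrow> \<bar>x - y\<bar> < d \<Longrightarrow> \<bar>\<phi> x - \<phi> y\<bar> \<le> \<epsilon>"
proof -
  obtain R where c: "continuous_on {0..} \<phi>" and R: "0 < R" "\<And>x. x \<ge> R \<Longrightarrow> \<phi> x = 0"
    using assms(1) Cc_half_line_iff by auto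
  have "uniformly_continuous_on {0..R+1} \<phi>"
    by (intro compact_uniformly_continuous continuous_on_subset[OF c]) auto
  then obtain d where d: "0 < d" "\<And>x y. x \<in> {0..R+1} \<Longrightarrow> y \<in> {0..R+1} \<Longrightarrow> dist y x < d \<Longrightarrow> dist (\<phi> y) (\<phi> x) < \<epsilon>"
    unfolding uniformly_continuous_on_def using assms(2) by metis
  have "\<bar>\<phi> x - \<phi> y\<bar> \<le> \<epsilon>" if xy: "0 \<le> x" "0 \<le> y" "\<bar>x - y\<bar> < min 1 d" for x y
  proof (cases "x \<le> R \<or> y \<le> R")
    case True
    then have "dist (\<phi> x) (\<phi> y) < \<epsilon>" using xy by (intro d(2)) (auto simp: dist_real_def)
    then show ?thesis by (simp add: dist_real_def)
  qed (use R assms(2) in auto)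
  then show ?thesis using that[of "min 1 d"] d(1) by auto
qed

lemma lebesgue_on_integral_eq:
  fixes h :: "real \<Rightarrow> real"
  assumes S: "0 \<le> S" "S < T" and h: "h integrable_on {0..S}" "\<And>t. t \<in> {0..S} \<Longrightarrow> \<bar>h t\<bar> \<le> B"
    and zero: "\<And>t. S < t \<Longrightarrow> t < T \<Longrightarrow> h t = 0"
  shows "(\<integral>t. h t \<partial>lebesgue_on {0..<T}) = integral {0..S} h"
proof -
  have "(\<integral>t. h t \<partial>lebesgue_on {0..<T}) = (\<integral>t. indicator {0..<T} t *\<^sub>R h t \<partial>lebesgue)"
    by (rule integral_restrict_space) simp
  also have "(\<lambda>t. indicator {0..<T} t *\<^sub>R h t) = (\<lambda>t. indicator {0..S} t *\<^sub>R h t)"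
    using S zero by (auto split: split_indicator)
  also have "(\<integral>t. indicator {0..S} t *\<^sub>R h t \<partial>lebesgue) = (\<integral>t. h t \<partial>lebesgue_on {0..S})"
    by (rule integral_restrict_space[symmetric]) simp
  also have "\<dots> = integral {0..S} h"
  proof (rule lebesgue_integral_eq_integral)
    have "integrable (lebesgue_on {0..S}) (\<lambda>_. B)"
      by (simp add: finite_measure_lebesgue_on finite_measure.integrable_const)
    then show "integrable (lebesgue_on {0..S}) h"
      using integrable_imp_measurable[OF h(1)] h(2)
      by (intro measurable_bounded_by_integrable_imp_lebesgue_integrable[of h "{0..S}" "\<lambda>_. B"]) auto
  qed simp
  finally show ?thesis .
qed

lemma C1c_test_partial_t:
  assumes test: "C1c_test T \<phi> \<phi>t \<phi>x" and p: "0 \<le> t" "t < T" "0 \<le> x"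
  shows "((\<lambda>s. \<phi> (s, x)) has_real_derivative \<phi>t (t, x)) (at t within {0..<T})"
proof -
  let ?S = "{0..<T} \<times> {0..}"
  have d: "(\<phi> has_derivative (\<lambda>(h, k). \<phi>t (t, x) * h + \<phi>x (t, x) * k)) (at (t, x) within ?S)"
    using test p by (auto simp: C1c_test_def Let_def)
  have "((\<lambda>s. (s, x)) has_derivative (\<lambda>h. (h, 0))) (at t within {0..<T})"
    by (auto intro!: derivative_eq_intros)
  moreover have "(\<phi> has_derivative (\<lambda>(h, k). \<phi>t (t, x) * h + \<phi>x (t, x) * k)) (at (t, x) within (\<lambda>s. (s, x)) ` {0..<T})"
    by (rule has_derivative_subset[OF d]) (use p in auto)
  ultimately have "((\<lambda>s. \<phi> (s, x)) has_derivative (\<lambda>h. (\<lambda>(h, k). \<phi>t (t, x) * h + \<phi>x (t, x) * k) (h, 0))) (at t within {0..<T})"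
    by (rule has_derivative_in_compose)
  then show ?thesis by (simp add: has_field_derivative_def)
qed

lemma C1c_test_partial_x:
  assumes test: "C1c_test T \<phi> \<phi>t \<phi>x" and p: "0 \<le> t" "t < T" "0 \<le> x"
  shows "((\<lambda>y. \<phi> (t, y)) has_real_derivative \<phi>x (t, x)) (at x within {0..})"
proof -
  let ?S = "{0..<T} \<times> {0..}"
  have d: "(\<phi> has_derivative (\<lambda>(h, k). \<phi>t (t, x) * h + \<phi>x (t, x) * k)) (at (t, x) within ?S)"
    using test p by (auto simp: C1c_test_def Let_def)
  have "((\<lambda>y. (t, y)) has_derivative (\<lambda>h. (0, h))) (at x within {0..})"
    by (auto intro!: derivative_eq_intros)
  moreover have "(\<phi> has_derivative (\<lambda>(h, k). \<phi>t (t, x) * h + \<phi>x (t, x) * k)) (at (t, x) within (\<lambda>y. (t, y)) ` {0..})"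
    by (rule has_derivative_subset[OF d]) (use p in auto)
  ultimately have "((\<lambda>y. \<phi> (t, y)) has_derivative (\<lambda>h. (\<lambda>(h, k). \<phi>t (t, x) * h + \<phi>x (t, x) * k) (0, h))) (at x within {0..})"
    by (rule has_derivative_in_compose)
  then show ?thesis by (simp add: has_field_derivative_def)
qed

text \<open>
  The function vanishes on a relatively open set, and one-sided derivatives in each variable are
  unique; so the partial derivatives vanish there as well.  The margins between \<open>S0\<close> and \<open>S\<close> and
  between \<open>R0\<close> and \<open>R\<close> leave room for this at the boundary of the support.
\<close>
lemma C1c_test_support:
  assumes T: "0 < T" and test: "C1c_test T \<phi> \<phi>t \<phi>x"
  obtains S R B where "0 < S" "S < T" "0 < R" "0 \<le> B"
    "\<And>t x. 0 \<le> t \<Longrightarrow> t < T \<Longrightarrow> 0 \<le> x \<Longrightarrow> S \<le> t \<or> R \<le> x \<Longrightarrow> \<phi> (t, x) = 0"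
    "\<And>t x. 0 \<le> t \<Longrightarrow> t < T \<Longrightarrow> 0 \<le> x \<Longrightarrow> S \<le> t \<or> R \<le> x \<Longrightarrow> \<phi>t (t, x) = 0"
    "\<And>t x. 0 \<le> t \<Longrightarrow> t < T \<Longrightarrow> 0 \<le> x \<Longrightarrow> S \<le> t \<or> R \<le> x \<Longrightarrow> \<phi>x (t, x) = 0"
    "\<And>t x. 0 \<le> t \<Longrightarrow> t < T \<Longrightarrow> 0 \<le> x \<Longrightarrow> \<bar>\<phi> (t, x)\<bar> \<le> B"
    "\<And>t x. 0 \<le> t \<Longrightarrow> t < T \<Longrightarrow> 0 \<le> x \<Longrightarrow> \<bar>\<phi>t (t, x)\<bar> \<le> B"
    "\<And>t x. 0 \<le> t \<Longrightarrow> t < T \<Longrightarrow> 0 \<le> x \<Longrightarrow> \<bar>\<phi>x (t, x)\<bar> \<le> B"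
proof -
  let ?D = "{0..<T} \<times> {0::real..}"
  obtain K where K: "compact K" "K \<subseteq> ?D" "\<And>p. p \<in> ?D - K \<Longrightarrow> \<phi> p = 0"
    using test by (auto simp: C1c_test_def Let_def)
  have c: "continuous_on ?D \<phi>t" "continuous_on ?D \<phi>x" "continuous_on ?D \<phi>"
    using test by (auto simp: C1c_test_def Let_def intro!: has_derivative_continuous_on)
  have "\<exists>S0. 0 \<le> S0 \<and> S0 < T \<and> (\<forall>p\<in>K. fst p \<le> S0)"
  proof (cases "K = {}")
    case False
    moreover have "continuous_on K fst" by (intro continuous_intros)
    ultimately obtain p where "p \<in> K" "\<forall>q\<in>K. fst q \<le> fst p"
      using continuous_attains_sup[OF K(1)] by blast
    then show ?thesis using K(2) by (intro exI[of _ "fst p"]) auto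
  qed (use T in auto)
  then obtain S0 where S0: "0 \<le> S0" "S0 < T" "\<And>p. p \<in> K \<Longrightarrow> fst p \<le> S0" by blast
  obtain R0 where R0: "0 < R0" "\<And>p. p \<in> K \<Longrightarrow> norm p \<le> R0"
    using compact_imp_bounded[OF K(1)] by (auto simp: bounded_pos)
  define S where "S = (S0 + T) / 2"
  define R where "R = R0 + 1"
  have S: "0 < S" "S0 < S" "S < T" and R: "0 < R" "R0 < R" using S0 R0 by (auto simp: S_def R_def)
  have zero: "\<phi> (t, x) = 0" if "0 \<le> t" "t < T" "0 \<le> x" "S0 < t \<or> R0 < x" for t x
  proof (rule K(3))
    have "(t, x) \<notin> K"
    proof
      assume *: "(t, x) \<in> K"
      then have "t \<le> S0" "norm (t, x) \<le> R0" using S0(3)[of "(t, x)"] R0(2)[of "(t, x)"] by auto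
      moreover have "\<bar>x\<bar> \<le> norm (t, x)" using norm_snd_le[of x t] by simp
      ultimately show False using that by auto
    qed
    then show "(t, x) \<in> ?D - K" using that by auto
  qed
  have zt: "\<phi>t (t, x) = 0" if p: "0 \<le> t" "t < T" "0 \<le> x" and out: "S \<le> t \<or> R \<le> x" for t x
  proof -
    have "((\<lambda>s. 0) has_real_derivative \<phi>t (t, x)) (at t within {0..<T})"
    proof (rule has_field_derivative_transform_within[OF C1c_test_partial_t[OF test p], of "S - S0"])
      fix s assume s: "s \<in> {0..<T}" "dist s t < S - S0"
      then show "\<phi> (s, x) = 0" using out p R by (intro zero) (auto simp: dist_real_def)
    qed (use p S in auto)
    moreover have "((\<lambda>s::real. 0::real) has_real_derivative 0) (at t within {0..<T})" by simp
    moreover have "at t within {0..<T} \<noteq> bot"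
    proof -
      have "at t within {t..(t + T) / 2} \<noteq> bot" "{t..(t + T) / 2} \<subseteq> {0..<T}"
        using p at_within_Icc_at_right[of t "(t + T) / 2"] by (auto simp: trivial_limit_at_right_real)
      then show ?thesis using at_le[of "{t..(t + T) / 2}" "{0..<T}" t] by (metis bot.extremum_uniqueI)
    qed
    ultimately show ?thesis by (metis has_field_derivative_unique)
  qed
  have zx: "\<phi>x (t, x) = 0" if p: "0 \<le> t" "t < T" "0 \<le> x" and out: "S \<le> t \<or> R \<le> x" for t x
  proof -
    have "((\<lambda>s. 0) has_real_derivative \<phi>x (t, x)) (at x within {0..})"
    proof (rule has_field_derivative_transform_within[OF C1c_test_partial_x[OF test p], of "R - R0"])
      fix y assume y: "y \<in> {0..}" "dist y x < R - R0"
      then show "\<phi> (t, y) = 0" using out p S by (intro zero) (auto simp: dist_real_def)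
    qed (use p R in auto)
    moreover have "((\<lambda>s::real. 0::real) has_real_derivative 0) (at x within {0..})" by simp
    moreover have "at x within {0..} \<noteq> bot"
    proof -
      have "at x within {x..x+1} \<noteq> bot" "{x..x+1} \<subseteq> {0..}"
        using p at_within_Icc_at_right[of x "x + 1"] by (auto simp: trivial_limit_at_right_real)
      then show ?thesis using at_le[of "{x..x+1}" "{0..}" x] by (metis bot.extremum_uniqueI)
    qed
    ultimately show ?thesis by (metis has_field_derivative_unique)
  qed
  have z: "\<phi> (t, x) = 0" if "0 \<le> t" "t < T" "0 \<le> x" "S \<le> t \<or> R \<le> x" for t x
    using that S R by (intro zero) auto
  have bound: "\<exists>B. \<forall>t x. 0 \<le> t \<longrightarrow> t < T \<longrightarrow> 0 \<le> x \<longrightarrow> \<bar>h (t, x)\<bar> \<le> B"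
    if h: "continuous_on ?D h" "\<And>t x. 0 \<le> t \<Longrightarrow> t < T \<Longrightarrow> 0 \<le> x \<Longrightarrow> S \<le> t \<or> R \<le> x \<Longrightarrow> h (t, x) = 0"
    for h :: "real \<times> real \<Rightarrow> real"
  proof -
    have "bounded (h ` ({0..S} \<times> {0..R}))"
      using S by (intro compact_imp_bounded compact_continuous_image continuous_on_subset[OF h(1)] compact_Times) auto
    then obtain B where "0 < B" "\<forall>y\<in>h ` ({0..S} \<times> {0..R}). norm y \<le> B" unfolding bounded_pos by blast
    then have "\<bar>h (t, x)\<bar> \<le> B" if "0 \<le> t" "t < T" "0 \<le> x" for t x
      using h(2)[OF that] that by (cases "S \<le> t \<or> R \<le> x") auto
    then show ?thesis by blast
  qed
  obtain B1 where B1: "\<forall>t x. 0 \<le> t \<longrightarrow> t < T \<longrightarrow> 0 \<le> x \<longrightarrow> \<bar>\<phi> (t, x)\<bar> \<le> B1" using bound[OF c(3) z] by blast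
  obtain B2 where B2: "\<forall>t x. 0 \<le> t \<longrightarrow> t < T \<longrightarrow> 0 \<le> x \<longrightarrow> \<bar>\<phi>t (t, x)\<bar> \<le> B2" using bound[OF c(1) zt] by blast
  obtain B3 where B3: "\<forall>t x. 0 \<le> t \<longrightarrow> t < T \<longrightarrow> 0 \<le> x \<longrightarrow> \<bar>\<phi>x (t, x)\<bar> \<le> B3" using bound[OF c(2) zx] by blast
  show ?thesis
  proof (rule that[of S R "max 0 (max B1 (max B2 B3))"])
    fix t x :: real assume "0 \<le> t" "t < T" "0 \<le> x"
    then have "\<bar>\<phi> (t, x)\<bar> \<le> B1" "\<bar>\<phi>t (t, x)\<bar> \<le> B2" "\<bar>\<phi>x (t, x)\<bar> \<le> B3" using B1 B2 B3 by auto
    then show "\<bar>\<phi> (t, x)\<bar> \<le> max 0 (max B1 (max B2 B3))" "\<bar>\<phi>t (t, x)\<bar> \<le> max 0 (max B1 (max B2 B3))"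
      "\<bar>\<phi>x (t, x)\<bar> \<le> max 0 (max B1 (max B2 B3))" by linarith+
  qed (use S R z zt zx in auto)
qed

context BD_sequence
begin

lemma pairing_asymptotic:
  assumes \<phi>: "\<phi> \<in> Cc {0..}" and R: "\<And>x. x \<ge> R \<Longrightarrow> \<phi> x = 0" and t: "0 \<le> t" "t \<le> 1"
  shows "(\<lambda>n. (\<integral>x. \<phi> x \<partial>density_on {0..} (f n t)) - (\<Sum>i=2..cells n R. e n * \<phi> (e n * real i) * cs n i t)) \<longlonglongrightarrow> 0"
proof (rule tendstoI)
  fix \<epsilon> :: real assume \<epsilon>: "0 < \<epsilon>"
  define k where "k = Z + 1"
  define \<omega> where "\<omega> = \<epsilon> / (2 * k)"
  have Z1: "0 < k" using const_nonneg by (simp add: k_def)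
  have \<omega>: "0 < \<omega>" using \<epsilon> Z1 by (simp add: \<omega>_def)
  obtain d where d: "0 < d" "\<And>x y. 0 \<le> x \<Longrightarrow> 0 \<le> y \<Longrightarrow> \<bar>x - y\<bar> < d \<Longrightarrow> \<bar>\<phi> x - \<phi> y\<bar> \<le> \<omega>"
    by (rule Cc_half_line_uniformly_continuous[OF \<phi> \<omega>]) blast
  have c: "continuous_on {0..} \<phi>" using \<phi> by (simp add: Cc_def)
  have "\<forall>\<^sub>F n in sequentially. e n < d" using e_lim d(1) by (intro order_tendstoD(2)) auto
  then show "\<forall>\<^sub>F n in sequentially. dist ((\<integral>x. \<phi> x \<partial>density_on {0..} (f n t)) -
      (\<Sum>i=2..cells n R. e n * \<phi> (e n * real i) * cs n i t)) 0 < \<epsilon>"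
  proof eventually_elim
    case (elim n)
    have "\<bar>(\<integral>x. \<phi> x \<partial>density_on {0..} (f n t)) - (\<Sum>i=2..cells n R. e n * \<phi> (e n * real i) * cs n i t)\<bar> \<le> \<omega> * Z"
      by (rule f_pairing[OF t c R]) (use d(2) elim e_pos[of n] \<omega> in auto)
    also have "\<dots> \<le> \<omega> * k" using \<omega> by (intro mult_left_mono) (auto simp: k_def)
    also have "\<dots> < \<epsilon>" using Z1 \<epsilon> by (simp add: \<omega>_def)
    finally show ?case by (simp add: dist_real_def)
  qed
qed

text \<open>
  The mass balance sums over all sizes.  Up to the tail, its first moment is a finite sum against
  a test function, to which weak-star convergence applies.
\<close>
lemma mass_truncated:
  assumes t: "t \<in> {0..T}" and R: "0 < R"
    and tl: "\<And>k. (\<Sum>i\<in>{i\<in>{2..k}. R \<le> e n * real i}. (e n)\<^sup>2 * real i * cs n i t) \<le> \<tau>"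
  shows "\<bar>(ms n - us n t) - (\<Sum>i=2..cells n (2 * R). e n * truncated_size R (e n * real i) * cs n i t)\<bar> \<le> \<tau>"
proof -
  interpret S: BD_system r "e n" "\<alpha>s n" "\<beta>s n" K "ms n" "as n" "bs n" "us n" "cs n" by (rule sys)
  let ?P = "\<Sum>i=2..cells n (2 * R). e n * truncated_size R (e n * real i) * cs n i t"
  have t0: "0 \<le> t" using t by simp
  have zero: "truncated_size R x = 0" if "2 * R \<le> x" for x
  proof -
    have "2 \<le> x / R" using that R by (simp add: field_simps)
    then show ?thesis by (simp add: truncated_size_def)
  qed
  have part: "0 \<le> (\<Sum>i=2..k. (e n)\<^sup>2 * real i * cs n i t) - ?P \<and>
      (\<Sum>i=2..k. (e n)\<^sup>2 * real i * cs n i t) - ?P \<le> \<tau>" if k: "cells n (2 * R) \<le> k" for k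
  proof -
    let ?h = "\<lambda>i. (e n)\<^sup>2 * real i * cs n i t - e n * truncated_size R (e n * real i) * cs n i t"
    have P: "?P = (\<Sum>i=2..k. e n * truncated_size R (e n * real i) * cs n i t)"
    proof (rule sum.mono_neutral_left)
      show "\<forall>i\<in>{2..k} - {2..cells n (2 * R)}. e n * truncated_size R (e n * real i) * cs n i t = 0"
      proof
        fix i assume "i \<in> {2..k} - {2..cells n (2 * R)}"
        then have "e n * real (cells n (2 * R)) \<le> e n * real i" using e_pos[of n] by (intro mult_left_mono) auto
        then show "e n * truncated_size R (e n * real i) * cs n i t = 0"
          using cells(2)[of "2 * R" n] zero[of "e n * real i"] by auto
      qed
    qed (use k in auto)
    have h: "0 \<le> ?h i" "?h i \<le> (if R \<le> e n * real i then (e n)\<^sup>2 * real i * cs n i t else 0)" if "2 \<le> i" for i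
    proof -
      have x: "0 \<le> e n * real i" using e_pos[of n] by simp
      have h_eq: "?h i = e n * (e n * real i - truncated_size R (e n * real i)) * cs n i t"
        by (simp add: power2_eq_square algebra_simps)
      show "0 \<le> ?h i" unfolding h_eq
        using truncated_size_bounds[OF R x] e_pos[of n] cs_nonneg[OF that t0, of n] by simp
      show "?h i \<le> (if R \<le> e n * real i then (e n)\<^sup>2 * real i * cs n i t else 0)"
      proof (cases "R \<le> e n * real i")
        case True
        then show ?thesis using truncated_size_bounds[OF R x] e_pos[of n] cs_nonneg[OF that t0, of n] by simp
      next
        case False
        then show ?thesis unfolding h_eq using truncated_size_bounds(3)[OF R x] by simp
      qed
    qed
    have "(\<Sum>i=2..k. ?h i) \<le> (\<Sum>i=2..k. if R \<le> e n * real i then (e n)\<^sup>2 * real i * cs n i t else 0)"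
      by (rule sum_mono) (use h in auto)
    also have "\<dots> = (\<Sum>i\<in>{i\<in>{2..k}. R \<le> e n * real i}. (e n)\<^sup>2 * real i * cs n i t)"
      by (subst sum.inter_filter) auto
    also have "\<dots> \<le> \<tau>" by (rule tl)
    finally have "(\<Sum>i=2..k. ?h i) \<le> \<tau>" .
    moreover have "0 \<le> (\<Sum>i=2..k. ?h i)" by (rule sum_nonneg) (use h(1) in auto)
    ultimately show ?thesis by (simp add: P sum_subtractf)
  qed
  have "(\<lambda>k. \<Sum>i<k. (e n)\<^sup>2 * real (i + 2) * cs n (i + 2) t) \<longlonglongrightarrow> ms n - us n t"
    using S.mass_sums[OF t0] by (simp add: sums_def)
  then have lim: "(\<lambda>k. (\<Sum>i=2..k+1. (e n)\<^sup>2 * real i * cs n i t) - ?P) \<longlonglongrightarrow> (ms n - us n t) - ?P"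
    unfolding sum_shift2 by (intro tendsto_diff tendsto_const) simp
  have "0 \<le> (ms n - us n t) - ?P"
    by (rule LIMSEQ_le_const[OF lim]) (intro exI[of _ "cells n (2 * R)"] allI impI, rule part[THEN conjunct1], simp)
  moreover have "(ms n - us n t) - ?P \<le> \<tau>"
    by (rule LIMSEQ_le_const2[OF lim]) (intro exI[of _ "cells n (2 * R)"] allI impI, rule part[THEN conjunct2], simp)
  ultimately show ?thesis by simp
qed

lemma first_moment_converges:
  assumes t: "t \<in> {0..T}" and \<mu>: "\<mu> \<in> finite_borel {0..}"
    and lim: "weak_star_tendsto {0..} (\<lambda>n. density_on {0..} (f n t)) \<mu> sequentially"
  shows "integrable \<mu> (\<lambda>x. x)" "(\<lambda>n. ms n - us n t) \<longlonglongrightarrow> (\<integral>x. x \<partial>\<mu>)"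
proof -
  have "\<exists>R0>0. \<forall>R\<ge>R0. \<forall>\<^sub>F n in sequentially.
     \<bar>(ms n - us n t) - (\<integral>x. truncated_size R x \<partial>density_on {0..} (f n t))\<bar> \<le> \<epsilon>" if \<epsilon>: "0 < \<epsilon>" for \<epsilon>
  proof -
    obtain R0 where R0: "0 < R0" "\<And>n k.
      (\<Sum>i\<in>{i\<in>{2..k}. R0 \<le> e n * real i}. (e n)\<^sup>2 * real i * cs n i t) \<le> \<epsilon> / 2"
      using tail[of "\<epsilon> / 2"] \<epsilon> t by auto
    have "\<forall>\<^sub>F n in sequentially.
      \<bar>(ms n - us n t) - (\<integral>x. truncated_size R x \<partial>density_on {0..} (f n t))\<bar> \<le> \<epsilon>" if R: "R0 \<le> R" for R
    proof -
      have R_pos: "0 < R" using R R0 by simp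
      have "(\<Sum>i\<in>{i\<in>{2..k}. R \<le> e n * real i}. (e n)\<^sup>2 * real i * cs n i t) \<le> \<epsilon> / 2" for n k
      proof -
        have "(\<Sum>i\<in>{i\<in>{2..k}. R \<le> e n * real i}. (e n)\<^sup>2 * real i * cs n i t) \<le>
          (\<Sum>i\<in>{i\<in>{2..k}. R0 \<le> e n * real i}. (e n)\<^sup>2 * real i * cs n i t)"
          using R t cs_nonneg by (intro sum_mono2) auto
        then show ?thesis using R0(2)[of n k] by linarith
      qed
      note trunc = mass_truncated[OF t R_pos this]
      have zero: "truncated_size R x = 0" if "2 * R \<le> x" for x
      proof -
        have "2 \<le> x / R" using that R_pos by (simp add: field_simps)
        then show ?thesis by (simp add: truncated_size_def)
      qed
      have "(\<lambda>n. (\<integral>x. truncated_size R x \<partial>density_on {0..} (f n t)) -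
          (\<Sum>i=2..cells n (2 * R). e n * truncated_size R (e n * real i) * cs n i t)) \<longlonglongrightarrow> 0"
        by (rule pairing_asymptotic[OF truncated_size_Cc[OF R_pos] zero]) (use t T in auto)
      then have "\<forall>\<^sub>F n in sequentially. dist ((\<integral>x. truncated_size R x \<partial>density_on {0..} (f n t)) -
          (\<Sum>i=2..cells n (2 * R). e n * truncated_size R (e n * real i) * cs n i t)) 0 < \<epsilon> / 2"
        using \<epsilon> by (intro tendstoD) auto
      then show ?thesis
      proof eventually_elim
        case (elim n)
        then show ?case using trunc[of n] unfolding dist_real_def by linarith
      qed
    qed
    then show ?thesis using R0(1) by blast
  qed
  from first_moment_limit[OF \<mu> lim this]
  show "integrable \<mu> (\<lambda>x. x)" "(\<lambda>n. ms n - us n t) \<longlonglongrightarrow> (\<integral>x. x \<partial>\<mu>)" by blast+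
qed

definition mass :: real where "mass = u_in + (\<integral>x. x \<partial>\<mu>_in)"

lemma ms_lim: "ms \<longlonglongrightarrow> mass"
proof -
  have "(\<lambda>n. us n 0 + (ms n - us n 0)) \<longlonglongrightarrow> u_in + (\<integral>x. x \<partial>\<mu>_in)"
    by (intro tendsto_add u0_lim first_moment_converges[OF _ \<mu>_in f_in_lim]) (use T in auto)
  then show ?thesis by (simp add: mass_def)
qed

lemma density_continuous_in_time:
  assumes \<phi>: "\<phi> \<in> Cc {0..}"
  shows "continuous_on {0..T} (\<lambda>t. \<integral>x. \<phi> x \<partial>density_on {0..} (f n t))"
proof -
  obtain R where c: "continuous_on {0..} \<phi>" and R: "\<And>x. x \<ge> R \<Longrightarrow> \<phi> x = 0"
    using \<phi> Cc_half_line_iff by auto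
  have "continuous_on {0..T} (\<lambda>t. \<Sum>i=2..cells n R. cs n i t * (\<integral>x. indicator (cell (e n) i) x * \<phi> x \<partial>lborel))"
    by (intro continuous_intros continuous_on_subset[OF cs_cont]) auto
  then show ?thesis
  proof (rule continuous_on_eq)
    fix t assume "t \<in> {0..T}"
    then show "(\<Sum>i=2..cells n R. cs n i t * (\<integral>x. indicator (cell (e n) i) x * \<phi> x \<partial>lborel)) =
      (\<integral>x. \<phi> x \<partial>density_on {0..} (f n t))"
      by (intro step_fun_integral[OF e_pos _ c R cells, symmetric] cs_nonneg) auto
  qed
qed

end

locale BD_limit = BD_sequence +
  fixes \<mu> :: "real \<Rightarrow> real measure"
  assumes \<mu>_finite: "\<And>t. t \<in> {0..T} \<Longrightarrow> \<mu> t \<in> finite_borel {0..}"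
    and \<mu>_le: "\<And>t. t \<in> {0..T} \<Longrightarrow> measure (\<mu> t) {0..} \<le> Z + 2 * M + 1"
    and \<mu>_lim: "\<And>\<phi>. \<phi> \<in> Cc {0..} \<Longrightarrow> uniform_limit {0..T}
      (\<lambda>n t. \<integral>x. \<phi> x \<partial>density_on {0..} (f n t)) (\<lambda>t. \<integral>x. \<phi> x \<partial>\<mu> t) sequentially"
begin

lemma \<mu>_tendsto: "t \<in> {0..T} \<Longrightarrow> \<phi> \<in> Cc {0..} \<Longrightarrow>
    (\<lambda>n. \<integral>x. \<phi> x \<partial>density_on {0..} (f n t)) \<longlonglongrightarrow> (\<integral>x. \<phi> x \<partial>\<mu> t)"
  using \<mu>_lim by (rule tendsto_uniform_limitI)

lemma \<mu>_continuous: "\<phi> \<in> Cc {0..} \<Longrightarrow> continuous_on {0..T} (\<lambda>t. \<integral>x. \<phi> x \<partial>\<mu> t)"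
  by (rule uniform_limit_theorem[OF _ \<mu>_lim]) (auto intro: always_eventually density_continuous_in_time)

lemma path_converges:
  "tendsto_weak_star_continuous T {0..} (\<lambda>n t. density_on {0..} (f n t)) \<mu>"
  unfolding tendsto_weak_star_continuous_def weak_star_continuous_def
  using \<mu>_finite \<mu>_continuous \<mu>_lim f_finite_borel density_continuous_in_time T by auto

text \<open>Defined by the mass balance, and only then recognized as the limit of the monomer concentrations.\<close>
definition U :: "real \<Rightarrow> real" where "U t = mass - (\<integral>x. x \<partial>\<mu> t)"

lemma
  assumes t: "t \<in> {0..T}"
  shows \<mu>_moment: "integrable (\<mu> t) (\<lambda>x. x)" and us_tendsto: "(\<lambda>n. us n t) \<longlonglongrightarrow> U t"
proof -
  have lim: "weak_star_tendsto {0..} (\<lambda>n. density_on {0..} (f n t)) (\<mu> t) sequentially"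
    unfolding weak_star_tendsto_def using \<mu>_tendsto[OF t] by blast
  show "integrable (\<mu> t) (\<lambda>x. x)" by (rule first_moment_converges[OF t \<mu>_finite[OF t] lim])
  have "(\<lambda>n. ms n - (ms n - us n t)) \<longlonglongrightarrow> mass - (\<integral>x. x \<partial>\<mu> t)"
    by (intro tendsto_diff ms_lim first_moment_converges[OF t \<mu>_finite[OF t] lim])
  then show "(\<lambda>n. us n t) \<longlonglongrightarrow> U t" by (simp add: U_def)
qed

lemma U_range: "t \<in> {0..T} \<Longrightarrow> U t \<in> {ul..M}"
  using LIMSEQ_le_const[OF us_tendsto, of t ul] LIMSEQ_le_const2[OF us_tendsto, of t M] us_range[of t] by auto

lemma U_0: "U 0 = u_in"
  using LIMSEQ_unique[OF us_tendsto u0_lim] T by simp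

lemma U_continuous: "continuous_on {0..T} U"
proof -
  have "\<bar>U t - U s\<bar> \<le> speed * \<bar>t - s\<bar>" if "t \<in> {0..T}" "s \<in> {0..T}" for s t
  proof (rule LIMSEQ_le_const2)
    show "(\<lambda>n. \<bar>us n t - us n s\<bar>) \<longlonglongrightarrow> \<bar>U t - U s\<bar>" by (intro tendsto_intros us_tendsto that)
    show "\<exists>N. \<forall>n\<ge>N. \<bar>us n t - us n s\<bar> \<le> speed * \<bar>t - s\<bar>"
      using us_lipschitz[of s t] that T by auto
  qed
  then show ?thesis
    using const_nonneg by (intro lipschitz_on_continuous_on[of speed]) (auto simp: lipschitz_on_def dist_real_def)
qed

text \<open>
  The weights need not be close to the test function at the smallest size, because
  \<open>e * c 2\<close> is of order \<open>e powr (1 - r)\<close>.  This matters for the fragmentation term, which is absent at the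
  smallest size although \<open>b 0\<close> may be positive.
\<close>
lemma weighted_sum_limit:
  assumes t: "t \<in> {0..T}" and \<psi>: "\<psi> \<in> Cc {0..}" and R: "\<And>x. x \<ge> R \<Longrightarrow> \<psi> x = 0"
    and close: "\<And>\<epsilon>. 0 < \<epsilon> \<Longrightarrow>
       \<forall>\<^sub>F n in sequentially. \<forall>i. 3 \<le> i \<longrightarrow> i \<le> cells n R \<longrightarrow> \<bar>w n i - \<psi> (e n * real i)\<bar> \<le> \<epsilon>"
    and bound: "\<And>n. \<bar>w n 2\<bar> \<le> B"
  shows "(\<lambda>n. \<Sum>i=2..cells n R. e n * w n i * cs n i t) \<longlonglongrightarrow> (\<integral>x. \<psi> x \<partial>\<mu> t)"
proof -
  obtain B' where B': "0 \<le> B'" "\<And>x. 0 \<le> x \<Longrightarrow> \<bar>\<psi> x\<bar> \<le> B'" by (rule Cc_half_line_bounded[OF \<psi>]) blast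
  obtain D where D: "0 \<le> D" "\<And>n t. t \<in> {0..T} \<Longrightarrow> e n powr r * cs n 2 t \<le> D" by (rule dimer_bounds) blast
  have t1: "0 \<le> t" "t \<le> 1" using t T by auto
  let ?P = "\<lambda>n. \<Sum>i=2..cells n R. e n * \<psi> (e n * real i) * cs n i t"
  let ?W = "\<lambda>n. \<Sum>i=2..cells n R. e n * w n i * cs n i t"
  have "(\<lambda>n. (\<integral>x. \<psi> x \<partial>density_on {0..} (f n t)) -
      ((\<integral>x. \<psi> x \<partial>density_on {0..} (f n t)) - ?P n)) \<longlonglongrightarrow> (\<integral>x. \<psi> x \<partial>\<mu> t) - 0"
    by (intro tendsto_diff \<mu>_tendsto t \<psi> pairing_asymptotic R t1)
  then have P: "?P \<longlonglongrightarrow> (\<integral>x. \<psi> x \<partial>\<mu> t)" by simp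
  have e0: "(\<lambda>n. e n powr (1 - r)) \<longlonglongrightarrow> 0"
    by (rule tendsto_zero_powrI[OF e_lim tendsto_const]) (use e_pos r_less in \<open>auto simp: less_imp_le\<close>)
  have "(\<lambda>n. ?W n - ?P n) \<longlonglongrightarrow> 0"
  proof (rule tendstoI)
    fix \<epsilon> :: real assume \<epsilon>: "0 < \<epsilon>"
    define k where "k = Z + 1"
    define \<omega> where "\<omega> = \<epsilon> / (4 * k)"
    have Z1: "0 < k" using const_nonneg by (simp add: k_def)
    have \<omega>: "0 < \<omega>" using \<epsilon> Z1 by (simp add: \<omega>_def)
    have "(\<lambda>n. (B + B') * (e n powr (1 - r) * D)) \<longlonglongrightarrow> (B + B') * (0 * D)" by (intro tendsto_intros e0)
    then have "\<forall>\<^sub>F n in sequentially. (B + B') * (e n powr (1 - r) * D) < \<epsilon> / 2"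
      using \<epsilon> by (intro order_tendstoD(2)) auto
    then show "\<forall>\<^sub>F n in sequentially. dist (?W n - ?P n) 0 < \<epsilon>"
      using close[OF \<omega>]
    proof eventually_elim
      case (elim n)
      let ?d = "\<lambda>i. e n * (w n i - \<psi> (e n * real i)) * cs n i t"
      have ec: "0 \<le> e n * cs n i t" if "2 \<le> i" for i using e_pos[of n] cs_nonneg[OF that t1(1), of n] by simp
      have "e n * cs n 2 t = e n powr (1 - r) * (e n powr r * cs n 2 t)"
        using e_pos[of n] by (simp add: powr_diff)
      also have "\<dots> \<le> e n powr (1 - r) * D" using D(2)[OF t, of n] by (intro mult_left_mono) auto
      finally have ec2: "e n * cs n 2 t \<le> e n powr (1 - r) * D" .
      have two: "\<bar>w n 2 - \<psi> (e n * real 2)\<bar> \<le> B + B'" using bound[of n] B'(2)[of "e n * real 2"] e_pos[of n] by simp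
      from mult_mono[OF two ec2]
      have "\<bar>w n 2 - \<psi> (e n * real 2)\<bar> * (e n * cs n 2 t) \<le> (B + B') * (e n powr (1 - r) * D)"
        using ec[of 2] two by simp
      moreover have "\<bar>?d 2\<bar> = \<bar>w n 2 - \<psi> (e n * real 2)\<bar> * (e n * cs n 2 t)"
        using e_pos[of n] cs_nonneg[of 2 t n] t1 by (simp add: abs_mult)
      ultimately have d2: "\<bar>?d 2\<bar> < \<epsilon> / 2" using elim(1) by linarith
      have d3: "\<bar>\<Sum>i=3..cells n R. ?d i\<bar> \<le> \<epsilon> / 4"
      proof -
        have "\<bar>\<Sum>i=3..cells n R. ?d i\<bar> \<le> (\<Sum>i=3..cells n R. \<omega> * (e n * cs n i t))"
        proof (rule order.trans[OF sum_abs sum_mono])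
          fix i assume i: "i \<in> {3..cells n R}"
          have "\<bar>?d i\<bar> = \<bar>w n i - \<psi> (e n * real i)\<bar> * (e n * cs n i t)"
            using e_pos[of n] cs_nonneg[of i t n] i t1 by (simp add: abs_mult)
          also have "\<dots> \<le> \<omega> * (e n * cs n i t)" using elim(2) i ec[of i] by (intro mult_right_mono) auto
          finally show "\<bar>?d i\<bar> \<le> \<omega> * (e n * cs n i t)" .
        qed
        also have "\<dots> \<le> (\<Sum>i=2..cells n R. \<omega> * (e n * cs n i t))"
          using ec \<omega> by (intro sum_mono2) auto
        also have "\<dots> = \<omega> * (\<Sum>i=2..cells n R. e n * cs n i t)" by (simp add: sum_distrib_left)
        also have "\<dots> \<le> \<omega> * k"
          using zeroth[OF t1, of n "cells n R"] \<omega> by (intro mult_left_mono) (auto simp: k_def)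
        also have "\<dots> = \<epsilon> / 4" using Z1 by (simp add: \<omega>_def)
        finally show ?thesis .
      qed
      have "?W n - ?P n = (\<Sum>i=2..cells n R. ?d i)" by (simp add: sum_subtractf[symmetric] algebra_simps)
      also have "\<dots> = ?d 2 + (\<Sum>i=3..cells n R. ?d i)"
        using cells(1)[of n R] by (subst sum.atLeast_Suc_atMost) (auto simp: numeral_3_eq_3)
      finally show ?case using d2 d3 \<epsilon> unfolding dist_real_def by linarith
    qed
  qed
  from tendsto_add[OF this P] show ?thesis by simp
qed


text \<open>
  Integrated in time, the discrete weak formulation consists of the initial term, a sum \<open>Hn\<close> over the
  sizes, and the boundary term with \<open>J 1\<close>.  The sum converges at each time, by weak-star convergence
  and the convergence of the monomer concentration, and is bounded, so that dominated convergence
  applies.  The boundary term converges only after integration in time, by the quasi-steady state.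
\<close>
lemma weak_equation:
  assumes test: "C1c_test T \<phi> \<phi>t \<phi>x"
  shows "(\<integral>t. (\<integral>x. \<phi>t (t, x) + (a x * U t - b x) * \<phi>x (t, x) \<partial>\<mu> t) \<partial>lebesgue_on {0..<T})
    + (\<integral>x. \<phi> (0, x) \<partial>\<mu>_in) + (\<integral>s. \<phi> (s, 0) * N (U s) \<partial>lebesgue_on {0..<T}) = 0"
proof -
  obtain S R B where S: "0 < S" "S < T" and R: "0 < R" and B: "0 \<le> B"
    and z: "\<And>t x. 0 \<le> t \<Longrightarrow> t < T \<Longrightarrow> 0 \<le> x \<Longrightarrow> S \<le> t \<or> R \<le> x \<Longrightarrow> \<phi> (t, x) = 0"
    and zt: "\<And>t x. 0 \<le> t \<Longrightarrow> t < T \<Longrightarrow> 0 \<le> x \<Longrightarrow> S \<le> t \<or> R \<le> x \<Longrightarrow> \<phi>t (t, x) = 0"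
    and zx: "\<And>t x. 0 \<le> t \<Longrightarrow> t < T \<Longrightarrow> 0 \<le> x \<Longrightarrow> S \<le> t \<or> R \<le> x \<Longrightarrow> \<phi>x (t, x) = 0"
    and b\<phi>: "\<And>t x. 0 \<le> t \<Longrightarrow> t < T \<Longrightarrow> 0 \<le> x \<Longrightarrow> \<bar>\<phi> (t, x)\<bar> \<le> B"
    and bt: "\<And>t x. 0 \<le> t \<Longrightarrow> t < T \<Longrightarrow> 0 \<le> x \<Longrightarrow> \<bar>\<phi>t (t, x)\<bar> \<le> B"
    and bx: "\<And>t x. 0 \<le> t \<Longrightarrow> t < T \<Longrightarrow> 0 \<le> x \<Longrightarrow> \<bar>\<phi>x (t, x)\<bar> \<le> B"
    by (rule C1c_test_support[OF T(1) test]) blast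
  have ST: "{0..S} \<subseteq> {0..T}" "{0..S} \<subseteq> {0..<T}" "{0..S} \<subseteq> {0..}" "S \<le> T" using S by auto
  have c: "continuous_on ({0..<T} \<times> {0..}) \<phi>t" "continuous_on ({0..<T} \<times> {0..}) \<phi>x"
    using test by (auto simp: C1c_test_def Let_def)
  note dt = C1c_test_partial_t[OF test] and dx = C1c_test_partial_x[OF test]
  have lip: "\<bar>\<phi> (t, x) - \<phi> (t, y)\<bar> \<le> B * \<bar>x - y\<bar>" if "0 \<le> t" "t < T" "0 \<le> x" "0 \<le> y" for t x y
  proof -
    have "norm (\<phi> (t, x) - \<phi> (t, y)) \<le> B * norm (x - y)"
      using that bx by (intro field_differentiable_bound[of "{0..}" "\<lambda>y. \<phi> (t, y)" "\<lambda>y. \<phi>x (t, y)"] dx) auto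
    then show ?thesis by simp
  qed
  have mvt: "\<exists>\<xi>. x < \<xi> \<and> \<xi> < y \<and> \<phi> (t, y) - \<phi> (t, x) = (y - x) * \<phi>x (t, \<xi>)"
    if "0 \<le> t" "t < T" "0 < x" "x < y" for t x y
  proof -
    have "\<exists>\<xi>. x < \<xi> \<and> \<xi> < y \<and> \<phi> (t, y) - \<phi> (t, x) = (y - x) * \<phi>x (t, \<xi>)"
    proof (rule MVT2[OF \<open>x < y\<close>, of "\<lambda>y. \<phi> (t, y)" "\<lambda>y. \<phi>x (t, y)"])
      fix v assume "x \<le> v" "v \<le> y"
      then show "((\<lambda>y. \<phi> (t, y)) has_real_derivative \<phi>x (t, v)) (at v)"
        using dx[of t v] that by (simp add: at_within_interior[of v "{0..}"])
    qed
    then show ?thesis .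
  qed
  let ?N = "\<lambda>n. cells n R"
  let ?\<Delta> = "\<lambda>n t i. \<phi> (t, e n * real (i + 1)) - \<phi> (t, e n * real i)"
  have end_zero: "\<phi> (t, e n * real (?N n + 1)) = 0" if "0 \<le> t" "t < T" for n t
    using that cells(2)[of R n] e_pos[of n] by (intro z) (auto simp: distrib_left)
  have \<Delta>_le: "\<bar>?\<Delta> n t i\<bar> \<le> B * e n" if "0 \<le> t" "t < T" for n t i
    using lip[OF that, of "e n * real (i + 1)" "e n * real i"] e_pos[of n] by (simp add: distrib_left)
  define Hn where "Hn n t = (\<Sum>i=2..?N n. e n * \<phi>t (t, e n * real i) * cs n i t) + (\<Sum>i=2..?N n. ?\<Delta> n t i * J n i t)" for n t
  define h where "h t = (\<integral>x. \<phi>t (t, x) + (a x * U t - b x) * \<phi>x (t, x) \<partial>\<mu> t)" for t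
  have cont_t: "continuous_on {0..S} (\<lambda>t. \<phi> (t, x))" if "0 \<le> x" for x
  proof (rule DERIV_continuous_on)
    fix t assume "t \<in> {0..S}"
    then show "((\<lambda>t. \<phi> (t, x)) has_real_derivative \<phi>t (t, x)) (at t within {0..S})"
      using S that by (intro has_field_derivative_subset[OF dt]) auto
  qed
  have cont_\<phi>t: "continuous_on {0..S} (\<lambda>t. \<phi>t (t, x))" if "0 \<le> x" for x
    using that S by (intro continuous_on_compose2[OF c(1)] continuous_intros) auto
  have J_cont: "continuous_on {0..S} (J n i)" if "1 \<le> i" for n i
    by (rule continuous_on_subset[OF S_J_cont[OF that] ST(3)])
  have c_cont: "continuous_on {0..S} (cs n i)" if "2 \<le> i" for n i
    by (rule continuous_on_subset[OF cs_cont[OF that] ST(3)])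
  have Hn_cont: "continuous_on {0..S} (Hn n)" for n
    unfolding Hn_def[abs_def] using e_pos[of n]
    by (intro continuous_intros cont_t cont_\<phi>t J_cont c_cont) auto
  have bdry_cont: "continuous_on {0..S} (\<lambda>t. \<phi> (t, e n * 2) * J n 1 t)" for n
    using e_pos[of n] by (intro continuous_intros cont_t J_cont) auto

  have balance: "integral {0..S} (Hn n) + integral {0..S} (\<lambda>t. \<phi> (t, e n * 2) * J n 1 t)
      = - (\<Sum>i=2..?N n. e n * \<phi> (0, e n * real i) * cs n i 0)" for n
  proof -
    interpret Y: BD_system r "e n" "\<alpha>s n" "\<beta>s n" K "ms n" "as n" "bs n" "us n" "cs n" by (rule sys)
    let ?G = "\<lambda>t. \<Sum>i=2..?N n. e n * \<phi> (t, e n * real i) * cs n i t"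
    have "((\<lambda>t. Hn n t + \<phi> (t, e n * 2) * J n 1 t) has_integral (?G S - ?G 0)) {0..S}"
    proof (rule fundamental_theorem_of_calculus)
      fix t assume "t \<in> {0..S}"
      then have t: "0 \<le> t" "t < T" using S by auto
      have "(?G has_real_derivative ((\<Sum>i=2..?N n. e n * \<phi>t (t, e n * real i) * cs n i t) +
         \<phi> (t, e n * real 2) * J n 1 t + (\<Sum>i=2..?N n. ?\<Delta> n t i * J n i t))) (at t within {0..})"
      proof (rule Y.weighted_sum_deriv[where w = "\<lambda>i t. \<phi> (t, e n * real i)"])
        fix i
        have "at t within {0..} = at t within ({0..<T} :: real set)"
          using t by (intro at_within_nhd[of t "{..<T}"]) auto
        then show "((\<lambda>t. \<phi> (t, e n * real i)) has_real_derivative \<phi>t (t, e n * real i)) (at t within {0..})"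
          using dt[OF t, of "e n * real i"] e_pos[of n] by simp
      qed (use t cells(1)[of n R] end_zero in auto)
      then have "(?G has_real_derivative (Hn n t + \<phi> (t, e n * 2) * J n 1 t)) (at t within {0..})"
        by (simp add: Hn_def algebra_simps)
      then have "(?G has_real_derivative (Hn n t + \<phi> (t, e n * 2) * J n 1 t)) (at t within {0..S})"
        by (rule has_field_derivative_subset) (use ST in auto)
      then show "(?G has_vector_derivative (Hn n t + \<phi> (t, e n * 2) * J n 1 t)) (at t within {0..S})"
        by (rule has_real_derivative_iff_has_vector_derivative[THEN iffD1])
    qed (use S in simp)
    moreover have "?G S = 0" using z[of S] S e_pos[of n] by (intro sum.neutral) auto
    ultimately have "integral {0..S} (\<lambda>t. Hn n t + \<phi> (t, e n * 2) * J n 1 t) = - ?G 0"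
      by (simp add: integral_unique)
    then show ?thesis
      by (subst (asm) Henstock_Kurzweil_Integration.integral_add[OF
            integrable_continuous_real[OF Hn_cont] integrable_continuous_real[OF bdry_cont]])
  qed

  have init_lim: "(\<lambda>n. \<Sum>i=2..?N n. e n * \<phi> (0, e n * real i) * cs n i 0) \<longlonglongrightarrow> (\<integral>x. \<phi> (0, x) \<partial>\<mu>_in)"
  proof -
    have c0: "continuous_on {0..} (\<lambda>x. \<phi> (0, x))" using T by (intro DERIV_continuous_on[OF dx]) auto
    have z0: "\<phi> (0, x) = 0" if "R \<le> x" for x using z[of 0 x] T R that by simp
    have \<phi>0: "(\<lambda>x. \<phi> (0, x)) \<in> Cc {0..}" unfolding Cc_half_line_iff using c0 z0 R by blast
    have "(\<lambda>n. (\<integral>x. \<phi> (0, x) \<partial>density_on {0..} (f n 0)) - ((\<integral>x. \<phi> (0, x) \<partial>density_on {0..} (f n 0))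
        - (\<Sum>i=2..?N n. e n * \<phi> (0, e n * real i) * cs n i 0))) \<longlonglongrightarrow> (\<integral>x. \<phi> (0, x) \<partial>\<mu>_in) - 0"
      using f_in_lim \<phi>0 unfolding weak_star_tendsto_def
      by (intro tendsto_diff pairing_asymptotic[where \<phi> = "\<lambda>x. \<phi> (0, x)"] z0) auto
    then show ?thesis by simp
  qed

  have Hn_bound: "\<bar>Hn n t\<bar> \<le> B * (Z + flux_const)" if t: "t \<in> {0..S}" for n t
  proof -
    interpret Y: BD_system r "e n" "\<alpha>s n" "\<beta>s n" K "ms n" "as n" "bs n" "us n" "cs n" by (rule sys)
    have t': "0 \<le> t" "t < T" "t \<le> 1" using t S T by auto
    have "\<bar>\<Sum>i=2..?N n. e n * \<phi>t (t, e n * real i) * cs n i t\<bar> \<le> (\<Sum>i=2..?N n. B * (e n * cs n i t))"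
    proof (rule order.trans[OF sum_abs sum_mono])
      fix i assume i: "i \<in> {2..?N n}"
      have ec: "0 \<le> e n * cs n i t" using e_pos[of n] cs_nonneg[of i t n] i t' by simp
      have "\<bar>e n * \<phi>t (t, e n * real i) * cs n i t\<bar> = \<bar>\<phi>t (t, e n * real i)\<bar> * (e n * cs n i t)"
        using e_pos[of n] cs_nonneg[of i t n] i t' by (simp add: abs_mult)
      also have "\<dots> \<le> B * (e n * cs n i t)" using bt[OF t'(1,2)] e_pos[of n] ec by (intro mult_right_mono) auto
      finally show "\<bar>e n * \<phi>t (t, e n * real i) * cs n i t\<bar> \<le> B * (e n * cs n i t)" .
    qed
    also have "\<dots> = B * (\<Sum>i=2..?N n. e n * cs n i t)" by (simp add: sum_distrib_left)
    also have "\<dots> \<le> B * Z" using zeroth[OF t'(1,3)] B by (intro mult_left_mono) auto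
    finally have 1: "\<bar>\<Sum>i=2..?N n. e n * \<phi>t (t, e n * real i) * cs n i t\<bar> \<le> B * Z" .
    have "\<bar>\<Sum>i=2..?N n. ?\<Delta> n t i * J n i t\<bar> \<le> (\<Sum>i=2..?N n. B * (e n * \<bar>J n i t\<bar>))"
    proof (rule order.trans[OF sum_abs sum_mono])
      fix i
      have "\<bar>?\<Delta> n t i\<bar> * \<bar>J n i t\<bar> \<le> (B * e n) * \<bar>J n i t\<bar>" by (intro mult_right_mono \<Delta>_le t') auto
      then show "\<bar>?\<Delta> n t i * J n i t\<bar> \<le> B * (e n * \<bar>J n i t\<bar>)" by (simp add: abs_mult mult.assoc)
    qed
    also have "\<dots> = B * (\<Sum>i=2..?N n. e n * \<bar>J n i t\<bar>)" by (simp add: sum_distrib_left)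
    also have "\<dots> \<le> B * (K * (1 + ms n) * (Z + ms n))"
      using Y.flux_sum_bound[OF t'(1) zeroth[OF t'(1,3)]] B by (intro mult_left_mono) auto
    also have "\<dots> \<le> B * flux_const"
      unfolding flux_const_def using ms_le[of n] Y.m_nonneg const_nonneg B
      by (intro mult_left_mono[OF mult_mono]) (auto intro: mult_left_mono)
    finally show ?thesis using 1 unfolding Hn_def by (simp add: distrib_left)
  qed

  have Hn_lim: "(\<lambda>n. Hn n t) \<longlonglongrightarrow> h t" if t: "t \<in> {0..S}" for t
  proof -
    have t': "0 \<le> t" "t < T" "t \<in> {0..T}" using t S by auto
    have cx: "continuous_on {0..} (\<lambda>x. \<phi>x (t, x))" and ct: "continuous_on {0..} (\<lambda>x. \<phi>t (t, x))"
      using t' by (auto intro!: continuous_on_compose2[OF c(1)] continuous_on_compose2[OF c(2)] continuous_intros)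
    define \<psi> where "\<psi> x = \<phi>t (t, x) + (a x * U t - b x) * \<phi>x (t, x)" for x
    have \<psi>_zero: "\<psi> x = 0" if "R \<le> x" for x
      using zt[OF t'(1,2), of x] zx[OF t'(1,2), of x] that R by (simp add: \<psi>_def)
    have \<psi>_Cc: "\<psi> \<in> Cc {0..}"
      unfolding Cc_half_line_iff
    proof (intro conjI exI[of _ R])
      show "continuous_on {0..} \<psi>"
        unfolding \<psi>_def by (intro continuous_intros cx ct a_cont b_cont)
    qed (use R \<psi>_zero in auto)
    have \<phi>x_Cc: "(\<lambda>x. \<phi>x (t, x)) \<in> Cc {0..}"
      unfolding Cc_half_line_iff using cx R zx[OF t'(1,2)] by (auto intro!: exI[of _ R])
    \<comment> \<open>fragmentation moves a cluster of size \<open>i\<close> to size \<open>i - 1\<close>, hence the shifted increment\<close>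
    define w where "w n i = \<phi>t (t, e n * real i) + ?\<Delta> n t i / e n * (as n i * us n t)
       - (if i = 2 then 0 else ?\<Delta> n t (i - 1) / e n * bs n i)" for n i
    have Hn_w: "Hn n t = (\<Sum>i=2..?N n. e n * w n i * cs n i t)" for n
    proof -
      have e0: "e n \<noteq> 0" using e_pos[of n] by simp
      have N2: "2 \<le> ?N n" by (rule cells)
      have last: "?\<Delta> n t (?N n) = 0"
        using end_zero[OF t'(1,2), of n] z[OF t'(1,2), of "e n * real (?N n)"] cells(2)[of R n] R by auto
      have "(\<Sum>i=2..?N n. ?\<Delta> n t i * (bs n (i + 1) * cs n (i + 1) t)) =
        (\<Sum>i=2..?N n. (if i = 2 then 0 else ?\<Delta> n t (i - 1) * bs n i) * cs n i t)"
      proof -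
        have "(\<Sum>i=2..?N n. ?\<Delta> n t i * (bs n (i + 1) * cs n (i + 1) t)) =
          (\<Sum>i=2+1..?N n+1. ?\<Delta> n t (i - 1) * (bs n i * cs n i t))"
          by (subst sum.shift_bounds_cl_nat_ivl) simp
        also have "\<dots> = (\<Sum>i=2+1..?N n. ?\<Delta> n t (i - 1) * (bs n i * cs n i t))"
          using last N2 by simp
        also have "\<dots> = (\<Sum>i=2+1..?N n. (if i = 2 then 0 else ?\<Delta> n t (i - 1) * bs n i) * cs n i t)"
          by (intro sum.cong) auto
        also have "\<dots> = (\<Sum>i=2..?N n. (if i = 2 then 0 else ?\<Delta> n t (i - 1) * bs n i) * cs n i t)"
          using N2 by (subst (2) sum.atLeast_Suc_atMost) auto
        finally show ?thesis .
      qed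
      moreover have "(\<Sum>i=2..?N n. ?\<Delta> n t i * J n i t) =
         (\<Sum>i=2..?N n. ?\<Delta> n t i * (as n i * us n t * cs n i t)) - (\<Sum>i=2..?N n. ?\<Delta> n t i * (bs n (i + 1) * cs n (i + 1) t))"
        unfolding sum_subtractf[symmetric] by (intro sum.cong refl) (simp add: S_J_ge2 right_diff_distrib)
      ultimately have "Hn n t = (\<Sum>i=2..?N n. e n * \<phi>t (t, e n * real i) * cs n i t +
         (?\<Delta> n t i * (as n i * us n t * cs n i t) - (if i = 2 then 0 else ?\<Delta> n t (i - 1) * bs n i) * cs n i t))"
        unfolding Hn_def by (simp add: sum.distrib sum_subtractf)
      also have "\<dots> = (\<Sum>i=2..?N n. e n * w n i * cs n i t)"
      proof (intro sum.cong refl)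
        fix i
        have "e n * w n i = e n * \<phi>t (t, e n * real i) + ?\<Delta> n t i * (as n i * us n t)
          - (if i = 2 then 0 else ?\<Delta> n t (i - 1) * bs n i)"
          unfolding w_def using e0 by (simp add: distrib_left right_diff_distrib)
        moreover have "p * v + (q * (k * v) - l * v) = (p + q * k - l) * v" for p q k l v :: real
          by (simp add: algebra_simps)
        ultimately show "e n * \<phi>t (t, e n * real i) * cs n i t + (?\<Delta> n t i * (as n i * us n t * cs n i t)
            - (if i = 2 then 0 else ?\<Delta> n t (i - 1) * bs n i) * cs n i t) = e n * w n i * cs n i t"
          by simp
      qed
      finally show ?thesis .
    qed
    have quot_le: "\<bar>?\<Delta> n t i / e n\<bar> \<le> B" for n i
      using \<Delta>_le[OF t'(1,2), of n i] e_pos[of n] by (simp add: pos_divide_le_eq)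
    have a_bound: "0 \<le> as n i" "as n i \<le> K * (2 + R)" if "2 \<le> i" "e n * real i \<le> R + 1" for n i
    proof -
      interpret Y: BD_system r "e n" "\<alpha>s n" "\<beta>s n" K "ms n" "as n" "bs n" "us n" "cs n" by (rule sys)
      show "0 \<le> as n i" by (rule Y.a_nonneg[OF that(1)])
      have "K * (1 + e n * real i) \<le> K * (2 + R)" using that const_nonneg by (intro mult_left_mono) auto
      then show "as n i \<le> K * (2 + R)" using Y.a_le[OF that(1)] by linarith
    qed
    have "\<bar>w n 2\<bar> \<le> B + B * (K * 3 * M)" for n
    proof -
      interpret Y: BD_system r "e n" "\<alpha>s n" "\<beta>s n" K "ms n" "as n" "bs n" "us n" "cs n" by (rule sys)
      have "as n 2 \<le> K * (1 + e n * 2)" using Y.a_le[of 2] by simp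
      also have "\<dots> \<le> K * 3" using e_le[of n] const_nonneg by (intro mult_left_mono) auto
      finally have "\<bar>as n 2 * us n t\<bar> \<le> K * 3 * M"
        using Y.a_nonneg[of 2] us_nonneg[OF t'(1), of n] us_le[OF t'(1), of n] const_nonneg
        unfolding abs_mult by (intro mult_mono) auto
      then have "\<bar>?\<Delta> n t 2 / e n\<bar> * \<bar>as n 2 * us n t\<bar> \<le> B * (K * 3 * M)"
        using quot_le[of n 2] B by (intro mult_mono) auto
      then have "\<bar>?\<Delta> n t 2 / e n * (as n 2 * us n t)\<bar> \<le> B * (K * 3 * M)" by (simp only: abs_mult)
      moreover have "\<bar>\<phi>t (t, e n * real 2)\<bar> \<le> B" using bt[OF t'(1,2)] e_pos[of n] by simp
      moreover have "w n 2 = \<phi>t (t, e n * real 2) + ?\<Delta> n t 2 / e n * (as n 2 * us n t)" by (simp add: w_def)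
      ultimately show ?thesis by linarith
    qed
    note w2 = this
    have "bounded (a ` {0..R+1})"
      by (intro compact_imp_bounded compact_continuous_image continuous_on_subset[OF a_cont]) auto
    then obtain A0 where A0: "0 < A0" "\<And>x. 0 \<le> x \<Longrightarrow> x \<le> R + 1 \<Longrightarrow> \<bar>a x\<bar> \<le> A0"
      unfolding bounded_pos by (auto simp: image_iff)
    have "bounded (b ` {0..R+1})"
      by (intro compact_imp_bounded compact_continuous_image continuous_on_subset[OF b_cont]) auto
    then obtain B0 where B0: "0 < B0" "\<And>x. 0 \<le> x \<Longrightarrow> x \<le> R + 1 \<Longrightarrow> \<bar>b x\<bar> \<le> B0"
      unfolding bounded_pos by (auto simp: image_iff)
    have close: "\<forall>\<^sub>F n in sequentially. \<forall>i. 3 \<le> i \<longrightarrow> i \<le> ?N n \<longrightarrow> \<bar>w n i - \<psi> (e n * real i)\<bar> \<le> \<epsilon>"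
      if \<epsilon>: "0 < \<epsilon>" for \<epsilon>
    proof -
      define k where "k = K * (2 + R) * M + B * M + B * A0 + B + B0"
      have "0 \<le> K * (2 + R) * M" "0 \<le> B * M" "0 \<le> B * A0" using const_nonneg R B A0 by simp_all
      then have k: "0 < k" unfolding k_def using B B0(1) by linarith
      define \<delta> where "\<delta> = \<epsilon> / k"
      have \<delta>: "0 < \<delta>" using \<epsilon> k by (simp add: \<delta>_def)
      obtain d where d: "0 < d" "\<And>x y. 0 \<le> x \<Longrightarrow> 0 \<le> y \<Longrightarrow> \<bar>x - y\<bar> < d \<Longrightarrow> \<bar>\<phi>x (t, x) - \<phi>x (t, y)\<bar> \<le> \<delta>"
        by (rule Cc_half_line_uniformly_continuous[OF \<phi>x_Cc \<delta>]) blast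
      have ev_e: "\<forall>\<^sub>F n in sequentially. e n < d" using e_lim d(1) by (intro order_tendstoD(2)) auto
      have ev_u: "\<forall>\<^sub>F n in sequentially. dist (us n t) (U t) < \<delta>"
        using us_tendsto[OF t'(3)] \<delta> by (rule tendstoD)
      show ?thesis
        using ev_e ev_u a_conv[OF \<delta>, of "R + 1"] b_conv[OF \<delta>, of "R + 1"]
      proof eventually_elim
        case (elim n)
        show ?case
        proof (intro allI impI)
          fix i assume i: "3 \<le> i" "i \<le> ?N n"
          define x where "x = e n * real i"
          have e0: "0 < e n" "e n \<le> 1" using e_pos e_le by auto
          have "real (?N n) \<le> R / e n + 1 \<or> ?N n = 2" using R e0 unfolding cells_def by linarith
          then have "real i \<le> R / e n + 1" using i by auto
          then have "x \<le> R + e n" using e0 by (simp add: x_def field_simps)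
          then have x: "0 < x" "x \<le> R + 1" using e0 i by (auto simp: x_def)
          have x1: "e n * real (i + 1) = x + e n" and x2: "e n * real (i - 1) = x - e n" "0 < x - e n"
            using i e0 by (auto simp: x_def algebra_simps of_nat_diff)
          obtain \<xi> where \<xi>: "x < \<xi>" "\<xi> < x + e n" "\<phi> (t, x + e n) - \<phi> (t, x) = e n * \<phi>x (t, \<xi>)"
            using mvt[OF t'(1,2) x(1), of "x + e n"] e0 by auto
          obtain \<zeta> where \<zeta>: "x - e n < \<zeta>" "\<zeta> < x" "\<phi> (t, x) - \<phi> (t, x - e n) = e n * \<phi>x (t, \<zeta>)"
            using mvt[OF t'(1,2) x2(2), of x] e0 by auto
          have D1: "?\<Delta> n t i / e n = \<phi>x (t, \<xi>)" using \<xi>(3) e0 by (simp only: x1 x_def[symmetric]) simp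
          have "i - 1 + 1 = i" using i by simp
          then have D2: "?\<Delta> n t (i - 1) / e n = \<phi>x (t, \<zeta>)"
            using \<zeta>(3) e0 by (simp only: x2 x_def[symmetric]) simp
          have w_eq: "w n i = \<phi>t (t, x) + \<phi>x (t, \<xi>) * (as n i * us n t) - \<phi>x (t, \<zeta>) * bs n i"
            using i(1) unfolding w_def D1 D2 x_def by simp
          have near: "\<bar>\<phi>x (t, \<xi>) - \<phi>x (t, x)\<bar> \<le> \<delta>" "\<bar>\<phi>x (t, \<zeta>) - \<phi>x (t, x)\<bar> \<le> \<delta>"
            using \<xi> \<zeta> x x2 elim(1) by (auto intro!: d(2))
          have Bx: "\<bar>\<phi>x (t, x)\<bar> \<le> B" "\<bar>\<phi>x (t, \<zeta>)\<bar> \<le> B" using bx[OF t'(1,2)] x \<zeta> x2 by auto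
          have ai: "0 \<le> as n i" "as n i \<le> K * (2 + R)" using a_bound[of i n] i x by (auto simp: x_def)
          have aa: "\<bar>as n i - a x\<bar> \<le> \<delta>" "\<bar>bs n i - b x\<bar> \<le> \<delta>" using elim(3,4) i x by (auto simp: x_def)
          have uu: "0 \<le> us n t" "us n t \<le> M" "\<bar>us n t - U t\<bar> \<le> \<delta>"
            using us_nonneg[OF t'(1)] us_le[OF t'(1)] elim(2) by (auto simp: dist_real_def)
          have "\<bar>(\<phi>x (t, \<xi>) - \<phi>x (t, x)) * (as n i * us n t)\<bar> \<le> \<delta> * (K * (2 + R) * M)"
            unfolding abs_mult using near ai uu \<delta> R const_nonneg by (intro mult_mono) auto
          moreover have "\<bar>\<phi>x (t, x) * ((as n i - a x) * us n t)\<bar> \<le> B * (\<delta> * M)"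
            unfolding abs_mult using Bx(1) aa(1) uu(1,2) \<delta> B const_nonneg(2) by (intro mult_mono) auto
          moreover have "\<bar>\<phi>x (t, x) * (a x * (us n t - U t))\<bar> \<le> B * (A0 * \<delta>)"
            unfolding abs_mult using Bx A0(2)[of x] x uu B A0(1) by (intro mult_mono) auto
          moreover have "\<bar>\<phi>x (t, \<zeta>) * (bs n i - b x)\<bar> \<le> B * \<delta>"
            unfolding abs_mult using Bx aa B by (intro mult_mono) auto
          moreover have "\<bar>(\<phi>x (t, \<zeta>) - \<phi>x (t, x)) * b x\<bar> \<le> \<delta> * B0"
            unfolding abs_mult using near B0(2)[of x] x \<delta> by (intro mult_mono) auto
          moreover have "w n i - \<psi> x = (\<phi>x (t, \<xi>) - \<phi>x (t, x)) * (as n i * us n t)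
            + \<phi>x (t, x) * ((as n i - a x) * us n t) + \<phi>x (t, x) * (a x * (us n t - U t))
            - \<phi>x (t, \<zeta>) * (bs n i - b x) - (\<phi>x (t, \<zeta>) - \<phi>x (t, x)) * b x"
            unfolding w_eq \<psi>_def by (simp add: algebra_simps)
          moreover have "\<bar>v1 + v2 + v3 - v4 - v5\<bar> \<le> k1 + k2 + k3 + k4 + k5"
            if "\<bar>v1\<bar> \<le> k1" "\<bar>v2\<bar> \<le> k2" "\<bar>v3\<bar> \<le> k3" "\<bar>v4\<bar> \<le> k4" "\<bar>v5\<bar> \<le> k5"
            for v1 v2 v3 v4 v5 k1 k2 k3 k4 k5 :: real using that by linarith
          ultimately have "\<bar>w n i - \<psi> x\<bar> \<le> \<delta> * (K * (2 + R) * M) + B * (\<delta> * M) + B * (A0 * \<delta>) + B * \<delta> + \<delta> * B0"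
            by metis
          also have "\<dots> = \<delta> * k" by (simp add: k_def algebra_simps)
          also have "\<dots> = \<epsilon>" using k by (simp add: \<delta>_def)
          finally show "\<bar>w n i - \<psi> (e n * real i)\<bar> \<le> \<epsilon>" by (simp add: x_def)
        qed
      qed
    qed
    have "(\<lambda>n. \<Sum>i=2..?N n. e n * w n i * cs n i t) \<longlonglongrightarrow> (\<integral>x. \<psi> x \<partial>\<mu> t)"
      by (rule weighted_sum_limit[OF t'(3) \<psi>_Cc \<psi>_zero close w2])
    then show ?thesis by (simp add: Hn_w h_def \<psi>_def)
  qed

  have dominated: "h integrable_on {0..S}" "(\<lambda>n. integral {0..S} (Hn n)) \<longlonglongrightarrow> integral {0..S} h"
    using dominated_convergence[of Hn "{0..S}" "\<lambda>_. B * (Z + flux_const)" h] Hn_bound Hn_lim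
    by (auto intro: integrable_continuous_real Hn_cont)
  have h_bound: "\<bar>h t\<bar> \<le> B * (Z + flux_const)" if "t \<in> {0..S}" for t
    by (rule LIMSEQ_le_const2[OF tendsto_rabs[OF Hn_lim[OF that]]]) (use Hn_bound that in auto)
  have h_zero: "h t = 0" if "S < t" "t < T" for t
  proof -
    have "h t = (\<integral>x. 0 \<partial>\<mu> t)"
      unfolding h_def using that S zt[of t] zx[of t] finite_borel_measurable(2)[OF \<mu>_finite, of t]
      by (intro Bochner_Integration.integral_cong) auto
    then show ?thesis by simp
  qed

  have U_cont: "continuous_on {0..S} U" by (rule continuous_on_subset[OF U_continuous ST(1)])
  have NU_cont: "continuous_on {0..S} (\<lambda>t. N (U t))"
    by (rule continuous_on_compose2[OF N_continuous U_cont]) (use U_range ST in auto)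
  have us_rng: "us n ` {0..S} \<subseteq> {ul..M}" for n using us_range ST by blast
  have Nu_cont: "continuous_on {0..S} (\<lambda>t. N (us n t))" for n
    by (rule continuous_on_compose2[OF N_continuous continuous_on_subset[OF us_cont ST(3)] us_rng])
  have "bounded (N ` {ul..M})"
    by (intro compact_imp_bounded compact_continuous_image N_continuous) auto
  then obtain BN where BN: "0 < BN" "\<And>y. y \<in> {ul..M} \<Longrightarrow> \<bar>N y\<bar> \<le> BN"
    unfolding bounded_pos by (auto simp: image_iff)
  let ?NU = "\<lambda>t. \<phi> (t, 0) * N (U t)"
  have NU_lim: "(\<lambda>n. integral {0..S} (\<lambda>t. \<phi> (t, 0) * N (us n t))) \<longlonglongrightarrow> integral {0..S} ?NU"
  proof (rule dominated_convergence(2))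
    show "(\<lambda>t. \<phi> (t, 0) * N (us n t)) integrable_on {0..S}" for n
      by (intro integrable_continuous_real continuous_intros cont_t Nu_cont) auto
    show "(\<lambda>_. B * BN) integrable_on {0..S}" by auto
    fix t assume t: "t \<in> {0..S}"
    then have tT: "t \<in> {0..T}" "0 \<le> t" "t < T" using S by auto
    show "norm (\<phi> (t, 0) * N (us n t)) \<le> B * BN" for n
      unfolding norm_mult using b\<phi>[of t 0] BN(2)[OF us_range[OF tT(1)], of n] tT B by (intro mult_mono) auto
    have "(\<lambda>n. N (us n t)) \<longlonglongrightarrow> N (U t)"
      by (rule continuous_on_tendsto_compose[OF N_continuous us_tendsto[OF tT(1)] U_range[OF tT(1)]])
         (use us_range[OF tT(1)] in auto)
    then show "(\<lambda>n. \<phi> (t, 0) * N (us n t)) \<longlonglongrightarrow> \<phi> (t, 0) * N (U t)" by (intro tendsto_intros)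
  qed
  have qss: "(\<lambda>n. integral {0..S} (\<lambda>t. \<phi> (t, 0) * (J n 1 t - N (us n t)))) \<longlonglongrightarrow> 0"
  proof (rule quasi_steady_state[where \<psi>' = "\<lambda>t. \<phi>t (t, 0)" and C = B])
    fix t assume t: "0 \<le> t" "t \<le> S"
    then show "((\<lambda>t. \<phi> (t, 0)) has_real_derivative \<phi>t (t, 0)) (at t within {0..S})"
      using S by (intro has_field_derivative_subset[OF dt]) auto
    show "\<bar>\<phi> (t, 0)\<bar> \<le> B" "\<bar>\<phi>t (t, 0)\<bar> \<le> B" using t S b\<phi>[of t 0] bt[of t 0] by auto
  qed (use S in auto)
  obtain D where D: "0 \<le> D" "\<And>n t. t \<in> {0..T} \<Longrightarrow> \<bar>J n 1 t\<bar> \<le> D" by (rule dimer_bounds) blast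
  \<comment> \<open>the boundary value is taken at the smallest size \<open>2 * e n\<close> instead of \<open>0\<close>\<close>
  have shift: "(\<lambda>n. integral {0..S} (\<lambda>t. (\<phi> (t, e n * 2) - \<phi> (t, 0)) * J n 1 t)) \<longlonglongrightarrow> 0"
  proof (rule Lim_null_comparison[OF always_eventually])
    show "\<forall>n. norm (integral {0..S} (\<lambda>t. (\<phi> (t, e n * 2) - \<phi> (t, 0)) * J n 1 t)) \<le> (B * (e n * 2)) * D * (S - 0)"
    proof
      fix n
      show "norm (integral {0..S} (\<lambda>t. (\<phi> (t, e n * 2) - \<phi> (t, 0)) * J n 1 t)) \<le> (B * (e n * 2)) * D * (S - 0)"
      proof (rule integral_bound)
        show "continuous_on {0..S} (\<lambda>t. (\<phi> (t, e n * 2) - \<phi> (t, 0)) * J n 1 t)"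
          using e_pos[of n] by (intro continuous_intros cont_t J_cont) auto
        fix t assume t: "t \<in> {0..S}"
        have "\<bar>\<phi> (t, e n * 2) - \<phi> (t, 0)\<bar> \<le> B * (e n * 2)"
          using lip[of t "e n * 2" 0] t S e_pos[of n] by auto
        then show "norm ((\<phi> (t, e n * 2) - \<phi> (t, 0)) * J n 1 t) \<le> (B * (e n * 2)) * D"
          unfolding norm_mult using D(2)[of t n] t ST(1) B e_pos[of n] by (intro mult_mono) auto
      qed (use S in simp)
    qed
    have "(\<lambda>n. (B * (e n * 2)) * D * (S - 0)) \<longlonglongrightarrow> (B * (0 * 2)) * D * (S - 0)"
      by (intro tendsto_intros e_lim)
    then show "(\<lambda>n. (B * (e n * 2)) * D * (S - 0)) \<longlonglongrightarrow> 0" by simp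
  qed
  have bdry_lim: "(\<lambda>n. integral {0..S} (\<lambda>t. \<phi> (t, e n * 2) * J n 1 t)) \<longlonglongrightarrow> integral {0..S} ?NU"
  proof -
    have split: "integral {0..S} (\<lambda>t. \<phi> (t, e n * 2) * J n 1 t) =
       integral {0..S} (\<lambda>t. (\<phi> (t, e n * 2) - \<phi> (t, 0)) * J n 1 t)
       + (integral {0..S} (\<lambda>t. \<phi> (t, 0) * (J n 1 t - N (us n t)))
       + integral {0..S} (\<lambda>t. \<phi> (t, 0) * N (us n t)))" for n
    proof -
      have i1: "(\<lambda>t. (\<phi> (t, e n * 2) - \<phi> (t, 0)) * J n 1 t) integrable_on {0..S}"
        and i2: "(\<lambda>t. \<phi> (t, 0) * (J n 1 t - N (us n t))) integrable_on {0..S}"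
        and i3: "(\<lambda>t. \<phi> (t, 0) * N (us n t)) integrable_on {0..S}"
        using e_pos[of n]
        by (auto intro!: integrable_continuous_real continuous_intros cont_t J_cont[simplified] Nu_cont)
      show ?thesis
        unfolding Henstock_Kurzweil_Integration.integral_add[OF i2 i3, symmetric]
          Henstock_Kurzweil_Integration.integral_add[OF i1 integrable_add[OF i2 i3], symmetric]
        by (intro Henstock_Kurzweil_Integration.integral_cong) (simp add: algebra_simps)
    qed
    have "(\<lambda>n. integral {0..S} (\<lambda>t. (\<phi> (t, e n * 2) - \<phi> (t, 0)) * J n 1 t)
       + (integral {0..S} (\<lambda>t. \<phi> (t, 0) * (J n 1 t - N (us n t)))
       + integral {0..S} (\<lambda>t. \<phi> (t, 0) * N (us n t)))) \<longlonglongrightarrow> 0 + (0 + integral {0..S} ?NU)"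
      by (intro tendsto_add shift qss NU_lim)
    then show ?thesis unfolding split by simp
  qed

  have "(\<lambda>n. integral {0..S} (Hn n) + integral {0..S} (\<lambda>t. \<phi> (t, e n * 2) * J n 1 t)) \<longlonglongrightarrow>
     integral {0..S} h + integral {0..S} ?NU"
    by (intro tendsto_add dominated(2) bdry_lim)
  moreover have "(\<lambda>n. integral {0..S} (Hn n) + integral {0..S} (\<lambda>t. \<phi> (t, e n * 2) * J n 1 t)) \<longlonglongrightarrow>
     - (\<integral>x. \<phi> (0, x) \<partial>\<mu>_in)"
    unfolding balance by (intro tendsto_minus init_lim)
  ultimately have eq: "integral {0..S} h + integral {0..S} ?NU = - (\<integral>x. \<phi> (0, x) \<partial>\<mu>_in)"
    by (rule LIMSEQ_unique)
  have "(\<integral>t. h t \<partial>lebesgue_on {0..<T}) = integral {0..S} h"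
    by (rule lebesgue_on_integral_eq[OF _ S(2) dominated(1) h_bound h_zero]) (use S in auto)
  moreover have "(\<integral>s. \<phi> (s, 0) * N (U s) \<partial>lebesgue_on {0..<T}) = integral {0..S} ?NU"
  proof (rule lebesgue_on_integral_eq[where B = "B * BN"])
    show "?NU integrable_on {0..S}" by (intro integrable_continuous_real continuous_intros cont_t NU_cont) auto
    show "\<bar>?NU t\<bar> \<le> B * BN" if "t \<in> {0..S}" for t
      unfolding abs_mult using b\<phi>[of t 0] BN(2)[OF U_range, of t] that S B by (intro mult_mono) auto
    show "?NU t = 0" if "S < t" "t < T" for t using z[of t 0] that S by simp
  qed (use S in auto)
  ultimately show ?thesis using eq unfolding h_def by simp
qed

lemma is_N_solution: "N_solution T a b \<rho> u_in \<mu>_in mass N \<mu>"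
proof -
  have L: "\<mu> \<in> Linf_measures T {0..}"
    unfolding Linf_measures_def
    using \<mu>_finite \<mu>_le \<mu>_continuous
    by (auto intro!: continuous_imp_measurable_on_sets_lebesgue AE_I2 exI[of _ "Z + 2 * M + 1"]
        simp: space_restrict_space)
  have inf: "\<rho> < (INF t\<in>{0..T}. U t)"
  proof -
    have "ul \<le> (INF t\<in>{0..T}. U t)" using U_range T by (intro cINF_greatest) auto
    then show ?thesis using ul by linarith
  qed
  show ?thesis
    unfolding N_solution_def
  proof (intro conjI exI[of _ U] bexI[of _ \<mu>] ballI allI impI L inf)
    show "continuous_on {0..T} U" by (rule U_continuous)
    show "U 0 = u_in" by (rule U_0)
    show "0 \<le> U t" if "t \<in> {0..T}" for t using U_range[OF that] ul by auto
    show "AE t in lebesgue_on {0..T}. \<mu> t = \<mu> t" by simp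
    show "integrable (\<mu> t) (\<lambda>x. x)" if "t \<in> {0..T}" for t by (rule \<mu>_moment[OF that])
    show "U t + (\<integral>x. x \<partial>\<mu> t) = mass" for t by (simp add: U_def)
  qed (rule weak_equation)
qed

end


section \<open>From the hypotheses on the data to the uniform bounds\<close>

text \<open>
  The time \<open>T\<close> depends only on the constants of the locale, so that it is the same for a subsequence.
\<close>
lemma (in BD_sequence) subsequence:
  assumes s: "strict_mono s"
  shows "BD_sequence r abar \<rho> \<alpha> \<beta> K A M Z0 u_low u_in (\<lambda>n. e (s n)) (\<lambda>n. \<alpha>s (s n)) (\<lambda>n. \<beta>s (s n))
    (\<lambda>n. ms (s n)) (\<lambda>n. as (s n)) (\<lambda>n. bs (s n)) (\<lambda>n. us (s n)) (\<lambda>n. cs (s n)) a b N \<mu>_in"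
proof -
  have lim: "(\<lambda>n. X (s n)) \<longlonglongrightarrow> L" if "X \<longlonglongrightarrow> L" for X and L :: real
    using LIMSEQ_subseq_LIMSEQ[OF that s] by (simp add: o_def)
  have ev: "\<forall>\<^sub>F n in sequentially. P (s n)" if "\<forall>\<^sub>F n in sequentially. P n" for P
    using eventually_subseq[OF s that] .
  show ?thesis
  proof (rule BD_sequence.intro)
    show "\<exists>x0>0. \<forall>n i. e (s n) * real i < x0 \<longrightarrow>
       (2 \<le> i \<longrightarrow> \<bar>as (s n) i - abar * (e (s n) * real i) powr r\<bar> \<le> \<kappa> * (e (s n) * real i) powr r) \<and>
       (3 \<le> i \<longrightarrow> \<bar>bs (s n) i - abar * \<rho> * (e (s n) * real i) powr r\<bar> \<le> \<kappa> * (e (s n) * real i) powr r)"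
      if "0 < \<kappa>" for \<kappa> using rates[OF that] by blast
    show "\<exists>S. \<forall>n k. (\<Sum>i=2..k. e (s n) powr r * cs (s n) i 0 * exp (- real i * z)) \<le> S"
      if "0 < z" "z < 1" for z using exp_init[OF that] by blast
    show "\<exists>R>0. \<forall>n k. (\<Sum>i\<in>{i\<in>{2..k}. R \<le> e (s n) * real i}. (e (s n))\<^sup>2 * real i * cs (s n) i 0) \<le> \<epsilon>"
      if "0 < \<epsilon>" for \<epsilon> using tail_init[OF that] by blast
    show "weak_star_tendsto {0..} (\<lambda>n. density_on {0..} (step_fun 2 (e (s n)) (\<lambda>i. cs (s n) i 0))) \<mu>_in sequentially"
      using f_in_lim unfolding weak_star_tendsto_def by (intro ballI lim) blast
    show "(\<lambda>n. e (s n)) \<longlonglongrightarrow> 0" "(\<lambda>n. \<alpha>s (s n)) \<longlonglongrightarrow> \<alpha>" "(\<lambda>n. \<beta>s (s n)) \<longlonglongrightarrow> \<beta>" "(\<lambda>n. us (s n) 0) \<longlonglongrightarrow> u_in"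
      by (intro lim e_lim \<alpha>s_lim \<beta>s_lim u0_lim)+
    show "\<forall>\<^sub>F n in sequentially. \<forall>i\<ge>2. e (s n) * real i \<le> R \<longrightarrow> \<bar>as (s n) i - a (e (s n) * real i)\<bar> \<le> \<epsilon>"
      "\<forall>\<^sub>F n in sequentially. \<forall>i\<ge>3. e (s n) * real i \<le> R \<longrightarrow> \<bar>bs (s n) i - b (e (s n) * real i)\<bar> \<le> \<epsilon>"
      if "0 < \<epsilon>" for \<epsilon> R by (rule ev[OF a_conv[OF that]] ev[OF b_conv[OF that]])+
  qed (fact sys r_less \<alpha>s_le \<beta>s_le ms_le pos zeroth_init u_low u0_ge a_cont b_cont \<mu>_in N_eq)+
qed

lemma small_size_eventually:
  assumes "eventually P (small_size k)"
  obtains x0 where "0 < x0" "\<And>eps i. 0 < eps \<Longrightarrow> k \<le> i \<Longrightarrow> eps * real i < x0 \<Longrightarrow> P (eps, i)"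
proof -
  obtain Q where Q: "eventually Q (nhds 0)"
    "\<And>eps i. Q (eps * real i) \<Longrightarrow> 0 < eps \<Longrightarrow> k \<le> i \<Longrightarrow> P (eps, i)"
    using assms unfolding small_size_def eventually_inf_principal eventually_filtercomap by auto
  obtain d where d: "0 < d" "\<And>x. dist x 0 < d \<Longrightarrow> Q x" using Q(1) unfolding eventually_nhds_metric by blast
  show ?thesis by (rule that[OF d(1)]) (use Q(2) d(2) in \<open>auto simp: dist_real_def\<close>)
qed

lemma rate_near_zero:
  fixes a :: "real \<Rightarrow> real" and s :: "real \<Rightarrow> nat \<Rightarrow> real"
  assumes equiv: "a \<sim>[at_right 0] (\<lambda>x. c * x powr r)" and c: "0 < c" and k: "1 \<le> k"
    and small: "(\<lambda>(eps, i). s eps i - a (eps * real i)) \<in> o[small_size k](\<lambda>(eps, i). (eps * real i) powr r)"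
    and \<kappa>: "0 < \<kappa>"
  obtains x0 where "0 < x0" "\<And>eps i. 0 < eps \<Longrightarrow> k \<le> i \<Longrightarrow> eps * real i < x0 \<Longrightarrow>
    \<bar>s eps i - c * (eps * real i) powr r\<bar> \<le> \<kappa> * (eps * real i) powr r"
proof -
  have "(\<lambda>x. a x - c * x powr r) \<in> o[at_right 0](\<lambda>x. c * x powr r)"
    by (rule asymp_equiv_imp_diff_smallo[OF equiv])
  then have "\<forall>\<^sub>F x in at_right 0. norm (a x - c * x powr r) \<le> \<kappa> / (2 * c) * norm (c * x powr r)"
    using \<kappa> c by (intro landau_o.smallD) auto
  then obtain x1 where x1: "0 < x1" "\<And>x. 0 < x \<Longrightarrow> x < x1 \<Longrightarrow> \<bar>a x - c * x powr r\<bar> \<le> \<kappa> / 2 * x powr r"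
    using c unfolding eventually_at_right_field by (auto simp: abs_mult)
  have "\<forall>\<^sub>F p in small_size k. norm (case p of (eps, i) \<Rightarrow> s eps i - a (eps * real i))
      \<le> \<kappa> / 2 * norm (case p of (eps, i) \<Rightarrow> (eps * real i) powr r)"
    using \<kappa> by (intro landau_o.smallD[OF small]) auto
  then obtain x2 where x2: "0 < x2" "\<And>eps i. 0 < eps \<Longrightarrow> k \<le> i \<Longrightarrow> eps * real i < x2 \<Longrightarrow>
      \<bar>s eps i - a (eps * real i)\<bar> \<le> \<kappa> / 2 * (eps * real i) powr r"
    by (rule small_size_eventually) auto
  show ?thesis
  proof (rule that[of "min x1 x2"])
    fix eps :: real and i :: nat assume *: "0 < eps" "k \<le> i" "eps * real i < min x1 x2"
    have "0 < eps * real i" using * k by simp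
    then have "\<bar>a (eps * real i) - c * (eps * real i) powr r\<bar> \<le> \<kappa> / 2 * (eps * real i) powr r"
      using * by (intro x1) auto
    moreover have "\<bar>s eps i - a (eps * real i)\<bar> \<le> \<kappa> / 2 * (eps * real i) powr r" using * by (intro x2) auto
    moreover have "\<kappa> / 2 * (eps * real i) powr r + \<kappa> / 2 * (eps * real i) powr r = \<kappa> * (eps * real i) powr r" by simp
    ultimately show "\<bar>s eps i - c * (eps * real i) powr r\<bar> \<le> \<kappa> * (eps * real i) powr r" by linarith
  qed (use x1 x2 in auto)
qed

lemma ratio_limit:
  fixes a b :: "real \<Rightarrow> real"
  assumes a: "a \<sim>[at_right 0] (\<lambda>x. abar * x powr r)" and b: "b \<sim>[at_right 0] (\<lambda>x. bbar * x powr q)"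
    and pos: "0 < abar" and rq: "r \<le> q" and rho: "((\<lambda>x. b x / a x) \<longlongrightarrow> \<rho>) (at_right 0)"
  shows "\<rho> = (if r = q then bbar / abar else 0)"
proof -
  have "(\<lambda>x. b x / a x) \<sim>[at_right 0] (\<lambda>x. (bbar * x powr q) / (abar * x powr r))"
    by (intro asymp_equiv_intros a b)
  then have "((\<lambda>x. (bbar * x powr q) / (abar * x powr r)) \<longlongrightarrow> \<rho>) (at_right 0)"
    using rho tendsto_asymp_equiv_cong by blast
  moreover have "\<forall>\<^sub>F x in at_right 0. (bbar * x powr q) / (abar * x powr r) = bbar / abar * x powr (q - r)"
    unfolding eventually_at_right_field by (intro exI[of _ 1]) (auto simp: powr_diff)
  ultimately have lim: "((\<lambda>x. bbar / abar * x powr (q - r)) \<longlongrightarrow> \<rho>) (at_right 0)"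
    by (rule Lim_transform_eventually)
  show ?thesis
  proof (cases "r = q")
    case True
    have "\<forall>\<^sub>F x in at_right (0::real). bbar / abar * x powr (q - r) = bbar / abar"
      unfolding eventually_at_right_field using True by (intro exI[of _ 1]) auto
    from tendsto_unique[OF _ Lim_transform_eventually[OF lim this] tendsto_const] show ?thesis
      using True by simp
  next
    case False
    have "((\<lambda>x::real. x powr (q - r)) \<longlongrightarrow> 0) (at_right 0)"
    proof (rule tendsto_zero_powrI[OF tendsto_ident_at tendsto_const])
      show "\<forall>\<^sub>F x::real in at_right 0. 0 \<le> x" unfolding eventually_at_right_field by (intro exI[of _ 1]) auto
    qed (use False rq in auto)
    then have "((\<lambda>x. bbar / abar * x powr (q - r)) \<longlongrightarrow> bbar / abar * 0) (at_right 0)" by (intro tendsto_intros)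
    from tendsto_unique[OF _ lim this] show ?thesis using False by simp
  qed
qed

lemma higher_power_negligible:
  assumes "r < q" "0 < C" "0 < \<kappa>"
  obtains x0 where "0 < (x0::real)" "\<And>x. 0 < x \<Longrightarrow> x < x0 \<Longrightarrow> C * x powr q \<le> \<kappa> * x powr r"
proof -
  define x0 where "x0 = (\<kappa> / C) powr (1 / (q - r))"
  show ?thesis
  proof (rule that[of x0])
    show "0 < x0" using assms by (simp add: x0_def)
    fix x :: real assume x: "0 < x" "x < x0"
    have "x powr (q - r) \<le> x0 powr (q - r)" using x assms by (intro powr_mono2) auto
    also have "\<dots> = \<kappa> / C" using assms by (simp add: x0_def powr_powr)
    finally have "C * x powr (q - r) \<le> \<kappa>" using assms by (simp add: field_simps)
    then have "(C * x powr (q - r)) * x powr r \<le> \<kappa> * x powr r" by (intro mult_right_mono) auto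
    then show "C * x powr q \<le> \<kappa> * x powr r" by (simp add: mult.assoc powr_add[symmetric])
  qed
qed

text \<open>
  The cutoff equals \<open>1\<close> up to \<open>R + 1\<close>, hence on all cells around points below \<open>R\<close>.  It is a test
  function, so that weak-star convergence bounds the number of clusters of bounded size.
\<close>
lemma small_sizes_mass_le:
  assumes e: "0 < e" "e \<le> 1" and s: "\<And>i. 2 \<le> i \<Longrightarrow> 0 \<le> s i" and R: "0 < R"
  shows "(\<Sum>i\<in>{i\<in>{2..k}. e * real i \<le> R}. e * s i) \<le>
    (\<integral>x. max 0 (min 1 (R + 2 - x)) \<partial>density_on {0..} (step_fun 2 e s))"
proof -
  let ?\<phi> = "\<lambda>x::real. max 0 (min 1 (R + 2 - x))"
  have c: "continuous_on {0..} ?\<phi>" by (intro continuous_intros)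
  define n where "n = max 2 (nat \<lceil>(R + 2) / e\<rceil>)"
  have "(R + 2) / e \<le> real n" unfolding n_def by linarith
  then have n: "2 \<le> n" "R + 2 \<le> e * real n" using e by (auto simp: n_def field_simps)
  let ?c = "\<lambda>i. \<integral>x. indicator (cell e i) x * ?\<phi> x \<partial>lborel"
  have c0: "0 \<le> ?c i" for i by (intro Bochner_Integration.integral_nonneg) auto
  have c1: "?c i = e" if "2 \<le> i" "e * real i \<le> R" for i
  proof -
    have "?c i = (\<integral>x. indicator (cell e i) x \<partial>lborel)"
    proof (intro Bochner_Integration.integral_cong refl)
      fix x :: real
      show "indicator (cell e i) x * ?\<phi> x = indicator (cell e i) x"
      proof (cases "x \<in> cell e i")
        case True
        have "x \<le> R + 1" using cell_bounds(3)[OF e(1) that(1) True] that(2) e by linarith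
        then show ?thesis by simp
      qed simp
    qed
    then show ?thesis by (simp add: measure_cell[OF e(1)])
  qed
  have "(\<Sum>i\<in>{i\<in>{2..k}. e * real i \<le> R}. e * s i) = (\<Sum>i\<in>{i\<in>{2..k}. e * real i \<le> R}. s i * ?c i)"
    using c1 by (intro sum.cong) auto
  also have "\<dots> \<le> (\<Sum>i=2..n. s i * ?c i)"
  proof (intro sum_mono2)
    show "{i\<in>{2..k}. e * real i \<le> R} \<subseteq> {2..n}"
    proof
      fix i assume i: "i \<in> {i\<in>{2..k}. e * real i \<le> R}"
      then have "e * real i \<le> e * real n" using n by auto
      then show "i \<in> {2..n}" using i e by simp
    qed
  qed (use s c0 in auto)
  also have "\<dots> = (\<integral>x. ?\<phi> x \<partial>density_on {0..} (step_fun 2 e s))"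
    by (rule step_fun_integral[OF e(1) s c _ n, symmetric]) auto
  finally show ?thesis .
qed

lemma SUP_suminf_bound:
  fixes F :: "real \<Rightarrow> nat \<Rightarrow> real"
  assumes fin: "(SUP eps\<in>{0<..}. \<Sum>i. ennreal (F eps (i + 2))) < \<infinity>"
    and nonneg: "\<And>eps i. 0 < eps \<Longrightarrow> 2 \<le> i \<Longrightarrow> 0 \<le> F eps i"
  obtains S where "\<And>eps k. 0 < eps \<Longrightarrow> (\<Sum>i=2..k. F eps i) \<le> S"
proof -
  define S where "S = enn2real (SUP eps\<in>{0<..}. \<Sum>i. ennreal (F eps (i + 2)))"
  have S: "(SUP eps\<in>{0<..}. \<Sum>i. ennreal (F eps (i + 2))) = ennreal S" "0 \<le> S"
    using fin by (auto simp: S_def)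
  have "(\<Sum>i=2..k. F eps i) \<le> S" if eps: "0 < eps" for eps k
  proof -
    have "ennreal (\<Sum>i<k-1. F eps (i + 2)) = (\<Sum>i<k-1. ennreal (F eps (i + 2)))"
      using nonneg[OF eps] by (intro sum_ennreal[symmetric]) auto
    also have "\<dots> \<le> (\<Sum>i. ennreal (F eps (i + 2)))" by (intro sum_le_suminf summableI) auto
    also have "\<dots> \<le> ennreal S" unfolding S(1)[symmetric] using eps by (intro SUP_upper) auto
    finally show ?thesis using S(2) by (simp add: sum_shift2)
  qed
  then show ?thesis by (rule that)
qed

text \<open>\<open>k\<close> is chosen such that \<open>2 * P / k\<close>, the bound of \<open>superlinear_moment_tail\<close>, is at most \<open>\<epsilon>\<close>.\<close>
lemma superlinear_tail:
  fixes c :: "real \<Rightarrow> nat \<Rightarrow> real"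
  assumes \<Phi>: "\<Phi> \<in> superlinear_weights"
    and fin: "(SUP eps\<in>{0<..}. \<integral>\<^sup>+x\<in>{0..}. ennreal (\<Phi> x * step_fun 2 eps (c eps) x) \<partial>lborel) < \<infinity>"
    and c: "\<And>eps i. 0 < eps \<Longrightarrow> 2 \<le> i \<Longrightarrow> 0 \<le> c eps i" and \<epsilon>: "0 < \<epsilon>"
  obtains R where "0 < R" "\<And>eps k. 0 < eps \<Longrightarrow>
    (\<Sum>i\<in>{i\<in>{2..k}. R \<le> eps * real i}. eps\<^sup>2 * real i * c eps i) \<le> \<epsilon>"
proof -
  have \<Phi>0: "\<And>x. 0 \<le> x \<Longrightarrow> 0 \<le> \<Phi> x" and \<Phi>_lim: "filterlim (\<lambda>x. \<Phi> x / x) at_top at_top"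
    using \<Phi> by (auto simp: superlinear_weights_def)
  define P where "P = enn2real (SUP eps\<in>{0<..}. \<integral>\<^sup>+x\<in>{0..}. ennreal (\<Phi> x * step_fun 2 eps (c eps) x) \<partial>lborel)"
  have P: "(SUP eps\<in>{0<..}. \<integral>\<^sup>+x\<in>{0..}. ennreal (\<Phi> x * step_fun 2 eps (c eps) x) \<partial>lborel) = ennreal P" "0 \<le> P"
    using fin by (auto simp: P_def)
  define k where "k = 2 * (P + 1) / \<epsilon>"
  have k: "0 < k" using P \<epsilon> by (simp add: k_def)
  have "\<forall>\<^sub>F x in at_top. k \<le> \<Phi> x / x" using \<Phi>_lim by (simp add: filterlim_at_top)
  then obtain r0 where r0: "\<And>x. r0 \<le> x \<Longrightarrow> k \<le> \<Phi> x / x" by (auto simp: eventually_at_top_linorder)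
  define r where "r = max 1 r0"
  have r: "k * x \<le> \<Phi> x" if "r \<le> x" for x
    using r0[of x] that by (simp add: r_def field_simps)
  have "(\<Sum>i\<in>{i\<in>{2..n}. 2 * r \<le> eps * real i}. eps\<^sup>2 * real i * c eps i) \<le> \<epsilon>" if eps: "0 < eps" for eps n
  proof -
    have "(\<Sum>i\<in>{i\<in>{2..n}. 2 * r \<le> eps * real i}. eps\<^sup>2 * real i * c eps i) \<le> 2 * P / k"
    proof (rule superlinear_moment_tail[OF eps c[OF eps] _ P(2) k \<Phi>0 r])
      show "(\<integral>\<^sup>+x\<in>{0..}. ennreal (\<Phi> x * step_fun 2 eps (c eps) x) \<partial>lborel) \<le> ennreal P"
        unfolding P(1)[symmetric] by (rule SUP_upper) (use eps in simp)
    qed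
    also have "\<dots> \<le> \<epsilon>"
    proof -
      have "2 * P \<le> \<epsilon> * k" using P \<epsilon> by (simp add: k_def)
      then show ?thesis using k by (simp add: pos_divide_le_eq)
    qed
    finally show ?thesis .
  qed
  then show ?thesis using that[of "2 * r"] by (simp add: r_def)
qed


section \<open>Convergence to the Lifshitz--Slyozov equation with nucleation\<close>

theorem theorem2:
  fixes \<eta> \<alpha> \<beta> K\<^sub>a K\<^sub>b r\<^sub>a r\<^sub>b abar bbar \<rho> u_in m :: real
    and \<alpha>e \<beta>e me :: "real \<Rightarrow> real"
    and ae be :: "real \<Rightarrow> nat \<Rightarrow> real"
    and ue :: "real \<Rightarrow> real \<Rightarrow> real"
    and ce :: "real \<Rightarrow> nat \<Rightarrow> real \<Rightarrow> real"
    and fe :: "real \<Rightarrow> real \<Rightarrow> real \<Rightarrow> real"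
    and a b N :: "real \<Rightarrow> real"
    and \<mu>_in :: "real measure"
    and \<epsilon> :: "nat \<Rightarrow> real"
  assumes eta: "0 \<le> \<eta>"
    \<comment> \<open>the rescaled Becker--Doering system, one for each \<open>eps > 0\<close>\<close>
    and rates_pos: "\<And>eps. 0 < eps \<Longrightarrow>
          0 < \<alpha>e eps \<and> 0 < \<beta>e eps \<and> (\<forall>i\<ge>2. 0 < ae eps i) \<and> (\<forall>i\<ge>3. 0 < be eps i)"
    and rates_incr: "\<And>eps. 0 < eps \<Longrightarrow>
          \<exists>K>0. (\<forall>i\<ge>2. ae eps (i + 1) - ae eps i \<le> K) \<and> (\<forall>i\<ge>3. be eps i - be eps (i + 1) \<le> K)"
    and BD: "\<And>eps. 0 < eps \<Longrightarrow>
          BD_solution \<eta> eps (\<alpha>e eps) (\<beta>e eps) (ae eps) (be eps) (me eps) (ue eps) (ce eps)"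
    and fe_def: "\<And>eps t x. fe eps t x = step_fun 2 eps (\<lambda>i. ce eps i t) x"
    \<comment> \<open>rates\<close>
    and limits_pos: "0 < \<alpha>" "0 < \<beta>"
    and a_b_cont: "continuous_on {0..} a" "continuous_on {0..} b"
    and a_b_nonneg: "\<And>x. 0 \<le> x \<Longrightarrow> 0 \<le> a x" "\<And>x. 0 \<le> x \<Longrightarrow> 0 \<le> b x"
    and a_b_pos: "\<And>x. 0 < x \<Longrightarrow> 0 < a x" "\<And>x. 0 < x \<Longrightarrow> 0 < b x"
    and \<alpha>_\<beta>_lim: "(\<alpha>e \<longlongrightarrow> \<alpha>) (at_right 0)" "(\<beta>e \<longlongrightarrow> \<beta>) (at_right 0)"
    and a_lim: "\<And>K. compact K \<Longrightarrow> K \<subseteq> {0..} \<Longrightarrow>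
          uniform_limit K (\<lambda>eps. step_fun 2 eps (ae eps)) a (at_right 0)"
    and b_lim: "\<And>K. compact K \<Longrightarrow> K \<subseteq> {0..} \<Longrightarrow>
          uniform_limit K (\<lambda>eps. step_fun 3 eps (be eps)) b (at_right 0)"
    and growth_consts: "0 < K\<^sub>a" "0 < K\<^sub>b"
    and a_growth: "\<And>eps x. 0 < eps \<Longrightarrow> 0 \<le> x \<Longrightarrow> step_fun 2 eps (ae eps) x \<le> K\<^sub>a * (1 + x)"
    and b_growth: "\<And>eps x. 0 < eps \<Longrightarrow> 0 \<le> x \<Longrightarrow> step_fun 3 eps (be eps) x \<le> K\<^sub>b * (1 + x)"
    and exponents: "0 \<le> r\<^sub>a" "r\<^sub>a < 1" "r\<^sub>a \<le> r\<^sub>b"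
    and prefactors: "0 < abar" "0 < bbar"
    and a_equiv: "a \<sim>[at_right 0] (\<lambda>x. abar * x powr r\<^sub>a)"
    and b_equiv: "b \<sim>[at_right 0] (\<lambda>x. bbar * x powr r\<^sub>b)"
    and a_small: "(\<lambda>(eps, i). step_fun 2 eps (ae eps) (eps * real i) - a (eps * real i))
          \<in> o[small_size 2](\<lambda>(eps, i). (eps * real i) powr r\<^sub>a)"
    and b_small: "(\<lambda>(eps, i). step_fun 3 eps (be eps) (eps * real i) - b (eps * real i))
          \<in> o[small_size 3](\<lambda>(eps, i). (eps * real i) powr r\<^sub>b)"
    and rho: "((\<lambda>x. b x / a x) \<longlongrightarrow> \<rho>) (at_right 0)"
    \<comment> \<open>initial data\<close>
    and u_in: "\<rho> < u_in"
    and \<mu>_in: "\<mu>_in \<in> finite_borel {0..}"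
    and u_in_lim: "((\<lambda>eps. ue eps 0) \<longlongrightarrow> u_in) (at_right 0)"
    and f_in_lim: "weak_star_tendsto {0..} (\<lambda>eps. density_on {0..} (fe eps 0)) \<mu>_in (at_right 0)"
    and \<Phi>_moment: "\<exists>\<Phi>\<in>superlinear_weights.
          (SUP eps\<in>{0<..}. \<integral>\<^sup>+x\<in>{0..}. ennreal (\<Phi> x * fe eps 0 x) \<partial>lborel) < \<infinity>"
    and exp_moment: "\<And>z. 0 < z \<Longrightarrow> z < 1 \<Longrightarrow>
          (SUP eps\<in>{0<..}. \<Sum>i. ennreal (eps powr r\<^sub>a * ce eps (i + 2) 0 * exp (- real (i + 2) * z))) < \<infinity>"
    and m: "m = u_in + (\<integral>x. x \<partial>\<mu>_in)"
    \<comment> \<open>the critical scaling and its nucleation rate\<close>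
    and critical: "\<eta> = r\<^sub>a"
    and N: "Linf_loc N"
    and N_lt: "\<And>u. r\<^sub>a < r\<^sub>b \<Longrightarrow> 0 \<le> u \<Longrightarrow>
          N u = \<alpha> * u\<^sup>2 * (u / (u + \<beta> / (abar * 2 powr \<eta>)))"
    and N_eq: "\<And>u. r\<^sub>a = r\<^sub>b \<Longrightarrow> \<rho> < u \<Longrightarrow>
          N u = \<alpha> * u\<^sup>2 * ((abar * u - bbar) / (abar * u - bbar + \<beta> / 2 powr \<eta>))"
    and \<epsilon>_pos: "\<And>n. 0 < \<epsilon> n"
    and \<epsilon>_lim: "\<epsilon> \<longlonglongrightarrow> 0"
  shows "\<exists>T>0. \<exists>s :: nat \<Rightarrow> nat. strict_mono s \<and>
           (\<exists>\<mu>. N_solution T a b \<rho> u_in \<mu>_in m N \<mu> \<and>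
                tendsto_weak_star_continuous T {0..}
                  (\<lambda>n t. density_on {0..} (fe (\<epsilon> (s n)) t)) \<mu>)"
proof -
  note exponents_r = exponents[folded critical]
  have pos_eps: "0 \<le> ce eps i t" if "0 < eps" "2 \<le> i" "0 \<le> t" for eps i t
    using BD[OF that(1)] that(2,3) by (auto simp: BD_solution_def Let_def)
  have fe_eq: "fe eps t = step_fun 2 eps (\<lambda>i. ce eps i t)" for eps t by (rule ext) (rule fe_def)
  have ae_eq: "step_fun 2 eps (ae eps) (eps * real i) = ae eps i" if "0 < eps" "2 \<le> i" for eps i
    using that by (intro step_fun_cell mid_in_cell)
  have be_eq: "step_fun 3 eps (be eps) (eps * real i) = be eps i" if "0 < eps" "3 \<le> i" for eps i
    using that by (intro step_fun_cell mid_in_cell)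

  \<comment> \<open>both forms of the behaviour of the rates near \<open>0\<close> are expressed through \<open>\<rho>\<close>\<close>
  have rho_eq: "\<rho> = (if \<eta> = r\<^sub>b then bbar / abar else 0)"
    using ratio_limit[OF a_equiv b_equiv prefactors(1) exponents(3) rho] critical by simp
  then have rho_nonneg: "0 \<le> \<rho>" using prefactors by simp
  have rates: "\<exists>x0>0. \<forall>eps i. 0 < eps \<longrightarrow> eps * real i < x0 \<longrightarrow>
       (2 \<le> i \<longrightarrow> \<bar>ae eps i - abar * (eps * real i) powr \<eta>\<bar> \<le> \<kappa> * (eps * real i) powr \<eta>) \<and>
       (3 \<le> i \<longrightarrow> \<bar>be eps i - abar * \<rho> * (eps * real i) powr \<eta>\<bar> \<le> \<kappa> * (eps * real i) powr \<eta>)"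
    if \<kappa>: "0 < \<kappa>" for \<kappa>
  proof -
    obtain x1 where x1: "0 < x1" "\<And>eps i. 0 < eps \<Longrightarrow> 2 \<le> i \<Longrightarrow> eps * real i < x1 \<Longrightarrow>
      \<bar>step_fun 2 eps (ae eps) (eps * real i) - abar * (eps * real i) powr r\<^sub>a\<bar> \<le> \<kappa> * (eps * real i) powr r\<^sub>a"
      by (rule rate_near_zero[OF a_equiv prefactors(1) _ a_small \<kappa>]) auto
    have "\<exists>x2>0. \<forall>eps i. 0 < eps \<longrightarrow> 3 \<le> i \<longrightarrow> eps * real i < x2 \<longrightarrow>
      \<bar>be eps i - abar * \<rho> * (eps * real i) powr \<eta>\<bar> \<le> \<kappa> * (eps * real i) powr \<eta>"
    proof (cases "\<eta> = r\<^sub>b")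
      case True
      obtain x2 where x2: "0 < x2" "\<And>eps i. 0 < eps \<Longrightarrow> 3 \<le> i \<Longrightarrow> eps * real i < x2 \<Longrightarrow>
        \<bar>step_fun 3 eps (be eps) (eps * real i) - bbar * (eps * real i) powr r\<^sub>b\<bar> \<le> \<kappa> * (eps * real i) powr r\<^sub>b"
        by (rule rate_near_zero[OF b_equiv prefactors(2) _ b_small \<kappa>]) auto
      moreover have "abar * \<rho> = bbar" using rho_eq True prefactors by simp
      ultimately show ?thesis using be_eq True by (intro exI[of _ x2]) auto
    next
      case False
      then have less: "\<eta> < r\<^sub>b" and rho0: "\<rho> = 0" using exponents_r rho_eq by auto
      obtain x2 where x2: "0 < x2" "\<And>eps i. 0 < eps \<Longrightarrow> 3 \<le> i \<Longrightarrow> eps * real i < x2 \<Longrightarrow>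
        \<bar>step_fun 3 eps (be eps) (eps * real i) - bbar * (eps * real i) powr r\<^sub>b\<bar> \<le> 1 * (eps * real i) powr r\<^sub>b"
        by (rule rate_near_zero[OF b_equiv prefactors(2) _ b_small zero_less_one]) auto
      obtain x3 where x3: "0 < x3" "\<And>x. 0 < x \<Longrightarrow> x < x3 \<Longrightarrow> (bbar + 1) * x powr r\<^sub>b \<le> \<kappa> * x powr \<eta>"
        by (rule higher_power_negligible[OF less _ \<kappa>, of "bbar + 1"]) (use prefactors in auto)
      have "\<bar>be eps i - abar * \<rho> * (eps * real i) powr \<eta>\<bar> \<le> \<kappa> * (eps * real i) powr \<eta>"
        if "0 < eps" "3 \<le> i" "eps * real i < min x2 x3" for eps i
      proof -
        have "0 < eps * real i" using that by simp
        then have "(bbar + 1) * (eps * real i) powr r\<^sub>b \<le> \<kappa> * (eps * real i) powr \<eta>" using that by (intro x3) auto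
        moreover have "\<bar>be eps i - bbar * (eps * real i) powr r\<^sub>b\<bar> \<le> 1 * (eps * real i) powr r\<^sub>b"
          using x2(2)[of eps i] be_eq[of eps i] that by auto
        moreover have "0 \<le> bbar * (eps * real i) powr r\<^sub>b" using prefactors by simp
        ultimately show ?thesis unfolding rho0 by (simp add: distrib_right)
      qed
      then show ?thesis using x2(1) x3(1) by (intro exI[of _ "min x2 x3"]) auto
    qed
    then obtain x2 where x2: "0 < x2" "\<And>eps i. 0 < eps \<Longrightarrow> 3 \<le> i \<Longrightarrow> eps * real i < x2 \<Longrightarrow>
      \<bar>be eps i - abar * \<rho> * (eps * real i) powr \<eta>\<bar> \<le> \<kappa> * (eps * real i) powr \<eta>" by blast
    show ?thesis
      using x1 x2 ae_eq critical by (intro exI[of _ "min x1 x2"]) auto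
  qed
  have N_unified: "N u = \<alpha> * u\<^sup>2 * (abar * 2 powr \<eta> * (u - \<rho>) / (\<beta> + abar * 2 powr \<eta> * (u - \<rho>)))"
    if u: "\<rho> < u" for u
  proof (cases "\<eta> = r\<^sub>b")
    case True
    have "abar * u - bbar = abar * (u - \<rho>)" using rho_eq True prefactors by (simp add: field_simps)
    then have "N u = \<alpha> * u\<^sup>2 * (abar * (u - \<rho>) / (abar * (u - \<rho>) + \<beta> / 2 powr \<eta>))"
      using N_eq[OF _ u] True critical by simp
    also have "abar * (u - \<rho>) / (abar * (u - \<rho>) + \<beta> / 2 powr \<eta>) =
        (2 powr \<eta> * (abar * (u - \<rho>))) / (2 powr \<eta> * (abar * (u - \<rho>) + \<beta> / 2 powr \<eta>))" by simp
    also have "2 powr \<eta> * (abar * (u - \<rho>) + \<beta> / 2 powr \<eta>) = \<beta> + abar * 2 powr \<eta> * (u - \<rho>)"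
      by (simp add: distrib_left)
    finally show ?thesis by (simp add: mult_ac)
  next
    case False
    then have "r\<^sub>a < r\<^sub>b" and rho0: "\<rho> = 0" using exponents_r rho_eq critical by auto
    then have "N u = \<alpha> * u\<^sup>2 * (u / (u + \<beta> / (abar * 2 powr \<eta>)))" using N_lt u by simp
    also have "u / (u + \<beta> / (abar * 2 powr \<eta>)) =
        ((abar * 2 powr \<eta>) * u) / ((abar * 2 powr \<eta>) * (u + \<beta> / (abar * 2 powr \<eta>)))"
      using prefactors by simp
    also have "(abar * 2 powr \<eta>) * (u + \<beta> / (abar * 2 powr \<eta>)) = \<beta> + abar * 2 powr \<eta> * u"
      using prefactors by (simp add: distrib_left)
    finally show ?thesis by (simp add: rho0)
  qed

  \<comment> \<open>uniform bounds on the initial data\<close>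
  have tail: "\<exists>R>0. \<forall>eps k. 0 < eps \<longrightarrow>
      (\<Sum>i\<in>{i\<in>{2..k}. R \<le> eps * real i}. eps\<^sup>2 * real i * ce eps i 0) \<le> \<epsilon>0" if \<epsilon>0: "0 < \<epsilon>0" for \<epsilon>0
  proof -
    obtain \<Phi> where \<Phi>: "\<Phi> \<in> superlinear_weights"
      "(SUP eps\<in>{0<..}. \<integral>\<^sup>+x\<in>{0..}. ennreal (\<Phi> x * step_fun 2 eps (\<lambda>i. ce eps i 0) x) \<partial>lborel) < \<infinity>"
      using \<Phi>_moment unfolding fe_eq by blast
    obtain R where "0 < R" "\<And>eps k. 0 < eps \<Longrightarrow>
      (\<Sum>i\<in>{i\<in>{2..k}. R \<le> eps * real i}. eps\<^sup>2 * real i * ce eps i 0) \<le> \<epsilon>0"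
      by (rule superlinear_tail[OF \<Phi> _ \<epsilon>0]) (use pos_eps in auto)
    then show ?thesis by blast
  qed
  have exp_init: "\<exists>S. \<forall>eps k. 0 < eps \<longrightarrow> (\<Sum>i=2..k. eps powr \<eta> * ce eps i 0 * exp (- real i * z)) \<le> S"
    if z: "0 < z" "z < 1" for z
  proof -
    obtain S where "\<And>eps k. 0 < eps \<Longrightarrow> (\<Sum>i=2..k. eps powr r\<^sub>a * ce eps i 0 * exp (- real i * z)) \<le> S"
      by (rule SUP_suminf_bound[OF exp_moment[OF z]]) (use pos_eps in auto)
    then show ?thesis using critical by blast
  qed
  obtain R where R: "0 < R" "\<And>eps k. 0 < eps \<Longrightarrow>
      (\<Sum>i\<in>{i\<in>{2..k}. R \<le> eps * real i}. eps\<^sup>2 * real i * ce eps i 0) \<le> 1"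
    using tail[of 1] by auto
  have \<epsilon>_right: "filterlim \<epsilon> (at_right 0) sequentially"
    by (rule tendsto_imp_filterlim_at_right[OF \<epsilon>_lim]) (simp add: \<epsilon>_pos)
  let ?\<phi> = "\<lambda>x::real. max 0 (min 1 (R + 2 - x))"
  have "?\<phi> \<in> Cc {0..}"
    unfolding Cc_half_line_iff using R(1) by (auto intro!: continuous_intros exI[of _ "R + 2"])
  then have "((\<lambda>eps. \<integral>x. ?\<phi> x \<partial>density_on {0..} (fe eps 0)) \<longlongrightarrow> (\<integral>x. ?\<phi> x \<partial>\<mu>_in)) (at_right 0)"
    using f_in_lim unfolding weak_star_tendsto_def by blast
  then have "\<forall>\<^sub>F eps in at_right 0. (\<integral>x. ?\<phi> x \<partial>density_on {0..} (fe eps 0)) < (\<integral>x. ?\<phi> x \<partial>\<mu>_in) + 1"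
    by (rule order_tendstoD) simp
  moreover have "\<forall>\<^sub>F eps in at_right 0. \<alpha>e eps < \<alpha> + 1" "\<forall>\<^sub>F eps in at_right 0. \<beta>e eps < \<beta> + 1"
    by (rule order_tendstoD(2)[OF \<alpha>_\<beta>_lim(1)] order_tendstoD(2)[OF \<alpha>_\<beta>_lim(2)]; simp)+
  moreover have "\<forall>\<^sub>F eps in at_right 0. ue eps 0 < u_in + 1"
    by (rule order_tendstoD(2)[OF u_in_lim]) simp
  moreover have "\<forall>\<^sub>F eps in at_right 0. (\<rho> + u_in) / 2 < ue eps 0"
    by (rule order_tendstoD(1)[OF u_in_lim]) (use u_in in simp)
  moreover have "\<forall>\<^sub>F eps::real in at_right 0. 0 < eps \<and> eps < 1"
    unfolding eventually_at_right_field by (intro exI[of _ 1]) auto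
  ultimately have "\<forall>\<^sub>F eps in at_right 0. 0 < eps \<and> eps < 1 \<and> \<alpha>e eps < \<alpha> + 1 \<and> \<beta>e eps < \<beta> + 1 \<and>
      ue eps 0 < u_in + 1 \<and> (\<rho> + u_in) / 2 < ue eps 0 \<and>
      (\<integral>x. ?\<phi> x \<partial>density_on {0..} (fe eps 0)) < (\<integral>x. ?\<phi> x \<partial>\<mu>_in) + 1"
    by eventually_elim auto
  then have "\<forall>\<^sub>F n in sequentially. 0 < \<epsilon> n \<and> \<epsilon> n < 1 \<and> \<alpha>e (\<epsilon> n) < \<alpha> + 1 \<and> \<beta>e (\<epsilon> n) < \<beta> + 1 \<and>
      ue (\<epsilon> n) 0 < u_in + 1 \<and> (\<rho> + u_in) / 2 < ue (\<epsilon> n) 0 \<and>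
      (\<integral>x. ?\<phi> x \<partial>density_on {0..} (fe (\<epsilon> n) 0)) < (\<integral>x. ?\<phi> x \<partial>\<mu>_in) + 1"
    by (rule eventually_compose_filterlim[OF _ \<epsilon>_right])
  then obtain n0 where n0: "\<And>n. n0 \<le> n \<Longrightarrow> 0 < \<epsilon> n \<and> \<epsilon> n < 1 \<and> \<alpha>e (\<epsilon> n) < \<alpha> + 1 \<and> \<beta>e (\<epsilon> n) < \<beta> + 1 \<and>
      ue (\<epsilon> n) 0 < u_in + 1 \<and> (\<rho> + u_in) / 2 < ue (\<epsilon> n) 0 \<and>
      (\<integral>x. ?\<phi> x \<partial>density_on {0..} (fe (\<epsilon> n) 0)) < (\<integral>x. ?\<phi> x \<partial>\<mu>_in) + 1"
    unfolding eventually_sequentially by blast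
  \<comment> \<open>dropping finitely many members turns the eventual bounds into uniform ones\<close>
  define e where "e n = \<epsilon> (n + n0)" for n
  have e: "0 < e n" "e n < 1" "\<alpha>e (e n) < \<alpha> + 1" "\<beta>e (e n) < \<beta> + 1" "ue (e n) 0 < u_in + 1"
    "(\<rho> + u_in) / 2 < ue (e n) 0"
    "(\<integral>x. ?\<phi> x \<partial>density_on {0..} (fe (e n) 0)) < (\<integral>x. ?\<phi> x \<partial>\<mu>_in) + 1" for n
    using n0[of "n + n0"] by (auto simp: e_def)
  have e_right: "filterlim e (at_right 0) sequentially"
    unfolding e_def[abs_def]
    using filterlim_compose[OF \<epsilon>_right filterlim_add_const_nat_at_top[of n0]] by simp
  have e_lim: "e \<longlonglongrightarrow> 0"
    unfolding e_def[abs_def] using \<epsilon>_lim by (rule LIMSEQ_ignore_initial_segment)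
  have along: "(\<lambda>n. F (e n)) \<longlonglongrightarrow> L" if "(F \<longlongrightarrow> L) (at_right 0)" for F and L :: real
    using filterlim_compose[OF that e_right] .
  define I0 where "I0 = (\<integral>x. ?\<phi> x \<partial>\<mu>_in) + 1"
  have small: "(\<Sum>i\<in>{i\<in>{2..k}. e n * real i \<le> R}. e n * ce (e n) i 0) \<le> I0" for n k
  proof -
    have "(\<Sum>i\<in>{i\<in>{2..k}. e n * real i \<le> R}. e n * ce (e n) i 0) \<le>
        (\<integral>x. ?\<phi> x \<partial>density_on {0..} (fe (e n) 0))"
      unfolding fe_eq by (rule small_sizes_mass_le) (use e[of n] pos_eps R(1) in auto)
    then show ?thesis using e(7)[of n] by (simp add: I0_def)
  qed
  \<comment> \<open>sizes below \<open>R\<close> are bounded in number, those above \<open>R\<close> in mass\<close>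
  have moments: "(\<Sum>i=2..k. e n * ce (e n) i 0) \<le> I0 + 1 / R"
    "(\<Sum>i=2..k. (e n)\<^sup>2 * real i * ce (e n) i 0) \<le> R * I0 + 1" for n k
  proof -
    let ?A = "{i\<in>{2..k}. e n * real i \<le> R}" and ?B = "{i\<in>{2..k}. R \<le> e n * real i}"
    have c: "0 \<le> ce (e n) i 0" if "2 \<le> i" for i using pos_eps[OF e(1) that] by simp
    have split: "(\<Sum>i=2..k. F i) \<le> (\<Sum>i\<in>?A. F i) + (\<Sum>i\<in>?B. F i)" if "\<And>i. 2 \<le> i \<Longrightarrow> 0 \<le> F i" for F :: "nat \<Rightarrow> real"
    proof -
      have "{2..k} = ?A \<union> ?B" by auto
      then have "(\<Sum>i=2..k. F i) = sum F (?A \<union> ?B)" by (rule arg_cong)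
      also have "\<dots> = sum F ?A + sum F ?B - sum F (?A \<inter> ?B)" by (rule sum_Un) auto
      also have "\<dots> \<le> sum F ?A + sum F ?B"
        using sum_nonneg[of "?A \<inter> ?B" F] that by simp
      finally show ?thesis .
    qed
    have "(\<Sum>i\<in>?B. e n * ce (e n) i 0) \<le> (\<Sum>i\<in>?B. 1 / R * ((e n)\<^sup>2 * real i * ce (e n) i 0))"
    proof (rule sum_mono)
      fix i assume i: "i \<in> ?B"
      have "1 * (e n * ce (e n) i 0) \<le> (e n * real i / R) * (e n * ce (e n) i 0)"
        using i R(1) e(1)[of n] c[of i] by (intro mult_right_mono) auto
      then show "e n * ce (e n) i 0 \<le> 1 / R * ((e n)\<^sup>2 * real i * ce (e n) i 0)"
        by (simp add: power2_eq_square mult_ac)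
    qed
    also have "\<dots> = 1 / R * (\<Sum>i\<in>?B. (e n)\<^sup>2 * real i * ce (e n) i 0)" by (rule sum_distrib_left[symmetric])
    also have "\<dots> \<le> 1 / R * 1" using R(1) R(2)[OF e(1)] by (intro mult_left_mono) auto
    finally have "(\<Sum>i\<in>?B. e n * ce (e n) i 0) \<le> 1 / R" by simp
    moreover have "(\<Sum>i=2..k. e n * ce (e n) i 0) \<le> (\<Sum>i\<in>?A. e n * ce (e n) i 0) + (\<Sum>i\<in>?B. e n * ce (e n) i 0)"
      by (rule split) (use c e(1)[of n] in auto)
    ultimately show "(\<Sum>i=2..k. e n * ce (e n) i 0) \<le> I0 + 1 / R" using small[where k=k and n=n] by linarith
    have "(\<Sum>i\<in>?A. (e n)\<^sup>2 * real i * ce (e n) i 0) \<le> (\<Sum>i\<in>?A. R * (e n * ce (e n) i 0))"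
    proof (rule sum_mono)
      fix i assume i: "i \<in> ?A"
      have "(e n * real i) * (e n * ce (e n) i 0) \<le> R * (e n * ce (e n) i 0)"
        using i e(1)[of n] c[of i] by (intro mult_right_mono) auto
      then show "(e n)\<^sup>2 * real i * ce (e n) i 0 \<le> R * (e n * ce (e n) i 0)" by (simp add: power2_eq_square mult_ac)
    qed
    also have "\<dots> = R * (\<Sum>i\<in>?A. e n * ce (e n) i 0)" by (rule sum_distrib_left[symmetric])
    also have "\<dots> \<le> R * I0" using R(1) small by (intro mult_left_mono) auto
    finally have "(\<Sum>i\<in>?A. (e n)\<^sup>2 * real i * ce (e n) i 0) \<le> R * I0" .
    moreover have "(\<Sum>i=2..k. (e n)\<^sup>2 * real i * ce (e n) i 0) \<le>
        (\<Sum>i\<in>?A. (e n)\<^sup>2 * real i * ce (e n) i 0) + (\<Sum>i\<in>?B. (e n)\<^sup>2 * real i * ce (e n) i 0)"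
      by (rule split) (use c in auto)
    ultimately show "(\<Sum>i=2..k. (e n)\<^sup>2 * real i * ce (e n) i 0) \<le> R * I0 + 1" using R(2)[OF e(1)[of n], of k] by linarith
  qed
  have mass_le: "me (e n) \<le> u_in + 1 + (R * I0 + 1)" for n
  proof -
    have "(\<lambda>i. (e n)\<^sup>2 * real (i + 2) * ce (e n) (i + 2) 0) sums (me (e n) - ue (e n) 0)"
      using BD[OF e(1)[of n]] unfolding BD_solution_def Let_def by (elim conjE) simp
    then have "(\<lambda>k. \<Sum>i<k. (e n)\<^sup>2 * real (i + 2) * ce (e n) (i + 2) 0) \<longlonglongrightarrow> me (e n) - ue (e n) 0"
      by (simp add: sums_def)
    moreover have "(\<Sum>i<k. (e n)\<^sup>2 * real (i + 2) * ce (e n) (i + 2) 0) \<le> R * I0 + 1" for k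
      using moments(2)[of n "k + 1"] unfolding sum_shift2 by simp
    ultimately have "me (e n) - ue (e n) 0 \<le> R * I0 + 1" by (intro LIMSEQ_le_const2) auto
    then show ?thesis using e(5)[of n] by linarith
  qed

  interpret Q: BD_sequence \<eta> abar \<rho> \<alpha> \<beta> "K\<^sub>a + K\<^sub>b" "\<alpha> + \<beta> + 1" "u_in + 1 + (R * I0 + 1)" "I0 + 1 / R"
    "(\<rho> + u_in) / 2" u_in e "\<lambda>n. \<alpha>e (e n)" "\<lambda>n. \<beta>e (e n)" "\<lambda>n. me (e n)" "\<lambda>n. ae (e n)" "\<lambda>n. be (e n)"
    "\<lambda>n. ue (e n)" "\<lambda>n. ce (e n)" a b N \<mu>_in
  proof (rule BD_sequence.intro)
    show "BD_system \<eta> (e n) (\<alpha>e (e n)) (\<beta>e (e n)) (K\<^sub>a + K\<^sub>b) (me (e n)) (ae (e n)) (be (e n)) (ue (e n)) (ce (e n))" for n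
    proof (rule BD_system.intro)
      fix i :: nat
      have i0: "0 \<le> e n * real i" using e(1)[of n] by simp
      show "ae (e n) i \<le> (K\<^sub>a + K\<^sub>b) * (1 + e n * real i)" if "2 \<le> i"
      proof -
        have "ae (e n) i \<le> K\<^sub>a * (1 + e n * real i)" using a_growth[OF e(1)[of n] i0] ae_eq[OF e(1)[of n] that] by simp
        also have "\<dots> \<le> (K\<^sub>a + K\<^sub>b) * (1 + e n * real i)" using growth_consts i0 by (intro mult_right_mono) auto
        finally show ?thesis .
      qed
      show "be (e n) i \<le> (K\<^sub>a + K\<^sub>b) * (1 + e n * real i)" if "3 \<le> i"
      proof -
        have "be (e n) i \<le> K\<^sub>b * (1 + e n * real i)" using b_growth[OF e(1)[of n] i0] be_eq[OF e(1)[of n] that] by simp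
        also have "\<dots> \<le> (K\<^sub>a + K\<^sub>b) * (1 + e n * real i)" using growth_consts i0 by (intro mult_right_mono) auto
        finally show ?thesis .
      qed
    qed (use e[of n] eta rates_pos[OF e(1)[of n]] growth_consts BD[OF e(1)[of n]] in \<open>auto intro: less_imp_le\<close>)
    show "\<exists>x0>0. \<forall>n i. e n * real i < x0 \<longrightarrow>
       (2 \<le> i \<longrightarrow> \<bar>ae (e n) i - abar * (e n * real i) powr \<eta>\<bar> \<le> \<kappa> * (e n * real i) powr \<eta>) \<and>
       (3 \<le> i \<longrightarrow> \<bar>be (e n) i - abar * \<rho> * (e n * real i) powr \<eta>\<bar> \<le> \<kappa> * (e n * real i) powr \<eta>)"
      if "0 < \<kappa>" for \<kappa> using rates[OF that] e(1) by blast
    show "\<exists>S. \<forall>n k. (\<Sum>i=2..k. e n powr \<eta> * ce (e n) i 0 * exp (- real i * z)) \<le> S"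
      if "0 < z" "z < 1" for z using exp_init[OF that] e(1) by blast
    show "\<exists>R>0. \<forall>n k. (\<Sum>i\<in>{i\<in>{2..k}. R \<le> e n * real i}. (e n)\<^sup>2 * real i * ce (e n) i 0) \<le> \<epsilon>0"
      if "0 < \<epsilon>0" for \<epsilon>0 using tail[OF that] e(1) by blast
    show "(\<lambda>n. \<alpha>e (e n)) \<longlonglongrightarrow> \<alpha>" "(\<lambda>n. \<beta>e (e n)) \<longlonglongrightarrow> \<beta>" "(\<lambda>n. ue (e n) 0) \<longlonglongrightarrow> u_in"
      by (intro along \<alpha>_\<beta>_lim u_in_lim)+
    show "weak_star_tendsto {0..} (\<lambda>n. density_on {0..} (step_fun 2 (e n) (\<lambda>i. ce (e n) i 0))) \<mu>_in sequentially"
      using f_in_lim unfolding weak_star_tendsto_def fe_eq by (intro ballI along) blast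
    show "\<forall>\<^sub>F n in sequentially. \<forall>i\<ge>2. e n * real i \<le> X \<longrightarrow> \<bar>ae (e n) i - a (e n * real i)\<bar> \<le> \<epsilon>0"
      if "0 < \<epsilon>0" for \<epsilon>0 X
    proof -
      have "\<forall>\<^sub>F eps in at_right 0. \<forall>x\<in>{0..X}. dist (step_fun 2 eps (ae eps) x) (a x) < \<epsilon>0"
        using a_lim[of "{0..X}"] that by (intro uniform_limitD) auto
      from eventually_compose_filterlim[OF this e_right] show ?thesis
      proof eventually_elim
        case (elim n)
        show ?case
        proof (intro allI impI)
          fix i assume i: "2 \<le> i" "e n * real i \<le> X"
          have "e n * real i \<in> {0..X}" using i e(1)[of n] by simp
          from bspec[OF elim this] ae_eq[OF e(1)[of n] i(1)]
          show "\<bar>ae (e n) i - a (e n * real i)\<bar> \<le> \<epsilon>0" by (simp add: dist_real_def)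
        qed
      qed
    qed
    show "\<forall>\<^sub>F n in sequentially. \<forall>i\<ge>3. e n * real i \<le> X \<longrightarrow> \<bar>be (e n) i - b (e n * real i)\<bar> \<le> \<epsilon>0"
      if "0 < \<epsilon>0" for \<epsilon>0 X
    proof -
      have "\<forall>\<^sub>F eps in at_right 0. \<forall>x\<in>{0..X}. dist (step_fun 3 eps (be eps) x) (b x) < \<epsilon>0"
        using b_lim[of "{0..X}"] that by (intro uniform_limitD) auto
      from eventually_compose_filterlim[OF this e_right] show ?thesis
      proof eventually_elim
        case (elim n)
        show ?case
        proof (intro allI impI)
          fix i assume i: "3 \<le> i" "e n * real i \<le> X"
          have "e n * real i \<in> {0..X}" using i e(1)[of n] by simp
          from bspec[OF elim this] be_eq[OF e(1)[of n] i(1)]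
          show "\<bar>be (e n) i - b (e n * real i)\<bar> \<le> \<epsilon>0" by (simp add: dist_real_def)
        qed
      qed
    qed
    show "\<alpha>e (e n) \<le> \<alpha> + \<beta> + 1" "\<beta>e (e n) \<le> \<alpha> + \<beta> + 1" "(\<rho> + u_in) / 2 \<le> ue (e n) 0" for n
      using e[of n] limits_pos by linarith+
    show "\<eta> < 1" "\<rho> < (\<rho> + u_in) / 2" using exponents_r u_in by auto
  qed (fact e_lim mass_le prefactors limits_pos rho_nonneg moments a_b_cont \<mu>_in N_unified)+

  obtain s \<mu> where s: "strict_mono s"
    and \<mu>: "\<And>t. t \<in> {0..Q.T} \<Longrightarrow> \<mu> t \<in> finite_borel {0..}"
      "\<And>t. t \<in> {0..Q.T} \<Longrightarrow> measure (\<mu> t) {0..} \<le> Q.Z + 2 * (u_in + 1 + (R * I0 + 1)) + 1"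
      "\<And>\<phi>. \<phi> \<in> Cc {0..} \<Longrightarrow> uniform_limit {0..Q.T} (\<lambda>n t. \<integral>x. \<phi> x \<partial>density_on {0..} (Q.f (s n) t))
        (\<lambda>t. \<integral>x. \<phi> x \<partial>\<mu> t) sequentially"
    by (rule Q.path_compactness) blast
  interpret W: BD_limit \<eta> abar \<rho> \<alpha> \<beta> "K\<^sub>a + K\<^sub>b" "\<alpha> + \<beta> + 1" "u_in + 1 + (R * I0 + 1)" "I0 + 1 / R"
    "(\<rho> + u_in) / 2" u_in "\<lambda>n. e (s n)" "\<lambda>n. \<alpha>e (e (s n))" "\<lambda>n. \<beta>e (e (s n))" "\<lambda>n. me (e (s n))"
    "\<lambda>n. ae (e (s n))" "\<lambda>n. be (e (s n))" "\<lambda>n. ue (e (s n))" "\<lambda>n. ce (e (s n))" a b N \<mu>_in \<mu>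
    by (intro BD_limit.intro Q.subsequence s BD_limit_axioms.intro \<mu>)
  have mono: "strict_mono (\<lambda>n. s n + n0)" using s by (simp add: strict_mono_def)
  have "N_solution Q.T a b \<rho> u_in \<mu>_in m N \<mu>" using W.is_N_solution unfolding W.mass_def m .
  moreover have "tendsto_weak_star_continuous Q.T {0..} (\<lambda>n t. density_on {0..} (fe (\<epsilon> (s n + n0)) t)) \<mu>"
    using W.path_converges unfolding e_def fe_eq .
  ultimately show ?thesis using Q.T mono by blast
qed

end
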